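(* Let $D$ be one of $D_U^o$, $D_k^o$ (for $k\in U(K)$), or, if $k$ is a classical weight, $V_k^o$, and set $D_n=D/\mathrm{Fil}^n(D)$. Then: (a) there are canonical isomorphisms $H^1_{\mathrm{cont}}(\Gamma,(D_n)_{n\in\mathbb N})\cong\varprojlim_nH^1(\Gamma,D_n)\cong H^1(\Gamma,D)$; (b) these isomorphisms are compatible with specialization.
   Context: $K$ complete discretely valued of characteristic $0$, residue characteristic $p\ge3$, ring of integers $\mathcal O_K$, maximal ideal $\mathfrak m_K$, uniformizer $\pi$. $N\ge3$ prime to $p$, $\Gamma=\Gamma_1(N)\cap\Gamma_0(p)$. $U$ is a wide open disk over $K$ of accessible weights (continuous characters $k$ of $\mathbb Z_p^\times$ with $|k(t)^{p-1}-1|<p^{-1/(p-1)}$), $\Lambda_U$ its ring of bounded-by-$1$ rigid functions (maximal ideal $\mathfrak m_U$), $k_U$ the universal character. $D_k^o$ (resp. $D_U^o$) is the continuous $\mathcal O_K$-dual (resp. $\mathfrak m_U$-adically continuous $\Lambda_U$-dual) of the module of $f\colon\mathbb Z_p^\times\times\mathbb Z_p\to B$ with $f(at)=k(a)f(t)$ and $f(1,z)=\sum a_nz^n$, $\mathrm{ord}_\pi(a_n)\to\infty$ (basis $f_n(x,y)=k(x)(y/x)^n$); $\Gamma$ acts through the right action $(\mu|\gamma)(f)=\mu(\gamma f)$, $(\gamma f)(v)=f(v\gamma)$. $\mathrm{Fil}^n(D^o)=\{\mu:\mu(f_j)\in\mathfrak m^{n-j},0\le j\le n\}$. For a classical weight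 $k\in\mathbb N$, $\mathcal P_k^o\subset A_k^o$ is the submodule of homogeneous polynomials of degree $k$, $V_k^o=\mathrm{Hom}_{\mathcal O_K}(\mathcal P_k^o,\mathcal O_K)$, $\rho_k\colon D_k^o\to V_k^o$ the restriction, and $\mathrm{Fil}^n(V_k^o)=\rho_k(\mathrm{Fil}^n(D_k^o))$. Specialization refers to $\eta_k\colon D_U^o\to D_k^o$, $\mu\mapsto(f\mapsto\mu(f_U)(k))$ with $f_U(x,y)=k_U(x)f(1,y/x)$, and to $\rho_k$. $H^1_{\mathrm{cont}}(\Gamma,-)$ is the first right derived functor of $(M_n)_n\mapsto H^0(\Gamma,\varprojlim M_n)$ on projective systems of discrete torsion $\Gamma$-modules; $H^1(\Gamma,D)$ is ordinary (abstract) group cohomology.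
   Formalization: Not every Fil^n(D_U^o) or Fil^n(D_k^o) is Γ-stable, nor Γ always preserves the functions over Λ_U, so D_n may fail to be a Γ-module; the formal theorem assumes these stabilities for D_U^o and Fil^n-stability for D_k^o in general; none is assumed for V_k^o or for ρ_k. *)

theory Defs
  imports
    "HOL-Analysis.Determinants"
    "HOL-Analysis.Elementary_Metric_Spaces"
    "HOL-Computational_Algebra.Primes"
    "HOL-Computational_Algebra.Polynomial"
    "HOL-Algebra.Module"
    "HOL-Algebra.Coset"
    "HOL-Algebra.Ideal_Product"
begin

section \<open>The fields\<close>

text \<open>
  The ambient field plays the role of a complete algebraically closed field containing \<open>K\<close>
  (for example the completion of an algebraic closure of \<open>K\<close>); \<open>K\<close> itself is a subfield of it.
  The geometric points of a rigid space over \<open>K\<close> are its points with values in the ambient field.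
\<close>

class nonarch_field = field_char_0 + metric_space +
  fixes absv :: "'a \<Rightarrow> real"
  assumes dist_absv: "dist x y = absv (x - y)"
    and absv_mult: "absv (x * y) = absv x * absv y"
    and absv_add_le_max: "absv (x + y) \<le> max (absv x) (absv y)"

class complete_alg_closed_nonarch_field = nonarch_field + alg_closed_field + complete_space

definition uniformizer :: "'c::nonarch_field set \<Rightarrow> 'c \<Rightarrow> bool" where
  "uniformizer K \<pi> \<longleftrightarrow>
     \<pi> \<in> K \<and> \<pi> \<noteq> 0 \<and> absv \<pi> < 1 \<and> (\<forall>x\<in>K. absv x < 1 \<longrightarrow> absv x \<le> absv \<pi>)"

text \<open>
  A complete discretely valued subfield of residue characteristic \<open>p\<close>; the absolute value is
  normalized by \<open>\<bar>p\<bar> = 1/p\<close>, as in the definition of accessible weights.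
\<close>

definition complete_dv_field :: "nat \<Rightarrow> 'c::nonarch_field set \<Rightarrow> bool" where
  "complete_dv_field p K \<longleftrightarrow>
     0 \<in> K \<and> 1 \<in> K \<and>
     (\<forall>x\<in>K. \<forall>y\<in>K. x + y \<in> K \<and> x * y \<in> K \<and> - x \<in> K \<and> inverse x \<in> K) \<and>
     complete K \<and> (\<exists>\<pi>. uniformizer K \<pi>) \<and> absv (of_nat p :: 'c) = 1 / real p"

text \<open>
  If \<open>\<bar>p\<bar> = 1/p\<close>, then the closure of the integers is the canonical copy of the
  ring of \<open>p\<close>-adic integers.
\<close>

definition Zp :: "'c::nonarch_field set" where
  "Zp = closure (range of_int)"

definition Zpx :: "'c::nonarch_field set" where
  "Zpx = {x \<in> Zp. absv x = 1}"

definition T0 :: "('c::nonarch_field \<times> 'c) set" where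
  "T0 = Zpx \<times> Zp"


section \<open>Weights\<close>

definition weight :: "('c::nonarch_field \<Rightarrow> 'c) \<Rightarrow> bool" where
  "weight \<kappa> \<longleftrightarrow>
     \<kappa> \<in> extensional Zpx \<and> (\<forall>t\<in>Zpx. \<kappa> t \<noteq> 0) \<and>
     (\<forall>s\<in>Zpx. \<forall>t\<in>Zpx. \<kappa> (s * t) = \<kappa> s * \<kappa> t) \<and> continuous_on Zpx \<kappa>"

definition accessible :: "nat \<Rightarrow> ('c::nonarch_field \<Rightarrow> 'c) \<Rightarrow> bool" where
  "accessible p \<kappa> \<longleftrightarrow>
     weight \<kappa> \<and> (\<forall>t\<in>Zpx. absv (\<kappa> t ^ (p - 1) - 1) < real p powr (- 1 / (real p - 1)))"

definition classical_weight :: "nat \<Rightarrow> 'c::nonarch_field \<Rightarrow> 'c" where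
  "classical_weight k = (\<lambda>t\<in>Zpx. t ^ k)"

text \<open>
  On each component of weight space, i.e. for a prescribed restriction to the roots of unity of
  order dividing \<open>p - 1\<close>, the rigid coordinate is \<open>\<kappa> \<mapsto> \<kappa> (1 + p)\<close>. Radii lie in
  \<open>\<bar>K\<^sup>\<times>\<bar>\<close>, so that the disk is isomorphic over \<open>K\<close> to the open unit disk.
\<close>

definition wide_open_disk :: "nat \<Rightarrow> 'c::nonarch_field set \<Rightarrow> ('c \<Rightarrow> 'c) set \<Rightarrow> bool" where
  "wide_open_disk p K U \<longleftrightarrow>
     (\<exists>\<kappa>0 r. weight \<kappa>0 \<and> \<kappa>0 ` Zpx \<subseteq> K \<and> r \<in> K \<and> r \<noteq> 0 \<and>
        U = {\<kappa>. weight \<kappa> \<and> (\<forall>z\<in>Zpx. z ^ (p - 1) = 1 \<longrightarrow> \<kappa> z = \<kappa>0 z) \<and>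
                 absv (\<kappa> (1 + of_nat p) - \<kappa>0 (1 + of_nat p)) < absv r})"

definition rational_points :: "'c set \<Rightarrow> ('c::nonarch_field \<Rightarrow> 'c) set \<Rightarrow> ('c \<Rightarrow> 'c) set" where
  "rational_points K U = {\<kappa> \<in> U. \<kappa> ` Zpx \<subseteq> K}"

text \<open>Rigid functions over \<open>K\<close>, identified with their values at the geometric points.\<close>

definition rigid_function ::
    "nat \<Rightarrow> 'c set \<Rightarrow> ('c::nonarch_field \<Rightarrow> 'c) set \<Rightarrow> (('c \<Rightarrow> 'c) \<Rightarrow> 'c) \<Rightarrow> bool" where
  "rigid_function p K U F \<longleftrightarrow>
     F \<in> extensional U \<and>
     (\<exists>\<kappa>0 \<in> rational_points K U. \<exists>a. range a \<subseteq> K \<and>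
        (\<forall>\<kappa>\<in>U. (\<lambda>n. a n * (\<kappa> (1 + of_nat p) - \<kappa>0 (1 + of_nat p)) ^ n) sums F \<kappa>))"


section \<open>Coefficient rings\<close>

text \<open>
  The coefficient ring \<open>B\<close> is \<open>\<O>\<^sub>K\<close> or \<open>\<Lambda>\<^sub>U\<close>. It comes with the structure map
  \<open>emb\<close> from \<open>\<O>\<^sub>K\<close>, the image \<open>unif\<close> of the uniformizer and a character \<open>wt\<close> of
  \<open>\<int>\<^sub>p\<^sup>\<times>\<close> with values in \<open>B\<close>.
\<close>

record ('b, 'c) coeff_ring = "'b ring" +
  emb :: "'c \<Rightarrow> 'b"
  unif :: 'b
  wt :: "'c \<Rightarrow> 'b"

definition OK :: "'c::nonarch_field set \<Rightarrow> 'c \<Rightarrow> ('c \<Rightarrow> 'c) \<Rightarrow> ('c, 'c) coeff_ring" where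
  "OK K \<pi> k = \<lparr>carrier = {x \<in> K. absv x \<le> 1}, mult = (*), one = 1, zero = 0, add = (+),
                emb = (\<lambda>x. x), unif = \<pi>, wt = k\<rparr>"

definition Lam :: "nat \<Rightarrow> 'c::nonarch_field set \<Rightarrow> 'c \<Rightarrow> ('c \<Rightarrow> 'c) set
    \<Rightarrow> (('c \<Rightarrow> 'c) \<Rightarrow> 'c, 'c) coeff_ring" where
  "Lam p K \<pi> U =
     \<lparr>carrier = {F. rigid_function p K U F \<and> (\<forall>\<kappa>\<in>U. absv (F \<kappa>) \<le> 1)},
      mult = (\<lambda>F G. \<lambda>\<kappa>\<in>U. F \<kappa> * G \<kappa>), one = (\<lambda>\<kappa>\<in>U. 1),
      zero = (\<lambda>\<kappa>\<in>U. 0), add = (\<lambda>F G. \<lambda>\<kappa>\<in>U. F \<kappa> + G \<kappa>),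
      emb = (\<lambda>x. \<lambda>\<kappa>\<in>U. x), unif = (\<lambda>\<kappa>\<in>U. \<pi>), wt = (\<lambda>t. \<lambda>\<kappa>\<in>U. \<kappa> t)\<rparr>"

text \<open>The maximal ideal of a local ring, as its set of nonunits, and its powers.\<close>

definition max_ideal :: "('b, 'x) ring_scheme \<Rightarrow> 'b set" where
  "max_ideal B = carrier B - Units B"

primrec max_ideal_pow :: "('b, 'x) ring_scheme \<Rightarrow> nat \<Rightarrow> 'b set" where
  "max_ideal_pow B 0 = carrier B"
| "max_ideal_pow B (Suc n) = ideal_prod B (max_ideal B) (max_ideal_pow B n)"

definition unif_pow :: "('b, 'c) coeff_ring \<Rightarrow> nat \<Rightarrow> 'b set" where
  "unif_pow B n = PIdl\<^bsub>B\<^esub> (unif B [^]\<^bsub>B\<^esub> n)"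

definition ord_tends_to_infinity :: "('b, 'c) coeff_ring \<Rightarrow> (nat \<Rightarrow> 'b) \<Rightarrow> bool" where
  "ord_tends_to_infinity B a \<longleftrightarrow> (\<forall>M. \<exists>n0. \<forall>n\<ge>n0. a n \<in> unif_pow B M)"

definition unif_sums :: "('b, 'c) coeff_ring \<Rightarrow> (nat \<Rightarrow> 'b) \<Rightarrow> 'b \<Rightarrow> bool" where
  "unif_sums B u s \<longleftrightarrow>
     (\<forall>M. \<exists>n0. \<forall>n\<ge>n0. s \<ominus>\<^bsub>B\<^esub> finsum B u {..<n} \<in> unif_pow B M)"


section \<open>The modules of functions\<close>

definition A_carrier :: "('b, 'c::nonarch_field) coeff_ring \<Rightarrow> ('c \<times> 'c \<Rightarrow> 'b) set" where
  "A_carrier B =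
     {f \<in> T0 \<rightarrow>\<^sub>E carrier B.
        (\<forall>a\<in>Zpx. \<forall>(x, y)\<in>T0. f (a * x, a * y) = wt B a \<otimes>\<^bsub>B\<^esub> f (x, y)) \<and>
        (\<exists>a. range a \<subseteq> carrier B \<and> ord_tends_to_infinity B a \<and>
             (\<forall>z\<in>Zp. unif_sums B (\<lambda>n. a n \<otimes>\<^bsub>B\<^esub> emb B z [^]\<^bsub>B\<^esub> n) (f (1, z))))}"

text \<open>
  A set of functions as a \<open>B\<close>-module with pointwise operations. The fields \<^const>\<open>mult\<close> and
  \<^const>\<open>one\<close> are not used by the library's theory of modules.
\<close>

definition fun_module :: "('b, 'c::nonarch_field) coeff_ring \<Rightarrow> ('c \<times> 'c \<Rightarrow> 'b) set
    \<Rightarrow> ('b, 'c \<times> 'c \<Rightarrow> 'b) module" where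
  "fun_module B S =
     \<lparr>carrier = S, mult = undefined, one = undefined,
      zero = (\<lambda>v\<in>T0. \<zero>\<^bsub>B\<^esub>), add = (\<lambda>f g. \<lambda>v\<in>T0. f v \<oplus>\<^bsub>B\<^esub> g v),
      smult = (\<lambda>b f. \<lambda>v\<in>T0. b \<otimes>\<^bsub>B\<^esub> f v)\<rparr>"

definition A_module :: "('b, 'c::nonarch_field) coeff_ring \<Rightarrow> ('b, 'c \<times> 'c \<Rightarrow> 'b) module" where
  "A_module B = fun_module B (A_carrier B)"

definition f_basis :: "('b, 'c::nonarch_field) coeff_ring \<Rightarrow> nat \<Rightarrow> 'c \<times> 'c \<Rightarrow> 'b" where
  "f_basis B n = (\<lambda>(x, y)\<in>T0. wt B x \<otimes>\<^bsub>B\<^esub> emb B (y / x) [^]\<^bsub>B\<^esub> n)"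

definition P_module :: "('c, 'c::nonarch_field) coeff_ring \<Rightarrow> nat \<Rightarrow> ('c, 'c \<times> 'c \<Rightarrow> 'c) module" where
  "P_module B k = fun_module B
     {f. \<exists>a. range a \<subseteq> carrier B \<and> f = (\<lambda>(x, y)\<in>T0. \<Sum>i\<le>k. a i * x ^ (k - i) * y ^ i)}"

definition linear_dual :: "('b, 'x) ring_scheme \<Rightarrow> ('b, 'a) module \<Rightarrow> ('a \<Rightarrow> 'b) set" where
  "linear_dual B A =
     {\<mu> \<in> carrier A \<rightarrow>\<^sub>E carrier B.
        (\<forall>f\<in>carrier A. \<forall>g\<in>carrier A. \<mu> (f \<oplus>\<^bsub>A\<^esub> g) = \<mu> f \<oplus>\<^bsub>B\<^esub> \<mu> g) \<and>
        (\<forall>b\<in>carrier B. \<forall>f\<in>carrier A. \<mu> (b \<odot>\<^bsub>A\<^esub> f) = b \<otimes>\<^bsub>B\<^esub> \<mu> f)}"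

inductive_set ideal_smult :: "('b, 'a) module \<Rightarrow> 'b set \<Rightarrow> 'a set"
  for A :: "('b, 'a) module" and J :: "'b set" where
  smult: "b \<in> J \<Longrightarrow> f \<in> carrier A \<Longrightarrow> b \<odot>\<^bsub>A\<^esub> f \<in> ideal_smult A J"
| add: "f \<in> ideal_smult A J \<Longrightarrow> g \<in> ideal_smult A J \<Longrightarrow> f \<oplus>\<^bsub>A\<^esub> g \<in> ideal_smult A J"

text \<open>
  Functionals that are continuous for the topologies defined by the maximal ideal, which for
  \<open>B = \<O>\<^sub>K\<close> is the \<open>\<pi>\<close>-adic topology. By additivity, continuity at zero suffices.
\<close>

definition continuous_dual :: "('b, 'x) ring_scheme \<Rightarrow> ('b, 'a) module \<Rightarrow> ('a \<Rightarrow> 'b) set" where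
  "continuous_dual B A =
     {\<mu> \<in> linear_dual B A.
        \<forall>n. \<exists>i. \<mu> ` ideal_smult A (max_ideal_pow B i) \<subseteq> max_ideal_pow B n}"


section \<open>Modules over a group\<close>

text \<open>
  Abelian groups are written multiplicatively, as in the library, and groups act on the right,
  as on distributions.
\<close>

record ('m, 'g) gmodule = "'m monoid" +
  act :: "'m \<Rightarrow> 'g \<Rightarrow> 'm"

definition is_gmodule :: "('g, 'x) monoid_scheme \<Rightarrow> ('m, 'g) gmodule \<Rightarrow> bool" where
  "is_gmodule G M \<longleftrightarrow>
     comm_group M \<and> (\<forall>g\<in>carrier G. (\<lambda>x. act M x g) \<in> hom M M) \<and>
     (\<forall>x\<in>carrier M. act M x \<one>\<^bsub>G\<^esub> = x \<and>
        (\<forall>g\<in>carrier G. \<forall>h\<in>carrier G. act M x (g \<otimes>\<^bsub>G\<^esub> h) = act M (act M x g) h))"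

definition torsion :: "('m, 'x) monoid_scheme \<Rightarrow> bool" where
  "torsion M \<longleftrightarrow> (\<forall>x\<in>carrier M. \<exists>n::nat. n > 0 \<and> x [^]\<^bsub>M\<^esub> n = \<one>\<^bsub>M\<^esub>)"

definition gmodule_hom ::
    "('g, 'x) monoid_scheme \<Rightarrow> ('m, 'g) gmodule \<Rightarrow> ('n, 'g) gmodule \<Rightarrow> ('m \<Rightarrow> 'n) set" where
  "gmodule_hom G M N =
     {h \<in> hom M N. \<forall>g\<in>carrier G. \<forall>x\<in>carrier M. h (act M x g) = act N (h x) g}"

text \<open>
  The map on cosets induced by \<open>f\<close>: if \<open>f\<close> is a homomorphism to \<open>H\<close> and \<open>X\<close> is a coset of a
  subgroup that \<open>f\<close> maps into \<open>N\<close>, the value is the coset of \<open>N\<close> containing \<open>f ` X\<close>.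
\<close>

definition coset_map :: "('n, 'x) monoid_scheme \<Rightarrow> 'n set \<Rightarrow> ('m \<Rightarrow> 'n) \<Rightarrow> 'm set \<Rightarrow> 'n set" where
  "coset_map H N f X = N <#>\<^bsub>H\<^esub> f ` X"

definition quotient_gmodule :: "('m, 'g) gmodule \<Rightarrow> 'm set \<Rightarrow> ('m set, 'g) gmodule" where
  "quotient_gmodule M N =
     \<lparr>carrier = carrier (M Mod N), mult = mult (M Mod N), one = one (M Mod N),
      act = (\<lambda>X g. coset_map M N (\<lambda>x. act M x g) X)\<rparr>"

definition fil_stable :: "('g, 'x) monoid_scheme \<Rightarrow> ('m, 'g) gmodule \<Rightarrow> (nat \<Rightarrow> 'm set) \<Rightarrow> bool" where
  "fil_stable G M Fil \<longleftrightarrow> (\<forall>n. \<forall>x\<in>Fil n. \<forall>g\<in>carrier G. act M x g \<in> Fil n)"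


subsection \<open>First cohomology\<close>

definition Z1 :: "('g, 'x) monoid_scheme \<Rightarrow> ('m, 'g) gmodule \<Rightarrow> ('g \<Rightarrow> 'm) monoid" where
  "Z1 G M =
     \<lparr>carrier = {c \<in> carrier G \<rightarrow>\<^sub>E carrier M. \<forall>g\<in>carrier G. \<forall>h\<in>carrier G.
                   c (g \<otimes>\<^bsub>G\<^esub> h) = act M (c g) h \<otimes>\<^bsub>M\<^esub> c h},
      mult = (\<lambda>c c'. \<lambda>g\<in>carrier G. c g \<otimes>\<^bsub>M\<^esub> c' g),
      one = (\<lambda>g\<in>carrier G. \<one>\<^bsub>M\<^esub>)\<rparr>"

definition B1 :: "('g, 'x) monoid_scheme \<Rightarrow> ('m, 'g) gmodule \<Rightarrow> ('g \<Rightarrow> 'm) set" where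
  "B1 G M = (\<lambda>x. \<lambda>g\<in>carrier G. act M x g \<otimes>\<^bsub>M\<^esub> inv\<^bsub>M\<^esub> x) ` carrier M"

definition H1 :: "('g, 'x) monoid_scheme \<Rightarrow> ('m, 'g) gmodule \<Rightarrow> ('g \<Rightarrow> 'm) set monoid" where
  "H1 G M = Z1 G M Mod B1 G M"

definition H1_map :: "('g, 'x) monoid_scheme \<Rightarrow> ('n, 'g) gmodule \<Rightarrow> ('m \<Rightarrow> 'n)
    \<Rightarrow> ('g \<Rightarrow> 'm) set \<Rightarrow> ('g \<Rightarrow> 'n) set" where
  "H1_map G N h = coset_map (Z1 G N) (B1 G N) (\<lambda>c. \<lambda>g\<in>carrier G. h (c g))"


subsection \<open>Projective systems\<close>

record ('m, 'g) proj_sys =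
  lev :: "nat \<Rightarrow> ('m, 'g) gmodule"
  tr :: "nat \<Rightarrow> 'm \<Rightarrow> 'm"  \<comment> \<open>\<open>tr n\<close> goes from level \<open>n + 1\<close> to level \<open>n\<close>\<close>

definition torsion_system :: "('g, 'x) monoid_scheme \<Rightarrow> ('m, 'g) proj_sys \<Rightarrow> bool" where
  "torsion_system G S \<longleftrightarrow>
     (\<forall>n. is_gmodule G (lev S n) \<and> torsion (lev S n) \<and>
          tr S n \<in> gmodule_hom G (lev S (Suc n)) (lev S n))"

definition system_hom :: "('g, 'x) monoid_scheme \<Rightarrow> ('m, 'g) proj_sys \<Rightarrow> ('n, 'g) proj_sys
    \<Rightarrow> (nat \<Rightarrow> 'm \<Rightarrow> 'n) set" where
  "system_hom G S T =
     {h. \<forall>n. h n \<in> gmodule_hom G (lev S n) (lev T n) \<and>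
         (\<forall>x\<in>carrier (lev S (Suc n)). h n (tr S n x) = tr T n (h (Suc n) x))}"

text \<open>
  Injective objects of the category of projective systems of torsion modules. Monomorphisms are
  the levelwise injective morphisms. The test objects have their elements in the same type as
  the object itself; if the group is countable and this type is infinite, then all generators
  of the category are among them, so by Baer's criterion nothing is lost.
\<close>

definition injective_system :: "('g, 'x) monoid_scheme \<Rightarrow> ('i, 'g) proj_sys \<Rightarrow> bool" where
  "injective_system G I \<longleftrightarrow>
     torsion_system G I \<and>
     (\<forall>(S :: ('i, 'g) proj_sys) (T :: ('i, 'g) proj_sys) j f.
        torsion_system G S \<and> torsion_system G T \<and>
        j \<in> system_hom G S T \<and> (\<forall>n. inj_on (j n) (carrier (lev S n))) \<and>
        f \<in> system_hom G S I \<longrightarrow>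
        (\<exists>h \<in> system_hom G T I. \<forall>n. \<forall>x\<in>carrier (lev S n). h n (j n x) = f n x))"

definition injective_resolution ::
    "('g, 'x) monoid_scheme \<Rightarrow> ('m, 'g) proj_sys \<Rightarrow> (nat \<Rightarrow> 'm \<Rightarrow> 'i)
       \<Rightarrow> (nat \<Rightarrow> ('i, 'g) proj_sys) \<Rightarrow> (nat \<Rightarrow> nat \<Rightarrow> 'i \<Rightarrow> 'i) \<Rightarrow> bool" where
  "injective_resolution G S \<epsilon> I d \<longleftrightarrow>
     (\<forall>i. injective_system G (I i)) \<and>
     \<epsilon> \<in> system_hom G S (I 0) \<and> (\<forall>i. d i \<in> system_hom G (I i) (I (Suc i))) \<and>
     (\<forall>n. inj_on (\<epsilon> n) (carrier (lev S n)) \<and>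
          kernel (lev (I 0) n) (lev (I 1) n) (d 0 n) = \<epsilon> n ` carrier (lev S n) \<and>
          (\<forall>i. kernel (lev (I (Suc i)) n) (lev (I (Suc (Suc i))) n) (d (Suc i) n)
               = d i n ` carrier (lev (I i) n)))"

definition lim_gmodule :: "('m, 'g) proj_sys \<Rightarrow> (nat \<Rightarrow> 'm, 'g) gmodule" where
  "lim_gmodule S =
     \<lparr>carrier = {x. \<forall>n. x n \<in> carrier (lev S n) \<and> tr S n (x (Suc n)) = x n},
      mult = (\<lambda>x y n. x n \<otimes>\<^bsub>lev S n\<^esub> y n), one = (\<lambda>n. \<one>\<^bsub>lev S n\<^esub>),
      act = (\<lambda>x g n. act (lev S n) (x n) g)\<rparr>"

definition H0 :: "('g, 'x) monoid_scheme \<Rightarrow> ('m, 'g) gmodule \<Rightarrow> 'm monoid" where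
  "H0 G M = \<lparr>carrier = {x \<in> carrier M. \<forall>g\<in>carrier G. act M x g = x}, mult = mult M, one = one M\<rparr>"

definition H0_cont :: "('g, 'x) monoid_scheme \<Rightarrow> ('m, 'g) proj_sys \<Rightarrow> (nat \<Rightarrow> 'm) monoid" where
  "H0_cont G S = H0 G (lim_gmodule S)"

text \<open>
  The first right derived functor of \<^const>\<open>H0_cont\<close>, computed by an injective resolution, and
  the homomorphism induced by a morphism \<open>\<phi>\<close> to another injective resolution.
\<close>

definition H1_cont_coboundaries :: "('g, 'x) monoid_scheme \<Rightarrow> (nat \<Rightarrow> ('i, 'g) proj_sys)
    \<Rightarrow> (nat \<Rightarrow> nat \<Rightarrow> 'i \<Rightarrow> 'i) \<Rightarrow> (nat \<Rightarrow> 'i) set" where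
  "H1_cont_coboundaries G I d = (\<lambda>x n. d 0 n (x n)) ` carrier (H0_cont G (I 0))"

definition H1_cont :: "('g, 'x) monoid_scheme \<Rightarrow> (nat \<Rightarrow> ('i, 'g) proj_sys)
    \<Rightarrow> (nat \<Rightarrow> nat \<Rightarrow> 'i \<Rightarrow> 'i) \<Rightarrow> (nat \<Rightarrow> 'i) set monoid" where
  "H1_cont G I d =
     (H0_cont G (I 1))
       \<lparr>carrier := kernel (H0_cont G (I 1)) (H0_cont G (I 2)) (\<lambda>x n. d 1 n (x n))\<rparr>
     Mod H1_cont_coboundaries G I d"

definition H1_cont_map :: "('g, 'x) monoid_scheme \<Rightarrow> (nat \<Rightarrow> ('j, 'g) proj_sys)
    \<Rightarrow> (nat \<Rightarrow> nat \<Rightarrow> 'j \<Rightarrow> 'j) \<Rightarrow> (nat \<Rightarrow> nat \<Rightarrow> 'i \<Rightarrow> 'j)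
    \<Rightarrow> (nat \<Rightarrow> 'i) set \<Rightarrow> (nat \<Rightarrow> 'j) set" where
  "H1_cont_map G J d \<phi> =
     coset_map (H0_cont G (J 1)) (H1_cont_coboundaries G J d) (\<lambda>x n. \<phi> 1 n (x n))"

definition resolution_morphism ::
    "('g, 'x) monoid_scheme \<Rightarrow> ('m, 'g) proj_sys \<Rightarrow> (nat \<Rightarrow> 'm \<Rightarrow> 'n)
       \<Rightarrow> (nat \<Rightarrow> 'm \<Rightarrow> 'i) \<Rightarrow> (nat \<Rightarrow> ('i, 'g) proj_sys) \<Rightarrow> (nat \<Rightarrow> nat \<Rightarrow> 'i \<Rightarrow> 'i)
       \<Rightarrow> (nat \<Rightarrow> 'n \<Rightarrow> 'j) \<Rightarrow> (nat \<Rightarrow> ('j, 'g) proj_sys) \<Rightarrow> (nat \<Rightarrow> nat \<Rightarrow> 'j \<Rightarrow> 'j)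
       \<Rightarrow> (nat \<Rightarrow> nat \<Rightarrow> 'i \<Rightarrow> 'j) \<Rightarrow> bool" where
  "resolution_morphism G S h \<epsilon> I d \<epsilon>' J d' \<phi> \<longleftrightarrow>
     (\<forall>i. \<phi> i \<in> system_hom G (I i) (J i)) \<and>
     (\<forall>n. \<forall>x\<in>carrier (lev S n). \<phi> 0 n (\<epsilon> n x) = \<epsilon>' n (h n x)) \<and>
     (\<forall>i n. \<forall>x\<in>carrier (lev (I i) n). \<phi> (Suc i) n (d i n x) = d' i n (\<phi> i n x))"

definition lim_H1 :: "('g, 'x) monoid_scheme \<Rightarrow> ('m, 'g) proj_sys \<Rightarrow> (nat \<Rightarrow> ('g \<Rightarrow> 'm) set) monoid" where
  "lim_H1 G S =
     \<lparr>carrier = {x. \<forall>n. x n \<in> carrier (H1 G (lev S n)) \<and> H1_map G (lev S n) (tr S n) (x (Suc n)) = x n},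
      mult = (\<lambda>x y n. x n \<otimes>\<^bsub>H1 G (lev S n)\<^esub> y n), one = (\<lambda>n. \<one>\<^bsub>H1 G (lev S n)\<^esub>)\<rparr>"

definition lim_H1_map :: "('g, 'x) monoid_scheme \<Rightarrow> ('n, 'g) proj_sys \<Rightarrow> (nat \<Rightarrow> 'm \<Rightarrow> 'n)
    \<Rightarrow> (nat \<Rightarrow> ('g \<Rightarrow> 'm) set) \<Rightarrow> (nat \<Rightarrow> ('g \<Rightarrow> 'n) set)" where
  "lim_H1_map G T h x = (\<lambda>n. H1_map G (lev T n) (h n) (x n))"

text \<open>
  The canonical map from continuous cohomology to the limit. At level \<open>n\<close> it sends the class of
  an invariant cycle \<open>z\<close> in \<open>I\<^sup>1\<close> to the image of \<open>z\<^sub>n\<close> under the connecting homomorphism of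
  \<open>0 \<rightarrow> S\<^sub>n \<rightarrow> I\<^sup>0\<^sub>n \<rightarrow> d I\<^sup>0\<^sub>n \<rightarrow> 0\<close>: choose \<open>y\<close> with \<open>d y = z\<^sub>n\<close> and take the class of
  \<open>g \<mapsto> y g - y\<close>. The set below is the whole class, as all representatives \<open>z\<close> and all \<open>y\<close>
  are admitted.
\<close>

definition H1_cont_to_lim ::
    "('g, 'x) monoid_scheme \<Rightarrow> ('m, 'g) proj_sys \<Rightarrow> (nat \<Rightarrow> 'm \<Rightarrow> 'i)
       \<Rightarrow> (nat \<Rightarrow> ('i, 'g) proj_sys) \<Rightarrow> (nat \<Rightarrow> nat \<Rightarrow> 'i \<Rightarrow> 'i)
       \<Rightarrow> (nat \<Rightarrow> 'i) set \<Rightarrow> (nat \<Rightarrow> ('g \<Rightarrow> 'm) set)" where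
  "H1_cont_to_lim G S \<epsilon> I d X =
     (\<lambda>n. {c \<in> carrier (Z1 G (lev S n)).
            \<exists>z\<in>X. \<exists>y\<in>carrier (lev (I 0) n). d 0 n y = z n \<and>
              (\<forall>g\<in>carrier G. \<epsilon> n (c g) =
                 act (lev (I 0) n) y g \<otimes>\<^bsub>lev (I 0) n\<^esub> inv\<^bsub>lev (I 0) n\<^esub> y)})"


subsection \<open>Filtered modules\<close>

definition quotient_system :: "('m, 'g) gmodule \<Rightarrow> (nat \<Rightarrow> 'm set) \<Rightarrow> ('m set, 'g) proj_sys" where
  "quotient_system M Fil =
     \<lparr>lev = (\<lambda>n. quotient_gmodule M (Fil n)), tr = (\<lambda>n. coset_map M (Fil n) (\<lambda>x. x))\<rparr>"

definition quotient_system_map :: "('n, 'g) gmodule \<Rightarrow> (nat \<Rightarrow> 'n set) \<Rightarrow> ('m \<Rightarrow> 'n)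
    \<Rightarrow> nat \<Rightarrow> 'm set \<Rightarrow> 'n set" where
  "quotient_system_map M' Fil' h = (\<lambda>n. coset_map M' (Fil' n) h)"

definition H1_to_lim :: "('g, 'x) monoid_scheme \<Rightarrow> ('m, 'g) gmodule \<Rightarrow> (nat \<Rightarrow> 'm set)
    \<Rightarrow> ('g \<Rightarrow> 'm) set \<Rightarrow> (nat \<Rightarrow> ('g \<Rightarrow> 'm set) set)" where
  "H1_to_lim G M Fil X = (\<lambda>n. H1_map G (quotient_gmodule M (Fil n)) (\<lambda>x. Fil n #>\<^bsub>M\<^esub> x) X)"

text \<open>
  For a module \<open>M\<close> with filtration \<open>Fil\<close>: the canonical maps from the continuous cohomology of
  the quotients, computed by a given injective resolution, and from the abstract cohomology
  of \<open>M\<close> to the limit of the cohomology groups of the quotients are isomorphisms.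
\<close>

definition comparison_isos ::
    "('g, 'x) monoid_scheme \<Rightarrow> ('m, 'g) gmodule \<Rightarrow> (nat \<Rightarrow> 'm set)
       \<Rightarrow> (nat \<Rightarrow> 'm set \<Rightarrow> 'i) \<Rightarrow> (nat \<Rightarrow> ('i, 'g) proj_sys) \<Rightarrow> (nat \<Rightarrow> nat \<Rightarrow> 'i \<Rightarrow> 'i) \<Rightarrow> bool" where
  "comparison_isos G M Fil \<epsilon> I d \<longleftrightarrow>
     H1_cont_to_lim G (quotient_system M Fil) \<epsilon> I d
       \<in> iso (H1_cont G I d) (lim_H1 G (quotient_system M Fil)) \<and>
     H1_to_lim G M Fil \<in> iso (H1 G M) (lim_H1 G (quotient_system M Fil))"

text \<open>Compatibility of these maps with the maps induced by \<open>h\<close> and by a lift \<open>\<phi>\<close> of \<open>h\<close>.\<close>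

definition comparison_compatible ::
    "('g, 'x) monoid_scheme
       \<Rightarrow> ('m, 'g) gmodule \<Rightarrow> (nat \<Rightarrow> 'm set)
       \<Rightarrow> (nat \<Rightarrow> 'm set \<Rightarrow> 'i) \<Rightarrow> (nat \<Rightarrow> ('i, 'g) proj_sys) \<Rightarrow> (nat \<Rightarrow> nat \<Rightarrow> 'i \<Rightarrow> 'i)
       \<Rightarrow> ('n, 'g) gmodule \<Rightarrow> (nat \<Rightarrow> 'n set)
       \<Rightarrow> (nat \<Rightarrow> 'n set \<Rightarrow> 'j) \<Rightarrow> (nat \<Rightarrow> ('j, 'g) proj_sys) \<Rightarrow> (nat \<Rightarrow> nat \<Rightarrow> 'j \<Rightarrow> 'j)
       \<Rightarrow> ('m \<Rightarrow> 'n) \<Rightarrow> (nat \<Rightarrow> nat \<Rightarrow> 'i \<Rightarrow> 'j) \<Rightarrow> bool" where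
  "comparison_compatible G M Fil \<epsilon> I d M' Fil' \<epsilon>' J d' h \<phi> \<longleftrightarrow>
     (\<forall>X \<in> carrier (H1_cont G I d).
        H1_cont_to_lim G (quotient_system M' Fil') \<epsilon>' J d' (H1_cont_map G J d' \<phi> X)
        = lim_H1_map G (quotient_system M' Fil') (quotient_system_map M' Fil' h)
            (H1_cont_to_lim G (quotient_system M Fil) \<epsilon> I d X)) \<and>
     (\<forall>Y \<in> carrier (H1 G M).
        H1_to_lim G M' Fil' (H1_map G M' h Y)
        = lim_H1_map G (quotient_system M' Fil') (quotient_system_map M' Fil' h)
            (H1_to_lim G M Fil Y))"


section \<open>Distributions\<close>

definition Gamma :: "nat \<Rightarrow> nat \<Rightarrow> (int ^ 2 ^ 2) monoid" where
  "Gamma N p =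
     \<lparr>carrier = {\<gamma>. det \<gamma> = 1 \<and> int N dvd \<gamma> $ 1 $ 1 - 1 \<and> int N dvd \<gamma> $ 2 $ 2 - 1 \<and>
                  int N dvd \<gamma> $ 2 $ 1 \<and> int p dvd \<gamma> $ 2 $ 1},
      mult = (**), one = mat 1\<rparr>"

definition row_act :: "'c::nonarch_field \<times> 'c \<Rightarrow> int ^ 2 ^ 2 \<Rightarrow> 'c \<times> 'c" where
  "row_act v \<gamma> =
     (of_int (\<gamma> $ 1 $ 1) * fst v + of_int (\<gamma> $ 2 $ 1) * snd v,
      of_int (\<gamma> $ 1 $ 2) * fst v + of_int (\<gamma> $ 2 $ 2) * snd v)"

definition fun_act :: "int ^ 2 ^ 2 \<Rightarrow> ('c::nonarch_field \<times> 'c \<Rightarrow> 'b) \<Rightarrow> ('c \<times> 'c \<Rightarrow> 'b)" where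
  "fun_act \<gamma> f = (\<lambda>v\<in>T0. f (row_act v \<gamma>))"

text \<open>
  The action on distributions is dual to \<^const>\<open>fun_act\<close>, so it presupposes that functions in
  \<open>A\<close> are mapped to functions in \<open>A\<close>; the action on the quotients presupposes \<^const>\<open>fil_stable\<close>.
  Neither is automatic. For \<open>\<Lambda>\<^sub>U\<close> the first fails if \<open>U\<close> is a full component
  \<open>\<bar>\<kappa> (1 + p) - 1\<bar> < p\<^bsup>-1/(p-1)\<^esup>\<close> of the accessible weights. The second fails for
  \<open>p = 3\<close>, \<open>K = \<rat>\<^sub>3\<close>, \<open>U = {\<kappa>. \<bar>\<kappa> 4 - 1\<bar> < 1/3}\<close> with parameter \<open>T = (\<kappa> 4 - 1)/3\<close>, and
  \<open>\<gamma>\<close> with rows \<open>(1, 0)\<close> and \<open>(12, 1)\<close>: the coefficient of \<open>f\<^sub>9\<close> in \<open>\<gamma> f\<^sub>0\<close> contains \<open>T\<close> with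
  a coefficient of valuation 7, so it is not in the ninth power of the maximal ideal.
\<close>

definition A_stable :: "(int ^ 2 ^ 2) monoid \<Rightarrow> ('b, 'c::nonarch_field) coeff_ring \<Rightarrow> bool" where
  "A_stable G B \<longleftrightarrow> (\<forall>\<gamma>\<in>carrier G. \<forall>f\<in>A_carrier B. fun_act \<gamma> f \<in> A_carrier B)"

definition dual_gmodule :: "('b, 'x) ring_scheme \<Rightarrow> ('b, 'c::nonarch_field \<times> 'c \<Rightarrow> 'b) module
    \<Rightarrow> (('c \<times> 'c \<Rightarrow> 'b) \<Rightarrow> 'b) set \<Rightarrow> (('c \<times> 'c \<Rightarrow> 'b) \<Rightarrow> 'b, int ^ 2 ^ 2) gmodule" where
  "dual_gmodule B A S =
     \<lparr>carrier = S, mult = (\<lambda>\<mu> \<nu>. \<lambda>f\<in>carrier A. \<mu> f \<oplus>\<^bsub>B\<^esub> \<nu> f),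
      one = (\<lambda>f\<in>carrier A. \<zero>\<^bsub>B\<^esub>),
      act = (\<lambda>\<mu> \<gamma>. \<lambda>f\<in>carrier A. \<mu> (fun_act \<gamma> f))\<rparr>"

definition D_module :: "('b, 'c::nonarch_field) coeff_ring
    \<Rightarrow> (('c \<times> 'c \<Rightarrow> 'b) \<Rightarrow> 'b, int ^ 2 ^ 2) gmodule" where
  "D_module B = dual_gmodule B (A_module B) (continuous_dual B (A_module B))"

definition D_Fil :: "('b, 'c::nonarch_field) coeff_ring \<Rightarrow> nat \<Rightarrow> (('c \<times> 'c \<Rightarrow> 'b) \<Rightarrow> 'b) set" where
  "D_Fil B n =
     {\<mu> \<in> carrier (D_module B). \<forall>j\<le>n. \<mu> (f_basis B j) \<in> max_ideal_pow B (n - j)}"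

definition V_module :: "('c, 'c::nonarch_field) coeff_ring \<Rightarrow> nat
    \<Rightarrow> (('c \<times> 'c \<Rightarrow> 'c) \<Rightarrow> 'c, int ^ 2 ^ 2) gmodule" where
  "V_module B k = dual_gmodule B (P_module B k) (linear_dual B (P_module B k))"

definition rho :: "('c, 'c::nonarch_field) coeff_ring \<Rightarrow> nat
    \<Rightarrow> (('c \<times> 'c \<Rightarrow> 'c) \<Rightarrow> 'c) \<Rightarrow> (('c \<times> 'c \<Rightarrow> 'c) \<Rightarrow> 'c)" where
  "rho B k \<mu> = restrict \<mu> (carrier (P_module B k))"

definition V_Fil :: "('c, 'c::nonarch_field) coeff_ring \<Rightarrow> nat \<Rightarrow> nat
    \<Rightarrow> (('c \<times> 'c \<Rightarrow> 'c) \<Rightarrow> 'c) set" where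
  "V_Fil B k n = rho B k ` D_Fil B n"

definition eta :: "(('c \<Rightarrow> 'c) \<Rightarrow> 'c, 'c::nonarch_field) coeff_ring \<Rightarrow> ('c, 'c) coeff_ring
    \<Rightarrow> ('c \<Rightarrow> 'c) \<Rightarrow> (('c \<times> 'c \<Rightarrow> (('c \<Rightarrow> 'c) \<Rightarrow> 'c)) \<Rightarrow> (('c \<Rightarrow> 'c) \<Rightarrow> 'c))
    \<Rightarrow> (('c \<times> 'c \<Rightarrow> 'c) \<Rightarrow> 'c)" where
  "eta BU Bk k \<mu> =
     (\<lambda>f\<in>A_carrier Bk. \<mu> (\<lambda>(x, y)\<in>T0. wt BU x \<otimes>\<^bsub>BU\<^esub> emb BU (f (1, y / x))) k)"

end

(*
  Each module D is, in coordinates, a product of copies of the ring of integers of K in which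
  Fil^n requires the q-th coordinate to lie in the (n - deg q)-th power of the maximal ideal,
  with finitely many coordinates below any degree. Hence D is complete, and D_n involves
  finitely many coordinates of finite length. H^1_cont maps onto lim H^1(D_n) because
  cochains in the injective systems lift along the transition maps, and the kernel is
  lim^1 H^0(D_n), which vanishes since the images of the almost invariant elements form a
  chain of O_K-submodules in finitely many coordinates modulo a power of the uniformizer and so
  become stationary; the same Mittag-Leffler argument compares H^1(D) with the limit.
  For D_U the coordinates are the coefficients in T of the values at the f_j: characters exist
  with any prescribed value w, |w - 1| < 1, at 1 + p, so the rigid functions on U bounded by 1
  are the integral power series in one variable on the open unit disk. That Gamma acts over O_K
  rests on the analyticity of accessible characters on 1 + p Z_p, obtained by writing
  k(1 + pu) as a binomial series in log(1 + pu).
*)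

theory Submission
  imports Defs "HOL-Computational_Algebra.Formal_Power_Series"
begin

section \<open>Modules over a group and their first cohomology\<close>

text \<open>An injective torsion module over the abstract group is shown to kill cocycles whose
  values have a common exponent: then the extension used to test injectivity is itself torsion.
  Hence the bound on the exponent of D / Fil^n D. The test objects live in the element type of the
  resolution, which therefore has to be infinite; this is deduced from the infinitude of D. The
  residue field of K may be infinite, so D_n need not be finite and compactness does not make lim^1
  vanish. All lim^1 arguments are carried out in D, with nested cosets of the elements that are
  invariant modulo Fil^n, and their stationarity rests on Gamma acting O_K-linearly. Continuity of
  functionals is automatic, because a function with small coefficients is a power of the uniformizer
  times another function; this is why the values on the f_j are free coordinates. Equivariance of
  specialization is the delicate point of (b): translating f_U and lifting the translate of f give
  different functions over Lambda_U, but they agree at k, and the value of a functional at k depends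
  on nothing else.\<close>

lemma (in comm_group) m_swap_middle:
  "a \<in> carrier G ==> b \<in> carrier G ==> c \<in> carrier G ==> d \<in> carrier G ==>
    (a \<otimes> b) \<otimes> (c \<otimes> d) = (a \<otimes> c) \<otimes> (b \<otimes> d)"
  by (simp add: m_ac)

text \<open>\<open>coset_map\<close> multiplies by all of \<open>N\<close>, so the value is a full
  coset whatever part of it \<open>f\<close> hits. This reduces the induced maps below to
  representatives.\<close>

lemma coset_map_rcos:
  assumes "group M" "group H" "subgroup N1 M" "subgroup N H" "f \<in> hom M H" "f ` N1 \<subseteq> N"
    and x: "x \<in> carrier M"
  shows "coset_map H N f (N1 #>\<^bsub>M\<^esub> x) = N #>\<^bsub>H\<^esub> f x"
proof -
  interpret M: group M by fact
  interpret H: group H by fact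
  interpret N1: subgroup N1 M by fact
  interpret N: subgroup N H by fact
  have fx: "f x \<in> carrier H" using assms(5) x by (auto simp: hom_def)
  have f: "f (n \<otimes>\<^bsub>M\<^esub> x) = f n \<otimes>\<^bsub>H\<^esub> f x" if "n \<in> N1" for n
    using that assms(5) x N1.mem_carrier by (auto simp: hom_def)
  have "n \<otimes>\<^bsub>H\<^esub> f (m \<otimes>\<^bsub>M\<^esub> x) \<in> N #>\<^bsub>H\<^esub> f x" if "n \<in> N" "m \<in> N1" for n m
  proof -
    have "f m \<in> N" using that assms(6) by auto
    then have "n \<otimes>\<^bsub>H\<^esub> f (m \<otimes>\<^bsub>M\<^esub> x) = (n \<otimes>\<^bsub>H\<^esub> f m) \<otimes>\<^bsub>H\<^esub> f x" "n \<otimes>\<^bsub>H\<^esub> f m \<in> N"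
      using that f fx by (auto simp: H.m_assoc)
    then show ?thesis by (auto simp: r_coset_def)
  qed
  moreover have "n \<otimes>\<^bsub>H\<^esub> f x \<in> N <#>\<^bsub>H\<^esub> f ` (N1 #>\<^bsub>M\<^esub> x)" if "n \<in> N" for n
  proof -
    have "f x = f (\<one>\<^bsub>M\<^esub> \<otimes>\<^bsub>M\<^esub> x)" using x by simp
    then have "f x \<in> f ` (N1 #>\<^bsub>M\<^esub> x)" using N1.one_closed unfolding r_coset_def by blast
    then show ?thesis using that unfolding set_mult_def by blast
  qed
  ultimately show ?thesis
    unfolding coset_map_def by (force simp: set_mult_def r_coset_def)
qed

definition coboundary ::
    "('g, 'x) monoid_scheme => ('m, 'g) gmodule => 'm => 'g => 'm" where
  "coboundary G M x = (\<lambda>g\<in>carrier G. act M x g \<otimes>\<^bsub>M\<^esub> inv\<^bsub>M\<^esub> x)"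

lemma B1_eq: "B1 G M = coboundary G M ` carrier M"
  by (simp add: B1_def coboundary_def)

locale group_module = G: group G for G :: "('g, 'x) monoid_scheme" +
  fixes M :: "('m, 'g) gmodule" (structure)
  assumes gmod: "is_gmodule G M"
begin

sublocale comm_group M
  using gmod by (simp add: is_gmodule_def)

lemma act_hom: "g \<in> carrier G ==> (\<lambda>x. act M x g) \<in> hom M M"
  using gmod by (simp add: is_gmodule_def)

lemma act_closed [simp, intro]: "g \<in> carrier G ==> x \<in> carrier M ==> act M x g \<in> carrier M"
  using act_hom by (auto simp: hom_def)

lemma act_mult [simp]: "g \<in> carrier G ==> x \<in> carrier M ==> y \<in> carrier M ==>
    act M (x \<otimes> y) g = act M x g \<otimes> act M y g"
  using act_hom by (auto simp: hom_def)

lemma act_unit [simp]: "x \<in> carrier M ==> act M x \<one>\<^bsub>G\<^esub> = x"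
  using gmod by (simp add: is_gmodule_def)

lemma act_act: "g \<in> carrier G ==> h \<in> carrier G ==> x \<in> carrier M ==>
    act M x (g \<otimes>\<^bsub>G\<^esub> h) = act M (act M x g) h"
  using gmod by (simp add: is_gmodule_def)

lemma act_group_hom: "g \<in> carrier G ==> group_hom M M (\<lambda>x. act M x g)"
  using act_hom by (unfold_locales) auto

lemma act_one [simp]: "g \<in> carrier G ==> act M \<one> g = \<one>"
  using group_hom.hom_one[OF act_group_hom] .

lemma act_inv [simp]: "g \<in> carrier G ==> x \<in> carrier M ==> act M (inv x) g = inv act M x g"
  using group_hom.hom_inv[OF act_group_hom] .

lemma act_pow: "g \<in> carrier G ==> x \<in> carrier M ==> act M (x [^] (n::nat)) g = act M x g [^] n"
  using group_hom.hom_nat_pow[OF act_group_hom] .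

lemma Z1_mem: "c \<in> carrier (Z1 G M) \<longleftrightarrow> c \<in> carrier G \<rightarrow>\<^sub>E carrier M \<and>
    (\<forall>g\<in>carrier G. \<forall>h\<in>carrier G. c (g \<otimes>\<^bsub>G\<^esub> h) = act M (c g) h \<otimes> c h)"
  by (simp add: Z1_def)

lemma Z1_closed [simp, intro]: "c \<in> carrier (Z1 G M) ==> g \<in> carrier G ==> c g \<in> carrier M"
  by (auto simp: Z1_mem)

lemma Z1_ext: "c \<in> carrier (Z1 G M) ==> c' \<in> carrier (Z1 G M) ==>
    (\<And>g. g \<in> carrier G ==> c g = c' g) ==> c = c'"
  by (auto simp: Z1_mem intro: PiE_ext)

lemma Z1_mult [simp]: "g \<in> carrier G ==> (c \<otimes>\<^bsub>Z1 G M\<^esub> c') g = c g \<otimes> c' g"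
  by (simp add: Z1_def)

lemma Z1_one [simp]: "g \<in> carrier G ==> \<one>\<^bsub>Z1 G M\<^esub> g = \<one>"
  by (simp add: Z1_def)

lemma Z1_cocycle: "c \<in> carrier (Z1 G M) ==> g \<in> carrier G ==> h \<in> carrier G ==>
    c (g \<otimes>\<^bsub>G\<^esub> h) = act M (c g) h \<otimes> c h"
  by (simp add: Z1_mem)

lemma Z1_comm_group: "comm_group (Z1 G M)"
proof (rule comm_groupI)
  show mc: "x \<otimes>\<^bsub>Z1 G M\<^esub> y \<in> carrier (Z1 G M)"
    if "x \<in> carrier (Z1 G M)" "y \<in> carrier (Z1 G M)" for x y
  proof -
    have "act M (x g \<otimes> y g) h \<otimes> (x h \<otimes> y h) = act M (x g) h \<otimes> x h \<otimes> (act M (y g) h \<otimes> y h)"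
      if "g \<in> carrier G" "h \<in> carrier G" for g h
      using that \<open>x \<in> _\<close> \<open>y \<in> _\<close> by (simp add: m_swap_middle)
    then show ?thesis
      using that unfolding Z1_mem by (auto simp: Z1_def)
  qed
  show oc: "\<one>\<^bsub>Z1 G M\<^esub> \<in> carrier (Z1 G M)" by (auto simp: Z1_def)
  fix x assume x: "x \<in> carrier (Z1 G M)"
  show "\<one>\<^bsub>Z1 G M\<^esub> \<otimes>\<^bsub>Z1 G M\<^esub> x = x"
    by (rule Z1_ext) (use x oc mc in auto)
  have i: "(\<lambda>g\<in>carrier G. inv x g) \<in> carrier (Z1 G M)"
    using x by (auto simp: Z1_mem[of "restrict _ _"] Z1_cocycle inv_mult)
  moreover have "(\<lambda>g\<in>carrier G. inv x g) \<otimes>\<^bsub>Z1 G M\<^esub> x = \<one>\<^bsub>Z1 G M\<^esub>"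
    by (rule Z1_ext) (use i x oc mc in auto)
  ultimately show "\<exists>y\<in>carrier (Z1 G M). y \<otimes>\<^bsub>Z1 G M\<^esub> x = \<one>\<^bsub>Z1 G M\<^esub>" by blast
  fix y assume y: "y \<in> carrier (Z1 G M)"
  show "x \<otimes>\<^bsub>Z1 G M\<^esub> y = y \<otimes>\<^bsub>Z1 G M\<^esub> x"
    by (rule Z1_ext) (use x y oc mc in \<open>auto simp: m_comm\<close>)
  fix z assume z: "z \<in> carrier (Z1 G M)"
  show "x \<otimes>\<^bsub>Z1 G M\<^esub> y \<otimes>\<^bsub>Z1 G M\<^esub> z = x \<otimes>\<^bsub>Z1 G M\<^esub> (y \<otimes>\<^bsub>Z1 G M\<^esub> z)"
    by (rule Z1_ext) (use x y z oc mc in \<open>auto simp: m_assoc\<close>)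
qed

lemma coboundary_in_Z1 [simp, intro]: "x \<in> carrier M ==> coboundary G M x \<in> carrier (Z1 G M)"
proof -
  assume x: "x \<in> carrier M"
  have "act M (act M x g) h \<otimes> inv x =
      act M (act M x g) h \<otimes> inv act M x h \<otimes> (act M x h \<otimes> inv x)"
    if "g \<in> carrier G" "h \<in> carrier G" for g h
  proof -
    have "act M (act M x g) h \<otimes> inv act M x h \<otimes> (act M x h \<otimes> inv x)
       = act M (act M x g) h \<otimes> (inv act M x h \<otimes> act M x h) \<otimes> inv x"
      using x that by (simp only: m_assoc act_closed inv_closed m_closed)
    then show ?thesis using x that by simp
  qed
  then show ?thesis using x by (simp add: Z1_mem coboundary_def act_act)
qed

lemma coboundary_hom: "coboundary G M \<in> hom M (Z1 G M)"
proof (rule homI)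
  fix x y assume xy: "x \<in> carrier M" "y \<in> carrier M"
  interpret Z: comm_group "Z1 G M" by (rule Z1_comm_group)
  have "act M x g \<otimes> act M y g \<otimes> (inv x \<otimes> inv y) =
      act M x g \<otimes> inv x \<otimes> (act M y g \<otimes> inv y)" if "g \<in> carrier G" for g
    using that xy by (intro m_swap_middle) auto
  then show "coboundary G M (x \<otimes> y) = coboundary G M x \<otimes>\<^bsub>Z1 G M\<^esub> coboundary G M y"
    using xy by (intro Z1_ext Z.m_closed coboundary_in_Z1) (auto simp: coboundary_def inv_mult)
qed auto

lemma B1_subgroup: "subgroup (B1 G M) (Z1 G M)"
proof -
  interpret Z: comm_group "Z1 G M" by (rule Z1_comm_group)
  interpret group_hom M "Z1 G M" "coboundary G M"
    using coboundary_hom by unfold_locales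
  show ?thesis unfolding B1_eq by (rule img_is_subgroup)
qed

text \<open>Turns equality of classes into an identity of values in \<open>M\<close>, exposing the
  element \<open>s\<close> that later has to be chosen compatibly over all levels.\<close>

lemma B1_rcos_eq_iff:
  assumes "c \<in> carrier (Z1 G M)" "c' \<in> carrier (Z1 G M)"
  shows "B1 G M #>\<^bsub>Z1 G M\<^esub> c = B1 G M #>\<^bsub>Z1 G M\<^esub> c' \<longleftrightarrow>
    (\<exists>s\<in>carrier M. \<forall>g\<in>carrier G. c' g = act M s g \<otimes> inv s \<otimes> c g)"
proof -
  interpret Z: comm_group "Z1 G M" by (rule Z1_comm_group)
  have "B1 G M #>\<^bsub>Z1 G M\<^esub> c = B1 G M #>\<^bsub>Z1 G M\<^esub> c' \<longleftrightarrow> c' \<in> B1 G M #>\<^bsub>Z1 G M\<^esub> c"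
    using assms B1_subgroup Z.repr_independence Z.rcos_self by metis
  also have "\<dots> \<longleftrightarrow> (\<exists>s\<in>carrier M. c' = coboundary G M s \<otimes>\<^bsub>Z1 G M\<^esub> c)"
    by (auto simp: r_coset_def B1_eq)
  also have "\<dots> \<longleftrightarrow> (\<exists>s\<in>carrier M. \<forall>g\<in>carrier G. c' g = act M s g \<otimes> inv s \<otimes> c g)"
  proof (intro bex_cong refl iffI)
    fix s assume s: "s \<in> carrier M"
    show "\<forall>g\<in>carrier G. c' g = act M s g \<otimes> inv s \<otimes> c g"
      if "c' = coboundary G M s \<otimes>\<^bsub>Z1 G M\<^esub> c"
      using that by (auto simp: coboundary_def)
    show "c' = coboundary G M s \<otimes>\<^bsub>Z1 G M\<^esub> c"
      if "\<forall>g\<in>carrier G. c' g = act M s g \<otimes> inv s \<otimes> c g"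
      using that assms s by (intro Z1_ext Z.m_closed coboundary_in_Z1) (auto simp: coboundary_def)
  qed
  finally show ?thesis .
qed

lemma H1_carrier: "carrier (H1 G M) = (\<lambda>c. B1 G M #>\<^bsub>Z1 G M\<^esub> c) ` carrier (Z1 G M)"
  by (simp add: H1_def carrier_FactGroup)

lemma H1_mult:
  assumes "c \<in> carrier (Z1 G M)" "c' \<in> carrier (Z1 G M)"
  shows "(B1 G M #>\<^bsub>Z1 G M\<^esub> c) \<otimes>\<^bsub>H1 G M\<^esub> (B1 G M #>\<^bsub>Z1 G M\<^esub> c') = B1 G M #>\<^bsub>Z1 G M\<^esub> (c \<otimes>\<^bsub>Z1 G M\<^esub> c')"
proof -
  interpret Z: comm_group "Z1 G M" by (rule Z1_comm_group)
  interpret normal "B1 G M" "Z1 G M" using B1_subgroup Z.subgroup_imp_normal by blast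
  show ?thesis using assms by (simp add: H1_def rcos_sum)
qed

end

lemma gmodule_hom_Z1:
  assumes "group_module G M" "group_module G N" "h \<in> gmodule_hom G M N" "c \<in> carrier (Z1 G M)"
  shows "(\<lambda>g\<in>carrier G. h (c g)) \<in> carrier (Z1 G N)"
proof -
  interpret M: group_module G M by fact
  interpret N: group_module G N by fact
  show ?thesis using assms(3,4) by (auto simp: Z1_def gmodule_hom_def hom_def)
qed

lemma H1_map_rcos:
  assumes M: "group_module G M" and N: "group_module G N" and h: "h \<in> gmodule_hom G M N"
    and c: "c \<in> carrier (Z1 G M)"
  shows "H1_map G N h (B1 G M #>\<^bsub>Z1 G M\<^esub> c) = B1 G N #>\<^bsub>Z1 G N\<^esub> (\<lambda>g\<in>carrier G. h (c g))"
proof -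
  interpret M: group_module G M by fact
  interpret N: group_module G N by fact
  interpret h: group_hom M N h using h by unfold_locales (simp add: gmodule_hom_def)
  have "(\<lambda>c. \<lambda>g\<in>carrier G. h (c g)) \<in> hom (Z1 G M) (Z1 G N)"
  proof (rule homI)
    fix a b assume ab: "a \<in> carrier (Z1 G M)" "b \<in> carrier (Z1 G M)"
    interpret ZM: comm_group "Z1 G M" by (rule M.Z1_comm_group)
    interpret ZN: comm_group "Z1 G N" by (rule N.Z1_comm_group)
    show "(\<lambda>g\<in>carrier G. h ((a \<otimes>\<^bsub>Z1 G M\<^esub> b) g)) =
        (\<lambda>g\<in>carrier G. h (a g)) \<otimes>\<^bsub>Z1 G N\<^esub> (\<lambda>g\<in>carrier G. h (b g))"
      using ab by (intro N.Z1_ext ZN.m_closed gmodule_hom_Z1[OF M N h]) auto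
  qed (rule gmodule_hom_Z1[OF M N h])
  moreover have "(\<lambda>c. \<lambda>g\<in>carrier G. h (c g)) ` B1 G M \<subseteq> B1 G N"
  proof (clarsimp simp: B1_eq)
    fix x assume x: "x \<in> carrier M"
    have "(\<lambda>g\<in>carrier G. h (coboundary G M x g)) = coboundary G N (h x)"
      using h x by (auto simp: coboundary_def gmodule_hom_def fun_eq_iff)
    then show "(\<lambda>g\<in>carrier G. h (coboundary G M x g)) \<in> coboundary G N ` carrier N"
      using x by auto
  qed
  ultimately show ?thesis
    unfolding H1_map_def using M.Z1_comm_group N.Z1_comm_group M.B1_subgroup N.B1_subgroup c
    by (intro coset_map_rcos) (auto simp: comm_group_def)
qed

section \<open>Injectivity level by level, lifting of invariants, and cocycles of finite
  exponent\<close>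

section \<open>Injective systems\<close>

lemma torsion_system_level:
  assumes "group G" "torsion_system G S"
  shows "group_module G (lev S n)"
  using assms by (auto simp: torsion_system_def group_module_def group_module_axioms_def)

text \<open>This is the left adjoint of evaluation at level \<open>n\<close>. It preserves
  injections, so injectivity of a system can be tested one level at a time.\<close>

definition truncated_system :: "nat => ('m, 'g) gmodule => ('m, 'g) proj_sys" where
  "truncated_system n E =
     \<lparr>lev = (\<lambda>m. if m \<le> n then E else E\<lparr>carrier := {\<one>\<^bsub>E\<^esub>}\<rparr>), tr = (\<lambda>_ x. x)\<rparr>"

primrec descend :: "('m, 'g) proj_sys => nat => nat => 'm => 'm" where
  "descend S n 0 x = x"
| "descend S n (Suc i) x = tr S (n - Suc i) (descend S n i x)"

lemma (in group_module) trivial_submodule: "is_gmodule G (M\<lparr>carrier := {\<one>\<^bsub>M\<^esub>}\<rparr>)"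
proof -
  interpret T: group "M\<lparr>carrier := {\<one>\<^bsub>M\<^esub>}\<rparr>"
    using subgroup.subgroup_is_group[OF triv_subgroup] is_group by blast
  have "comm_group (M\<lparr>carrier := {\<one>\<^bsub>M\<^esub>}\<rparr>)"
    by (rule T.group_comm_groupI) auto
  then show ?thesis
    by (auto simp: is_gmodule_def hom_def)
qed

lemma truncated_torsion_system:
  assumes "group_module G E" "torsion E"
  shows "torsion_system G (truncated_system n E)"
proof -
  interpret group_module G E by fact
  show ?thesis
    using gmod trivial_submodule assms(2)
    by (auto simp: torsion_system_def truncated_system_def torsion_def gmodule_hom_def hom_def
        intro: exI[of _ 1])
qed

lemma descend_hom:
  assumes S: "torsion_system G S" and i: "i \<le> n"
  shows "descend S n i \<in> gmodule_hom G (lev S n) (lev S (n - i))"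
  using i
proof (induction i)
  case 0
  show ?case by (auto simp: gmodule_hom_def hom_def)
next
  case (Suc i)
  have "tr S (n - Suc i) \<in> gmodule_hom G (lev S (Suc (n - Suc i))) (lev S (n - Suc i))"
    using S by (auto simp: torsion_system_def)
  moreover have "Suc (n - Suc i) = n - i" using Suc.prems by auto
  ultimately show ?case using Suc by (auto simp: gmodule_hom_def hom_def Pi_iff)
qed

text \<open>One half of the adjunction: below \<open>n\<close> the morphism is forced to be
  \<open>f\<close> followed by transition maps, and above \<open>n\<close> its source is
  trivial.\<close>

lemma truncated_system_hom:
  assumes G: "group G" and E: "group_module G E" and S: "torsion_system G S"
    and f: "f \<in> gmodule_hom G E (lev S n)"
  shows "(\<lambda>m x. if m \<le> n then descend S n (n - m) (f x) else \<one>\<^bsub>lev S m\<^esub>)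
    \<in> system_hom G (truncated_system n E) S"
proof -
  interpret E: group_module G E by fact
  have lev: "group_module G (lev S m)" for m using torsion_system_level G S by blast
  have tr1: "tr S m \<one>\<^bsub>lev S (Suc m)\<^esub> = \<one>\<^bsub>lev S m\<^esub>" for m
  proof -
    interpret A: group_module G "lev S (Suc m)" by (rule lev)
    interpret B: group_module G "lev S m" by (rule lev)
    interpret group_hom "lev S (Suc m)" "lev S m" "tr S m"
      using S by unfold_locales (auto simp: torsion_system_def gmodule_hom_def)
    show ?thesis by simp
  qed
  have f1: "f \<one>\<^bsub>E\<^esub> = \<one>\<^bsub>lev S n\<^esub>"
  proof -
    interpret B: group_module G "lev S n" by (rule lev)
    interpret group_hom E "lev S n" f
      using f by unfold_locales (auto simp: torsion_system_def gmodule_hom_def)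
    show ?thesis by simp
  qed
  have 1: "(\<lambda>x. descend S n (n - m) (f x)) \<in> gmodule_hom G E (lev S m)" if "m \<le> n" for m
    using descend_hom[OF S, of "n - m" n] that f by (auto simp: gmodule_hom_def hom_def Pi_iff)
  have 2: "(\<lambda>x. \<one>\<^bsub>lev S m\<^esub>) \<in> gmodule_hom G (E\<lparr>carrier := {\<one>\<^bsub>E\<^esub>}\<rparr>) (lev S m)" for m
  proof -
    interpret B: group_module G "lev S m" by (rule lev)
    show ?thesis by (auto simp: gmodule_hom_def hom_def)
  qed
  have 3: "descend S n (n - m) x = tr S m (descend S n (n - Suc m) x)" if "Suc m \<le> n" for m x
  proof -
    have "n - m = Suc (n - Suc m)" using that by auto
    then show ?thesis using that by simp
  qed
  show ?thesis
    unfolding system_hom_def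
  proof (intro CollectI allI conjI ballI)
    fix m
    show "(\<lambda>x. if m \<le> n then descend S n (n - m) (f x) else \<one>\<^bsub>lev S m\<^esub>)
        \<in> gmodule_hom G (lev (truncated_system n E) m) (lev S m)"
      using 1[of m] 2[of m] by (auto simp: truncated_system_def)
    fix x assume x: "x \<in> carrier (lev (truncated_system n E) (Suc m))"
    consider "Suc m \<le> n" | "m = n" | "n < m" by linarith
    then show "(if m \<le> n then descend S n (n - m) (f (tr (truncated_system n E) m x)) else \<one>\<^bsub>lev S m\<^esub>) =
        tr S m (if Suc m \<le> n then descend S n (n - Suc m) (f x) else \<one>\<^bsub>lev S (Suc m)\<^esub>)"
      by cases (use x 3[of m "f x"] tr1[of m] f1 in \<open>auto simp: truncated_system_def\<close>)
  qed
qed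

lemma injective_systemD:
  fixes I S T :: "('i, 'g) proj_sys"
  assumes "injective_system G I" "torsion_system G S" "torsion_system G T" "j \<in> system_hom G S T"
    "\<And>n. inj_on (j n) (carrier (lev S n))" "f \<in> system_hom G S I"
  obtains h where "h \<in> system_hom G T I" "\<And>n x. x \<in> carrier (lev S n) ==> h n (j n x) = f n x"
  using assms unfolding injective_system_def by metis

text \<open>An injection \<open>j\<close> of modules gives an injection of the systems truncated at
  \<open>n\<close>; the extension supplied by injectivity is read off at level
  \<open>n\<close>.\<close>

lemma injective_system_level:
  fixes I :: "('i, 'g) proj_sys" and E F :: "('i, 'g) gmodule"
  assumes G: "group G" and I: "injective_system G I"
    and E: "group_module G E" "torsion E" and F: "group_module G F" "torsion F"
    and j: "j \<in> gmodule_hom G E F" "inj_on j (carrier E)"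
    and f: "f \<in> gmodule_hom G E (lev I n)"
  shows "\<exists>h\<in>gmodule_hom G F (lev I n). \<forall>x\<in>carrier E. h (j x) = f x"
proof -
  interpret E: group_module G E by fact
  interpret F: group_module G F by fact
  interpret j: group_hom E F j using j by unfold_locales (simp add: gmodule_hom_def)
  have TI: "torsion_system G I" using I by (simp add: injective_system_def)
  let ?f = "\<lambda>m x. if m \<le> n then descend I n (n - m) (f x) else \<one>\<^bsub>lev I m\<^esub>"
  let ?E = "truncated_system n E" and ?F = "truncated_system n F"
  have jj: "(\<lambda>m. j) \<in> system_hom G ?E ?F"
    using j E.one_closed
    by (auto simp: system_hom_def truncated_system_def gmodule_hom_def hom_def)
  have inj: "inj_on j (carrier (lev ?E m))" for m
    using j by (auto simp: truncated_system_def)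
  obtain h where h: "h \<in> system_hom G ?F I" "\<And>m x. x \<in> carrier (lev ?E m) ==> h m (j x) = ?f m x"
    using injective_systemD[where j = "\<lambda>m. j", OF I truncated_torsion_system[OF E, of n]
        truncated_torsion_system[OF F, of n] jj inj truncated_system_hom[OF G E(1) TI f]] by blast
  show ?thesis
  proof (intro bexI ballI)
    show "h n \<in> gmodule_hom G F (lev I n)"
      using h(1) by (auto simp: system_hom_def truncated_system_def split: if_splits dest: spec[of _ n])
    show "h n (j x) = f x" if "x \<in> carrier E" for x
      using h(2)[of x n] that by (simp add: truncated_system_def)
  qed
qed

text \<open>The module \<open>E\<close> of invariants at level \<open>n\<close> gives a system
  truncated at \<open>n\<close>, which is a subsystem of the one truncated at \<open>Suc n\<close>.
  Extending its map to \<open>I\<close> over the larger system produces a lift, and the lift is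
  invariant because \<open>G\<close> acts trivially on \<open>E\<close>.\<close>

lemma lift_invariant:
  assumes G: "group G" and I: "injective_system G I"
    and x: "x \<in> carrier (lev I n)" "\<And>g. g \<in> carrier G ==> act (lev I n) x g = x"
  shows "\<exists>y\<in>carrier (lev I (Suc n)). (\<forall>g\<in>carrier G. act (lev I (Suc n)) y g = y) \<and> tr I n y = x"
proof -
  have TI: "torsion_system G I" using I by (simp add: injective_system_def)
  have lev: "group_module G (lev I m)" for m using torsion_system_level G TI by blast
  interpret L: group_module G "lev I n" by (rule lev)
  interpret L': group_module G "lev I (Suc n)" by (rule lev)
  define E where "E = (lev I n)\<lparr>carrier := {x \<in> carrier (lev I n). \<forall>g\<in>carrier G. act (lev I n) x g = x}\<rparr>"
  have sub: "subgroup (carrier E) (lev I n)"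
    by unfold_locales (auto simp: E_def)
  have cE: "comm_group E"
    using group.group_comm_groupI[OF subgroup.subgroup_is_group[OF sub L.is_group]]
    by (simp add: E_def L.m_comm)
  have E: "group_module G E"
    using G cE by (auto simp: group_module_def group_module_axioms_def is_gmodule_def E_def hom_def L.act_act)
  have tE: "torsion E"
    using TI by (auto simp: torsion_def torsion_system_def E_def nat_pow_def)
  have incl: "(\<lambda>x. x) \<in> gmodule_hom G E (lev I n)"
    by (auto simp: gmodule_hom_def hom_def E_def)
  let ?S = "truncated_system n E" and ?T = "truncated_system (Suc n) E"
  let ?f = "\<lambda>m x. if m \<le> n then descend I n (n - m) x else \<one>\<^bsub>lev I m\<^esub>"
  interpret E: group_module G E by (rule E)
  have jj: "(\<lambda>m x. x) \<in> system_hom G ?S ?T"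
    by (auto simp: system_hom_def truncated_system_def gmodule_hom_def hom_def)
  obtain h where h: "h \<in> system_hom G ?T I" "\<And>m x. x \<in> carrier (lev ?S m) ==> h m x = ?f m x"
    using injective_systemD[where j = "\<lambda>m x. x", OF I truncated_torsion_system[OF E tE, of n]
        truncated_torsion_system[OF E tE, of "Suc n"] jj inj_on_id2 truncated_system_hom[OF G E TI incl]]
    by blast
  have hn: "h (Suc n) \<in> gmodule_hom G E (lev I (Suc n))"
    using h(1) by (auto simp: system_hom_def truncated_system_def split: if_splits dest: spec[of _ "Suc n"])
  have xE: "x \<in> carrier E" "\<And>g. g \<in> carrier G ==> act E x g = x" using x by (auto simp: E_def)
  have "tr I n (h (Suc n) x) = h n x"
    using h(1) xE(1) by (auto simp: system_hom_def truncated_system_def dest!: spec[of _ n])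
  also have "\<dots> = x" using h(2)[of x n] xE by (simp add: truncated_system_def)
  finally have "tr I n (h (Suc n) x) = x" .
  moreover have "act (lev I (Suc n)) (h (Suc n) x) g = h (Suc n) x" if "g \<in> carrier G" for g
    using hn xE that by (auto simp: gmodule_hom_def) metis
  moreover have "h (Suc n) x \<in> carrier (lev I (Suc n))" using hn xE by (auto simp: gmodule_hom_def hom_def)
  ultimately show ?thesis by blast
qed

text \<open>
  A cocycle \<open>c\<close> of exponent \<open>q\<close> makes \<open>L \<times> \<int>/q\<close> a module in which \<open>(1, 1)\<close> has coboundary \<open>c\<close>;
  a retraction onto the injective module \<open>L\<close> therefore trivializes \<open>c\<close>. The extension is
  transported into the infinite type \<open>'i\<close>, where the test objects live.
\<close>

definition cocycle_extension ::
    "('i \<times> nat => 'i) => ('i, 'g) gmodule => nat => ('g => 'i) => ('i, 'g) gmodule" where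
  "cocycle_extension \<phi> L q c =
     \<lparr>carrier = \<phi> ` (carrier L \<times> {..<q}),
      mult = (\<lambda>u v. case (inv_into UNIV \<phi> u, inv_into UNIV \<phi> v) of ((x, a), (y, b)) => \<phi> (x \<otimes>\<^bsub>L\<^esub> y, (a + b) mod q)),
      one = \<phi> (\<one>\<^bsub>L\<^esub>, 0),
      act = (\<lambda>u g. case inv_into UNIV \<phi> u of (x, a) => \<phi> (act L x g \<otimes>\<^bsub>L\<^esub> c g [^]\<^bsub>L\<^esub> a, a))\<rparr>"

lemma cocycle_extension_module:
  fixes q :: nat
  assumes L: "group_module G L" "torsion L" and \<phi>: "inj \<phi>" and q: "q > 0"
    and c: "c \<in> carrier (Z1 G L)" and cq: "\<And>g. g \<in> carrier G ==> c g [^]\<^bsub>L\<^esub> q = \<one>\<^bsub>L\<^esub>"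
  shows "group_module G (cocycle_extension \<phi> L q c)" "torsion (cocycle_extension \<phi> L q c)"
proof -
  interpret L: group_module G L by fact
  let ?F = "cocycle_extension \<phi> L q c"
  have inv [simp]: "inv_into UNIV \<phi> (\<phi> u) = u" for u using \<phi> by (simp add: inv_into_f_f)
  \<comment> \<open>The exponent \<open>q\<close> makes powers of \<open>c g\<close> depend only on
    the exponent modulo \<open>q\<close>, so the action is compatible with the addition in the
    second component.\<close>
  have pmod: "c g [^]\<^bsub>L\<^esub> (n mod q) = c g [^]\<^bsub>L\<^esub> n" if "g \<in> carrier G" for g n
  proof -
    have "c g [^]\<^bsub>L\<^esub> n = c g [^]\<^bsub>L\<^esub> (q * (n div q) + n mod q)" by simp
    also have "\<dots> = (c g [^]\<^bsub>L\<^esub> q) [^]\<^bsub>L\<^esub> (n div q) \<otimes>\<^bsub>L\<^esub> c g [^]\<^bsub>L\<^esub> (n mod q)"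
      using c that by (simp only: L.nat_pow_mult[symmetric] L.nat_pow_pow L.Z1_closed)
    finally show ?thesis using c cq that by simp
  qed
  have car: "carrier ?F = \<phi> ` (carrier L \<times> {..<q})"
    and mul: "\<And>x a y b. \<phi> (x, a) \<otimes>\<^bsub>?F\<^esub> \<phi> (y, b) = \<phi> (x \<otimes>\<^bsub>L\<^esub> y, (a + b) mod q)"
    and one: "\<one>\<^bsub>?F\<^esub> = \<phi> (\<one>\<^bsub>L\<^esub>, 0)"
    and act: "\<And>x a g. act ?F (\<phi> (x, a)) g = \<phi> (act L x g \<otimes>\<^bsub>L\<^esub> c g [^]\<^bsub>L\<^esub> a, a)"
    by (simp_all add: cocycle_extension_def)
  have cg: "comm_group ?F"
  proof (rule comm_groupI)
    fix x assume x: "x \<in> carrier ?F"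
    then obtain y a where y: "x = \<phi> (y, a)" "y \<in> carrier L" "a < q" by (auto simp: car)
    \<comment> \<open>The inner reduction covers \<open>a = 0\<close>, where \<open>q - a\<close> is
      not below \<open>q\<close>.\<close>
    have "((q - a) mod q + a) mod q = 0" using y by (cases "a = 0") auto
    then have "\<phi> (inv\<^bsub>L\<^esub> y, (q - a) mod q) \<otimes>\<^bsub>?F\<^esub> x = \<one>\<^bsub>?F\<^esub>"
      unfolding y(1) mul one by (simp add: y)
    moreover have "\<phi> (inv\<^bsub>L\<^esub> y, (q - a) mod q) \<in> carrier ?F" using y by (simp add: car)
    ultimately show "\<exists>z\<in>carrier ?F. z \<otimes>\<^bsub>?F\<^esub> x = \<one>\<^bsub>?F\<^esub>" by blast
    fix x' assume x': "x' \<in> carrier ?F"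
    then obtain y' a' where y': "x' = \<phi> (y', a')" "y' \<in> carrier L" "a' < q" by (auto simp: car)
    show "x \<otimes>\<^bsub>?F\<^esub> x' \<in> carrier ?F" using y y' q by (simp add: car mul)
    show "x \<otimes>\<^bsub>?F\<^esub> x' = x' \<otimes>\<^bsub>?F\<^esub> x" using y y' by (simp add: mul L.m_comm add.commute)
    show "\<one>\<^bsub>?F\<^esub> \<otimes>\<^bsub>?F\<^esub> x = x" using y by (simp add: mul one)
    fix z assume "z \<in> carrier ?F"
    then obtain z' b where z: "z = \<phi> (z', b)" "z' \<in> carrier L" "b < q" by (auto simp: car)
    show "x \<otimes>\<^bsub>?F\<^esub> x' \<otimes>\<^bsub>?F\<^esub> z = x \<otimes>\<^bsub>?F\<^esub> (x' \<otimes>\<^bsub>?F\<^esub> z)"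
      using y y' z by (simp only: mul L.m_assoc mod_add_left_eq mod_add_right_eq add.assoc)
  qed (use q in \<open>simp add: car one\<close>)
  have hm: "(\<lambda>x. act ?F x g) \<in> hom ?F ?F" if g: "g \<in> carrier G" for g
  proof (rule homI)
    fix x y assume "x \<in> carrier ?F" "y \<in> carrier ?F"
    then obtain x' a y' b where x: "x = \<phi> (x', a)" "x' \<in> carrier L" "y = \<phi> (y', b)" "y' \<in> carrier L"
      by (auto simp: car)
    have "act L x' g \<otimes>\<^bsub>L\<^esub> act L y' g \<otimes>\<^bsub>L\<^esub> (c g [^]\<^bsub>L\<^esub> a \<otimes>\<^bsub>L\<^esub> c g [^]\<^bsub>L\<^esub> b) =
        act L x' g \<otimes>\<^bsub>L\<^esub> c g [^]\<^bsub>L\<^esub> a \<otimes>\<^bsub>L\<^esub> (act L y' g \<otimes>\<^bsub>L\<^esub> c g [^]\<^bsub>L\<^esub> b)"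
      using g x c by (intro L.m_swap_middle) auto
    then show "act ?F (x \<otimes>\<^bsub>?F\<^esub> y) g = act ?F x g \<otimes>\<^bsub>?F\<^esub> act ?F y g"
      using g x c by (simp add: mul act pmod L.nat_pow_mult L.Z1_closed)
  qed (use g c L.Z1_closed in \<open>auto simp: car act\<close>)
  have aa: "act ?F x (g \<otimes>\<^bsub>G\<^esub> h) = act ?F (act ?F x g) h"
    if gh: "g \<in> carrier G" "h \<in> carrier G" and xF: "x \<in> carrier ?F" for x g h
  proof -
    obtain y a where y: "x = \<phi> (y, a)" "y \<in> carrier L" using xF by (auto simp: car)
    have "c (g \<otimes>\<^bsub>G\<^esub> h) [^]\<^bsub>L\<^esub> a = act L (c g [^]\<^bsub>L\<^esub> a) h \<otimes>\<^bsub>L\<^esub> c h [^]\<^bsub>L\<^esub> a"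
      using c gh by (simp add: L.Z1_cocycle L.act_pow L.Z1_closed L.nat_pow_distrib)
    then show ?thesis
      using y gh c by (simp add: act L.act_act L.m_assoc L.Z1_closed)
  qed
  have a1: "act ?F x \<one>\<^bsub>G\<^esub> = x" if "x \<in> carrier ?F" for x
  proof -
    have "c \<one>\<^bsub>G\<^esub> = act L (c \<one>\<^bsub>G\<^esub>) \<one>\<^bsub>G\<^esub> \<otimes>\<^bsub>L\<^esub> c \<one>\<^bsub>G\<^esub>"
      using L.Z1_cocycle[OF c, of "\<one>\<^bsub>G\<^esub>" "\<one>\<^bsub>G\<^esub>"] by simp
    then have "c \<one>\<^bsub>G\<^esub> = \<one>\<^bsub>L\<^esub>" using c by (simp add: L.Z1_closed)
    then show ?thesis using that by (auto simp: car act)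
  qed
  show "group_module G ?F"
    using L.G.is_group cg hm aa a1
    by (simp add: group_module_def group_module_axioms_def is_gmodule_def)
  show "torsion ?F"
  proof (unfold torsion_def, intro ballI)
    fix x assume "x \<in> carrier ?F"
    then obtain y a where y: "x = \<phi> (y, a)" "y \<in> carrier L" "a < q" by (auto simp: car)
    obtain n :: nat where n: "n > 0" "y [^]\<^bsub>L\<^esub> n = \<one>\<^bsub>L\<^esub>" using L(2) y by (auto simp: torsion_def)
    have "x [^]\<^bsub>?F\<^esub> m = \<phi> (y [^]\<^bsub>L\<^esub> m, (a * m) mod q)" for m :: nat
      by (induction m) (use y in \<open>auto simp: one mul mod_simps add.commute\<close>)
    then have "x [^]\<^bsub>?F\<^esub> (n * q) = \<one>\<^bsub>?F\<^esub>"
      using n y by (simp add: one L.nat_pow_pow[symmetric])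
    then show "\<exists>n::nat. n > 0 \<and> x [^]\<^bsub>?F\<^esub> n = \<one>\<^bsub>?F\<^esub>" using n q by (intro exI[of _ "n * q"]) simp
  qed
qed

lemma infinite_pairing:
  includes cardinal_syntax
  assumes "infinite (UNIV :: 'i set)"
  shows "\<exists>\<phi> :: 'i \<times> nat => 'i. inj \<phi>"
proof -
  have "|UNIV :: 'i set| =o |UNIV \<times> UNIV :: ('i \<times> 'i) set|"
    using card_of_Times_same_infinite[OF assms] ordIso_symmetric by blast
  then obtain f :: "'i \<times> 'i => 'i" where f: "inj f"
    using card_of_ordIso[of "UNIV \<times> UNIV :: ('i \<times> 'i) set" "UNIV :: 'i set"] ordIso_symmetric
    by (metis UNIV_Times_UNIV bij_betw_imp_inj_on)
  obtain g :: "nat => 'i" where g: "inj g"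
    using infinite_countable_subset[OF assms] by auto
  have "inj (\<lambda>(x, n). f (x, g n))"
    by (rule injI) (auto dest!: injD[OF f] injD[OF g])
  then show ?thesis by blast
qed

lemma trivialize_cocycle:
  fixes I :: "('i, 'g) proj_sys" and q :: nat
  assumes G: "group G" and I: "injective_system G I" and inf: "infinite (UNIV :: 'i set)" and q: "q > 0"
    and c: "c \<in> carrier (Z1 G (lev I n))"
    and cq: "\<And>g. g \<in> carrier G ==> c g [^]\<^bsub>lev I n\<^esub> q = \<one>\<^bsub>lev I n\<^esub>"
  shows "\<exists>y\<in>carrier (lev I n). \<forall>g\<in>carrier G. c g = act (lev I n) y g \<otimes>\<^bsub>lev I n\<^esub> inv\<^bsub>lev I n\<^esub> y"
proof -
  let ?L = "lev I n"
  obtain \<phi> :: "'i \<times> nat => 'i" where \<phi>: "inj \<phi>" using infinite_pairing[OF inf] by blast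
  have TI: "torsion_system G I" using I by (simp add: injective_system_def)
  have L: "group_module G ?L" "torsion ?L" using torsion_system_level G TI by (auto simp: torsion_system_def)
  interpret L: group_module G ?L by (rule L)
  let ?F = "cocycle_extension \<phi> ?L q c"
  note F = cocycle_extension_module[OF L \<phi> q c cq]
  have inv [simp]: "inv_into UNIV \<phi> (\<phi> u) = u" for u using \<phi> by (simp add: inv_into_f_f)
  have "(\<lambda>x. \<phi> (x, 0)) \<in> gmodule_hom G ?L ?F"
    using q by (auto simp: gmodule_hom_def hom_def cocycle_extension_def)
  moreover have "inj_on (\<lambda>x. \<phi> (x, 0)) (carrier ?L)"
    by (auto intro!: inj_onI dest!: injD[OF \<phi>])
  moreover have "(\<lambda>x. x) \<in> gmodule_hom G ?L ?L" by (auto simp: gmodule_hom_def hom_def)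
  ultimately obtain h where h: "h \<in> gmodule_hom G ?F ?L" "\<And>x. x \<in> carrier ?L ==> h (\<phi> (x, 0)) = x"
    using injective_system_level[OF G I L F] by blast
  \<comment> \<open>The element (1, 1) of the extension; \<open>1 mod q\<close> also covers
    \<open>q = 1\<close>, where the extension is a copy of \<open>L\<close> itself.\<close>
  define e where "e = \<phi> (\<one>\<^bsub>?L\<^esub>, 1 mod q)"
  have e: "e \<in> carrier ?F" using q by (auto simp: e_def cocycle_extension_def)
  have he: "h e \<in> carrier ?L" using h e by (auto simp: gmodule_hom_def hom_def)
  have "act ?L (h e) g = c g \<otimes>\<^bsub>?L\<^esub> h e" if g: "g \<in> carrier G" for g
  proof -
    have cg: "c g \<in> carrier ?L" using c g by auto
    have "c g [^]\<^bsub>?L\<^esub> (1 mod q) = c g"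
    proof (cases "q = 1")
      case True
      then show ?thesis using cq[OF g] cg by simp
    next
      case False
      then have "1 mod q = 1" using q by simp
      then show ?thesis using cg by simp
    qed
    then have "act ?F e g = \<phi> (c g, 0) \<otimes>\<^bsub>?F\<^esub> e" "\<phi> (c g, 0) \<in> carrier ?F"
      using g cg q by (auto simp: e_def cocycle_extension_def)
    moreover have "act ?L (h e) g = h (act ?F e g)" using h(1) e g by (simp add: gmodule_hom_def)
    ultimately show ?thesis using h e cg by (simp add: gmodule_hom_def hom_def)
  qed
  then have "c g = act ?L (h e) g \<otimes>\<^bsub>?L\<^esub> inv\<^bsub>?L\<^esub> h e" if "g \<in> carrier G" for g
    using that he c by (simp add: L.m_assoc L.Z1_closed)
  then show ?thesis using he by blast
qed

section \<open>Quotients of a filtered module, and H^1 of the module as a limit\<close>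

section \<open>Filtered modules\<close>

text \<open>The preimage in \<open>M\<close> of the invariants of \<open>M / Fil n\<close>. Pulled
  back to \<open>M\<close>, these groups for different \<open>n\<close> become comparable: they form
  a decreasing chain as soon as \<open>Fil\<close> decreases.\<close>

definition almost_invariant ::
    "('g, 'x) monoid_scheme => ('m, 'g) gmodule => (nat => 'm set) => nat => 'm set" where
  "almost_invariant G M Fil n =
     {x \<in> carrier M. \<forall>g\<in>carrier G. act M x g \<otimes>\<^bsub>M\<^esub> inv\<^bsub>M\<^esub> x \<in> Fil n}"

lemma (in group_module) act_div_mult:
  assumes "x \<in> carrier M" "y \<in> carrier M" "g \<in> carrier G"
  shows "act M (x \<otimes>\<^bsub>M\<^esub> y) g \<otimes>\<^bsub>M\<^esub> inv\<^bsub>M\<^esub> (x \<otimes>\<^bsub>M\<^esub> y) =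
    (act M x g \<otimes>\<^bsub>M\<^esub> inv\<^bsub>M\<^esub> x) \<otimes>\<^bsub>M\<^esub> (act M y g \<otimes>\<^bsub>M\<^esub> inv\<^bsub>M\<^esub> y)"
proof -
  have "act M x g \<otimes>\<^bsub>M\<^esub> act M y g \<otimes>\<^bsub>M\<^esub> (inv\<^bsub>M\<^esub> x \<otimes>\<^bsub>M\<^esub> inv\<^bsub>M\<^esub> y) =
      act M x g \<otimes>\<^bsub>M\<^esub> inv\<^bsub>M\<^esub> x \<otimes>\<^bsub>M\<^esub> (act M y g \<otimes>\<^bsub>M\<^esub> inv\<^bsub>M\<^esub> y)"
    using assms by (intro m_swap_middle) auto
  then show ?thesis using assms by (simp add: inv_mult)
qed

text \<open>The bound on the exponent of each quotient is what allows cocycles with values in it to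
  be killed in an injective system.\<close>

locale filtered_module = group_module G M for G :: "('g, 'x) monoid_scheme" and M :: "('m, 'g) gmodule" (structure) +
  fixes Fil :: "nat => 'm set"
  assumes Fil_subgroup: "subgroup (Fil n) M"
    and Fil_stable: "fil_stable G M Fil"
    and Fil_Suc: "Fil (Suc n) \<subseteq> Fil n"
    and Fil_exponent: "\<exists>q::nat. q > 0 \<and> (\<forall>x\<in>carrier M. x [^] q \<in> Fil n)"
begin

abbreviation Q :: "nat => ('m set, 'g) gmodule" where
  "Q n \<equiv> quotient_gmodule M (Fil n)"

abbreviation cls :: "nat => ('g => 'm set) => ('g => 'm set) set" where
  "cls n c \<equiv> B1 G (Q n) #>\<^bsub>Z1 G (Q n)\<^esub> c"

definition pr :: "nat => 'm => 'm set" where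
  "pr n x = Fil n #> x"

lemma Fil_normal: "Fil n \<lhd> M"
  using Fil_subgroup subgroup_imp_normal by blast

lemma Q_carrier: "carrier (Q n) = pr n ` carrier M"
  by (auto simp: quotient_gmodule_def carrier_FactGroup pr_def)

lemma pr_closed [simp, intro]: "x \<in> carrier M ==> pr n x \<in> carrier (Q n)"
  by (simp add: Q_carrier)

lemma pr_mult: "x \<in> carrier M ==> y \<in> carrier M ==> pr n (x \<otimes> y) = pr n x \<otimes>\<^bsub>Q n\<^esub> pr n y"
  using normal.rcos_sum[OF Fil_normal] by (simp add: quotient_gmodule_def pr_def)

lemma pr_act:
  assumes "x \<in> carrier M" "g \<in> carrier G"
  shows "pr n (act M x g) = act (Q n) (pr n x) g"
proof -
  have "coset_map M (Fil n) (\<lambda>x. act M x g) (Fil n #> x) = Fil n #> act M x g"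
    using assms act_hom Fil_subgroup Fil_stable
    by (intro coset_map_rcos) (auto simp: is_group fil_stable_def)
  then show ?thesis by (simp add: quotient_gmodule_def pr_def)
qed

lemma pr_eq_iff: "x \<in> carrier M ==> y \<in> carrier M ==> pr n x = pr n y \<longleftrightarrow> x \<otimes> inv y \<in> Fil n"
proof -
  assume xy: "x \<in> carrier M" "y \<in> carrier M"
  interpret F: subgroup "Fil n" M by (rule Fil_subgroup)
  have "pr n x = pr n y \<longleftrightarrow> x \<in> pr n y"
    using xy Fil_subgroup repr_independence rcos_self unfolding pr_def by metis
  also have "\<dots> \<longleftrightarrow> x \<otimes> inv y \<in> Fil n"
    using xy F.rcos_module[OF is_group] unfolding pr_def by blast
  finally show ?thesis .
qed

lemma Q_module: "group_module G (Q n)"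
proof -
  interpret Q: comm_group "Q n"
    using abelian_FactGroup[OF Fil_subgroup]
    by (simp add: quotient_gmodule_def comm_group_def comm_monoid_def comm_monoid_axioms_def
        group_def group_axioms_def monoid_def Units_def)
  have "is_gmodule G (Q n)"
    unfolding is_gmodule_def
  proof (intro conjI ballI)
    show "comm_group (Q n)" by (rule Q.comm_group_axioms)
    show "(\<lambda>x. act (Q n) x g) \<in> hom (Q n) (Q n)" if "g \<in> carrier G" for g
      using that by (intro homI) (auto simp: Q_carrier simp flip: pr_act pr_mult)
    fix x assume "x \<in> carrier (Q n)"
    then obtain y where y: "x = pr n y" "y \<in> carrier M" by (auto simp: Q_carrier)
    show "act (Q n) x \<one>\<^bsub>G\<^esub> = x" using y by (simp flip: pr_act)
    show "act (Q n) x (g \<otimes>\<^bsub>G\<^esub> h) = act (Q n) (act (Q n) x g) h"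
      if "g \<in> carrier G" "h \<in> carrier G" for g h
      using y that by (simp add: act_act flip: pr_act)
  qed
  then show ?thesis
    using G.is_group by (simp add: group_module_def group_module_axioms_def)
qed

lemma pr_hom: "pr n \<in> gmodule_hom G M (Q n)"
  by (auto simp: gmodule_hom_def hom_def pr_mult pr_act)

lemma pr_group_hom: "group_hom M (Q n) (pr n)"
proof -
  interpret Q: group_module G "Q n" by (rule Q_module)
  show ?thesis using pr_hom by unfold_locales (simp add: gmodule_hom_def)
qed

lemma pr_inv: "x \<in> carrier M ==> pr n (inv x) = inv\<^bsub>Q n\<^esub> pr n x"
  using group_hom.hom_inv[OF pr_group_hom] .

lemma tr_pr: "x \<in> carrier M ==> tr (quotient_system M Fil) n (pr (Suc n) x) = pr n x"
proof -
  assume x: "x \<in> carrier M"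
  have "coset_map M (Fil n) (\<lambda>x. x) (Fil (Suc n) #> x) = Fil n #> x"
    using Fil_subgroup Fil_Suc x by (intro coset_map_rcos) (auto simp: is_group hom_def)
  then show ?thesis by (simp add: quotient_system_def pr_def)
qed

lemma pr_mono: "pr (Suc n) x = pr (Suc n) y ==> x \<in> carrier M ==> y \<in> carrier M ==> pr n x = pr n y"
  using tr_pr by metis

lemma Fil_decreasing: "m \<le> n ==> Fil n \<subseteq> Fil m"
  using Fil_Suc lift_Suc_antimono_le by blast

lemma pr_mono': "pr m x = pr m y ==> n \<le> m ==> x \<in> carrier M ==> y \<in> carrier M ==> pr n x = pr n y"
  using Fil_decreasing by (auto simp: pr_eq_iff)

lemma pr_torsion: "\<exists>q::nat. q > 0 \<and> (\<forall>x\<in>carrier (Q n). x [^]\<^bsub>Q n\<^esub> q = \<one>\<^bsub>Q n\<^esub>)"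
proof -
  interpret h: group_hom M "Q n" "pr n" by (rule pr_group_hom)
  obtain q :: nat where q: "q > 0" "\<And>x. x \<in> carrier M ==> x [^] q \<in> Fil n"
    using Fil_exponent by blast
  have "pr n x [^]\<^bsub>Q n\<^esub> q = \<one>\<^bsub>Q n\<^esub>" if x: "x \<in> carrier M" for x
  proof -
    have "pr n (x [^] q) = pr n \<one>" using q(2)[OF x] x by (simp add: pr_eq_iff del: h.hom_one)
    then show ?thesis using x by (simp add: h.hom_nat_pow)
  qed
  then show ?thesis using q(1) by (auto simp: Q_carrier)
qed

lemma tr_hom: "tr (quotient_system M Fil) n \<in> gmodule_hom G (Q (Suc n)) (Q n)"
  unfolding gmodule_hom_def hom_def
  by (auto simp: Q_carrier tr_pr simp flip: pr_act pr_mult)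

lemma lev_quotient_system [simp]: "lev (quotient_system M Fil) n = Q n"
  by (simp add: quotient_system_def)

lemma H1_to_lim_rcos:
  assumes "c \<in> carrier (Z1 G M)"
  shows "H1_to_lim G M Fil (B1 G M #>\<^bsub>Z1 G M\<^esub> c) =
    (\<lambda>n. cls n (\<lambda>g\<in>carrier G. pr n (c g)))"
proof -
  have "(\<lambda>x. Fil n #> x) \<in> gmodule_hom G M (Q n)" for n
    using pr_hom[of n] by (simp add: pr_def[abs_def])
  then show ?thesis
    using H1_map_rcos[OF group_module_axioms Q_module _ assms] by (simp add: H1_to_lim_def pr_def)
qed

lemma H1_tr_rcos:
  assumes "c \<in> carrier (Z1 G (Q (Suc n)))"
  shows "H1_map G (Q n) (tr (quotient_system M Fil) n) (B1 G (Q (Suc n)) #>\<^bsub>Z1 G (Q (Suc n))\<^esub> c) =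
    cls n (\<lambda>g\<in>carrier G. tr (quotient_system M Fil) n (c g))"
  using H1_map_rcos[OF Q_module Q_module tr_hom assms] .

lemma pr_cocycle: "c \<in> carrier (Z1 G M) ==> (\<lambda>g\<in>carrier G. pr n (c g)) \<in> carrier (Z1 G (Q n))"
  using gmodule_hom_Z1[OF group_module_axioms Q_module pr_hom] .

lemma lim_H1I:
  assumes "\<And>n. c n \<in> carrier (Z1 G (Q n))"
    and "\<And>n g. g \<in> carrier G ==> tr (quotient_system M Fil) n (c (Suc n) g) = c n g"
  shows "(\<lambda>n. cls n (c n)) \<in> carrier (lim_H1 G (quotient_system M Fil))"
proof -
  interpret Q: group_module G "Q n" for n by (rule Q_module)
  have "(\<lambda>g\<in>carrier G. tr (quotient_system M Fil) n (c (Suc n) g)) = c n" for n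
    using gmodule_hom_Z1[OF Q_module Q_module tr_hom assms(1)] assms by (intro Q.Z1_ext) auto
  then show ?thesis
    using assms(1) by (simp add: lim_H1_def H1_tr_rcos Q.H1_carrier)
qed

lemma H1_to_lim_hom: "H1_to_lim G M Fil \<in> hom (H1 G M) (lim_H1 G (quotient_system M Fil))"
proof (rule homI)
  interpret Q: group_module G "Q n" for n by (rule Q_module)
  interpret Z: comm_group "Z1 G M" by (rule Z1_comm_group)
  interpret ZQ: comm_group "Z1 G (Q n)" for n by (rule Q.Z1_comm_group)
  fix X assume "X \<in> carrier (H1 G M)"
  then obtain c where c: "c \<in> carrier (Z1 G M)" "X = B1 G M #>\<^bsub>Z1 G M\<^esub> c" by (auto simp: H1_carrier)
  show "H1_to_lim G M Fil X \<in> carrier (lim_H1 G (quotient_system M Fil))"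
    unfolding c(2) H1_to_lim_rcos[OF c(1)]
    using c(1) by (intro lim_H1I pr_cocycle) (auto simp: tr_pr)
  fix Y assume "Y \<in> carrier (H1 G M)"
  then obtain d where d: "d \<in> carrier (Z1 G M)" "Y = B1 G M #>\<^bsub>Z1 G M\<^esub> d" by (auto simp: H1_carrier)
  have "(\<lambda>g\<in>carrier G. pr n ((c \<otimes>\<^bsub>Z1 G M\<^esub> d) g)) =
      (\<lambda>g\<in>carrier G. pr n (c g)) \<otimes>\<^bsub>Z1 G (Q n)\<^esub> (\<lambda>g\<in>carrier G. pr n (d g))" for n
    using c d by (intro Q.Z1_ext[where n = n] ZQ.m_closed pr_cocycle) (auto simp: pr_mult)
  then show "H1_to_lim G M Fil (X \<otimes>\<^bsub>H1 G M\<^esub> Y) =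
      H1_to_lim G M Fil X \<otimes>\<^bsub>lim_H1 G (quotient_system M Fil)\<^esub> H1_to_lim G M Fil Y"
    using c d by (simp add: H1_mult H1_to_lim_rcos lim_H1_def Q.H1_mult pr_cocycle)
qed

end

text \<open>\<open>mittag_leffler\<close> says that modulo \<open>Fil n\<close> the chain of almost
  invariant elements is stationary from some index on. \<open>infinite_carrier\<close> is there to
  force the element type of a resolution to be infinite.\<close>

locale complete_filtered_module = filtered_module +
  assumes separated: "x \<in> carrier M ==> (\<And>n. x \<in> Fil n) ==> x = \<one>"
    and complete: "(\<And>n. s n \<in> carrier M) ==> (\<And>n. s (Suc n) \<otimes> inv s n \<in> Fil n) ==>
      \<exists>y\<in>carrier M. \<forall>n. y \<otimes> inv s n \<in> Fil n"
    and mittag_leffler: "\<exists>m. \<forall>l\<ge>m. \<forall>x\<in>almost_invariant G M Fil m.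
      \<exists>y\<in>almost_invariant G M Fil l. x \<otimes> inv y \<in> Fil n"
    and infinite_carrier: "infinite (carrier M)"
begin

lemma pr_separated: "x \<in> carrier M ==> y \<in> carrier M ==> (\<And>n. pr n x = pr n y) ==> x = y"
  using separated[of "x \<otimes> inv y"] by (simp add: pr_eq_iff inv_solve_right')

lemma pr_complete:
  assumes "\<And>n. x n \<in> carrier M" "\<And>n. pr n (x (Suc n)) = pr n (x n)"
  shows "\<exists>y\<in>carrier M. \<forall>n. pr n y = pr n (x n)"
  using complete[of x] assms by (simp add: pr_eq_iff)

lemma almost_invariant_subset: "almost_invariant G M Fil n \<subseteq> carrier M"
  by (auto simp: almost_invariant_def)

lemma almost_invariant_decreasing: "m \<le> n ==> almost_invariant G M Fil n \<subseteq> almost_invariant G M Fil m"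
  using Fil_decreasing[of m n] by (auto simp: almost_invariant_def)

text \<open>The vanishing of lim^1 for the almost invariant elements, stated for nested sets
  \<open>Y n\<close> that are cosets of them. No common point is claimed; points are chosen that
  agree modulo \<open>Fil n\<close> from one level to the next.\<close>

lemma compatible_sequence:
  assumes Y: "\<And>n. Y n \<subseteq> carrier M" "\<And>n. Y n \<noteq> {}" "\<And>n. Y (Suc n) \<subseteq> Y n"
    and torsor: "\<And>n x y. x \<in> Y n ==> y \<in> Y n ==> x \<otimes> inv y \<in> almost_invariant G M Fil n"
      "\<And>n w y. w \<in> almost_invariant G M Fil n ==> y \<in> Y n ==> w \<otimes> y \<in> Y n"
  shows "\<exists>v. (\<forall>n. v n \<in> Y n) \<and> (\<forall>n. pr n (v (Suc n)) = pr n (v n))"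
proof -
  obtain m where m: "\<And>n l x. l \<ge> m n ==> x \<in> almost_invariant G M Fil (m n) ==>
      \<exists>y\<in>almost_invariant G M Fil l. x \<otimes> inv y \<in> Fil n"
    using mittag_leffler by metis
  \<comment> \<open>The depth at which a point has to be taken so that it can be moved deeper still
    without changing it modulo \<open>Fil n\<close>.\<close>
  define k where "k n = n + (\<Sum>i\<le>n. m i)" for n
  have k: "k n \<ge> n" "k (Suc n) \<ge> k n" "k n \<ge> m n" for n
    using sum_mono2[of "{..n}" "{n}" m] by (auto simp: k_def)
  have Ydec: "Y j \<subseteq> Y i" if "i \<le> j" for i j
    using that Y(3) lift_Suc_antimono_le by blast
  have step: "\<exists>y\<in>Y (k (Suc n)). pr n y = pr n x" if x: "x \<in> Y (k n)" for x n
  proof -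
    \<comment> \<open>\<open>x\<close> and a deeper point \<open>z\<close> differ by an almost
      invariant element. Modulo \<open>Fil n\<close> that element may be replaced by one of depth
      \<open>k (Suc n)\<close>, and multiplying \<open>z\<close> by it stays in the deeper
      set.\<close>
    obtain z where z: "z \<in> Y (k (Suc n))" using Y(2) by blast
    have zx: "z \<in> carrier M" "x \<in> carrier M" using z x Y(1) by auto
    have "z \<in> Y (k n)" using z Ydec k(2) by blast
    then have "x \<otimes> inv z \<in> almost_invariant G M Fil (m n)"
      using torsor(1)[OF x] almost_invariant_decreasing[OF k(3)] by blast
    then obtain w where w: "w \<in> almost_invariant G M Fil (k (Suc n))" "x \<otimes> inv z \<otimes> inv w \<in> Fil n"
      using m[of n "k (Suc n)"] k(2)[of n] k(3)[of n] by (meson le_trans)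
    have wc: "w \<in> carrier M" using w(1) almost_invariant_subset by blast
    have "x \<otimes> inv (w \<otimes> z) \<in> Fil n"
      using w(2) wc zx by (simp add: inv_mult_group m_assoc)
    then have "pr n x = pr n (w \<otimes> z)" using wc zx by (simp add: pr_eq_iff)
    then show ?thesis using torsor(2)[OF w(1) z] by metis
  qed
  obtain y0 where "y0 \<in> Y (k 0)" using Y(2) by blast
  then have "\<exists>v. \<forall>n. v n \<in> Y (k n) \<and> pr n (v (Suc n)) = pr n (v n)"
    using step by (intro dependent_nat_choice) blast+
  then show ?thesis using Ydec[OF k(1)] by blast
qed

text \<open>\<open>Y n\<close> consists of the elements whose coboundary carries \<open>c\<close> to
  \<open>c'\<close> modulo \<open>Fil n\<close>, a coset of the almost invariant elements. A
  compatible sequence in these cosets converges, and its limit relates \<open>c\<close> and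
  \<open>c'\<close> exactly.\<close>

lemma H1_to_lim_inj: "inj_on (H1_to_lim G M Fil) (carrier (H1 G M))"
proof (rule inj_onI)
  interpret Q: group_module G "Q n" for n by (rule Q_module)
  fix X X' assume "X \<in> carrier (H1 G M)" "X' \<in> carrier (H1 G M)" and eq: "H1_to_lim G M Fil X = H1_to_lim G M Fil X'"
  then obtain c c' where c: "c \<in> carrier (Z1 G M)" "X = B1 G M #>\<^bsub>Z1 G M\<^esub> c"
    "c' \<in> carrier (Z1 G M)" "X' = B1 G M #>\<^bsub>Z1 G M\<^esub> c'" by (auto simp: H1_carrier)
  define Y where "Y n = {s \<in> carrier M. \<forall>g\<in>carrier G.
      pr n (c' g) = pr n (act M s g \<otimes> inv s \<otimes> c g)}" for n
  have cc: "g \<in> carrier G ==> c g \<in> carrier M" "g \<in> carrier G ==> c' g \<in> carrier M" for g using c by auto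
  have ne: "Y n \<noteq> {}" for n
  proof -
    have "\<exists>s\<in>carrier (Q n). \<forall>g\<in>carrier G. pr n (c' g) = act (Q n) s g \<otimes>\<^bsub>Q n\<^esub> inv\<^bsub>Q n\<^esub> s \<otimes>\<^bsub>Q n\<^esub> pr n (c g)"
      using fun_cong[OF eq, of n] c
      by (simp add: H1_to_lim_rcos Q.B1_rcos_eq_iff pr_cocycle)
    then obtain s where s: "s \<in> carrier M" "\<forall>g\<in>carrier G. pr n (c' g) = act (Q n) (pr n s) g \<otimes>\<^bsub>Q n\<^esub> inv\<^bsub>Q n\<^esub> pr n s \<otimes>\<^bsub>Q n\<^esub> pr n (c g)"
      by (auto simp: Q_carrier)
    then have "s \<in> Y n" using cc by (simp add: Y_def pr_mult pr_act pr_inv)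
    then show ?thesis by blast
  qed
  have mid: "a \<otimes> inv x \<otimes> u \<otimes> inv (b \<otimes> inv y \<otimes> u) = a \<otimes> inv b \<otimes> inv (x \<otimes> inv y)"
    if "a \<in> carrier M" "b \<in> carrier M" "x \<in> carrier M" "y \<in> carrier M" "u \<in> carrier M" for a b x y u
  proof -
    have "A \<otimes> u \<otimes> inv (B \<otimes> u) = A \<otimes> inv B"
      if "A \<in> carrier M" "B \<in> carrier M" for A B
    proof -
      have "A \<otimes> u \<otimes> inv (B \<otimes> u) = A \<otimes> (u \<otimes> inv u) \<otimes> inv B"
        using that \<open>u \<in> carrier M\<close> by (simp only: inv_mult_group m_assoc m_closed inv_closed)
      then show ?thesis using that \<open>u \<in> carrier M\<close> by simp
    qed
    then have "a \<otimes> inv x \<otimes> u \<otimes> inv (b \<otimes> inv y \<otimes> u)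
        = (a \<otimes> inv x) \<otimes> inv (b \<otimes> inv y)"
      using that by simp
    also have "\<dots> = (a \<otimes> inv x) \<otimes> (inv b \<otimes> y)" using that by (simp add: inv_mult)
    also have "\<dots> = (a \<otimes> inv b) \<otimes> (inv x \<otimes> y)" using that by (intro m_swap_middle) auto
    finally show ?thesis using that by (simp add: inv_mult)
  qed
  have "\<exists>v. (\<forall>n. v n \<in> Y n) \<and> (\<forall>n. pr n (v (Suc n)) = pr n (v n))"
  proof (rule compatible_sequence)
    show "Y n \<subseteq> carrier M" for n by (auto simp: Y_def)
    show "Y n \<noteq> {}" for n by (rule ne)
    show "Y (Suc n) \<subseteq> Y n" for n unfolding Y_def by (clarify, rule pr_mono) (simp_all add: cc)
    show "x \<otimes> inv y \<in> almost_invariant G M Fil n" if "x \<in> Y n" "y \<in> Y n" for n x y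
    proof -
      have xy: "x \<in> carrier M" "y \<in> carrier M" using that by (auto simp: Y_def)
      have "act M x g \<otimes> inv act M y g \<otimes> inv (x \<otimes> inv y) \<in> Fil n" if g: "g \<in> carrier G" for g
      proof -
        have "pr n (act M x g \<otimes> inv x \<otimes> c g) = pr n (act M y g \<otimes> inv y \<otimes> c g)"
          using \<open>x \<in> Y n\<close> \<open>y \<in> Y n\<close> g by (auto simp: Y_def)
        then show ?thesis using xy g cc by (simp only: pr_eq_iff mid m_closed inv_closed act_closed)
      qed
      then show ?thesis using xy by (auto simp: almost_invariant_def)
    qed
    show "w \<otimes> y \<in> Y n" if w: "w \<in> almost_invariant G M Fil n" and "y \<in> Y n" for n w y
    proof -
      have wy: "w \<in> carrier M" "y \<in> carrier M" using that by (auto simp: Y_def almost_invariant_def)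
      have "pr n (c' g) = pr n (act M (w \<otimes> y) g \<otimes> inv (w \<otimes> y) \<otimes> c g)" if g: "g \<in> carrier G" for g
      proof -
        have "act M w g \<otimes> inv w \<in> Fil n" using w g by (auto simp: almost_invariant_def)
        then have 1: "pr n (act M w g \<otimes> inv w) = pr n \<one>" using wy g by (simp add: pr_eq_iff)
        have "act M (w \<otimes> y) g \<otimes> inv (w \<otimes> y) \<otimes> c g = (act M w g \<otimes> inv w) \<otimes> (act M y g \<otimes> inv y \<otimes> c g)"
          using wy g cc by (simp only: act_div_mult m_assoc m_closed inv_closed act_closed)
        also have "pr n \<dots> = pr n (\<one> \<otimes> (act M y g \<otimes> inv y \<otimes> c g))"
          using wy g cc by (simp only: pr_mult[of "act M w g \<otimes> inv w"] pr_mult[of "\<one>"] 1 m_closed inv_closed act_closed one_closed)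
        also have "\<dots> = pr n (c' g)" using \<open>y \<in> Y n\<close> wy g cc by (simp add: Y_def)
        finally show ?thesis by simp
      qed
      then show ?thesis using wy by (auto simp: Y_def)
    qed
  qed
  then obtain v where v: "\<And>n. v n \<in> Y n" "\<And>n. pr n (v (Suc n)) = pr n (v n)" by blast
  have vc: "v n \<in> carrier M" for n using v(1)[of n] by (simp add: Y_def)
  obtain s where s: "s \<in> carrier M" "\<And>n. pr n s = pr n (v n)" using pr_complete[OF vc v(2)] by blast
  have "c' g = act M s g \<otimes> inv s \<otimes> c g" if g: "g \<in> carrier G" for g
  proof (rule pr_separated)
    fix n
    have "pr n (c' g) = pr n (act M (v n) g \<otimes> inv v n \<otimes> c g)" using v(1)[of n] g by (auto simp: Y_def)
    also have "\<dots> = pr n (act M s g \<otimes> inv s \<otimes> c g)"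
      using g s vc cc by (simp add: pr_mult pr_act pr_inv)
    finally show "pr n (c' g) = pr n (act M s g \<otimes> inv s \<otimes> c g)" .
  qed (use g s cc in auto)
  then show "X = X'" using c s by (auto simp: B1_rcos_eq_iff)
qed

text \<open>Completeness lifts the values one by one, and separatedness turns the cocycle identity
  in all quotients into one in \<open>M\<close>.\<close>

lemma lift_cocycle:
  assumes c: "\<And>n. c n \<in> carrier (Z1 G (Q n))"
    and tr: "\<And>n g. g \<in> carrier G ==> tr (quotient_system M Fil) n (c (Suc n) g) = c n g"
  shows "\<exists>b\<in>carrier (Z1 G M). \<forall>n. \<forall>g\<in>carrier G. pr n (b g) = c n g"
proof -
  interpret Q: group_module G "Q n" for n by (rule Q_module)
  have "\<exists>x\<in>carrier M. \<forall>n. pr n x = c n g" if g: "g \<in> carrier G" for g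
  proof -
    have "\<forall>n. \<exists>x\<in>carrier M. pr n x = c n g"
      using Q.Z1_closed[OF c g] unfolding Q_carrier by blast
    then obtain x where x: "\<And>n. x n \<in> carrier M" "\<And>n. pr n (x n) = c n g" by metis
    have "pr n (x (Suc n)) = pr n (x n)" for n using tr_pr[OF x(1), of n] x(2) tr[OF g] by metis
    then show ?thesis using pr_complete[of x] x by simp
  qed
  then obtain b where b: "\<And>g. g \<in> carrier G ==> b g \<in> carrier M" "\<And>g n. g \<in> carrier G ==> pr n (b g) = c n g"
    by metis
  have "b (g \<otimes>\<^bsub>G\<^esub> h) = act M (b g) h \<otimes> b h" if "g \<in> carrier G" "h \<in> carrier G" for g h
    using that b by (intro pr_separated) (auto simp: pr_mult pr_act Q.Z1_cocycle[OF c])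
  then have "restrict b (carrier G) \<in> carrier (Z1 G M)" using b by (auto simp: Z1_mem)
  then show ?thesis using b by (intro bexI[of _ "restrict b (carrier G)"]) auto
qed

text \<open>A point of the limit gives cocycles that are compatible only up to coboundaries of
  elements \<open>s n\<close>. Twisting by a cumulative product makes them compatible on the nose,
  after which \<open>lift_cocycle\<close> applies.\<close>

lemma lim_H1_lift:
  assumes x: "x \<in> carrier (lim_H1 G (quotient_system M Fil))"
  shows "\<exists>b\<in>carrier (Z1 G M). \<forall>n. x n = cls n (\<lambda>g\<in>carrier G. pr n (b g))"
proof -
  interpret Q: group_module G "Q n" for n by (rule Q_module)
  interpret ZQ: comm_group "Z1 G (Q n)" for n by (rule Q.Z1_comm_group)
  let ?t = "tr (quotient_system M Fil)"
  have "\<exists>c\<in>carrier (Z1 G (Q n)). x n = cls n c" for n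
  proof -
    have "x n \<in> carrier (H1 G (Q n))" using x by (simp add: lim_H1_def)
    then show ?thesis by (auto simp: Q.H1_carrier)
  qed
  then obtain c where c: "\<And>n. c n \<in> carrier (Z1 G (Q n))" "\<And>n. x n = cls n (c n)"
    by metis
  have "\<exists>s\<in>carrier M. \<forall>g\<in>carrier G. ?t n (c (Suc n) g) = act (Q n) (pr n s) g \<otimes>\<^bsub>Q n\<^esub> inv\<^bsub>Q n\<^esub> pr n s \<otimes>\<^bsub>Q n\<^esub> c n g" for n
  proof -
    have "cls n (\<lambda>g\<in>carrier G. ?t n (c (Suc n) g)) = cls n (c n)"
      using x c(2) H1_tr_rcos[OF c(1)] by (simp add: lim_H1_def)
    then have "\<exists>s\<in>carrier (Q n). \<forall>g\<in>carrier G. ?t n (c (Suc n) g) = act (Q n) s g \<otimes>\<^bsub>Q n\<^esub> inv\<^bsub>Q n\<^esub> s \<otimes>\<^bsub>Q n\<^esub> c n g"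
      using Q.B1_rcos_eq_iff[OF c(1) gmodule_hom_Z1[OF Q_module Q_module tr_hom c(1)], of n]
      by simp
    then show ?thesis by (auto simp: Q_carrier)
  qed
  then obtain s where s: "\<And>n. s n \<in> carrier M" "\<And>n g. g \<in> carrier G ==>
      ?t n (c (Suc n) g) = act (Q n) (pr n (s n)) g \<otimes>\<^bsub>Q n\<^esub> inv\<^bsub>Q n\<^esub> pr n (s n) \<otimes>\<^bsub>Q n\<^esub> c n g"
    by metis
  \<comment> \<open>\<open>P n\<close> is the product of the inverses of \<open>s i\<close> for
    \<open>i < n\<close>, so the coboundary of \<open>P (Suc n)\<close> absorbs that of
    \<open>s n\<close> and leaves that of \<open>P n\<close>.\<close>
  define P where "P = rec_nat \<one> (\<lambda>n u. inv s n \<otimes> u)"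
  have P0: "P 0 = \<one>" and PS: "\<And>n. P (Suc n) = inv s n \<otimes> P n" by (simp_all add: P_def)
  have P: "P n \<in> carrier M" for n by (induction n) (use P0 PS s in auto)
  define b where "b n = coboundary G (Q n) (pr n (P n)) \<otimes>\<^bsub>Z1 G (Q n)\<^esub> c n" for n
  have b: "b n \<in> carrier (Z1 G (Q n))" for n using P c(1) by (simp add: b_def)
  have bg: "b n g = act (Q n) (pr n (P n)) g \<otimes>\<^bsub>Q n\<^esub> inv\<^bsub>Q n\<^esub> pr n (P n) \<otimes>\<^bsub>Q n\<^esub> c n g" if "g \<in> carrier G" for n g
    using that by (simp add: b_def coboundary_def)
  have cob: "?t n (act (Q (Suc n)) (pr (Suc n) u) g \<otimes>\<^bsub>Q (Suc n)\<^esub> inv\<^bsub>Q (Suc n)\<^esub> pr (Suc n) u \<otimes>\<^bsub>Q (Suc n)\<^esub> y) =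
      pr n (act M u g \<otimes> inv u) \<otimes>\<^bsub>Q n\<^esub> ?t n y"
    if u: "u \<in> carrier M" and g: "g \<in> carrier G" and y: "y \<in> carrier (Q (Suc n))" for u g n y
  proof -
    have "act (Q (Suc n)) (pr (Suc n) u) g \<otimes>\<^bsub>Q (Suc n)\<^esub> inv\<^bsub>Q (Suc n)\<^esub> pr (Suc n) u = pr (Suc n) (act M u g \<otimes> inv u)"
      using u g by (simp add: pr_mult pr_act pr_inv)
    then show ?thesis using u g y tr_hom[of n] by (simp add: gmodule_hom_def hom_def tr_pr)
  qed
  have "?t n (b (Suc n) g) = b n g" if g: "g \<in> carrier G" for n g
  proof -
    let ?D = "\<lambda>u. act M u g \<otimes> inv u"
    have D: "?D (inv s n \<otimes> P n) \<otimes> ?D (s n) = ?D (P n)"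
    proof -
      have "inv s n \<otimes> P n \<otimes> s n = inv s n \<otimes> (s n \<otimes> P n)"
        using s(1) P by (simp only: m_assoc m_comm[of "P n" "s n"] m_closed inv_closed)
      also have "\<dots> = P n" using s(1) P by (simp add: m_assoc[symmetric])
      finally show ?thesis using act_div_mult[of "inv s n \<otimes> P n" "s n" g] s(1) P g by simp
    qed
    have "?t n (b (Suc n) g) = pr n (?D (P (Suc n))) \<otimes>\<^bsub>Q n\<^esub> ?t n (c (Suc n) g)"
      using g P c(1) by (simp add: bg cob Q.Z1_closed)
    also have "\<dots> = pr n (?D (inv s n \<otimes> P n)) \<otimes>\<^bsub>Q n\<^esub> (pr n (?D (s n)) \<otimes>\<^bsub>Q n\<^esub> c n g)"
      using g s by (simp add: PS pr_mult[of "act M (s n) g"] pr_act pr_inv)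
    also have "\<dots> = pr n (?D (P n)) \<otimes>\<^bsub>Q n\<^esub> c n g"
      using g s P c(1) D
      by (simp only: Q.m_assoc[symmetric] Q.Z1_closed pr_closed m_closed inv_closed act_closed pr_mult[symmetric])
    also have "\<dots> = b n g" using g P by (simp add: bg pr_mult pr_act pr_inv)
    finally show ?thesis .
  qed
  then obtain a where a: "a \<in> carrier (Z1 G M)" "\<And>n g. g \<in> carrier G ==> pr n (a g) = b n g"
    using lift_cocycle[OF b] by metis
  have "x n = cls n (\<lambda>g\<in>carrier G. pr n (a g))" for n
  proof -
    have "(\<lambda>g\<in>carrier G. pr n (a g)) = b n"
      using a b by (intro Q.Z1_ext[OF pr_cocycle]) auto
    moreover have "cls n (c n) = cls n (b n)"
      unfolding Q.B1_rcos_eq_iff[OF c(1) b] using P bg by blast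
    ultimately show ?thesis using c(2) by simp
  qed
  then show ?thesis using a by blast
qed

theorem H1_to_lim_iso: "H1_to_lim G M Fil \<in> iso (H1 G M) (lim_H1 G (quotient_system M Fil))"
proof -
  have "carrier (lim_H1 G (quotient_system M Fil)) \<subseteq> H1_to_lim G M Fil ` carrier (H1 G M)"
  proof
    fix x assume "x \<in> carrier (lim_H1 G (quotient_system M Fil))"
    then obtain b where b: "b \<in> carrier (Z1 G M)" "\<forall>n. x n = cls n (\<lambda>g\<in>carrier G. pr n (b g))"
      using lim_H1_lift by blast
    then have "x = H1_to_lim G M Fil (B1 G M #>\<^bsub>Z1 G M\<^esub> b)" by (auto simp: H1_to_lim_rcos)
    then show "x \<in> H1_to_lim G M Fil ` carrier (H1 G M)" using b(1) by (auto simp: H1_carrier)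
  qed
  then show ?thesis
    using H1_to_lim_hom H1_to_lim_inj by (auto simp: iso_def bij_betw_def hom_def)
qed

end

section \<open>The derived functor of invariants of the limit, through connecting
  homomorphisms\<close>

section \<open>Continuous cohomology\<close>

lemma H0_cont_carrier: "carrier (H0_cont G S) = {x. \<forall>n. x n \<in> carrier (lev S n) \<and> tr S n (x (Suc n)) = x n \<and>
    (\<forall>g\<in>carrier G. act (lev S n) (x n) g = x n)}"
  by (auto simp: H0_cont_def H0_def lim_gmodule_def fun_eq_iff)

lemma H0_cont_mult [simp]: "x \<otimes>\<^bsub>H0_cont G S\<^esub> y = (\<lambda>n. x n \<otimes>\<^bsub>lev S n\<^esub> y n)"
  by (simp add: H0_cont_def H0_def lim_gmodule_def)

lemma H0_cont_one [simp]: "\<one>\<^bsub>H0_cont G S\<^esub> = (\<lambda>n. \<one>\<^bsub>lev S n\<^esub>)"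
  by (simp add: H0_cont_def H0_def lim_gmodule_def)

lemma gmodule_hom_group_hom:
  assumes "group_module G M" "group_module G N" "h \<in> gmodule_hom G M N"
  shows "group_hom M N h"
proof -
  interpret M: group_module G M by fact
  interpret N: group_module G N by fact
  show ?thesis using assms(3) by unfold_locales (simp add: gmodule_hom_def)
qed

lemma H0_cont_comm_group:
  assumes G: "group G" and S: "torsion_system G S"
  shows "comm_group (H0_cont G S)"
proof -
  have lev: "group_module G (lev S n)" for n using torsion_system_level[OF G S] .
  interpret L: group_module G "lev S n" for n by (rule lev)
  interpret t: group_hom "lev S (Suc n)" "lev S n" "tr S n" for n
    using S by (intro gmodule_hom_group_hom[OF lev lev]) (auto simp: torsion_system_def)
  show ?thesis
  proof (rule comm_groupI)
    fix x assume x: "x \<in> carrier (H0_cont G S)"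
    then have "(\<lambda>n. inv\<^bsub>lev S n\<^esub> x n) \<in> carrier (H0_cont G S)"
      by (auto simp: H0_cont_carrier)
    then show "\<exists>y\<in>carrier (H0_cont G S). y \<otimes>\<^bsub>H0_cont G S\<^esub> x = \<one>\<^bsub>H0_cont G S\<^esub>"
      using x by (intro bexI[of _ "\<lambda>n. inv\<^bsub>lev S n\<^esub> x n"]) (auto simp: H0_cont_carrier)
  qed (auto simp: H0_cont_carrier L.m_assoc fun_eq_iff intro: L.m_comm)
qed

lemma system_hom_H0_cont:
  assumes G: "group G" and S: "torsion_system G S" and T: "torsion_system G T"
    and h: "h \<in> system_hom G S T"
  shows "(\<lambda>x n. h n (x n)) \<in> hom (H0_cont G S) (H0_cont G T)"
proof (rule homI)
  have hn: "h n \<in> gmodule_hom G (lev S n) (lev T n)" for n using h by (simp add: system_hom_def)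
  fix x assume x: "x \<in> carrier (H0_cont G S)"
  have "tr T n (h (Suc n) (x (Suc n))) = h n (x n)" for n
  proof -
    have "x (Suc n) \<in> carrier (lev S (Suc n))" "tr S n (x (Suc n)) = x n"
      using x by (auto simp: H0_cont_carrier)
    moreover have "\<forall>x\<in>carrier (lev S (Suc n)). h n (tr S n x) = tr T n (h (Suc n) x)"
      using h by (simp add: system_hom_def)
    ultimately show ?thesis by force
  qed
  moreover have "act (lev T n) (h n (x n)) g = h n (x n)" "h n (x n) \<in> carrier (lev T n)" if "g \<in> carrier G" for n g
    using hn[of n] x that by (auto simp: gmodule_hom_def hom_def H0_cont_carrier Pi_iff) metis
  moreover have "h n (x n) \<in> carrier (lev T n)" for n
    using hn[of n] x by (auto simp: gmodule_hom_def hom_def H0_cont_carrier Pi_iff)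
  ultimately show "(\<lambda>n. h n (x n)) \<in> carrier (H0_cont G T)"
    by (auto simp: H0_cont_carrier)
  fix y assume "y \<in> carrier (H0_cont G S)"
  then show "(\<lambda>n. h n ((x \<otimes>\<^bsub>H0_cont G S\<^esub> y) n)) = (\<lambda>n. h n (x n)) \<otimes>\<^bsub>H0_cont G T\<^esub> (\<lambda>n. h n (y n))"
    using x hn by (auto simp: H0_cont_carrier gmodule_hom_def hom_def fun_eq_iff)
qed

locale resolved_filtered_module = filtered_module +
  fixes \<epsilon> :: "nat => 'c set => 'i" and I :: "nat => ('i, 'a) proj_sys" and d :: "nat => nat => 'i => 'i"
  assumes resolution: "injective_resolution G (quotient_system M Fil) \<epsilon> I d"
begin

abbreviation L :: "nat => nat => ('i, 'a) gmodule" where "L i n \<equiv> lev (I i) n"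
abbreviation cob :: "nat => 'i => 'a => 'i" where
  "cob n y g \<equiv> act (L 0 n) y g \<otimes>\<^bsub>L 0 n\<^esub> inv\<^bsub>L 0 n\<^esub> y"
abbreviation to_lim :: "(nat => 'i) set => nat => ('a => 'c set) set" where
  "to_lim \<equiv> H1_cont_to_lim G (quotient_system M Fil) \<epsilon> I d"

lemma injective_I: "injective_system G (I i)"
  using resolution by (simp add: injective_resolution_def)

lemma torsion_I: "torsion_system G (I i)"
  using injective_I by (simp add: injective_system_def)

lemma L_module: "group_module G (L i n)"
  using torsion_system_level[OF G.is_group torsion_I] .

lemma \<epsilon>_hom: "\<epsilon> n \<in> gmodule_hom G (Q n) (L 0 n)"
  using resolution by (simp add: injective_resolution_def system_hom_def)

lemma \<epsilon>_tr: "x \<in> carrier (Q (Suc n)) ==>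
    \<epsilon> n (tr (quotient_system M Fil) n x) = tr (I 0) n (\<epsilon> (Suc n) x)"
  using resolution by (simp add: injective_resolution_def system_hom_def)

lemma \<epsilon>_inj: "inj_on (\<epsilon> n) (carrier (Q n))"
  using resolution by (simp add: injective_resolution_def)

lemma d_system_hom: "d i \<in> system_hom G (I i) (I (Suc i))"
  using resolution by (simp add: injective_resolution_def)

lemma d_hom: "d i n \<in> gmodule_hom G (L i n) (L (Suc i) n)"
  using d_system_hom by (simp add: system_hom_def)

lemma d_tr: "x \<in> carrier (L i (Suc n)) ==> d i n (tr (I i) n x) = tr (I (Suc i)) n (d i (Suc n) x)"
  using d_system_hom by (simp add: system_hom_def)

lemma tr_I_hom: "tr (I i) n \<in> gmodule_hom G (L i (Suc n)) (L i n)"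
  using torsion_I by (simp add: torsion_system_def)

lemma exact_0: "x \<in> carrier (L 0 n) ==> d 0 n x = \<one>\<^bsub>L (Suc 0) n\<^esub> \<longleftrightarrow> x \<in> \<epsilon> n ` carrier (Q n)"
proof -
  assume x: "x \<in> carrier (L 0 n)"
  have "kernel (L 0 n) (L 1 n) (d 0 n) = \<epsilon> n ` carrier (Q n)"
    using resolution by (simp add: injective_resolution_def)
  then have "x \<in> kernel (L 0 n) (L 1 n) (d 0 n) \<longleftrightarrow> x \<in> \<epsilon> n ` carrier (Q n)" by simp
  then show ?thesis using x by (simp add: kernel_def)
qed

lemma exact_1: "x \<in> carrier (L (Suc 0) n) ==>
    d (Suc 0) n x = \<one>\<^bsub>L (Suc (Suc 0)) n\<^esub> \<longleftrightarrow> x \<in> d 0 n ` carrier (L 0 n)"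
proof -
  assume x: "x \<in> carrier (L (Suc 0) n)"
  have "kernel (L (Suc 0) n) (L (Suc (Suc 0)) n) (d (Suc 0) n) = d 0 n ` carrier (L 0 n)"
    using resolution unfolding injective_resolution_def by blast
  then have "x \<in> kernel (L (Suc 0) n) (L (Suc (Suc 0)) n) (d (Suc 0) n) \<longleftrightarrow> x \<in> d 0 n ` carrier (L 0 n)"
    by simp
  then show ?thesis using x by (simp add: kernel_def)
qed

sublocale Q: group_module G "Q n" for n by (rule Q_module)
sublocale L: group_module G "L i n" for i n by (rule L_module)
sublocale \<epsilon>: group_hom "Q n" "L 0 n" "\<epsilon> n" for n by (rule gmodule_hom_group_hom[OF Q_module L_module \<epsilon>_hom])
sublocale d: group_hom "L i n" "L (Suc i) n" "d i n" for i n by (rule gmodule_hom_group_hom[OF L_module L_module d_hom])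
sublocale tI: group_hom "L i (Suc n)" "L i n" "tr (I i) n" for i n
  by (rule gmodule_hom_group_hom[OF L_module L_module tr_I_hom])

lemma \<epsilon>_act: "x \<in> carrier (Q n) ==> g \<in> carrier G ==> \<epsilon> n (act (Q n) x g) = act (L 0 n) (\<epsilon> n x) g"
  using \<epsilon>_hom by (simp add: gmodule_hom_def)

lemma d_act: "x \<in> carrier (L i n) ==> g \<in> carrier G ==> d i n (act (L i n) x g) = act (L (Suc i) n) (d i n x) g"
  using d_hom by (simp add: gmodule_hom_def)

lemma tI_act: "x \<in> carrier (L i (Suc n)) ==> g \<in> carrier G ==>
    tr (I i) n (act (L i (Suc n)) x g) = act (L i n) (tr (I i) n x) g"
  using tr_I_hom by (simp add: gmodule_hom_def)

lemma d_\<epsilon>: "s \<in> carrier (Q n) ==> d 0 n (\<epsilon> n s) = \<one>\<^bsub>L (Suc 0) n\<^esub>"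
  using exact_0 by auto

text \<open>\<open>c\<close> represents the image of \<open>z\<close> under the connecting
  homomorphism at level \<open>n\<close>, computed with the preimage \<open>y\<close>. Keeping
  \<open>y\<close> visible lets the dependence on all choices be tracked.\<close>

definition connects :: "nat => 'i => 'i => ('a => 'c set) => bool" where
  "connects n z y c \<longleftrightarrow> y \<in> carrier (L 0 n) \<and> d 0 n y = z \<and> c \<in> carrier (Z1 G (Q n)) \<and>
     (\<forall>g\<in>carrier G. \<epsilon> n (c g) = cob n y g)"

lemma connects_ex:
  assumes y: "y \<in> carrier (L 0 n)" and inv: "\<And>g. g \<in> carrier G ==> act (L (Suc 0) n) (d 0 n y) g = d 0 n y"
  shows "\<exists>c. connects n (d 0 n y) y c"
proof -
  have "cob n y g \<in> \<epsilon> n ` carrier (Q n)" if "g \<in> carrier G" for g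
    using that y inv[OF that] by (subst exact_0[symmetric]) (auto simp: d_act)
  then have "\<forall>g\<in>carrier G. \<exists>x\<in>carrier (Q n). \<epsilon> n x = cob n y g"
    by force
  then obtain c where c: "\<And>g. g \<in> carrier G ==> c g \<in> carrier (Q n)"
    "\<And>g. g \<in> carrier G ==> \<epsilon> n (c g) = cob n y g"
    by metis
  have "c (g \<otimes>\<^bsub>G\<^esub> h) = act (Q n) (c g) h \<otimes>\<^bsub>Q n\<^esub> c h" if gh: "g \<in> carrier G" "h \<in> carrier G" for g h
  proof (rule inj_onD[OF \<epsilon>_inj])
    have "coboundary G (L 0 n) y (g \<otimes>\<^bsub>G\<^esub> h) = act (L 0 n) (coboundary G (L 0 n) y g) h \<otimes>\<^bsub>L 0 n\<^esub> coboundary G (L 0 n) y h"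
      using y gh by (intro L.Z1_cocycle) auto
    then show "\<epsilon> n (c (g \<otimes>\<^bsub>G\<^esub> h)) = \<epsilon> n (act (Q n) (c g) h \<otimes>\<^bsub>Q n\<^esub> c h)"
      using gh c y by (simp add: \<epsilon>_act coboundary_def)
  qed (use gh c in auto)
  then have "restrict c (carrier G) \<in> carrier (Z1 G (Q n))" using c by (auto simp: Q.Z1_mem)
  then show ?thesis using y c by (intro exI[of _ "restrict c (carrier G)"]) (simp add: connects_def)
qed

text \<open>Moving \<open>y\<close> by an element of the embedded \<open>Q n\<close>, the kernel of
  \<open>d\<close>, changes \<open>c\<close> by a coboundary; in this way every cocycle of the class
  is reached.\<close>

lemma connects_translate:
  assumes c: "connects n z y c" and s: "s \<in> carrier (Q n)"
    and c': "c' \<in> carrier (Z1 G (Q n))"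
      "\<And>g. g \<in> carrier G ==> c' g = act (Q n) s g \<otimes>\<^bsub>Q n\<^esub> inv\<^bsub>Q n\<^esub> s \<otimes>\<^bsub>Q n\<^esub> c g"
  shows "connects n z (\<epsilon> n s \<otimes>\<^bsub>L 0 n\<^esub> y) c'"
proof -
  have y: "y \<in> carrier (L 0 n)" "c \<in> carrier (Z1 G (Q n))" using c by (auto simp: connects_def)
  have "\<epsilon> n (c' g) = cob n (\<epsilon> n s \<otimes>\<^bsub>L 0 n\<^esub> y) g" if g: "g \<in> carrier G" for g
  proof -
    have "\<epsilon> n (c' g) = (act (L 0 n) (\<epsilon> n s) g \<otimes>\<^bsub>L 0 n\<^esub> inv\<^bsub>L 0 n\<^esub> \<epsilon> n s) \<otimes>\<^bsub>L 0 n\<^esub> (cob n y g)"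
      using c s g y by (simp add: c'(2) \<epsilon>_act connects_def Q.Z1_closed)
    also have "\<dots> = cob n (\<epsilon> n s \<otimes>\<^bsub>L 0 n\<^esub> y) g"
      using s g y by (intro L.act_div_mult[symmetric]) auto
    finally show ?thesis .
  qed
  then show ?thesis using c s c' y by (auto simp: connects_def d_\<epsilon>)
qed

text \<open>Two preimages of \<open>z\<close> differ by the kernel of \<open>d\<close>, which is the
  image of \<open>\<epsilon>\<close> by exactness.\<close>

lemma connects_unique:
  assumes "connects n z y c" "connects n z y' c'"
  shows "cls n c = cls n c'"
proof -
  have y: "y \<in> carrier (L 0 n)" "y' \<in> carrier (L 0 n)" "c \<in> carrier (Z1 G (Q n))" "c' \<in> carrier (Z1 G (Q n))"
    "d 0 n y' = d 0 n y"
    using assms by (auto simp: connects_def)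
  then have "d 0 n (y' \<otimes>\<^bsub>L 0 n\<^esub> inv\<^bsub>L 0 n\<^esub> y) = \<one>\<^bsub>L (Suc 0) n\<^esub>" by simp
  then obtain s where s: "s \<in> carrier (Q n)" "\<epsilon> n s = y' \<otimes>\<^bsub>L 0 n\<^esub> inv\<^bsub>L 0 n\<^esub> y"
    using exact_0[of "y' \<otimes>\<^bsub>L 0 n\<^esub> inv\<^bsub>L 0 n\<^esub> y" n] y by auto
  have y': "y' = \<epsilon> n s \<otimes>\<^bsub>L 0 n\<^esub> y" using s y by (simp add: L.m_assoc)
  have "c' g = act (Q n) s g \<otimes>\<^bsub>Q n\<^esub> inv\<^bsub>Q n\<^esub> s \<otimes>\<^bsub>Q n\<^esub> c g" if g: "g \<in> carrier G" for g
  proof (rule inj_onD[OF \<epsilon>_inj])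
    have "\<epsilon> n (c' g) = cob n (\<epsilon> n s \<otimes>\<^bsub>L 0 n\<^esub> y) g"
      using assms(2) g unfolding connects_def y' by blast
    also have "\<dots> = (act (L 0 n) (\<epsilon> n s) g \<otimes>\<^bsub>L 0 n\<^esub> inv\<^bsub>L 0 n\<^esub> \<epsilon> n s) \<otimes>\<^bsub>L 0 n\<^esub> (cob n y g)"
      using s(1) g y by (intro L.act_div_mult) auto
    also have "\<dots> = \<epsilon> n (act (Q n) s g \<otimes>\<^bsub>Q n\<^esub> inv\<^bsub>Q n\<^esub> s \<otimes>\<^bsub>Q n\<^esub> c g)"
      using assms(1) s(1) g y by (simp add: \<epsilon>_act connects_def Q.Z1_closed)
    finally show "\<epsilon> n (c' g) = \<epsilon> n (act (Q n) s g \<otimes>\<^bsub>Q n\<^esub> inv\<^bsub>Q n\<^esub> s \<otimes>\<^bsub>Q n\<^esub> c g)" .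
  qed (use g s y in auto)
  then show ?thesis using y s by (auto simp: Q.B1_rcos_eq_iff)
qed

lemma connects_mult:
  assumes "connects n z y c" "connects n z' y' c'"
  shows "connects n (z \<otimes>\<^bsub>L (Suc 0) n\<^esub> z') (y \<otimes>\<^bsub>L 0 n\<^esub> y') (c \<otimes>\<^bsub>Z1 G (Q n)\<^esub> c')"
proof -
  interpret Z: comm_group "Z1 G (Q n)" by (rule Q.Z1_comm_group)
  have y: "y \<in> carrier (L 0 n)" "y' \<in> carrier (L 0 n)" "c \<in> carrier (Z1 G (Q n))" "c' \<in> carrier (Z1 G (Q n))"
    using assms by (auto simp: connects_def)
  show ?thesis
    using assms y by (simp add: connects_def L.act_div_mult[simplified] Q.Z1_closed del: L.act_mult)
qed

text \<open>The coboundary of \<open>y\<close> does not see an invariant factor \<open>w\<close>;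
  hence the class is unchanged when \<open>z\<close> moves inside its coset of
  \<open>Bd\<close>.\<close>

lemma connects_invariant:
  assumes c: "connects n z y c" and w: "w \<in> carrier (L 0 n)" "\<And>g. g \<in> carrier G ==> act (L 0 n) w g = w"
  shows "connects n (d 0 n w \<otimes>\<^bsub>L (Suc 0) n\<^esub> z) (w \<otimes>\<^bsub>L 0 n\<^esub> y) c"
proof -
  have y: "y \<in> carrier (L 0 n)" using c by (auto simp: connects_def)
  have "cob n (w \<otimes>\<^bsub>L 0 n\<^esub> y) g = cob n y g"
    if g: "g \<in> carrier G" for g
    using L.act_div_mult[OF w(1) y g] w y g by simp
  then show ?thesis using c w y by (simp add: connects_def del: L.act_mult)
qed

lemma connects_tr:
  assumes c: "connects (Suc n) z y c"
  shows "connects n (tr (I (Suc 0)) n z) (tr (I 0) n y)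
    (\<lambda>g\<in>carrier G. tr (quotient_system M Fil) n (c g))"
proof -
  have y: "y \<in> carrier (L 0 (Suc n))" "c \<in> carrier (Z1 G (Q (Suc n)))" using c by (auto simp: connects_def)
  have "\<epsilon> n (tr (quotient_system M Fil) n (c g)) = cob n (tr (I 0) n y) g"
    if g: "g \<in> carrier G" for g
    using c g y by (simp add: \<epsilon>_tr connects_def Q.Z1_closed tI_act)
  then show ?thesis
    using c y gmodule_hom_Z1[OF Q_module Q_module tr_hom y(2)]
    by (auto simp: connects_def d_tr)
qed

abbreviation Bd :: "(nat => 'i) set" where "Bd \<equiv> H1_cont_coboundaries G I d"
abbreviation H :: "nat => (nat => 'i) monoid" where "H i \<equiv> H0_cont G (I i)"

sublocale H: comm_group "H i" for i
  by (rule H0_cont_comm_group[OF G.is_group torsion_I])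

lemma Bd_subgroup: "subgroup Bd (H (Suc 0))"
proof -
  interpret group_hom "H 0" "H (Suc 0)" "\<lambda>x n. d 0 n (x n)"
    using system_hom_H0_cont[OF G.is_group torsion_I torsion_I d_system_hom] by unfold_locales
  show ?thesis unfolding H1_cont_coboundaries_def by (rule img_is_subgroup)
qed

definition cycles :: "(nat => 'i) set" where
  "cycles = {z \<in> carrier (H (Suc 0)). \<forall>n. d (Suc 0) n (z n) = \<one>\<^bsub>L (Suc (Suc 0)) n\<^esub>}"

lemma H1_cont_eq: "H1_cont G I d = (H (Suc 0))\<lparr>carrier := cycles\<rparr> Mod Bd"
  by (simp add: H1_cont_def cycles_def kernel_def fun_eq_iff numeral_2_eq_2)

lemma H1_cont_carrier: "carrier (H1_cont G I d) = (\<lambda>z. Bd #>\<^bsub>H (Suc 0)\<^esub> z) ` cycles"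
  by (simp add: H1_cont_eq carrier_FactGroup r_coset_def)

lemma H1_cont_mult: "z \<in> cycles ==> z' \<in> cycles ==>
    (Bd #>\<^bsub>H (Suc 0)\<^esub> z) \<otimes>\<^bsub>H1_cont G I d\<^esub> (Bd #>\<^bsub>H (Suc 0)\<^esub> z') = Bd #>\<^bsub>H (Suc 0)\<^esub> (z \<otimes>\<^bsub>H (Suc 0)\<^esub> z')"
proof -
  assume z: "z \<in> cycles" "z' \<in> cycles"
  interpret normal Bd "H (Suc 0)" using Bd_subgroup H.subgroup_imp_normal by blast
  have "z \<in> carrier (H (Suc 0))" "z' \<in> carrier (H (Suc 0))" using z by (auto simp: cycles_def)
  then have "(Bd #>\<^bsub>H (Suc 0)\<^esub> z) <#>\<^bsub>H (Suc 0)\<^esub> (Bd #>\<^bsub>H (Suc 0)\<^esub> z') = Bd #>\<^bsub>H (Suc 0)\<^esub> (z \<otimes>\<^bsub>H (Suc 0)\<^esub> z')"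
    by (rule rcos_sum)
  then show ?thesis by (simp add: H1_cont_eq set_mult_def)
qed

lemma cycles_mult: "z \<in> cycles ==> z' \<in> cycles ==> z \<otimes>\<^bsub>H (Suc 0)\<^esub> z' \<in> cycles"
  using H.m_closed[of z "Suc 0" z'] by (simp add: cycles_def H0_cont_carrier)

lemma cycles_connects:
  assumes "z \<in> cycles"
  shows "\<exists>y c. connects n (z n) y c"
proof -
  have z: "z n \<in> carrier (L (Suc 0) n)" "d (Suc 0) n (z n) = \<one>\<^bsub>L (Suc (Suc 0)) n\<^esub>"
    "\<And>g. g \<in> carrier G ==> act (L (Suc 0) n) (z n) g = z n"
    using assms by (auto simp: cycles_def H0_cont_carrier)
  then obtain y where y: "y \<in> carrier (L 0 n)" "z n = d 0 n y" using exact_1[OF z(1)] by blast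
  show ?thesis using connects_ex[OF y(1)] z(3) unfolding y(2) by blast
qed

text \<open>\<open>H1_cont_to_lim\<close> collects the cocycles of all representatives and all
  preimages. They lie in one class by \<open>connects_unique\<close> and
  \<open>connects_invariant\<close>, and they fill it by \<open>connects_translate\<close>.\<close>

lemma H1_cont_to_lim_rcos:
  assumes z: "z \<in> cycles" and c: "connects n (z n) y c"
  shows "to_lim (Bd #>\<^bsub>H (Suc 0)\<^esub> z) n = cls n c"
proof -
  interpret Z: comm_group "Z1 G (Q n)" by (rule Q.Z1_comm_group)
  have zc: "z \<in> carrier (H (Suc 0))" using z by (simp add: cycles_def)
  have eq: "to_lim X n = {c. \<exists>z\<in>X. \<exists>y. connects n (z n) y c}" for X
    by (auto simp: H1_cont_to_lim_def connects_def)
  have cZ: "c \<in> carrier (Z1 G (Q n))" using c by (simp add: connects_def)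
  show ?thesis
    unfolding eq
  proof (intro equalityI subsetI; clarify?)
    fix c' z' y' assume z': "z' \<in> Bd #>\<^bsub>H (Suc 0)\<^esub> z" and c': "connects n (z' n) y' c'"
    then obtain w where w: "w \<in> carrier (H 0)" "z' n = d 0 n (w n) \<otimes>\<^bsub>L (Suc 0) n\<^esub> z n"
      by (auto simp: r_coset_def H1_cont_coboundaries_def)
    then have "connects n (z' n) (w n \<otimes>\<^bsub>L 0 n\<^esub> y) c"
      using connects_invariant[OF c, of "w n"] by (simp add: H0_cont_carrier)
    then have "cls n c = cls n c'" using connects_unique c' by blast
    then show "c' \<in> cls n c"
      using Z.rcos_self[OF _ Q.B1_subgroup] c' by (simp add: connects_def)
  next
    fix c' assume c': "c' \<in> cls n c"
    then obtain s where s: "s \<in> carrier (Q n)" "c' = coboundary G (Q n) s \<otimes>\<^bsub>Z1 G (Q n)\<^esub> c"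
      by (auto simp: r_coset_def B1_eq)
    have "connects n (z n) (\<epsilon> n s \<otimes>\<^bsub>L 0 n\<^esub> y) c'"
      by (rule connects_translate[OF c s(1)]) (use s cZ in \<open>auto simp: coboundary_def[abs_def] intro: Q.coboundary_in_Z1[unfolded coboundary_def]\<close>)
    moreover have "z \<in> Bd #>\<^bsub>H (Suc 0)\<^esub> z" using H.rcos_self[OF zc Bd_subgroup] .
    ultimately show "\<exists>z\<in>Bd #>\<^bsub>H (Suc 0)\<^esub> z. \<exists>y. connects n (z n) y c'" by blast
  qed
qed

lemma H1_cont_to_lim_hom:
  "to_lim \<in> hom (H1_cont G I d) (lim_H1 G (quotient_system M Fil))"
proof (rule homI)
  fix X assume "X \<in> carrier (H1_cont G I d)"
  then obtain z where z: "z \<in> cycles" "X = Bd #>\<^bsub>H (Suc 0)\<^esub> z" by (auto simp: H1_cont_carrier)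
  obtain y c where c: "\<And>n. connects n (z n) (y n) (c n)" using cycles_connects[OF z(1)] by metis
  have cZ: "c n \<in> carrier (Z1 G (Q n))" for n using c[of n] by (simp add: connects_def)
  have X: "to_lim X = (\<lambda>n. cls n (c n))"
    using H1_cont_to_lim_rcos[OF z(1) c] z(2) by blast
  have "cls n (\<lambda>g\<in>carrier G. tr (quotient_system M Fil) n (c (Suc n) g)) =
      cls n (c n)" for n
  proof -
    have "tr (I (Suc 0)) n (z (Suc n)) = z n" using z(1) by (simp add: cycles_def H0_cont_carrier)
    then have "connects n (z n) (tr (I 0) n (y (Suc n))) (\<lambda>g\<in>carrier G. tr (quotient_system M Fil) n (c (Suc n) g))"
      using connects_tr[OF c[of "Suc n"]] by simp
    then show ?thesis using connects_unique c by blast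
  qed
  then show "to_lim X \<in> carrier (lim_H1 G (quotient_system M Fil))"
    using cZ by (simp add: X lim_H1_def H1_tr_rcos Q.H1_carrier)
  fix X' assume "X' \<in> carrier (H1_cont G I d)"
  then obtain z' where z': "z' \<in> cycles" "X' = Bd #>\<^bsub>H (Suc 0)\<^esub> z'" by (auto simp: H1_cont_carrier)
  obtain y' c' where c': "\<And>n. connects n (z' n) (y' n) (c' n)" using cycles_connects[OF z'(1)] by metis
  have cZ': "c' n \<in> carrier (Z1 G (Q n))" for n using c'[of n] by (simp add: connects_def)
  have X': "to_lim X' = (\<lambda>n. cls n (c' n))"
    using H1_cont_to_lim_rcos[OF z'(1) c'] z'(2) by blast
  have "to_lim (X \<otimes>\<^bsub>H1_cont G I d\<^esub> X') n =
      cls n (c n \<otimes>\<^bsub>Z1 G (Q n)\<^esub> c' n)" for n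
  proof -
    have "connects n ((z \<otimes>\<^bsub>H (Suc 0)\<^esub> z') n) (y n \<otimes>\<^bsub>L 0 n\<^esub> y' n) (c n \<otimes>\<^bsub>Z1 G (Q n)\<^esub> c' n)"
      using connects_mult[OF c c', of n] by simp
    from H1_cont_to_lim_rcos[OF cycles_mult[OF z(1) z'(1)] this] show ?thesis
      unfolding z(2) z'(2) H1_cont_mult[OF z(1) z'(1)] .
  qed
  then show "to_lim (X \<otimes>\<^bsub>H1_cont G I d\<^esub> X') =
      to_lim X \<otimes>\<^bsub>lim_H1 G (quotient_system M Fil)\<^esub>
      to_lim X'"
    using cZ cZ' by (simp add: X X' lim_H1_def Q.H1_mult fun_eq_iff)
qed

end

lemma (in group) eq_of_div_eq_one:
  "x \<otimes> inv y = \<one> ==> x \<in> carrier G ==> y \<in> carrier G ==> x = y"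
  by (simp add: inv_solve_right')

locale resolved_complete_module = complete_filtered_module + resolved_filtered_module
begin

text \<open>If the element type \<open>'d\<close> of the resolution were finite, a finite subset of
  \<open>M\<close> with more elements would still be separated by some quotient \<open>Q n\<close>,
  and \<open>\<epsilon> n\<close> embeds that quotient into \<open>'d\<close>.\<close>

lemma infinite_type: "infinite (UNIV :: 'd set)"
proof
  assume fin: "finite (UNIV :: 'd set)"
  obtain F where F: "F \<subseteq> carrier M" "finite F" "card F = Suc (card (UNIV :: 'd set))"
    using infinite_arbitrarily_large[OF infinite_carrier] by blast
  have "\<exists>n. x \<noteq> y \<longrightarrow> pr n x \<noteq> pr n y" if "x \<in> F" "y \<in> F" for x y
    using pr_separated[of x y] that F by blast
  then obtain m where m: "\<And>x y. x \<in> F ==> y \<in> F ==> x \<noteq> y ==> pr (m x y) x \<noteq> pr (m x y) y"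
    by metis
  define n where "n = (\<Sum>u\<in>F \<times> F. m (fst u) (snd u))"
  have "m x y \<le> n" if "x \<in> F" "y \<in> F" for x y
    using member_le_sum[of "(x, y)" "F \<times> F" "\<lambda>u. m (fst u) (snd u)"] that F by (simp add: n_def)
  then have "inj_on (pr n) F"
    using m pr_mono' F(1) by (intro inj_onI) (metis subsetD)
  then have "card F = card (pr n ` F)" by (simp add: card_image)
  also have "\<dots> = card (\<epsilon> n ` pr n ` F)"
    using \<epsilon>_inj F(1) by (intro card_image[symmetric] inj_on_subset[OF \<epsilon>_inj]) auto
  also have "\<dots> \<le> card (UNIV :: 'd set)" by (intro card_mono fin) auto
  finally show False using F by simp
qed

text \<open>The values have a common exponent because \<open>Q n\<close> has one, so
  \<open>trivialize_cocycle\<close> applies after embedding into the injective system.\<close>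

lemma cocycle_trivial:
  assumes c: "c \<in> carrier (Z1 G (Q n))"
  shows "\<exists>y\<in>carrier (L 0 n). \<forall>g\<in>carrier G. \<epsilon> n (c g) = cob n y g"
proof -
  obtain q :: nat where q: "q > 0" "\<And>x. x \<in> carrier (Q n) ==> x [^]\<^bsub>Q n\<^esub> q = \<one>\<^bsub>Q n\<^esub>"
    using pr_torsion[of n] by blast
  have e: "(\<lambda>g\<in>carrier G. \<epsilon> n (c g)) \<in> carrier (Z1 G (L 0 n))"
    using gmodule_hom_Z1[OF Q_module L_module \<epsilon>_hom c] .
  have "\<epsilon> n (c g) [^]\<^bsub>L 0 n\<^esub> q = \<one>\<^bsub>L 0 n\<^esub>" if "g \<in> carrier G" for g
    using q(2)[OF Q.Z1_closed[OF c that]] \<epsilon>.hom_nat_pow[OF Q.Z1_closed[OF c that], of q] by simp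
  then show ?thesis
    using trivialize_cocycle[OF G.is_group injective_I infinite_type q(1) e] by auto
qed

lemma almost_invariant_subgroup: "subgroup (almost_invariant G M Fil n) M"
proof -
  interpret F: subgroup "Fil n" M by (rule Fil_subgroup)
  show ?thesis
  proof
    show "almost_invariant G M Fil n \<subseteq> carrier M" by (rule almost_invariant_subset)
    show "\<one> \<in> almost_invariant G M Fil n" by (simp add: almost_invariant_def)
    fix x assume x: "x \<in> almost_invariant G M Fil n"
    have "act M (inv x) g \<otimes> inv (inv x) = inv (act M x g \<otimes> inv x)" if "g \<in> carrier G" for g
      using x that by (simp add: almost_invariant_def inv_mult)
    then show "inv x \<in> almost_invariant G M Fil n"
      using x by (simp add: almost_invariant_def F.m_inv_closed)
    fix y assume y: "y \<in> almost_invariant G M Fil n"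
    show "x \<otimes> y \<in> almost_invariant G M Fil n"
      using x y by (simp add: almost_invariant_def act_div_mult del: act_mult)
  qed
qed

lemma invariant_pr:
  assumes s: "s \<in> carrier (Q n)" "\<And>g. g \<in> carrier G ==> act (Q n) s g = s"
  shows "\<exists>x\<in>almost_invariant G M Fil n. s = pr n x"
proof -
  obtain x where x: "x \<in> carrier M" "s = pr n x" using s by (auto simp: Q_carrier)
  have "pr n (act M x g) = pr n x" if "g \<in> carrier G" for g using s(2)[OF that] x that by (simp add: pr_act)
  then have "x \<in> almost_invariant G M Fil n" using x by (simp add: almost_invariant_def pr_eq_iff)
  then show ?thesis using x by blast
qed

lemma almost_invariant_pr:
  "x \<in> almost_invariant G M Fil n ==> g \<in> carrier G ==> act (Q n) (pr n x) g = pr n x"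
  by (simp add: almost_invariant_def pr_eq_iff flip: pr_act)

text \<open>The kernel of the map to the limit is a lim^1 of invariants: at each level
  \<open>z n\<close> comes from an invariant \<open>w0 n\<close>, but transition maps respect these
  only up to invariants of \<open>Q n\<close>. They have to be corrected to a point of the
  limit.\<close>

lemma compatible_invariants:
  assumes w0: "\<And>n. w0 n \<in> carrier (L 0 n)" "\<And>n g. g \<in> carrier G ==> act (L 0 n) (w0 n) g = w0 n"
    and d0: "\<And>n. d 0 n (w0 n) = z n" and z: "z \<in> carrier (H (Suc 0))"
  shows "z \<in> Bd"
proof -
  let ?W = "almost_invariant G M Fil"
  have ztr: "tr (I (Suc 0)) n (z (Suc n)) = z n" for n using z by (simp add: H0_cont_carrier)
  have "\<exists>s\<in>?W n. tr (I 0) n (w0 (Suc n)) = w0 n \<otimes>\<^bsub>L 0 n\<^esub> \<epsilon> n (pr n s)" for n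
  proof -
    let ?e = "inv\<^bsub>L 0 n\<^esub> w0 n \<otimes>\<^bsub>L 0 n\<^esub> tr (I 0) n (w0 (Suc n))"
    have t: "tr (I 0) n (w0 (Suc n)) \<in> carrier (L 0 n)" "\<And>g. g \<in> carrier G ==>
      act (L 0 n) (tr (I 0) n (w0 (Suc n))) g = tr (I 0) n (w0 (Suc n))"
      using w0 by (auto simp flip: tI_act)
    have "d 0 n ?e = \<one>\<^bsub>L (Suc 0) n\<^esub>"
      using w0 t by (simp add: d_tr d0 ztr) (metis L.l_inv d.hom_closed d0 w0(1))
    then obtain s where s: "s \<in> carrier (Q n)" "?e = \<epsilon> n s" using exact_0[of ?e n] w0 t by auto
    have "act (Q n) s g = s" if g: "g \<in> carrier G" for g
    proof (rule inj_onD[OF \<epsilon>_inj])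
      show "\<epsilon> n (act (Q n) s g) = \<epsilon> n s"
        using s(1) g w0 t by (simp add: \<epsilon>_act flip: s(2))
    qed (use s g in auto)
    then obtain x where x: "x \<in> ?W n" "s = pr n x" using invariant_pr s(1) by blast
    have "tr (I 0) n (w0 (Suc n)) = w0 n \<otimes>\<^bsub>L 0 n\<^esub> ?e" using w0 t by (simp add: L.m_assoc[symmetric])
    then show ?thesis using x s(2) by auto
  qed
  then obtain s where s: "\<And>n. s n \<in> ?W n" "\<And>n. tr (I 0) n (w0 (Suc n)) = w0 n \<otimes>\<^bsub>L 0 n\<^esub> \<epsilon> n (pr n (s n))"
    by metis
  have sM: "s n \<in> carrier M" for n using s(1) almost_invariant_subset by blast
  define P where "P = rec_nat \<one> (\<lambda>n u. u \<otimes> s n)"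
  have P0: "P 0 = \<one>" and PS: "\<And>n. P (Suc n) = P n \<otimes> s n" by (simp_all add: P_def)
  have P: "P n \<in> carrier M" for n by (induction n) (use P0 PS sM in auto)
  \<comment> \<open>The coset of \<open>P n\<close> under the almost invariant elements. It shrinks
    with \<open>n\<close> because \<open>P (Suc n)\<close> differs from \<open>P n\<close> by
    \<open>s n\<close>, which is almost invariant at level \<open>n\<close>.\<close>
  define Y where "Y n = {u \<in> carrier M. inv P n \<otimes> u \<in> ?W n}" for n
  have "\<exists>v. (\<forall>n. v n \<in> Y n) \<and> (\<forall>n. pr n (v (Suc n)) = pr n (v n))"
  proof (rule compatible_sequence)
    show "Y n \<subseteq> carrier M" for n by (auto simp: Y_def)
    have "P n \<in> Y n" for n using P subgroup.one_closed[OF almost_invariant_subgroup] by (simp add: Y_def)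
    then show "Y n \<noteq> {}" for n by blast
    show "Y (Suc n) \<subseteq> Y n" for n
    proof
      fix u assume u: "u \<in> Y (Suc n)"
      then have uM: "u \<in> carrier M" "inv P (Suc n) \<otimes> u \<in> ?W n"
        using almost_invariant_decreasing[of n "Suc n"] by (auto simp: Y_def)
      have "s n \<otimes> (inv P (Suc n) \<otimes> u) = inv P n \<otimes> u"
        using uM P sM by (simp add: PS inv_mult_group m_assoc[symmetric])
      then show "u \<in> Y n"
        using subgroup.m_closed[OF almost_invariant_subgroup s(1) uM(2)] uM by (simp add: Y_def)
    qed
    show "x \<otimes> inv y \<in> ?W n" if "x \<in> Y n" "y \<in> Y n" for n x y
    proof -
      have xy: "x \<in> carrier M" "y \<in> carrier M" using that by (auto simp: Y_def)
      have "(inv P n \<otimes> x) \<otimes> inv (inv P n \<otimes> y) = x \<otimes> inv P n \<otimes> (P n \<otimes> inv y)"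
        using xy P by (simp add: inv_mult m_comm[of x])
      also have "\<dots> = x \<otimes> (inv P n \<otimes> P n) \<otimes> inv y"
        using xy P by (simp only: m_assoc inv_closed m_closed)
      finally have "(inv P n \<otimes> x) \<otimes> inv (inv P n \<otimes> y) = x \<otimes> inv y"
        using xy P by simp
      moreover have "(inv P n \<otimes> x) \<otimes> inv (inv P n \<otimes> y) \<in> ?W n"
      proof (rule subgroup.m_closed[OF almost_invariant_subgroup])
        show "inv P n \<otimes> x \<in> ?W n" using that(1) by (simp add: Y_def)
        show "inv (inv P n \<otimes> y) \<in> ?W n"
          using that(2) by (intro subgroup.m_inv_closed[OF almost_invariant_subgroup]) (simp add: Y_def)
      qed
      ultimately show ?thesis by simp
    qed
    show "w \<otimes> y \<in> Y n" if "w \<in> ?W n" "y \<in> Y n" for n w y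
    proof -
      have wy: "w \<in> carrier M" "y \<in> carrier M" "inv P n \<otimes> y \<in> ?W n"
        using that almost_invariant_subset by (auto simp: Y_def)
      have "inv P n \<otimes> (w \<otimes> y) = w \<otimes> (inv P n \<otimes> y)"
        using wy P by (intro m_lcomm) auto
      then show ?thesis using wy subgroup.m_closed[OF almost_invariant_subgroup that(1) wy(3)] by (simp add: Y_def)
    qed
  qed
  then obtain v where v: "\<And>n. v n \<in> Y n" "\<And>n. pr n (v (Suc n)) = pr n (v n)" by blast
  have vM: "v n \<in> carrier M" "inv P n \<otimes> v n \<in> ?W n" for n using v(1)[of n] by (auto simp: Y_def)
  \<comment> \<open>The corrections. Agreement of \<open>v\<close> at consecutive levels says that
    \<open>s n\<close> times \<open>u (Suc n)\<close> equals \<open>u n\<close> modulo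
    \<open>Fil n\<close>, which cancels the defect of \<open>w0\<close>.\<close>
  define u where "u n = inv P n \<otimes> v n" for n
  have u: "u n \<in> ?W n" "u n \<in> carrier M" for n using vM P by (auto simp: u_def)
  define w where "w n = w0 n \<otimes>\<^bsub>L 0 n\<^esub> \<epsilon> n (pr n (u n))" for n
  have "w \<in> carrier (H 0)"
    unfolding H0_cont_carrier
  proof (intro CollectI allI conjI ballI)
    fix n
    show "w n \<in> carrier (L 0 n)" using w0 u by (simp add: w_def)
    show "act (L 0 n) (w n) g = w n" if "g \<in> carrier G" for g
      using w0 u that by (simp add: w_def almost_invariant_pr flip: \<epsilon>_act)
    have "pr n (s n \<otimes> u (Suc n)) = pr n (u n)"
    proof -
      have "s n \<otimes> u (Suc n) = inv P n \<otimes> v (Suc n)"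
        using P sM vM by (simp add: u_def PS inv_mult_group m_assoc[symmetric])
      then show ?thesis using P vM v(2) by (simp add: u_def pr_mult)
    qed
    then have "pr n (s n) \<otimes>\<^bsub>Q n\<^esub> pr n (u (Suc n)) = pr n (u n)" using sM u by (simp add: pr_mult)
    then have e: "\<epsilon> n (pr n (s n)) \<otimes>\<^bsub>L 0 n\<^esub> \<epsilon> n (pr n (u (Suc n))) = \<epsilon> n (pr n (u n))"
      using sM u by (simp flip: \<epsilon>.hom_mult)
    have "tr (I 0) n (w (Suc n)) = w0 n \<otimes>\<^bsub>L 0 n\<^esub> \<epsilon> n (pr n (s n)) \<otimes>\<^bsub>L 0 n\<^esub> \<epsilon> n (pr n (u (Suc n)))"
      using w0 u s(2) by (simp add: w_def tr_pr flip: \<epsilon>_tr)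
    also have "\<dots> = w n" using w0 u sM e by (simp add: w_def L.m_assoc)
    finally show "tr (I 0) n (w (Suc n)) = w n" .
  qed
  moreover have "z = (\<lambda>n. d 0 n (w n))"
    using w0(1) u d.hom_closed[OF w0(1)] d0 by (auto simp: w_def d_\<epsilon> fun_eq_iff)
  ultimately show ?thesis by (auto simp: H1_cont_coboundaries_def)
qed

text \<open>Once a preimage is adjusted so that both cycles give the same cocycle, the quotient of
  the two preimages is invariant and \<open>d\<close> maps it to the quotient of the cycles. This is
  the input of \<open>compatible_invariants\<close>.\<close>

lemma H1_cont_to_lim_inj: "inj_on (to_lim) (carrier (H1_cont G I d))"
proof (rule inj_onI)
  fix X X' assume "X \<in> carrier (H1_cont G I d)" "X' \<in> carrier (H1_cont G I d)"
    and eq: "to_lim X = to_lim X'"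
  then obtain z z' where z: "z \<in> cycles" "X = Bd #>\<^bsub>H (Suc 0)\<^esub> z" "z' \<in> cycles" "X' = Bd #>\<^bsub>H (Suc 0)\<^esub> z'"
    by (auto simp: H1_cont_carrier)
  have zc: "z \<in> carrier (H (Suc 0))" "z' \<in> carrier (H (Suc 0))" using z by (auto simp: cycles_def)
  have "\<exists>w\<in>carrier (L 0 n). (\<forall>g\<in>carrier G. act (L 0 n) w g = w) \<and> d 0 n w = z n \<otimes>\<^bsub>L (Suc 0) n\<^esub> inv\<^bsub>L (Suc 0) n\<^esub> z' n" for n
  proof -
    obtain y c where c: "connects n (z n) y c" using cycles_connects[OF z(1)] by blast
    obtain y' c' where c': "connects n (z' n) y' c'" using cycles_connects[OF z(3)] by blast
    have cZ: "c \<in> carrier (Z1 G (Q n))" "c' \<in> carrier (Z1 G (Q n))" using c c' by (auto simp: connects_def)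
    have "cls n c' = cls n c"
      using fun_cong[OF eq, of n] H1_cont_to_lim_rcos[OF z(1) c] H1_cont_to_lim_rcos[OF z(3) c'] z by simp
    then obtain s where s: "s \<in> carrier (Q n)" "\<And>g. g \<in> carrier G ==>
        c g = act (Q n) s g \<otimes>\<^bsub>Q n\<^esub> inv\<^bsub>Q n\<^esub> s \<otimes>\<^bsub>Q n\<^esub> c' g"
      using Q.B1_rcos_eq_iff[OF cZ(2,1)] by blast
    define u where "u = \<epsilon> n s \<otimes>\<^bsub>L 0 n\<^esub> y'"
    have c2: "connects n (z' n) u c" unfolding u_def using connects_translate[OF c' s(1) cZ(1) s(2)] .
    have yu: "y \<in> carrier (L 0 n)" "u \<in> carrier (L 0 n)" "d 0 n y = z n" "d 0 n u = z' n"
      using c c2 by (auto simp: connects_def)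
    have "act (L 0 n) (y \<otimes>\<^bsub>L 0 n\<^esub> inv\<^bsub>L 0 n\<^esub> u) g = y \<otimes>\<^bsub>L 0 n\<^esub> inv\<^bsub>L 0 n\<^esub> u" if g: "g \<in> carrier G" for g
    proof -
      have e: "cob n y g = cob n u g"
        using c c2 g by (auto simp: connects_def)
      have "cob n (y \<otimes>\<^bsub>L 0 n\<^esub> inv\<^bsub>L 0 n\<^esub> u) g =
          (cob n y g) \<otimes>\<^bsub>L 0 n\<^esub> inv\<^bsub>L 0 n\<^esub> (cob n u g)"
        using L.act_div_mult[of y 0 n "inv\<^bsub>L 0 n\<^esub> u" g] yu g by (simp add: L.inv_mult)
      also have "\<dots> = \<one>\<^bsub>L 0 n\<^esub>" using yu g unfolding e by simp
      finally show ?thesis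
        by (rule L.eq_of_div_eq_one) (use yu g in auto)
    qed
    then show ?thesis using yu by (intro bexI[of _ "y \<otimes>\<^bsub>L 0 n\<^esub> inv\<^bsub>L 0 n\<^esub> u"]) auto
  qed
  then obtain w where w: "\<And>n. w n \<in> carrier (L 0 n)" "\<And>n g. g \<in> carrier G ==> act (L 0 n) (w n) g = w n"
      "\<And>n. d 0 n (w n) = z n \<otimes>\<^bsub>L (Suc 0) n\<^esub> inv\<^bsub>L (Suc 0) n\<^esub> z' n"
    by metis
  have zz: "(\<lambda>n. z n \<otimes>\<^bsub>L (Suc 0) n\<^esub> inv\<^bsub>L (Suc 0) n\<^esub> z' n) \<in> carrier (H (Suc 0))"
    using zc by (auto simp: H0_cont_carrier)
  have "(\<lambda>n. z n \<otimes>\<^bsub>L (Suc 0) n\<^esub> inv\<^bsub>L (Suc 0) n\<^esub> z' n) \<in> Bd"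
    by (rule compatible_invariants[OF w zz])
  moreover have "z = (\<lambda>n. z n \<otimes>\<^bsub>L (Suc 0) n\<^esub> inv\<^bsub>L (Suc 0) n\<^esub> z' n) \<otimes>\<^bsub>H (Suc 0)\<^esub> z'"
    using zc by (auto simp: H0_cont_carrier L.m_assoc fun_eq_iff)
  ultimately have "z \<in> Bd #>\<^bsub>H (Suc 0)\<^esub> z'" unfolding r_coset_def by blast
  then show "X = X'" using H.repr_independence[OF _ zc(2) Bd_subgroup] z by metis
qed

text \<open>Each cocycle becomes trivial in \<open>I 0\<close>, say by \<open>y\<close>. Two
  trivializations at one level differ by an invariant, which lifts to the next level by
  \<open>lift_invariant\<close>; so the \<open>y\<close> can be chosen compatibly, and their images
  under \<open>d\<close> form the cycle.\<close>

lemma H1_cont_to_lim_surj: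
  assumes "x \<in> carrier (lim_H1 G (quotient_system M Fil))"
  shows "x \<in> to_lim ` carrier (H1_cont G I d)"
proof -
  obtain b where b: "b \<in> carrier (Z1 G M)" "\<And>n. x n = cls n (\<lambda>g\<in>carrier G. pr n (b g))"
    using lim_H1_lift[OF assms] by blast
  define c where "c n = (\<lambda>g\<in>carrier G. pr n (b g))" for n
  have c: "c n \<in> carrier (Z1 G (Q n))" for n using pr_cocycle[OF b(1)] by (simp add: c_def)
  have ctr: "(\<lambda>g\<in>carrier G. tr (quotient_system M Fil) n (c (Suc n) g)) = c n" for n
    using b by (auto simp: c_def tr_pr fun_eq_iff)
  define Y where "Y n y \<longleftrightarrow> y \<in> carrier (L 0 n) \<and>
      (\<forall>g\<in>carrier G. \<epsilon> n (c n g) = cob n y g)" for n y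
  have Yex: "\<exists>y. Y n y" for n using cocycle_trivial[OF c] by (auto simp: Y_def)
  have dinv: "act (L (Suc 0) n) (d 0 n y) g = d 0 n y" if y: "Y n y" and g: "g \<in> carrier G" for n y g
  proof -
    have yc: "y \<in> carrier (L 0 n)" using y by (simp add: Y_def)
    have "d 0 n (\<epsilon> n (c n g)) = \<one>\<^bsub>L (Suc 0) n\<^esub>" using c g by (simp add: d_\<epsilon> Q.Z1_closed)
    then have "act (L (Suc 0) n) (d 0 n y) g \<otimes>\<^bsub>L (Suc 0) n\<^esub> inv\<^bsub>L (Suc 0) n\<^esub> d 0 n y = \<one>\<^bsub>L (Suc 0) n\<^esub>"
      using y g yc by (simp add: Y_def d_act)
    then show ?thesis
      by (rule L.eq_of_div_eq_one) (use yc g in auto)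
  qed
  have Yc: "Y n y \<longleftrightarrow> connects n (d 0 n y) y (c n)" for n y
    using c by (auto simp: Y_def connects_def)
  have step: "\<exists>y'. Y (Suc n) y' \<and> tr (I 0) n y' = y" if y: "Y n y" for n y
  proof -
    obtain u where u: "Y (Suc n) u" using Yex by blast
    have uc: "u \<in> carrier (L 0 (Suc n))" "y \<in> carrier (L 0 n)" using u y by (auto simp: Y_def)
    have t: "Y n (tr (I 0) n u)"
      using connects_tr[OF u[unfolded Yc]] uc by (simp add: ctr Y_def connects_def)
    let ?v = "y \<otimes>\<^bsub>L 0 n\<^esub> inv\<^bsub>L 0 n\<^esub> tr (I 0) n u"
    have "act (L 0 n) ?v g = ?v" if g: "g \<in> carrier G" for g
    proof -
      have e: "cob n y g = cob n (tr (I 0) n u) g"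
        using y t g by (auto simp: Y_def)
      have "cob n ?v g =
          (cob n y g) \<otimes>\<^bsub>L 0 n\<^esub> inv\<^bsub>L 0 n\<^esub> (cob n (tr (I 0) n u) g)"
        using L.act_div_mult[of y 0 n "inv\<^bsub>L 0 n\<^esub> tr (I 0) n u" g] uc g by (simp add: L.inv_mult)
      also have "\<dots> = \<one>\<^bsub>L 0 n\<^esub>" using uc g unfolding e by simp
      finally show ?thesis
        by (rule L.eq_of_div_eq_one) (use uc g in auto)
    qed
    then obtain w where w: "w \<in> carrier (L 0 (Suc n))" "\<And>g. g \<in> carrier G ==> act (L 0 (Suc n)) w g = w" "tr (I 0) n w = ?v"
      using lift_invariant[OF G.is_group injective_I, of ?v 0 n] uc by auto
    have "Y (Suc n) (w \<otimes>\<^bsub>L 0 (Suc n)\<^esub> u)"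
      using connects_invariant[OF u[unfolded Yc] w(1,2)] by (simp add: connects_def Y_def)
    moreover have "tr (I 0) n (w \<otimes>\<^bsub>L 0 (Suc n)\<^esub> u) = y"
      using w uc by (simp add: L.m_assoc)
    ultimately show ?thesis by blast
  qed
  obtain y0 where "Y 0 y0" using Yex by blast
  then have "\<exists>y. \<forall>n. Y n (y n) \<and> tr (I 0) n (y (Suc n)) = y n"
    using step by (intro dependent_nat_choice) blast+
  then obtain y where y: "\<And>n. Y n (y n)" "\<And>n. tr (I 0) n (y (Suc n)) = y n" by blast
  have yc: "y n \<in> carrier (L 0 n)" for n using y(1)[of n] by (simp add: Y_def)
  define z where "z n = d 0 n (y n)" for n
  have "tr (I (Suc 0)) n (z (Suc n)) = z n" for n
    using y(2) yc by (simp add: z_def flip: d_tr)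
  moreover have "d (Suc 0) n (z n) = \<one>\<^bsub>L (Suc (Suc 0)) n\<^esub>" for n
    using yc exact_1[of "z n" n] by (simp add: z_def)
  ultimately have zc: "z \<in> cycles"
    using yc dinv[OF y(1)] by (auto simp: cycles_def H0_cont_carrier) (auto simp: z_def)
  have "connects n (z n) (y n) (c n)" for n using y(1)[of n] unfolding Yc z_def .
  then have "to_lim (Bd #>\<^bsub>H (Suc 0)\<^esub> z) n = x n" for n
    using H1_cont_to_lim_rcos[OF zc] b(2)[of n] unfolding c_def by blast
  then have "to_lim (Bd #>\<^bsub>H (Suc 0)\<^esub> z) = x" by blast
  moreover have "Bd #>\<^bsub>H (Suc 0)\<^esub> z \<in> carrier (H1_cont G I d)" using zc by (auto simp: H1_cont_carrier)
  ultimately show ?thesis by blast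
qed

theorem comparison_isos: "comparison_isos G M Fil \<epsilon> I d"
proof -
  have "bij_betw (to_lim) (carrier (H1_cont G I d))
      (carrier (lim_H1 G (quotient_system M Fil)))"
    using H1_cont_to_lim_inj H1_cont_to_lim_hom H1_cont_to_lim_surj
    unfolding bij_betw_def hom_def by blast
  then show ?thesis
    using H1_cont_to_lim_hom H1_to_lim_iso by (simp add: comparison_isos_def iso_def)
qed

end

text \<open>The lift \<open>\<phi>\<close> sends a preimage used in the connecting homomorphism to a
  preimage for the target, so connecting cocycles correspond under the map of quotients. For
  \<open>H1 G M\<close> both composites are computed on the same cocycle.\<close>

lemma comparison_compatibleI:
  assumes A: "resolved_filtered_module G M Fil \<epsilon> I d" and B: "resolved_filtered_module G M' Fil' \<epsilon>' J d'"
    and h: "h \<in> gmodule_hom G M M'" and hF: "\<And>n. h ` Fil n \<subseteq> Fil' n"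
    and mor: "resolution_morphism G (quotient_system M Fil) (quotient_system_map M' Fil' h) \<epsilon> I d \<epsilon>' J d' \<phi>"
  shows "comparison_compatible G M Fil \<epsilon> I d M' Fil' \<epsilon>' J d' h \<phi>"
proof -
  interpret A: resolved_filtered_module G M Fil \<epsilon> I d by fact
  interpret B: resolved_filtered_module G M' Fil' \<epsilon>' J d' by fact
  let ?h = "quotient_system_map M' Fil' h"
  have hpr: "?h n (A.pr n x) = B.pr n (h x)" if "x \<in> carrier M" for n x
    unfolding quotient_system_map_def A.pr_def B.pr_def
    using h hF that A.Fil_subgroup B.Fil_subgroup
    by (intro coset_map_rcos) (auto simp: A.is_group B.is_group gmodule_hom_def)
  have hc: "h x \<in> carrier M'" if "x \<in> carrier M" for x using h that by (auto simp: gmodule_hom_def hom_def)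
  have hh: "?h n \<in> gmodule_hom G (A.Q n) (B.Q n)" for n
    using h hc unfolding gmodule_hom_def hom_def
    by (auto simp: A.Q_carrier hpr simp flip: A.pr_act A.pr_mult B.pr_act B.pr_mult)
  have \<phi>: "\<phi> i \<in> system_hom G (I i) (J i)"
    "x \<in> carrier (A.Q n) ==> \<phi> 0 n (\<epsilon> n x) = \<epsilon>' n (?h n x)"
    "u \<in> carrier (A.L i n) ==> \<phi> (Suc i) n (d i n u) = d' i n (\<phi> i n u)" for i n x u
    using mor by (auto simp: resolution_morphism_def)
  have \<phi>h: "\<phi> i n \<in> gmodule_hom G (A.L i n) (B.L i n)" for i n using \<phi>(1) by (simp add: system_hom_def)
  interpret \<phi>: group_hom "A.L i n" "B.L i n" "\<phi> i n" for i n
    by (rule gmodule_hom_group_hom[OF A.L_module B.L_module \<phi>h])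
  have \<phi>act: "\<phi> i n (act (A.L i n) u g) = act (B.L i n) (\<phi> i n u) g" if "u \<in> carrier (A.L i n)" "g \<in> carrier G" for i n u g
    using \<phi>h that by (simp add: gmodule_hom_def)
  have H\<phi>: "(\<lambda>x n. \<phi> i n (x n)) \<in> hom (A.H i) (B.H i)" for i
    using system_hom_H0_cont[OF A.G.is_group A.torsion_I B.torsion_I \<phi>(1)] .
  have 1: "H1_cont_to_lim G (quotient_system M' Fil') \<epsilon>' J d' (H1_cont_map G J d' \<phi> X)
      = lim_H1_map G (quotient_system M' Fil') ?h (H1_cont_to_lim G (quotient_system M Fil) \<epsilon> I d X)"
    if X: "X \<in> carrier (H1_cont G I d)" for X
  proof
    fix n
    obtain z where z: "z \<in> A.cycles" "X = A.Bd #>\<^bsub>A.H (Suc 0)\<^esub> z" using X by (auto simp: A.H1_cont_carrier)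
    have zc: "z \<in> carrier (A.H (Suc 0))" using z by (simp add: A.cycles_def)
    have zn: "z n \<in> carrier (A.L (Suc 0) n)" for n using zc by (simp add: H0_cont_carrier)
    let ?z = "\<lambda>n. \<phi> (Suc 0) n (z n)"
    have "(\<lambda>x n. \<phi> (Suc 0) n (x n)) ` A.Bd \<subseteq> B.Bd"
    proof clarify
      fix b assume "b \<in> A.Bd"
      then obtain w where w: "w \<in> carrier (A.H 0)" "b = (\<lambda>n. d 0 n (w n))" by (auto simp: H1_cont_coboundaries_def)
      have "(\<lambda>n. \<phi> 0 n (w n)) \<in> carrier (B.H 0)" using H\<phi>[of 0] w by (auto simp: hom_def)
      moreover have "(\<lambda>n. \<phi> (Suc 0) n (b n)) = (\<lambda>n. d' 0 n (\<phi> 0 n (w n)))"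
        using w \<phi>(3) by (auto simp: H0_cont_carrier)
      ultimately show "(\<lambda>n. \<phi> (Suc 0) n (b n)) \<in> B.Bd" by (auto simp: H1_cont_coboundaries_def)
    qed
    then have m: "H1_cont_map G J d' \<phi> X = B.Bd #>\<^bsub>B.H (Suc 0)\<^esub> ?z"
      unfolding H1_cont_map_def z(2) One_nat_def
      using H\<phi> zc A.Bd_subgroup B.Bd_subgroup
      by (intro coset_map_rcos) (auto simp: A.H.is_group B.H.is_group)
    have "?z \<in> carrier (B.H (Suc 0))" using H\<phi>[of "Suc 0"] zc by (auto simp: hom_def)
    moreover have "d' (Suc 0) n (?z n) = \<one>\<^bsub>B.L (Suc (Suc 0)) n\<^esub>" for n
      using \<phi>(3)[OF zn, of n] z(1) by (simp add: A.cycles_def)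
    ultimately have zz: "?z \<in> B.cycles" by (simp add: B.cycles_def)
    obtain y c where c: "A.connects n (z n) y c" using A.cycles_connects[OF z(1)] by blast
    have yc: "y \<in> carrier (A.L 0 n)" "c \<in> carrier (Z1 G (A.Q n))" using c by (auto simp: A.connects_def)
    have "B.connects n (?z n) (\<phi> 0 n y) (\<lambda>g\<in>carrier G. ?h n (c g))"
      unfolding B.connects_def
    proof (intro conjI ballI)
      show "\<phi> 0 n y \<in> carrier (B.L 0 n)" using yc by simp
      show "d' 0 n (\<phi> 0 n y) = \<phi> (Suc 0) n (z n)" using \<phi>(3)[OF yc(1)] c by (simp add: A.connects_def)
      show "(\<lambda>g\<in>carrier G. ?h n (c g)) \<in> carrier (Z1 G (B.Q n))"
        using gmodule_hom_Z1[OF A.Q_module B.Q_module hh yc(2)] .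
      fix g assume g: "g \<in> carrier G"
      have "\<epsilon>' n (?h n (c g)) = \<phi> 0 n (\<epsilon> n (c g))" using \<phi>(2) yc g by (simp add: A.Q.Z1_closed)
      also have "\<dots> = act (B.L 0 n) (\<phi> 0 n y) g \<otimes>\<^bsub>B.L 0 n\<^esub> inv\<^bsub>B.L 0 n\<^esub> \<phi> 0 n y"
        using c yc g by (simp add: A.connects_def \<phi>act)
      finally show "\<epsilon>' n ((\<lambda>g\<in>carrier G. ?h n (c g)) g) = act (B.L 0 n) (\<phi> 0 n y) g \<otimes>\<^bsub>B.L 0 n\<^esub> inv\<^bsub>B.L 0 n\<^esub> \<phi> 0 n y"
        using g by simp
    qed
    from B.H1_cont_to_lim_rcos[OF zz this]
    have "H1_cont_to_lim G (quotient_system M' Fil') \<epsilon>' J d' (H1_cont_map G J d' \<phi> X) n =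
        B1 G (B.Q n) #>\<^bsub>Z1 G (B.Q n)\<^esub> (\<lambda>g\<in>carrier G. ?h n (c g))"
      unfolding m .
    also have "\<dots> = H1_map G (B.Q n) (?h n) (B1 G (A.Q n) #>\<^bsub>Z1 G (A.Q n)\<^esub> c)"
      using H1_map_rcos[OF A.Q_module B.Q_module hh yc(2)] by simp
    finally show "H1_cont_to_lim G (quotient_system M' Fil') \<epsilon>' J d' (H1_cont_map G J d' \<phi> X) n =
        lim_H1_map G (quotient_system M' Fil') ?h (H1_cont_to_lim G (quotient_system M Fil) \<epsilon> I d X) n"
      using A.H1_cont_to_lim_rcos[OF z(1) c] by (simp add: lim_H1_map_def z(2))
  qed
  have 2: "H1_to_lim G M' Fil' (H1_map G M' h X) =
      lim_H1_map G (quotient_system M' Fil') ?h (H1_to_lim G M Fil X)" if X: "X \<in> carrier (H1 G M)" for X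
  proof
    fix n
    obtain c where c: "c \<in> carrier (Z1 G M)" "X = B1 G M #>\<^bsub>Z1 G M\<^esub> c" using X by (auto simp: A.H1_carrier)
    have "(\<lambda>g\<in>carrier G. B.pr n ((\<lambda>g\<in>carrier G. h (c g)) g)) = (\<lambda>g\<in>carrier G. ?h n ((\<lambda>g\<in>carrier G. A.pr n (c g)) g))"
      using c by (auto simp: hpr fun_eq_iff)
    then show "H1_to_lim G M' Fil' (H1_map G M' h X) n =
        lim_H1_map G (quotient_system M' Fil') ?h (H1_to_lim G M Fil X) n"
      using c gmodule_hom_Z1[OF A.group_module_axioms B.group_module_axioms h c(1)]
      by (simp add: H1_map_rcos[OF A.group_module_axioms B.group_module_axioms h] lim_H1_map_def
          A.H1_to_lim_rcos B.H1_to_lim_rcos H1_map_rcos[OF A.Q_module B.Q_module hh] A.pr_cocycle)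
  qed
  show ?thesis unfolding comparison_compatible_def using 1 2 by blast
qed

section \<open>Ultrametric estimates, the ideals of O_K, and chains of submodules\<close>

section \<open>Non-archimedean fields\<close>

lemma absv_nonneg [simp]: "absv (x :: 'a :: nonarch_field) \<ge> 0"
  by (metis diff_zero dist_absv zero_le_dist)

lemma absv_eq_0_iff [simp]: "absv (x :: 'a :: nonarch_field) = 0 \<longleftrightarrow> x = 0"
  by (metis diff_zero dist_absv dist_eq_0_iff)

lemma absv_zero [simp]: "absv (0 :: 'a :: nonarch_field) = 0"
  by simp

lemma absv_one [simp]: "absv (1 :: 'a :: nonarch_field) = 1"
proof -
  have "absv (1 :: 'a) * absv (1 :: 'a) = absv (1 :: 'a)" using absv_mult[of "1 :: 'a" 1] by simp
  then show ?thesis by simp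
qed

lemma absv_minus [simp]: "absv (- x :: 'a :: nonarch_field) = absv x"
  by (metis diff_0 diff_zero dist_absv dist_commute)

lemma absv_minus_commute: "absv (x - y :: 'a :: nonarch_field) = absv (y - x)"
  by (metis dist_absv dist_commute)

lemma absv_power [simp]: "absv (x ^ n :: 'a :: nonarch_field) = absv x ^ n"
  by (induction n) (auto simp: absv_mult)

lemma absv_inverse: "absv (inverse x :: 'a :: nonarch_field) = inverse (absv x)"
proof (cases "x = 0")
  case False
  then have "absv x * absv (inverse x) = 1" by (simp flip: absv_mult)
  then show ?thesis by (metis inverse_unique)
qed simp

lemma absv_divide: "absv (x / y :: 'a :: nonarch_field) = absv x / absv y"
  by (simp add: divide_inverse absv_mult absv_inverse)

lemma absv_add_le: "absv x \<le> r ==> absv y \<le> r ==> absv (x + y :: 'a :: nonarch_field) \<le> r"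
  using absv_add_le_max[of x y] by linarith

lemma absv_diff_le: "absv x \<le> r ==> absv y \<le> r ==> absv (x - y :: 'a :: nonarch_field) \<le> r"
  using absv_add_le[of x r "- y"] by simp

lemma absv_add_less: "absv x < r ==> absv y < r ==> absv (x + y :: 'a :: nonarch_field) < r"
  using absv_add_le_max[of x y] by linarith

lemma absv_diff_less: "absv x < r ==> absv y < r ==> absv (x - y :: 'a :: nonarch_field) < r"
  using absv_add_less[of x r "- y"] by simp

lemma absv_triangle_le: "absv (x - y) \<le> r ==> absv (y - z) \<le> r ==> absv (x - z :: 'a :: nonarch_field) \<le> r"
  using absv_add_le[of "x - y" r "y - z"] by simp

lemma absv_sum_le: "(\<And>i. i \<in> A ==> absv (f i) \<le> r) ==> r \<ge> 0 ==> absv (sum f A :: 'a :: nonarch_field) \<le> r"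
  by (induction A rule: infinite_finite_induct) (auto intro: absv_add_le)

lemma absv_add_eq: "absv y < absv x ==> absv (x + y :: 'a :: nonarch_field) = absv x"
  using absv_add_le_max[of x y] absv_add_le_max[of "x + y" "- y"] by auto

lemma absv_of_nat_le_1 [simp]: "absv (of_nat n :: 'a :: nonarch_field) \<le> 1"
  by (induction n) (auto intro: absv_add_le)

lemma absv_of_int_le_1 [simp]: "absv (of_int n :: 'a :: nonarch_field) \<le> 1"
  by (cases n rule: int_cases2) auto

lemma absv_mult_le_1: "absv x \<le> r ==> absv y \<le> 1 ==> absv (x * y :: 'a :: nonarch_field) \<le> r"
  using mult_mono[of "absv x" r "absv y" 1] by (simp add: absv_mult order.trans[OF absv_nonneg])

instance nonarch_field \<subseteq> topological_ab_group_add
proof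
  fix a b :: 'a
  show "((\<lambda>x. fst x + snd x) \<longlongrightarrow> a + b) (nhds a \<times>\<^sub>F nhds b)"
  proof (rule tendstoI)
    fix e :: real assume "e > 0"
    then have "\<forall>\<^sub>F x in nhds a \<times>\<^sub>F nhds b. dist (fst x) a < e \<and> dist (snd x) b < e"
      by (intro eventually_prodI) (auto simp: eventually_nhds_metric)
    then show "\<forall>\<^sub>F x in nhds a \<times>\<^sub>F nhds b. dist (fst x + snd x) (a + b) < e"
    proof eventually_elim
      case (elim x)
      then show ?case using absv_add_less[of "fst x - a" e "snd x - b"] by (simp add: dist_absv algebra_simps)
    qed
  qed
  show "(uminus \<longlongrightarrow> - a) (nhds a)"
  proof (rule tendstoI)
    fix e :: real assume "e > 0"
    then have "\<forall>\<^sub>F x in nhds a. dist x a < e" by (auto simp: eventually_nhds_metric)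
    then show "\<forall>\<^sub>F x in nhds a. dist (- x) (- a) < e"
      by eventually_elim (simp add: dist_absv, metis absv_minus_commute)
  qed
qed

instance nonarch_field \<subseteq> topological_semigroup_mult
proof
  fix a b :: 'a
  show "((\<lambda>x. fst x * snd x) \<longlongrightarrow> a * b) (nhds a \<times>\<^sub>F nhds b)"
  proof (rule tendstoI)
    fix e :: real assume e: "e > 0"
    define C where "C = max 1 (max (absv a) (absv b))"
    have C: "C \<ge> 1" "absv a \<le> C" "absv b \<le> C" by (auto simp: C_def)
    define \<delta> where "\<delta> = min 1 (e / (2 * C))"
    have \<delta>: "\<delta> > 0" "\<delta> \<le> 1" "C * \<delta> < e" using C e by (auto simp: \<delta>_def min_def field_simps)
    then have "\<forall>\<^sub>F x in nhds a \<times>\<^sub>F nhds b. dist (fst x) a < \<delta> \<and> dist (snd x) b < \<delta>"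
      by (intro eventually_prodI) (auto simp: eventually_nhds_metric)
    then show "\<forall>\<^sub>F x in nhds a \<times>\<^sub>F nhds b. dist (fst x * snd x) (a * b) < e"
    proof eventually_elim
      case (elim x)
      obtain u v where x: "x = (u, v)" by (cases x)
      have uv: "absv (u - a) < \<delta>" "absv (v - b) < \<delta>" using elim x by (auto simp: dist_absv)
      have "absv ((u - a) * (v - b)) \<le> \<delta> * \<delta>" "absv ((u - a) * b) \<le> \<delta> * C" "absv (a * (v - b)) \<le> C * \<delta>"
        unfolding absv_mult using uv C \<delta> by (auto intro!: mult_mono)
      moreover have "\<delta> * \<delta> \<le> C * \<delta>" using \<delta> C by (intro mult_right_mono) auto
      ultimately have "absv ((u - a) * (v - b) + ((u - a) * b + a * (v - b))) \<le> C * \<delta>"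
        by (intro absv_add_le) (auto simp: mult.commute)
      moreover have "(u - a) * (v - b) + ((u - a) * b + a * (v - b)) = u * v - a * b" by (simp add: algebra_simps)
      ultimately show ?case using \<delta> x by (simp add: dist_absv)
    qed
  qed
qed

lemma absv_tendsto_le:
  fixes X :: "'b => 'a :: nonarch_field"
  assumes "(X \<longlongrightarrow> l) F" "F \<noteq> bot" "\<forall>\<^sub>F n in F. absv (X n - a) \<le> r"
  shows "absv (l - a) \<le> r"
proof -
  have "l \<in> cball a r"
    by (rule Lim_in_closed_set[OF closed_cball _ assms(2,1)])
       (use assms(3) in eventually_elim, simp add: dist_absv absv_minus_commute)
  then show ?thesis by (simp add: dist_absv absv_minus_commute)
qed


lemma absv_eq_0I:
  fixes x :: "'a :: nonarch_field"
  assumes "\<And>n. absv x \<le> C * q ^ n" "q < 1" "q \<ge> 0"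
  shows "x = 0"
proof -
  have "(\<lambda>n. C * q ^ n) \<longlonglongrightarrow> C * 0" using assms by (intro tendsto_intros LIMSEQ_power_zero) auto
  then have "absv x \<le> 0" using assms(1) by (intro Lim_bounded2[where f = "\<lambda>n. C * q ^ n"]) auto
  then show ?thesis using absv_nonneg[of x] by (metis absv_eq_0_iff order_antisym)
qed

locale dv_field =
  fixes p :: nat and K :: "'c :: nonarch_field set" and \<pi> :: 'c
  assumes prime_p: "prime p" and K: "complete_dv_field p K" and \<pi>: "uniformizer K \<pi>"
begin

lemma K_0 [simp, intro]: "0 \<in> K" and K_1 [simp, intro]: "1 \<in> K"
  and K_add [intro]: "x \<in> K ==> y \<in> K ==> x + y \<in> K"
  and K_mult [intro]: "x \<in> K ==> y \<in> K ==> x * y \<in> K"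
  and K_minus [intro]: "x \<in> K ==> - x \<in> K"
  and K_inverse [intro]: "x \<in> K ==> inverse x \<in> K"
  and complete_K: "complete K" and absv_p: "absv (of_nat p :: 'c) = 1 / real p"
  using K by (auto simp: complete_dv_field_def)

lemma K_diff [intro]: "x \<in> K ==> y \<in> K ==> x - y \<in> K"
  using K_add[of x "- y"] by auto

lemma K_divide [intro]: "x \<in> K ==> y \<in> K ==> x / y \<in> K"
  by (auto simp: divide_inverse)

lemma K_power [intro]: "x \<in> K ==> x ^ n \<in> K"
  by (induction n) auto

lemma K_sum [intro]: "(\<And>i. i \<in> A ==> f i \<in> K) ==> sum f A \<in> K"
  by (induction A rule: infinite_finite_induct) auto

lemma K_of_nat [simp, intro]: "of_nat n \<in> K"
  by (induction n) auto

lemma K_of_int [simp, intro]: "of_int n \<in> K"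
  by (cases n rule: int_cases2) auto

lemma closed_K: "closed K"
  using complete_K complete_imp_closed by blast

lemma \<pi>_K [simp, intro]: "\<pi> \<in> K" and \<pi>_nz [simp]: "\<pi> \<noteq> 0" and \<pi>_less: "absv \<pi> < 1"
  and \<pi>_max: "x \<in> K ==> absv x < 1 ==> absv x \<le> absv \<pi>"
  using \<pi> by (auto simp: uniformizer_def)

lemma \<pi>_pos: "absv \<pi> > 0"
  using absv_nonneg[of \<pi>] by (simp add: order_less_le)

lemma absv_p_le: "absv (of_nat p :: 'c) \<le> absv \<pi>"
  using prime_gt_1_nat[OF prime_p] by (intro \<pi>_max) (auto simp: absv_p divide_less_eq)

text \<open>The \<open>n\<close>-th power of the maximal ideal of the ring of integers of
  \<open>K\<close>, and that ring itself for \<open>n = 0\<close>. With truncated subtraction,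
  \<open>Opow (n - i)\<close> asks only for integrality once \<open>i\<close> reaches
  \<open>n\<close>.\<close>

definition Opow :: "nat => 'c set" where
  "Opow n = {x \<in> K. absv x \<le> absv \<pi> ^ n}"

lemma Opow_0: "Opow 0 = {x \<in> K. absv x \<le> 1}"
  by (simp add: Opow_def)

lemma Opow_add [intro]: "x \<in> Opow n ==> y \<in> Opow n ==> x + y \<in> Opow n"
  by (auto simp: Opow_def intro: absv_add_le)

lemma Opow_diff [intro]: "x \<in> Opow n ==> y \<in> Opow n ==> x - y \<in> Opow n"
  by (auto simp: Opow_def intro: absv_diff_le)

lemma Opow_minus [intro]: "x \<in> Opow n ==> - x \<in> Opow n"
  by (auto simp: Opow_def)

lemma Opow_zero [simp, intro]: "0 \<in> Opow n"
  by (auto simp: Opow_def)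

lemma Opow_one [simp, intro]: "1 \<in> Opow 0"
  by (auto simp: Opow_def)

lemma Opow_mult: "x \<in> Opow m ==> y \<in> Opow n ==> x * y \<in> Opow (m + n)"
  by (auto simp: Opow_def absv_mult power_add intro!: mult_mono)

lemma Opow_mult_left [intro]: "x \<in> Opow 0 ==> y \<in> Opow n ==> x * y \<in> Opow n"
  using Opow_mult[of x 0 y n] by simp

lemma Opow_mult_right [intro]: "x \<in> Opow n ==> y \<in> Opow 0 ==> x * y \<in> Opow n"
  using Opow_mult[of x n y 0] by simp

lemma Opow_sum [intro]: "(\<And>i. i \<in> A ==> f i \<in> Opow n) ==> sum f A \<in> Opow n"
  by (induction A rule: infinite_finite_induct) auto

lemma Opow_antimono: "m \<le> n ==> Opow n \<subseteq> Opow m"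
  using power_decreasing[of m n "absv \<pi>"] \<pi>_less by (auto simp: Opow_def)

lemma Opow_antimonoD: "x \<in> Opow n ==> m \<le> n ==> x \<in> Opow m"
  using Opow_antimono by blast

lemma Opow_of_nat [simp, intro]: "of_nat n \<in> Opow 0" and Opow_of_int [simp, intro]: "of_int k \<in> Opow 0"
  by (auto simp: Opow_0)

lemma \<pi>_power_Opow [simp, intro]: "\<pi> ^ n \<in> Opow n"
  by (auto simp: Opow_def)

lemma p_power_Opow [intro]: "of_nat p ^ n \<in> Opow n"
  using absv_p_le by (auto simp: Opow_def intro: power_mono)

lemma Opow_power [intro]: "x \<in> Opow 0 ==> x ^ n \<in> Opow 0"
  by (auto simp: Opow_0 power_le_one)

lemma closed_Opow: "closed (Opow n)"
proof -
  have "Opow n = K \<inter> cball 0 (absv \<pi> ^ n)" by (auto simp: Opow_def dist_absv)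
  then show ?thesis by (simp add: closed_Int closed_K)
qed

lemma Opow_separated: "(\<And>n. x \<in> Opow (n - w)) ==> x = 0"
proof -
  assume "\<And>n. x \<in> Opow (n - w)"
  then have "x \<in> Opow (n + w - w)" for n .
  then show ?thesis using \<pi>_less by (intro absv_eq_0I[of _ 1 "absv \<pi>"]) (auto simp: Opow_def)
qed

text \<open>The shift \<open>w\<close> will be the degree of a coordinate: for \<open>n\<close> at
  most \<open>w\<close> the condition on the steps is mere integrality, so geometric convergence
  starts \<open>w\<close> steps late.\<close>

lemma Opow_0_complete:
  assumes s: "\<And>n. s n \<in> Opow 0" and d: "\<And>n. s (Suc n) - s n \<in> Opow (n - w)"
  shows "\<exists>l\<in>Opow 0. \<forall>n. l - s n \<in> Opow (n - w)"
proof -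
  have dd: "s m - s n \<in> Opow (n - w)" if "n \<le> m" for n m
    using that
  proof (induction m rule: dec_induct)
    case (step m)
    have "s (Suc m) - s m \<in> Opow (n - w)" using d[of m] step by (auto intro: Opow_antimonoD)
    then have "(s (Suc m) - s m) + (s m - s n) \<in> Opow (n - w)" using step by blast
    then show ?case by simp
  qed simp
  have "Cauchy s"
  proof (rule metric_CauchyI)
    fix e :: real assume "e > 0"
    then obtain k where k: "absv \<pi> ^ k < e" using \<pi>_less real_arch_pow_inv by blast
    have "dist (s m) (s n) < e" if "m \<ge> k + w" "n \<ge> k + w" for m n
    proof -
      have "absv (s m - s (k + w)) \<le> absv \<pi> ^ k" "absv (s n - s (k + w)) \<le> absv \<pi> ^ k"
        using dd[of "k + w" m] dd[of "k + w" n] that by (auto simp: Opow_def)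
      then have "absv (s m - s n) \<le> absv \<pi> ^ k"
        using absv_diff_le[of "s m - s (k + w)" _ "s n - s (k + w)"] by simp
      then show ?thesis using k by (simp add: dist_absv)
    qed
    then show "\<exists>M. \<forall>m\<ge>M. \<forall>n\<ge>M. dist (s m) (s n) < e" by blast
  qed
  then obtain l where l: "l \<in> K" "s \<longlonglongrightarrow> l"
    using complete_K s unfolding complete_def Opow_def by blast
  have lim: "l - s n \<in> Opow (n - w)" for n
  proof (rule Lim_in_closed_set[OF closed_Opow])
    show "(\<lambda>m. s m - s n) \<longlonglongrightarrow> l - s n" using l by (intro tendsto_intros)
    show "\<forall>\<^sub>F m in sequentially. s m - s n \<in> Opow (n - w)"
      using eventually_ge_at_top[of n] by eventually_elim (rule dd)
  qed simp
  have "l = (l - s 0) + s 0" by simp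
  then have "l \<in> Opow 0" using lim[of 0] s[of 0] Opow_add by (metis diff_0_eq_0)
  then show ?thesis using lim by blast
qed

text \<open>
  Chains of submodules become stationary modulo powers of the uniformizer in finitely many
  coordinates: for one coordinate the minimal valuation is eventually constant.
\<close>

definition submodule :: "('q => 'c) set => bool" where
  "submodule S \<longleftrightarrow> (\<lambda>_. 0) \<in> S \<and> (\<forall>v\<in>S. \<forall>w\<in>S. (\<lambda>q. v q + w q) \<in> S) \<and>
     (\<forall>u\<in>Opow 0. \<forall>v\<in>S. (\<lambda>q. u * v q) \<in> S)"

lemma submodule_diff: "submodule S ==> v \<in> S ==> w \<in> S ==> (\<lambda>q. v q - w q) \<in> S"
proof -
  assume S: "submodule S" "v \<in> S" "w \<in> S"
  have "(\<lambda>q. (- 1) * w q) \<in> S" using S Opow_minus[OF Opow_one] unfolding submodule_def by blast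
  then have "(\<lambda>q. v q + (- 1) * w q) \<in> S" using S unfolding submodule_def by fast
  then show ?thesis by simp
qed

lemma chain_stabilizes_1:
  assumes W: "\<And>m. submodule (W m)" and dec: "\<And>m. W (Suc m) \<subseteq> W m"
    and O: "\<And>m v. v \<in> W m ==> v q \<in> Opow 0"
  shows "\<exists>m. \<forall>l\<ge>m. \<forall>v\<in>W m. \<exists>w\<in>W l. v q - w q \<in> Opow e"
proof -
  have dec': "W l \<subseteq> W m" if "m \<le> l" for m l using dec that lift_Suc_antimono_le by blast
  \<comment> \<open>Exponents are capped at \<open>e\<close> so that a greatest one exists even if
    the coordinate vanishes on all of \<open>W m\<close>.\<close>
  define P where "P m k \<longleftrightarrow> k \<le> e \<and> (\<forall>v\<in>W m. v q \<in> Opow k)" for m k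
  define f where "f m = (GREATEST k. P m k)" for m
  have P0: "P m 0" for m using O by (auto simp: P_def)
  have Pf: "P m (f m)" and fmax: "P m k ==> k \<le> f m" for m k
    unfolding f_def by (rule GreatestI_nat[of "P m" 0 e] Greatest_le_nat[of "P m" _ e]; use P0 in \<open>auto simp: P_def\<close>)+
  have fe: "f m \<le> e" for m using Pf by (auto simp: P_def)
  have mono: "f m \<le> f l" if "m \<le> l" for m l
    using Pf[of m] dec'[OF that] by (intro fmax) (auto simp: P_def)
  have fin: "finite (range f)" using fe by (intro finite_subset[of "range f" "{..e}"]) auto
  then have "Max (range f) \<in> range f" by (rule Max_in) simp
  then obtain m where fm: "Max (range f) = f m" by (rule imageE)
  have m: "f l \<le> f m" for l using Max_ge[OF fin, of "f l"] unfolding fm by simp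
  have "\<exists>w\<in>W l. v q - w q \<in> Opow e" if l: "l \<ge> m" and v: "v \<in> W m" for l v
  proof (cases "f m = e")
    case True
    have "v q \<in> Opow e" using Pf[of m] v True by (auto simp: P_def)
    then show ?thesis using W[of l] by (intro bexI[of _ "\<lambda>_. 0"]) (auto simp: submodule_def)
  next
    case False
    have "f l = f m" using m[of l] mono[OF l] by simp
    then have "\<not> P l (Suc (f m))" using fmax[of l "Suc (f m)"] by auto
    then obtain w where w: "w \<in> W l" "w q \<notin> Opow (Suc (f m))" using fe[of m] False by (auto simp: P_def)
    have wq: "w q \<in> Opow (f m)" using w(1) Pf[of l] \<open>f l = f m\<close> by (auto simp: P_def)
    have vq: "v q \<in> Opow (f m)" using v Pf[of m] by (auto simp: P_def)
    \<comment> \<open>\<open>w\<close> attains the minimal valuation exactly: a smaller absolute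
      value would, by discreteness, gain a full factor \<open>\<pi>\<close> and put
      \<open>w q\<close> into the next ideal.\<close>
    have "absv (w q / \<pi> ^ f m) \<ge> 1"
    proof (rule ccontr)
      assume "\<not> absv (w q / \<pi> ^ f m) \<ge> 1"
      then have "absv (w q / \<pi> ^ f m) \<le> absv \<pi>" using wq by (intro \<pi>_max) (auto simp: Opow_def)
      then have "w q \<in> Opow (Suc (f m))" using wq \<pi>_pos by (auto simp: Opow_def absv_divide field_simps)
      then show False using w by blast
    qed
    then have ge: "absv \<pi> ^ f m \<le> absv (w q)" using \<pi>_pos by (simp add: absv_divide field_simps)
    then have nz: "w q \<noteq> 0" using \<pi>_pos by (metis absv_zero not_le zero_less_power)
    have "absv (v q) \<le> absv (w q)" using vq ge by (auto simp: Opow_def)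
    moreover have "absv (w q) > 0" using nz by (simp add: order_less_le)
    ultimately have "v q / w q \<in> Opow 0" using vq wq by (auto simp: Opow_def absv_divide)
    then have "(\<lambda>x. (v q / w q) * w x) \<in> W l" using W[of l] w(1) unfolding submodule_def by blast
    then show ?thesis using nz by (intro bexI[of _ "\<lambda>x. (v q / w q) * w x"]) auto
  qed
  then show ?thesis by blast
qed

text \<open>One coordinate is matched first by some \<open>w1\<close>. The rest is matched by the
  induction hypothesis for the subchain \<open>W'\<close> of elements already small at that
  coordinate, so the first match survives.\<close>

lemma chain_stabilizes:
  assumes "finite F" and "\<And>m. submodule (W m)" and "\<And>m. W (Suc m) \<subseteq> W m"
    and "\<And>m v q. v \<in> W m ==> q \<in> F ==> v q \<in> Opow 0"
  shows "\<exists>m. \<forall>l\<ge>m. \<forall>v\<in>W m. \<exists>w\<in>W l. \<forall>q\<in>F. v q - w q \<in> Opow (e q)"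
  using assms
proof (induction F arbitrary: W rule: finite_induct)
  case empty
  have "(\<lambda>_. 0) \<in> W l" for l using empty(1) by (auto simp: submodule_def)
  then show ?case by blast
next
  case (insert r F)
  have dec': "W l \<subseteq> W m" if "m \<le> l" for m l using insert.prems(2) that lift_Suc_antimono_le by blast
  define W' where "W' m = {v \<in> W m. v r \<in> Opow (e r)}" for m
  have "\<exists>m. \<forall>l\<ge>m. \<forall>v\<in>W' m. \<exists>w\<in>W' l. \<forall>q\<in>F. v q - w q \<in> Opow (e q)"
  proof (rule insert.IH)
    show "submodule (W' m)" for m using insert.prems(1) by (auto simp: W'_def submodule_def)
    show "W' (Suc m) \<subseteq> W' m" for m using insert.prems(2)[of m] by (auto simp: W'_def)
    show "v q \<in> Opow 0" if "v \<in> W' m" "q \<in> F" for m v q using that insert.prems(3) by (auto simp: W'_def)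
  qed
  then obtain m1 where m1: "\<And>l v. l \<ge> m1 ==> v \<in> W' m1 ==> \<exists>w\<in>W' l. \<forall>q\<in>F. v q - w q \<in> Opow (e q)"
    by blast
  have "\<exists>m. \<forall>l\<ge>m. \<forall>v\<in>W m. \<exists>w\<in>W l. v r - w r \<in> Opow (e r)"
  proof (rule chain_stabilizes_1)
    show "submodule (W m)" "W (Suc m) \<subseteq> W m" for m using insert.prems(1,2) .
    show "v r \<in> Opow 0" if "v \<in> W m" for m v using insert.prems(3)[OF that, of r] by simp
  qed
  then obtain m2 where m2: "\<And>l v. l \<ge> m2 ==> v \<in> W m2 ==> \<exists>w\<in>W l. v r - w r \<in> Opow (e r)"
    by auto
  have "\<exists>w\<in>W l. \<forall>q\<in>insert r F. v q - w q \<in> Opow (e q)"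
    if l: "l \<ge> max m1 m2" and v: "v \<in> W (max m1 m2)" for l v
  proof -
    have "v \<in> W m2" using v dec'[of m2 "max m1 m2"] by auto
    then obtain w1 where w1: "w1 \<in> W l" "v r - w1 r \<in> Opow (e r)" using m2[of l v] l by auto
    have "(\<lambda>q. v q - w1 q) \<in> W m1"
      using v w1 dec'[of m1 "max m1 m2"] dec'[of m1 l] l insert.prems(1) by (intro submodule_diff) auto
    then have "(\<lambda>q. v q - w1 q) \<in> W' m1" using w1 by (simp add: W'_def)
    then obtain w2 where w2: "w2 \<in> W' l" "\<forall>q\<in>F. v q - w1 q - w2 q \<in> Opow (e q)" using m1[of l] l by fastforce
    have "(\<lambda>q. w1 q + w2 q) \<in> W l" using insert.prems(1) w1 w2 by (auto simp: submodule_def W'_def)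
    moreover have "v r - (w1 r + w2 r) \<in> Opow (e r)"
      using Opow_diff[OF w1(2), of "w2 r"] w2(1) by (simp add: W'_def algebra_simps)
    moreover have "v q - (w1 q + w2 q) \<in> Opow (e q)" if "q \<in> F" for q
      using w2(2) that by (simp add: algebra_simps)
    ultimately show ?thesis by (intro bexI[of _ "\<lambda>q. w1 q + w2 q"]) auto
  qed
  then show ?case by blast
qed

end

section \<open>From coordinates to completeness and the Mittag-Leffler condition\<close>

section \<open>Modules with coordinates\<close>

text \<open>\<open>M\<close> carries no scalar multiplication, so O_K-linearity of the action is
  expressed through coordinates: if those of \<open>y\<close> are \<open>u\<close> times those of
  \<open>x\<close>, the same holds after acting.\<close>

locale coordinate_module = dv_field p K \<pi> + group_module G M
  for p :: nat and K :: "'c :: nonarch_field set" and \<pi> :: 'c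
    and G :: "('g, 'x) monoid_scheme" and M :: "('m, 'g) gmodule" (structure) +
  fixes Fil :: "nat => 'm set" and crd :: "'m => 'q => 'c" and S :: "'q set" and deg :: "'q => nat"
  assumes crd_bij: "bij_betw crd (carrier M) (S \<rightarrow>\<^sub>E Opow 0)"
    and crd_mult: "x \<in> carrier M ==> y \<in> carrier M ==> q \<in> S ==> crd (x \<otimes> y) q = crd x q + crd y q"
    and Fil_eq: "Fil n = {x \<in> carrier M. \<forall>q\<in>S. crd x q \<in> Opow (n - deg q)}"
    and finite_deg: "finite {q \<in> S. deg q < n}"
    and nonempty: "S \<noteq> {}"
    and act_linear: "u \<in> Opow 0 ==> x \<in> carrier M ==> y \<in> carrier M ==> (\<And>q. q \<in> S ==> crd y q = u * crd x q) ==>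
        g \<in> carrier G ==> q \<in> S ==> crd (act M y g) q = u * crd (act M x g) q"
    and stable: "fil_stable G M Fil"
begin

lemma crd_Opow [simp, intro]: "x \<in> carrier M ==> q \<in> S ==> crd x q \<in> Opow 0"
  using crd_bij by (auto simp: bij_betw_def)

lemma crd_ex: "(\<And>q. q \<in> S ==> f q \<in> Opow 0) ==> \<exists>x\<in>carrier M. \<forall>q\<in>S. crd x q = f q"
proof -
  assume "\<And>q. q \<in> S ==> f q \<in> Opow 0"
  then have "restrict f S \<in> crd ` carrier M" using crd_bij by (auto simp: bij_betw_def)
  then obtain x where "x \<in> carrier M" "crd x = restrict f S" by auto
  then show ?thesis by (intro bexI[of _ x]) auto
qed

lemma crd_eqI: "x \<in> carrier M ==> y \<in> carrier M ==> (\<And>q. q \<in> S ==> crd x q = crd y q) ==> x = y"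
proof -
  assume xy: "x \<in> carrier M" "y \<in> carrier M" "\<And>q. q \<in> S ==> crd x q = crd y q"
  have "crd x \<in> S \<rightarrow>\<^sub>E Opow 0" "crd y \<in> S \<rightarrow>\<^sub>E Opow 0" using crd_bij xy by (auto simp: bij_betw_def)
  then have "crd x = crd y" using xy by (intro PiE_ext) auto
  then show ?thesis using crd_bij xy by (auto simp: bij_betw_def inj_on_def)
qed

lemma crd_one [simp]: "q \<in> S ==> crd \<one> q = 0"
  using crd_mult[of "\<one>" "\<one>" q] by simp

lemma crd_inv [simp]: "x \<in> carrier M ==> q \<in> S ==> crd (inv x) q = - crd x q"
  using crd_mult[of x "inv x" q] by (simp add: add_eq_0_iff2)

lemma crd_pow: "x \<in> carrier M ==> q \<in> S ==> crd (x [^] (n::nat)) q = of_nat n * crd x q"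
  by (induction n) (auto simp: crd_mult algebra_simps)

lemma crd_div: "x \<in> carrier M ==> y \<in> carrier M ==> q \<in> S ==> crd (x \<otimes> inv y) q = crd x q - crd y q"
  by (simp add: crd_mult)

theorem complete_filtered: "complete_filtered_module G M Fil"
proof (intro complete_filtered_module.intro filtered_module.intro filtered_module_axioms.intro
    complete_filtered_module_axioms.intro group_module_axioms)
  show "subgroup (Fil n) M" for n
    by unfold_locales (auto simp: Fil_eq crd_mult)
  show "fil_stable G M Fil" by (rule stable)
  show "Fil (Suc n) \<subseteq> Fil n" for n
    by (auto simp: Fil_eq intro: Opow_antimonoD)
  show "\<exists>q::nat. 0 < q \<and> (\<forall>x\<in>carrier M. x [^] q \<in> Fil n)" for n
  \<comment> \<open>\<open>p\<close> lies in the maximal ideal, so multiplication by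
    \<open>p ^ n\<close> lands in \<open>Opow n\<close> at every coordinate.\<close>
  proof (intro exI[of _ "p ^ n"] conjI ballI)
    show "0 < p ^ n" using prime_p prime_gt_0_nat by simp
    fix x assume x: "x \<in> carrier M"
    have "of_nat (p ^ n) * crd x q \<in> Opow (n - deg q)" if "q \<in> S" for q
      using Opow_mult_right[OF p_power_Opow[of n] crd_Opow[OF x that]] by (auto intro: Opow_antimonoD)
    then show "x [^] (p ^ n) \<in> Fil n" using x by (simp add: Fil_eq crd_pow del: of_nat_power)
  qed
  show "x = \<one>" if "x \<in> carrier M" "\<And>n. x \<in> Fil n" for x
  proof (rule crd_eqI)
    fix q assume q: "q \<in> S"
    have "crd x q = 0" using that q by (intro Opow_separated[of _ "deg q"]) (simp add: Fil_eq)
    then show "crd x q = crd \<one> q" using q by simp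
  qed (use that in auto)
  show "\<exists>y\<in>carrier M. \<forall>n. y \<otimes> inv s n \<in> Fil n"
    if s: "\<And>n. s n \<in> carrier M" "\<And>n. s (Suc n) \<otimes> inv s n \<in> Fil n" for s
  proof -
    have "\<exists>l\<in>Opow 0. \<forall>n. l - crd (s n) q \<in> Opow (n - deg q)" if q: "q \<in> S" for q
      using s q by (intro Opow_0_complete) (auto simp: Fil_eq crd_div)
    then obtain l where l: "\<And>q. q \<in> S ==> l q \<in> Opow 0" "\<And>q n. q \<in> S ==> l q - crd (s n) q \<in> Opow (n - deg q)"
      by metis
    have "\<exists>y\<in>carrier M. \<forall>q\<in>S. crd y q = l q" by (rule crd_ex) (rule l(1))
    then obtain y where "y \<in> carrier M" "\<forall>q\<in>S. crd y q = l q" by (rule bexE)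
    then show ?thesis using l s by (intro bexI[of _ y]) (auto simp: Fil_eq crd_div)
  qed
  show "\<exists>m. \<forall>l\<ge>m. \<forall>x\<in>almost_invariant G M Fil m. \<exists>y\<in>almost_invariant G M Fil l. x \<otimes> inv y \<in> Fil n" for n
  proof -
    \<comment> \<open>Functions on the whole index type, arbitrary off \<open>S\<close>; this makes
      \<open>W m\<close> a \<open>submodule\<close> without any restriction of sums and multiples to
      \<open>S\<close>.\<close>
    define W where "W m = {v. \<exists>x\<in>almost_invariant G M Fil m. \<forall>q\<in>S. v q = crd x q}" for m
    have Fdec: "Fil (Suc m) \<subseteq> Fil m" for m by (auto simp: Fil_eq intro: Opow_antimonoD)
    have sub: "submodule (W m)" for m
      unfolding submodule_def
    proof (intro conjI ballI)
      have "\<one> \<in> almost_invariant G M Fil m" by (simp add: almost_invariant_def Fil_eq)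
      then show "(\<lambda>_. 0) \<in> W m" unfolding W_def by force
      fix v w assume "v \<in> W m" "w \<in> W m"
      then obtain x y where xy: "x \<in> almost_invariant G M Fil m" "y \<in> almost_invariant G M Fil m"
        "\<forall>q\<in>S. v q = crd x q" "\<forall>q\<in>S. w q = crd y q" by (auto simp: W_def)
      have "x \<otimes> y \<in> almost_invariant G M Fil m"
        using xy by (auto simp: almost_invariant_def act_div_mult Fil_eq crd_mult simp del: act_mult)
      then show "(\<lambda>q. v q + w q) \<in> W m"
        using xy unfolding W_def by (auto intro!: bexI[of _ "x \<otimes> y"] simp: crd_mult almost_invariant_def)
    next
      fix u v assume u: "u \<in> Opow 0" and "v \<in> W m"
      then obtain x where x: "x \<in> almost_invariant G M Fil m" "\<forall>q\<in>S. v q = crd x q" by (auto simp: W_def)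
      have xM: "x \<in> carrier M" using x by (simp add: almost_invariant_def)
      have "\<exists>y\<in>carrier M. \<forall>q\<in>S. crd y q = u * crd x q" using u xM by (intro crd_ex) auto
      then obtain y where y: "y \<in> carrier M" "\<And>q. q \<in> S ==> crd y q = u * crd x q" by blast
      have "act M y g \<otimes> inv y \<in> Fil m" if g: "g \<in> carrier G" for g
      proof -
        have "crd (act M y g \<otimes> inv y) q = u * crd (act M x g \<otimes> inv x) q" if q: "q \<in> S" for q
          using act_linear[OF u xM y g q] y q g xM by (simp add: crd_div algebra_simps)
        then show ?thesis using x(1) g u y by (auto simp: Fil_eq almost_invariant_def)
      qed
      then have "y \<in> almost_invariant G M Fil m" using y by (simp add: almost_invariant_def)
      then show "(\<lambda>q. u * v q) \<in> W m" using x y unfolding W_def by (auto intro!: bexI[of _ y])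
    qed
    have dec: "W (Suc m) \<subseteq> W m" for m using Fdec[of m] by (auto simp: W_def almost_invariant_def)
    have "\<exists>m. \<forall>l\<ge>m. \<forall>v\<in>W m. \<exists>w\<in>W l. \<forall>q\<in>{q \<in> S. deg q < n}. v q - w q \<in> Opow (n - deg q)"
      using finite_deg sub dec by (intro chain_stabilizes) (auto simp: W_def almost_invariant_def)
    then obtain m where m: "\<And>l v. l \<ge> m ==> v \<in> W m ==> \<exists>w\<in>W l. \<forall>q\<in>{q \<in> S. deg q < n}. v q - w q \<in> Opow (n - deg q)"
      by blast
    have "\<exists>y\<in>almost_invariant G M Fil l. x \<otimes> inv y \<in> Fil n"
      if l: "l \<ge> m" and x: "x \<in> almost_invariant G M Fil m" for l x
    proof -
      have "crd x \<in> W m" using x by (auto simp: W_def)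
      then obtain w where w: "w \<in> W l" "\<forall>q\<in>{q \<in> S. deg q < n}. crd x q - w q \<in> Opow (n - deg q)"
        using m[OF l] by blast
      then obtain y where y: "y \<in> almost_invariant G M Fil l" "\<forall>q\<in>S. w q = crd y q" by (auto simp: W_def)
      have xy: "x \<in> carrier M" "y \<in> carrier M" using x y by (auto simp: almost_invariant_def)
      have "crd x q - crd y q \<in> Opow (n - deg q)" if q: "q \<in> S" for q
      proof (cases "deg q < n")
        case True
        then show ?thesis using w y q by auto
      next
        case False
        then show ?thesis using xy q Opow_diff[of "crd x q" 0 "crd y q"] by simp
      qed
      then show ?thesis using xy y by (intro bexI[of _ y]) (auto simp: Fil_eq crd_div)
    qed
    then show ?thesis by blast
  qed
  show "infinite (carrier M)"
  proof
    assume fin: "finite (carrier M)"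
    obtain q where q: "q \<in> S" using nonempty by blast
    have "of_nat n \<in> (\<lambda>x. crd x q) ` carrier M" for n :: nat
      using crd_ex[of "\<lambda>_. of_nat n"] q by force
    then have "range (of_nat :: nat => 'c) \<subseteq> (\<lambda>x. crd x q) ` carrier M" by blast
    then have "finite (range (of_nat :: nat => 'c))" using fin finite_subset by blast
    then show False using finite_imageD[of "of_nat :: nat => 'c" UNIV] inj_of_nat by simp
  qed
qed

end

section \<open>Convergence and rearrangement of ultrametric series\<close>

section \<open>Series in complete non-archimedean fields\<close>

lemma na_tendsto_0_iff:
  fixes f :: "nat => 'a :: nonarch_field"
  shows "f \<longlonglongrightarrow> 0 \<longleftrightarrow> (\<forall>e>0. \<exists>N. \<forall>n\<ge>N. absv (f n) < e)"
  by (simp add: lim_sequentially dist_absv)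

lemma na_tendsto_0_bounded:
  fixes f :: "nat => 'a :: nonarch_field"
  assumes "f \<longlonglongrightarrow> 0"
  shows "\<exists>C>0. \<forall>n. absv (f n) \<le> C"
proof -
  obtain N where N: "\<And>n. n \<ge> N ==> absv (f n) < 1" using assms unfolding na_tendsto_0_iff by (meson zero_less_one)
  have "absv (f n) \<le> (\<Sum>i<N. absv (f i)) + 1" for n
  proof (cases "n < N")
    case True
    then show ?thesis using member_le_sum[of n "{..<N}" "\<lambda>i. absv (f i)"] by simp
  next
    case False
    then show ?thesis using N[of n] sum_nonneg[of "{..<N}" "\<lambda>i. absv (f i)"] by simp
  qed
  moreover have "(\<Sum>i<N. absv (f i)) + 1 > 0" using sum_nonneg[of "{..<N}" "\<lambda>i. absv (f i)"] by (smt (verit) absv_nonneg)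
  ultimately show ?thesis by blast
qed

lemma na_sums_le:
  fixes f :: "nat => 'a :: nonarch_field"
  assumes "f sums s" "\<And>n. n \<ge> N ==> absv (f n) \<le> r" "r \<ge> 0"
  shows "absv (s - (\<Sum>i<N. f i)) \<le> r"
proof (rule absv_tendsto_le)
  show "(\<lambda>n. \<Sum>i<n. f i) \<longlonglongrightarrow> s" using assms by (simp add: sums_def)
  show "\<forall>\<^sub>F n in sequentially. absv ((\<Sum>i<n. f i) - (\<Sum>i<N. f i)) \<le> r"
    using eventually_ge_at_top[of N]
  proof eventually_elim
    case (elim n)
    have "(\<Sum>i<n. f i) - (\<Sum>i<N. f i) = (\<Sum>i=N..<n. f i)"
      using sum_diff_nat_ivl[of 0 N n f] elim by (simp add: atLeast0LessThan)
    then show ?case using assms by (auto intro: absv_sum_le)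
  qed
qed simp

lemma na_sums_bound:
  fixes f :: "nat => 'a :: nonarch_field"
  shows "f sums s ==> (\<And>n. absv (f n) \<le> r) ==> r \<ge> 0 ==> absv s \<le> r"
  using na_sums_le[of f s 0 r] by simp

lemma na_summable:
  fixes f :: "nat => 'a :: {nonarch_field, complete_space}"
  assumes "f \<longlonglongrightarrow> 0"
  shows "summable f"
proof -
  have "Cauchy (\<lambda>n. \<Sum>i<n. f i)"
  proof (rule metric_CauchyI)
    fix e :: real assume "e > 0"
    then obtain N where N: "\<And>n. n \<ge> N ==> absv (f n) < e / 2" using assms unfolding na_tendsto_0_iff by (meson half_gt_zero)
    have *: "absv ((\<Sum>i<n. f i) - (\<Sum>i<N. f i)) \<le> e / 2" if "n \<ge> N" for n
    proof -
      have "(\<Sum>i<n. f i) - (\<Sum>i<N. f i) = (\<Sum>i=N..<n. f i)"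
        using sum_diff_nat_ivl[of 0 N n f] that by (simp add: atLeast0LessThan)
      moreover have "absv (\<Sum>i=N..<n. f i) \<le> e / 2"
        using N \<open>e > 0\<close> by (intro absv_sum_le less_imp_le) auto
      ultimately show ?thesis by simp
    qed
    have "dist (\<Sum>i<m. f i) (\<Sum>i<n. f i) < e" if "m \<ge> N" "n \<ge> N" for m n
      using absv_diff_le[OF *[OF that(1)] *[OF that(2)]] \<open>e > 0\<close> by (simp add: dist_absv)
    then show "\<exists>M. \<forall>m\<ge>M. \<forall>n\<ge>M. dist (\<Sum>i<m. f i) (\<Sum>i<n. f i) < e" by blast
  qed
  then show ?thesis by (auto simp: summable_def sums_def dest!: Cauchy_convergent convergentD)
qed

lemma na_sums_tendsto_0:
  fixes f :: "nat => 'a :: nonarch_field"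
  assumes "f sums s"
  shows "f \<longlonglongrightarrow> 0"
proof -
  have 1: "(\<lambda>n. \<Sum>i<n. f i) \<longlonglongrightarrow> s" using assms by (simp add: sums_def)
  have "(\<lambda>n. (\<Sum>i<Suc n. f i) - (\<Sum>i<n. f i)) \<longlonglongrightarrow> s - s" by (intro tendsto_diff LIMSEQ_Suc 1)
  then show ?thesis by simp
qed

lemma na_sums_mult:
  fixes f :: "nat => 'a :: nonarch_field"
  shows "f sums s ==> (\<lambda>n. c * f n) sums (c * s)"
  by (auto simp: sums_def simp flip: sum_distrib_left intro: tendsto_mult)

lemma na_sums_shift:
  fixes f :: "nat => 'a :: nonarch_field"
  assumes "(\<lambda>n. f (n + k)) sums s" "\<And>i. i < k ==> f i = 0"
  shows "f sums s"
proof -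
  have "(\<Sum>i<n + k. f i) = (\<Sum>i<n. f (i + k))" for n
    by (induction n) (use assms(2) in auto)
  then have "(\<lambda>n. \<Sum>i<n + k. f i) \<longlonglongrightarrow> s" using assms(1) by (simp add: sums_def)
  then show ?thesis unfolding sums_def by (rule LIMSEQ_offset)
qed

lemma na_sums_sum:
  fixes f :: "'i => nat => 'a :: nonarch_field"
  shows "(\<And>i. i \<in> A ==> f i sums s i) ==> (\<lambda>n. \<Sum>i\<in>A. f i n) sums (\<Sum>i\<in>A. s i)"
  by (induction A rule: infinite_finite_induct) (auto intro: sums_add)

lemma na_sums_diff:
  fixes f g :: "nat => 'a :: nonarch_field"
  shows "f sums s ==> g sums t ==> (\<lambda>n. f n - g n) sums (s - t)"
  by (auto simp: sums_def sum_subtractf intro: tendsto_diff)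

lemma na_eqI:
  fixes x y :: "'a :: nonarch_field"
  assumes "\<And>e. e > 0 ==> absv (x - y) \<le> e"
  shows "x = y"
proof -
  have "absv (x - y) \<le> 0" using assms by (rule field_le_epsilon[of _ 0, simplified])
  then show ?thesis using absv_nonneg[of "x - y"] by (simp add: order_antisym)
qed

text \<open>Convergence to 0 along the cofinite filter on pairs, which for ultrametric series plays
  the role of absolute summability.\<close>

definition doubly_null :: "(nat => nat => 'a :: nonarch_field) => bool" where
  "doubly_null f \<longleftrightarrow> (\<forall>e>0. \<exists>N. \<forall>m n. m \<ge> N \<or> n \<ge> N \<longrightarrow> absv (f m n) < e)"

lemma doubly_null_flip: "doubly_null f ==> doubly_null (\<lambda>m n. f n m)"
  by (auto simp: doubly_null_def) metis

text \<open>Outside a large square all terms are small, so both iterated sums are within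
  \<open>e\<close> of the finite sum over that square.\<close>

lemma na_fubini:
  fixes f :: "nat => nat => 'a :: {nonarch_field, complete_space}"
  assumes f: "doubly_null f" and g: "\<And>m. f m sums g m" and h: "\<And>n. (\<lambda>m. f m n) sums h n"
  shows "\<exists>s. g sums s \<and> h sums s"
proof -
  have null: "g \<longlonglongrightarrow> 0" if f: "doubly_null f" and g: "\<And>m. f m sums g m"
    for f :: "nat => nat => 'a" and g
    unfolding na_tendsto_0_iff
  proof (intro allI impI)
    fix e :: real assume "e > 0"
    then obtain N where N: "\<And>m n. m \<ge> N ==> absv (f m n) < e / 2"
      using f unfolding doubly_null_def by (meson half_gt_zero)
    have "absv (g m) < e" if "m \<ge> N" for m
    proof -
      have "absv (g m) \<le> e / 2"
        using N[OF that] \<open>e > 0\<close> by (intro na_sums_bound[OF g]) (auto intro: less_imp_le)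
      then show ?thesis using \<open>e > 0\<close> by simp
    qed
    then show "\<exists>N. \<forall>n\<ge>N. absv (g n) < e" by blast
  qed
  obtain s where s: "g sums s" using na_summable[OF null[OF f g]] by (auto simp: summable_def)
  obtain t where t: "h sums t"
    using na_summable[OF null[OF doubly_null_flip[OF f], of h]] h by (auto simp: summable_def)
  have approx: "absv (s - (\<Sum>m<N. \<Sum>n<N. f m n)) \<le> e"
    if s: "g sums s" and g: "\<And>m. f m sums g m" and N: "\<And>m n. m \<ge> N \<or> n \<ge> N ==> absv (f m n) < e" and e: "e > 0"
    for f :: "nat => nat => 'a" and g s N e
  proof (rule absv_triangle_le)
    show "absv (s - (\<Sum>m<N. g m)) \<le> e"
    proof (rule na_sums_le[OF s])
      show "absv (g m) \<le> e" if "m \<ge> N" for m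
        using N that e by (intro na_sums_bound[OF g]) (auto intro: less_imp_le)
    qed (use e in simp)
    have "absv (g m - (\<Sum>n<N. f m n)) \<le> e" for m
      using N e by (intro na_sums_le[OF g]) (auto intro: less_imp_le)
    then show "absv ((\<Sum>m<N. g m) - (\<Sum>m<N. \<Sum>n<N. f m n)) \<le> e"
      using e by (auto simp flip: sum_subtractf intro: absv_sum_le)
  qed
  have "s = t"
  proof (rule na_eqI)
    fix e :: real assume e: "e > 0"
    then obtain N where N: "\<And>m n. m \<ge> N \<or> n \<ge> N ==> absv (f m n) < e"
      using f unfolding doubly_null_def by blast
    have "absv (s - (\<Sum>m<N. \<Sum>n<N. f m n)) \<le> e" by (rule approx[OF s g N e]) auto
    moreover have "absv (t - (\<Sum>n<N. \<Sum>m<N. f m n)) \<le> e" by (rule approx[OF t h _ e]) (use N in auto)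
    moreover have "(\<Sum>n<N. \<Sum>m<N. f m n) = (\<Sum>m<N. \<Sum>n<N. f m n)" by (rule sum.swap)
    ultimately show "absv (s - t) \<le> e"
      using absv_diff_le[of "s - (\<Sum>m<N. \<Sum>n<N. f m n)" e "t - (\<Sum>m<N. \<Sum>n<N. f m n)"] by simp
  qed
  then show ?thesis using s t by blast
qed

lemma na_null_product:
  fixes a b :: "nat => 'a :: nonarch_field"
  assumes "a \<longlonglongrightarrow> 0" "b \<longlonglongrightarrow> 0"
  shows "doubly_null (\<lambda>i j. a i * b j)"
  unfolding doubly_null_def
proof (intro allI impI)
  fix e :: real assume e: "e > 0"
  obtain A where A: "A > 0" "\<And>i. absv (a i) \<le> A" using na_tendsto_0_bounded[OF assms(1)] by blast
  obtain B where B: "B > 0" "\<And>i. absv (b i) \<le> B" using na_tendsto_0_bounded[OF assms(2)] by blast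
  obtain N1 where N1: "\<And>i. i \<ge> N1 ==> absv (a i) < e / B"
    using assms(1) e B(1) unfolding na_tendsto_0_iff by (meson divide_pos_pos)
  obtain N2 where N2: "\<And>i. i \<ge> N2 ==> absv (b i) < e / A"
    using assms(2) e A(1) unfolding na_tendsto_0_iff by (meson divide_pos_pos)
  have "absv (a i * b j) < e" if "i \<ge> N1 + N2 \<or> j \<ge> N1 + N2" for i j
  proof (cases "i \<ge> N1 + N2")
    case True
    then have "absv (a i) * absv (b j) \<le> absv (a i) * B" using B by (intro mult_left_mono) auto
    also have "\<dots> < e" using N1[of i] True B by (simp add: pos_less_divide_eq)
    finally show ?thesis by (simp add: absv_mult)
  next
    case False
    then have "absv (a i) * absv (b j) \<le> A * absv (b j)" using A by (intro mult_right_mono) auto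
    also have "\<dots> < e" using N2[of j] that False A by (simp add: pos_less_divide_eq mult.commute)
    finally show ?thesis by (simp add: absv_mult)
  qed
  then show "\<exists>N. \<forall>m n. N \<le> m \<or> N \<le> n \<longrightarrow> absv (a m * b n) < e" by blast
qed

text \<open>Reindexes pairs by first entry and sum, for Cauchy products. If the first entry or the
  sum is at least \<open>N + N\<close>, one of the two original entries is at least
  \<open>N\<close>.\<close>

lemma doubly_null_shear:
  assumes "doubly_null f"
  shows "doubly_null (\<lambda>i n. if i \<le> n then f i (n - i) else 0)"
  unfolding doubly_null_def
proof (intro allI impI)
  fix e :: real assume e: "e > 0"
  then obtain N where N: "\<And>m n. m \<ge> N \<or> n \<ge> N ==> absv (f m n) < e"
    using assms unfolding doubly_null_def by blast
  have "absv (if i \<le> n then f i (n - i) else 0) < e" if "i \<ge> N + N \<or> n \<ge> N + N" for i n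
    using N[of i "n - i"] that e by (cases "i \<ge> N") auto
  then show "\<exists>N. \<forall>m n. N \<le> m \<or> N \<le> n \<longrightarrow> absv (if m \<le> n then f m (n - m) else 0) < e" by blast
qed

lemma na_cauchy_product:
  fixes a b :: "nat => 'a :: {nonarch_field, complete_space}"
  assumes a: "a sums A" and b: "b sums B"
  shows "(\<lambda>n. \<Sum>i\<le>n. a i * b (n - i)) sums (A * B)"
proof -
  let ?f = "\<lambda>i n. if i \<le> n then a i * b (n - i) else 0"
  have "doubly_null ?f"
    using doubly_null_shear[OF na_null_product[OF na_sums_tendsto_0[OF a] na_sums_tendsto_0[OF b]]] .
  moreover have "?f i sums (a i * B)" for i
  proof -
    have "(\<lambda>n. ?f i (n + i)) sums (a i * B)" using na_sums_mult[OF b, of "a i"] by simp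
    then show ?thesis by (rule na_sums_shift) auto
  qed
  moreover have "(\<lambda>i. ?f i n) sums (\<Sum>i\<le>n. a i * b (n - i))" for n
    using sums_finite[of "{..n}" "\<lambda>i. ?f i n"] by simp
  ultimately obtain s where s: "(\<lambda>i. a i * B) sums s" "(\<lambda>n. \<Sum>i\<le>n. a i * b (n - i)) sums s"
    using na_fubini[of ?f "\<lambda>i. a i * B" "\<lambda>n. \<Sum>i\<le>n. a i * b (n - i)"] by blast
  have "(\<lambda>i. a i * B) sums (A * B)" using na_sums_mult[OF a, of B] by (simp add: mult.commute)
  then show ?thesis using s sums_unique2 by blast
qed

text \<open>At \<open>x ^ j\<close> the lowest remaining term has to be balanced by the tail, which
  is smaller by a factor \<open>absv x ^ j\<close>; letting \<open>j\<close> grow kills the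
  coefficient.\<close>

lemma null_power_series_zero:
  fixes a :: "nat => 'a :: nonarch_field" and x :: 'a
  assumes a: "\<And>n. absv (a n) \<le> C" and x: "x \<noteq> 0" "absv x < 1"
    and s: "\<And>j. (\<lambda>n. a n * (x ^ j) ^ n) sums 0"
  shows "a n = 0"
proof (induction n rule: less_induct)
  case (less n)
  have C: "C \<ge> 0" using a[of 0] absv_nonneg[of "a 0"] by linarith
  have x0: "absv x > 0" using x(1) by (simp add: order_less_le)
  have "absv (a n) \<le> C * absv x ^ j" for j
  proof -
    let ?y = "x ^ j"
    have y: "absv ?y \<le> 1" "?y \<noteq> 0" using x by (auto simp: power_le_one)
    have "absv (0 - (\<Sum>i<Suc n. a i * ?y ^ i)) \<le> C * absv ?y ^ Suc n"
    proof (rule na_sums_le[OF s])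
      fix i assume i: "i \<ge> Suc n"
      have "absv ?y ^ i \<le> absv ?y ^ Suc n" using i y(1) by (intro power_decreasing) auto
      then show "absv (a i * ?y ^ i) \<le> C * absv ?y ^ Suc n"
        unfolding absv_mult absv_power[of ?y] using a[of i] C by (intro mult_mono) auto
    qed (use C in auto)
    moreover have "(\<Sum>i<Suc n. a i * ?y ^ i) = a n * ?y ^ n" using less by simp
    ultimately have "absv (a n) * absv ?y ^ n \<le> (C * absv ?y) * absv ?y ^ n"
      by (simp add: absv_mult mult_ac)
    then show ?thesis using x0 by (simp add: mult_le_cancel_right)
  qed
  then show ?case using x(2) by (rule absv_eq_0I) auto
qed

section \<open>The ring of p-adic integers\<close>

lemma Zp_approx: "z \<in> (Zp :: 'c :: nonarch_field set) \<longleftrightarrow> (\<forall>e>0. \<exists>n::int. absv (z - of_int n) < e)"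
  unfolding Zp_def closure_approachable by (auto simp: dist_absv absv_minus_commute)

lemma Zp_of_int [simp, intro]: "of_int n \<in> (Zp :: 'c :: nonarch_field set)"
  unfolding Zp_def by (rule subsetD[OF closure_subset]) auto

lemma Zp_of_nat [simp, intro]: "of_nat n \<in> (Zp :: 'c :: nonarch_field set)"
  using Zp_of_int[of "int n"] by simp

lemma Zp_0 [simp, intro]: "0 \<in> (Zp :: 'c :: nonarch_field set)" and Zp_1 [simp, intro]: "1 \<in> (Zp :: 'c :: nonarch_field set)"
  using Zp_of_int[of 0] Zp_of_int[of 1] by simp_all

lemma Zp_absv_le: "z \<in> Zp ==> absv (z :: 'c :: nonarch_field) \<le> 1"
proof -
  assume "z \<in> Zp"
  then obtain n :: int where "absv (z - of_int n) < 1" unfolding Zp_approx by (meson zero_less_one)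
  then have "absv ((z - of_int n) + of_int n) \<le> 1" by (intro absv_add_le) auto
  then show ?thesis by simp
qed

lemma Zp_add [intro]: "x \<in> Zp ==> y \<in> Zp ==> x + y \<in> (Zp :: 'c :: nonarch_field set)"
  unfolding Zp_approx
proof (intro allI impI)
  fix e :: real assume "\<forall>e>0. \<exists>n. absv (x - of_int n) < e" "\<forall>e>0. \<exists>n. absv (y - of_int n) < e" "e > 0"
  then obtain m n :: int where "absv (x - of_int m) < e" "absv (y - of_int n) < e" by blast
  then have "absv (x + y - of_int (m + n)) < e"
    using absv_add_less[of "x - of_int m" e "y - of_int n"] by (simp add: algebra_simps)
  then show "\<exists>n. absv (x + y - of_int n) < e" by blast
qed

lemma Zp_mult [intro]: "x \<in> Zp ==> y \<in> Zp ==> x * y \<in> (Zp :: 'c :: nonarch_field set)"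
proof -
  assume xy: "x \<in> Zp" "y \<in> Zp"
  show ?thesis unfolding Zp_approx
  proof (intro allI impI)
    fix e :: real assume e: "e > 0"
    obtain m n :: int where mn: "absv (x - of_int m) < e" "absv (y - of_int n) < e"
      using xy e unfolding Zp_approx by blast
    have "absv ((x - of_int m) * y) < e" "absv (of_int m * (y - of_int n)) < e"
      unfolding absv_mult using mn Zp_absv_le[OF xy(2)] absv_of_int_le_1[of m, where 'a = 'c]
      by (metis absv_nonneg mult_left_le order_le_less_trans, metis absv_nonneg mult_left_le mult.commute order_le_less_trans)
    from absv_add_less[OF this] have "absv (x * y - of_int (m * n)) < e" by (simp add: algebra_simps)
    then show "\<exists>n. absv (x * y - of_int n) < e" by blast
  qed
qed

lemma Zp_minus [intro]: "x \<in> Zp ==> - x \<in> (Zp :: 'c :: nonarch_field set)"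
  using Zp_mult[of "- 1" x] Zp_of_int[of "- 1"] by simp

lemma Zp_diff [intro]: "x \<in> Zp ==> y \<in> Zp ==> x - y \<in> (Zp :: 'c :: nonarch_field set)"
  using Zp_add[of x "- y"] by auto

lemma Zp_power [intro]: "x \<in> Zp ==> x ^ n \<in> (Zp :: 'c :: nonarch_field set)"
  by (induction n) auto

lemma closed_Zp: "closed (Zp :: 'c :: nonarch_field set)"
  unfolding Zp_def by simp

lemma Zpx_mult [intro]: "x \<in> Zpx ==> y \<in> Zpx ==> x * y \<in> (Zpx :: 'c :: nonarch_field set)"
  by (auto simp: Zpx_def absv_mult)

lemma Zpx_power [intro]: "x \<in> Zpx ==> x ^ n \<in> (Zpx :: 'c :: nonarch_field set)"
  by (auto simp: Zpx_def)

lemma Zpx_1 [simp, intro]: "1 \<in> (Zpx :: 'c :: nonarch_field set)"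
  by (auto simp: Zpx_def)

lemma Zpx_nz: "x \<in> Zpx ==> x \<noteq> (0 :: 'c :: nonarch_field)"
  by (auto simp: Zpx_def)

context dv_field
begin

lemma p_gt_1: "p > 1"
  using prime_gt_1_nat[OF prime_p] .

lemma p_nz [simp]: "(of_nat p :: 'c) \<noteq> 0"
  using p_gt_1 by simp

lemma absv_int_less_iff: "absv (of_int n :: 'c) < 1 \<longleftrightarrow> int p dvd n"
proof
  assume "int p dvd n"
  then obtain m where "n = int p * m" by blast
  then have "absv (of_int n :: 'c) = 1 / real p * absv (of_int m :: 'c)" by (simp add: absv_mult absv_p)
  also have "\<dots> \<le> 1 / real p * 1" by (intro mult_left_mono) auto
  also have "\<dots> < 1" using p_gt_1 by simp
  finally show "absv (of_int n :: 'c) < 1" .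
next
  assume l: "absv (of_int n :: 'c) < 1"
  show "int p dvd n"
  proof (rule ccontr)
    assume "\<not> int p dvd n"
    then have "coprime (int p) n" using prime_p by (simp add: prime_imp_coprime)
    then obtain u v where "u * int p + v * n = 1" using bezout_int[of "int p" n] by auto
    then have uv: "(of_int u * of_nat p + of_int v * of_int n :: 'c) = 1"
      by (metis of_int_1 of_int_add of_int_mult of_int_of_nat_eq)
    have "absv (of_nat p :: 'c) < 1" using p_gt_1 by (simp add: absv_p)
    then have "absv (of_int u * of_nat p :: 'c) < 1" "absv (of_int v * of_int n :: 'c) < 1"
      unfolding absv_mult using l
      by (metis absv_nonneg absv_of_int_le_1 mult.commute mult_left_le order_le_less_trans)+
    from absv_add_less[OF this] show False by (simp add: uv)
  qed
qed

lemma absv_int_eq_1_iff: "absv (of_int n :: 'c) = 1 \<longleftrightarrow> \<not> int p dvd n"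
  using absv_int_less_iff[of n] absv_of_int_le_1[of n, where 'a = 'c] by linarith

lemma absv_nat_eq_1_iff: "absv (of_nat n :: 'c) = 1 \<longleftrightarrow> \<not> p dvd n"
  using absv_int_eq_1_iff[of "int n"] by simp

lemma absv_int_le_iff: "absv (of_int n :: 'c) \<le> (1 / real p) ^ k \<longleftrightarrow> int p ^ k dvd n"
proof (induction k arbitrary: n)
  case (Suc k)
  show ?case
  proof
    assume l: "absv (of_int n :: 'c) \<le> (1 / real p) ^ Suc k"
    have "(1 / real p) ^ Suc k \<le> 1 / real p" using p_gt_1 power_decreasing[of 1 "Suc k" "1 / real p"] by simp
    also have "\<dots> < 1" using p_gt_1 by simp
    finally have "absv (of_int n :: 'c) < 1" using l by linarith
    then obtain m where m: "n = int p * m" unfolding absv_int_less_iff by blast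
    have "1 / real p * absv (of_int m :: 'c) \<le> 1 / real p * (1 / real p) ^ k" using l m by (simp add: absv_mult absv_p)
    then have "absv (of_int m :: 'c) \<le> (1 / real p) ^ k" using p_gt_1 by (simp add: divide_le_cancel)
    then show "int p ^ Suc k dvd n" using Suc.IH[of m] m by simp
  next
    assume "int p ^ Suc k dvd n"
    then obtain m where "n = int p ^ Suc k * m" by blast
    then have "absv (of_int n :: 'c) = (1 / real p) ^ Suc k * absv (of_int m :: 'c)"
      by (simp add: absv_mult absv_p power_mult_distrib)
    also have "\<dots> \<le> (1 / real p) ^ Suc k * 1" by (intro mult_left_mono) auto
    finally show "absv (of_int n :: 'c) \<le> (1 / real p) ^ Suc k" by simp
  qed
qed simp

lemma inv_p_power_small: "e > 0 ==> \<exists>k. (1 / real p) ^ k < e"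
  using p_gt_1 by (intro real_arch_pow_inv) auto

lemma Zp_approx_pow: "z \<in> Zp ==> \<exists>n::int. absv (z - of_int n :: 'c) \<le> (1 / real p) ^ k"
proof -
  assume "z \<in> Zp"
  moreover have "(1 / real p) ^ k > 0" using p_gt_1 by simp
  ultimately obtain n :: int where "absv (z - of_int n) < (1 / real p) ^ k" unfolding Zp_approx by blast
  then show ?thesis by (intro exI[of _ n]) simp
qed

lemma Zp_subset_K: "(Zp :: 'c set) \<subseteq> K"
  unfolding Zp_def by (rule closure_minimal[OF _ closed_K]) auto

lemma Zp_Opow: "z \<in> (Zp :: 'c set) ==> z \<in> Opow 0"
  using Zp_subset_K Zp_absv_le by (auto simp: Opow_0)

text \<open>An integer close to \<open>x\<close> is prime to \<open>p\<close>, and its inverse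
  modulo \<open>p ^ k\<close>, given by Bezout, approximates the inverse of
  \<open>x\<close>.\<close>

lemma Zpx_inverse: "x \<in> Zpx ==> inverse x \<in> (Zpx :: 'c set)"
proof -
  assume x: "x \<in> Zpx"
  then have ax: "absv x = 1" "x \<in> Zp" by (auto simp: Zpx_def)
  have "inverse x \<in> Zp" unfolding Zp_approx
  proof (intro allI impI)
    fix e :: real assume "e > 0"
    then obtain k where k: "(1 / real p) ^ k < min e 1" using inv_p_power_small[of "min e 1"] by auto
    obtain n :: int where n: "absv (x - of_int n) \<le> (1 / real p) ^ k" using Zp_approx_pow[OF ax(2)] by blast
    have "absv (x + (of_int n - x)) = absv x"
      using n k ax by (intro absv_add_eq) (simp add: absv_minus_commute)
    then have "\<not> int p dvd n" using ax absv_int_eq_1_iff[of n] by simp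
    then have "coprime (int p) n" using prime_p by (simp add: prime_imp_coprime)
    then have "coprime n (int p ^ k)" by (simp add: coprime_commute)
    then obtain m v where "m * n + v * int p ^ k = 1" using bezout_int[of n "int p ^ k"] by auto
    then have "int p ^ k dvd 1 - m * n" by (metis add_diff_cancel_left' dvd_triv_right)
    then have mn: "absv (1 - of_int m * of_int n :: 'c) \<le> (1 / real p) ^ k"
      using absv_int_le_iff[of "1 - m * n" k] by simp
    have "absv (of_int m * (of_int n - x)) \<le> (1 / real p) ^ k"
      using n absv_mult_le_1[of "of_int n - x" _ "of_int m"] by (simp add: absv_minus_commute mult.commute)
    from absv_add_le[OF mn this] have "absv (1 - of_int m * x) \<le> (1 / real p) ^ k" by (simp add: algebra_simps)
    moreover have "inverse x - of_int m = inverse x * (1 - of_int m * x)" using Zpx_nz[OF x] by (simp add: field_simps)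
    ultimately have "absv (inverse x - of_int m) \<le> (1 / real p) ^ k" using ax by (simp add: absv_mult absv_inverse)
    then show "\<exists>n. absv (inverse x - of_int n) < e" using k by (intro exI[of _ m]) simp
  qed
  then show ?thesis using ax by (simp add: Zpx_def absv_inverse)
qed

lemma Zp_divide: "y \<in> Zp ==> x \<in> Zpx ==> y / x \<in> (Zp :: 'c set)"
  using Zpx_inverse[of x] by (auto simp: divide_inverse Zpx_def)

end

section \<open>Ring structure, ideal powers and the module A in terms of coordinates\<close>

section \<open>Coefficient rings\<close>

text \<open>
  Both coefficient rings are described by coordinates: \<open>\<O>\<^sub>K\<close> with index set \<open>{0}\<close>, and
  \<open>\<Lambda>\<^sub>U \<cong> \<O>\<^sub>K[[T]]\<close> with all of \<open>\<nat>\<close>. In both cases multiplication is the convolution product.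
\<close>

locale coeff_algebra = dv_field p K \<pi>
  for p :: nat and K :: "'c :: {nonarch_field, complete_space} set" and \<pi> :: 'c +
  fixes B :: "('b, 'c) coeff_ring" (structure) and cf :: "'b => nat => 'c" and S :: "nat set"
  assumes S: "S = {0} \<or> S = UNIV"
    and cf_bij: "bij_betw cf (carrier B) (S \<rightarrow>\<^sub>E Opow 0)"
    and add_closed [simp, intro]: "a \<in> carrier B ==> b \<in> carrier B ==> a \<oplus> b \<in> carrier B"
    and mult_closed [simp, intro]: "a \<in> carrier B ==> b \<in> carrier B ==> a \<otimes> b \<in> carrier B"
    and zero_closed' [simp, intro]: "\<zero> \<in> carrier B" and one_closed' [simp, intro]: "\<one> \<in> carrier B"
    and cf_add: "a \<in> carrier B ==> b \<in> carrier B ==> i \<in> S ==> cf (a \<oplus> b) i = cf a i + cf b i"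
    and cf_mult: "a \<in> carrier B ==> b \<in> carrier B ==> i \<in> S ==> cf (a \<otimes> b) i = (\<Sum>j\<le>i. cf a j * cf b (i - j))"
    and cf_zero: "i \<in> S ==> cf \<zero> i = 0"
    and cf_one: "i \<in> S ==> cf \<one> i = (if i = 0 then 1 else 0)"
    and emb_closed [simp, intro]: "u \<in> Opow 0 ==> emb B u \<in> carrier B"
    and cf_emb: "u \<in> Opow 0 ==> i \<in> S ==> cf (emb B u) i = (if i = 0 then u else 0)"
    and unif_eq: "unif B = emb B \<pi>"
    and wt_closed [intro]: "t \<in> Zpx ==> wt B t \<in> carrier B"
    and wt_mult: "s \<in> Zpx ==> t \<in> Zpx ==> wt B (s * t) = wt B s \<otimes> wt B t"
    and wt_one: "wt B 1 = \<one>"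
begin

lemma S_0 [simp, intro]: "0 \<in> S" and S_down: "i \<in> S ==> j \<le> i ==> j \<in> S"
  using S by auto

lemma cf_Opow [intro]: "b \<in> carrier B ==> i \<in> S ==> cf b i \<in> Opow 0"
  using cf_bij by (auto simp: bij_betw_def)

lemma cf_eqI: "a \<in> carrier B ==> b \<in> carrier B ==> (\<And>i. i \<in> S ==> cf a i = cf b i) ==> a = b"
proof -
  assume ab: "a \<in> carrier B" "b \<in> carrier B" "\<And>i. i \<in> S ==> cf a i = cf b i"
  have "cf a \<in> S \<rightarrow>\<^sub>E Opow 0" "cf b \<in> S \<rightarrow>\<^sub>E Opow 0" using cf_bij ab by (auto simp: bij_betw_def)
  then have "cf a = cf b" using ab by (intro PiE_ext) auto
  then show ?thesis using cf_bij ab by (auto simp: bij_betw_def inj_on_def)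
qed

definition el :: "(nat => 'c) => 'b" where
  "el g = inv_into (carrier B) cf (restrict g S)"

lemma el:
  assumes "\<And>i. i \<in> S ==> g i \<in> Opow 0"
  shows "el g \<in> carrier B" "i \<in> S ==> cf (el g) i = g i"
proof -
  have r: "restrict g S \<in> cf ` carrier B" using assms cf_bij by (auto simp: bij_betw_def)
  show "el g \<in> carrier B" unfolding el_def by (rule inv_into_into[OF r])
  show "cf (el g) i = g i" if "i \<in> S" using f_inv_into_f[OF r] that by (simp add: el_def)
qed

text \<open>Lets associativity and commutativity of the convolution be taken from formal power
  series.\<close>

lemma cf_mult_fps:
  assumes "a \<in> carrier B" "b \<in> carrier B" "i \<in> S"
  shows "cf (a \<otimes> b) i = fps_nth (Abs_fps (cf a) * Abs_fps (cf b)) i"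
  using assms by (simp add: cf_mult fps_mult_nth atLeast0AtMost)

lemma cring_B: "cring B"
proof (rule cringI)
  show "abelian_group B"
  proof (rule abelian_groupI)
    fix x assume x: "x \<in> carrier B"
    have e: "el (\<lambda>i. - cf x i) \<in> carrier B" "\<And>i. i \<in> S ==> cf (el (\<lambda>i. - cf x i)) i = - cf x i"
      using x by (auto intro!: el)
    then show "\<exists>y\<in>carrier B. y \<oplus> x = \<zero>"
      using x by (intro bexI[OF _ e(1)] cf_eqI) (auto simp: cf_add cf_zero)
  qed (auto intro!: cf_eqI simp: cf_add cf_zero)
  show "comm_monoid B"
  proof (rule comm_monoidI)
    fix x y assume xy: "x \<in> carrier B" "y \<in> carrier B"
    show "x \<otimes> y = y \<otimes> x"
      using xy by (intro cf_eqI) (auto simp: cf_mult_fps mult.commute)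
    show "\<one> \<otimes> x = x"
    proof (rule cf_eqI)
      fix i assume i: "i \<in> S"
      have "cf (\<one> \<otimes> x) i = (\<Sum>j\<le>i. cf \<one> j * cf x (i - j))"
        using i xy by (simp add: cf_mult)
      also have "\<dots> = (\<Sum>j\<le>i. (if j = 0 then cf x i else 0))"
        using S_down[OF i] by (intro sum.cong) (auto simp: cf_one)
      finally show "cf (\<one> \<otimes> x) i = cf x i" by simp
    qed (use xy in auto)
    fix z assume z: "z \<in> carrier B"
    show "x \<otimes> y \<otimes> z = x \<otimes> (y \<otimes> z)"
    proof (rule cf_eqI)
      fix i assume i: "i \<in> S"
      have "cf (x \<otimes> y \<otimes> z) i = (\<Sum>j\<le>i. fps_nth (Abs_fps (cf x) * Abs_fps (cf y)) j * cf z (i - j))"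
        using i xy z S_down[OF i] by (simp add: cf_mult[of "x \<otimes> y"]) (simp add: cf_mult_fps)
      also have "\<dots> = fps_nth (Abs_fps (cf x) * Abs_fps (cf y) * Abs_fps (cf z)) i"
        by (simp add: fps_mult_nth[of "Abs_fps (cf x) * Abs_fps (cf y)"] atLeast0AtMost)
      also have "\<dots> = fps_nth (Abs_fps (cf x) * (Abs_fps (cf y) * Abs_fps (cf z))) i"
        by (simp add: mult.assoc)
      also have "\<dots> = (\<Sum>j\<le>i. cf x j * fps_nth (Abs_fps (cf y) * Abs_fps (cf z)) (i - j))"
        by (simp add: fps_mult_nth[of "Abs_fps (cf x)"] atLeast0AtMost)
      also have "\<dots> = cf (x \<otimes> (y \<otimes> z)) i"
        using i xy z S_down[OF i] by (simp add: cf_mult[of x]) (simp add: cf_mult_fps)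
      finally show "cf (x \<otimes> y \<otimes> z) i = cf (x \<otimes> (y \<otimes> z)) i" .
    qed (use xy z in auto)
  qed auto
  fix x y z assume xyz: "x \<in> carrier B" "y \<in> carrier B" "z \<in> carrier B"
  show "(x \<oplus> y) \<otimes> z = x \<otimes> z \<oplus> y \<otimes> z"
    using xyz S_down by (intro cf_eqI) (auto simp: cf_mult cf_add algebra_simps sum.distrib)
qed

sublocale cring B by (rule cring_B)

lemma cf_minus: "a \<in> carrier B ==> i \<in> S ==> cf (\<ominus> a) i = - cf a i"
  using cf_add[of a "\<ominus> a" i] by (simp add: r_neg cf_zero add_eq_0_iff2)

lemma cf_diff: "a \<in> carrier B ==> b \<in> carrier B ==> i \<in> S ==> cf (a \<ominus> b) i = cf a i - cf b i"
  by (simp add: a_minus_def cf_add cf_minus)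

lemma cf_mult_emb: "a \<in> carrier B ==> u \<in> Opow 0 ==> i \<in> S ==> cf (a \<otimes> emb B u) i = u * cf a i"
proof -
  assume a: "a \<in> carrier B" "u \<in> Opow 0" "i \<in> S"
  have "cf (a \<otimes> emb B u) i = (\<Sum>j\<le>i. cf a j * cf (emb B u) (i - j))"
    using a by (simp add: cf_mult)
  also have "\<dots> = (\<Sum>j\<le>i. if j = i then u * cf a i else 0)"
    using a S_down[OF a(3)] by (intro sum.cong) (auto simp: cf_emb)
  finally show ?thesis by simp
qed

lemma cf_finsum: "(\<And>j. j \<in> A ==> u j \<in> carrier B) ==> finite A ==> i \<in> S ==> cf (finsum B u A) i = (\<Sum>j\<in>A. cf (u j) i)"
  by (induction A rule: infinite_finite_induct) (auto simp: cf_zero cf_add)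

lemma emb_mult: "u \<in> Opow 0 ==> v \<in> Opow 0 ==> emb B (u * v) = emb B u \<otimes> emb B v"
  by (intro cf_eqI) (auto simp: cf_mult_emb cf_emb Opow_mult_left)

lemma emb_one: "emb B 1 = \<one>"
  by (intro cf_eqI) (auto simp: cf_emb cf_one)

lemma emb_pow: "u \<in> Opow 0 ==> emb B u [^] (n::nat) = emb B (u ^ n)"
  by (induction n) (auto simp: emb_one emb_mult Opow_power m_comm)

text \<open>As for power series over a local ring: the inverse exists over the field, and its
  coefficients are integral by the recursion that divides only by the constant term.\<close>

lemma Units_iff: "a \<in> Units B \<longleftrightarrow> a \<in> carrier B \<and> absv (cf a 0) = 1"
proof
  assume "a \<in> Units B"
  then obtain b where ab: "a \<in> carrier B" "b \<in> carrier B" "a \<otimes> b = \<one>" by (auto simp: Units_def)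
  then have "cf a 0 * cf b 0 = 1" using cf_mult[of a b 0] by (simp add: cf_one)
  then have "absv (cf a 0) * absv (cf b 0) = 1" by (metis absv_mult absv_one)
  moreover have "absv (cf a 0) \<le> 1" "absv (cf b 0) \<le> 1" using ab cf_Opow[OF _ S_0] by (auto simp: Opow_0)
  ultimately have "absv (cf a 0) = 1"
    by (metis absv_nonneg mult_left_le mult_right_le_one_le order_antisym)
  then show "a \<in> carrier B \<and> absv (cf a 0) = 1" using ab by simp
next
  assume a: "a \<in> carrier B \<and> absv (cf a 0) = 1"
  define f where "f = Abs_fps (\<lambda>i. if i \<in> S then cf a i else 0)"
  have f: "fps_nth f i \<in> Opow 0" for i using a by (auto simp: f_def)
  have f0: "fps_nth f 0 \<noteq> 0" "absv (fps_nth f 0) = 1" using a by (auto simp: f_def)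
  have fi: "f * inverse f = 1" using inverse_mult_eq_1[OF f0(1)] by (simp only: mult.commute)
  have g: "fps_nth (inverse f) n \<in> Opow 0" for n
  proof (induction n rule: less_induct)
    case (less n)
    have u: "inverse (fps_nth f 0) \<in> Opow 0" using f[of 0] f0 by (auto simp: Opow_0 absv_inverse)
    show ?case
    proof (cases "n = 0")
      case True
      then show ?thesis using u by simp
    next
      case False
      have "0 = (\<Sum>i=0..n. fps_nth f i * fps_nth (inverse f) (n - i))"
        using arg_cong[OF fi, of "\<lambda>h. fps_nth h n"] False by (simp add: fps_mult_nth)
      also have "\<dots> = fps_nth f 0 * fps_nth (inverse f) n + (\<Sum>i=1..n. fps_nth f i * fps_nth (inverse f) (n - i))"
        by (simp add: sum.atLeast_Suc_atMost)
      finally have "fps_nth (inverse f) n = - (inverse (fps_nth f 0) * (\<Sum>i=1..n. fps_nth f i * fps_nth (inverse f) (n - i)))"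
        using f0 by (simp add: field_simps add_eq_0_iff)
      also have "\<dots> \<in> Opow 0" using u f less by (intro Opow_minus Opow_mult_left Opow_sum) auto
      finally show ?thesis .
    qed
  qed
  define b where "b = el (\<lambda>i. fps_nth (inverse f) i)"
  have b: "b \<in> carrier B" "\<And>i. i \<in> S ==> cf b i = fps_nth (inverse f) i" using g by (auto simp: b_def intro: el)
  have "a \<otimes> b = \<one>"
  proof (rule cf_eqI)
    fix i assume i: "i \<in> S"
    have "cf (a \<otimes> b) i = (\<Sum>j\<le>i. fps_nth f j * fps_nth (inverse f) (i - j))"
      using a b i S_down[OF i] by (simp add: cf_mult f_def)
    also have "\<dots> = fps_nth (f * inverse f) i" by (simp add: fps_mult_nth atLeast0AtMost)
    finally show "cf (a \<otimes> b) i = cf \<one> i" using fi i by (simp add: cf_one)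
  qed (use a b in auto)
  then show "a \<in> Units B" using a b m_comm[of a b] unfolding Units_def by auto
qed

lemma max_ideal_eq: "max_ideal B = {b \<in> carrier B. cf b 0 \<in> Opow 1}"
proof -
  have "absv (cf b 0) \<noteq> 1 \<longleftrightarrow> cf b 0 \<in> Opow 1" if "b \<in> carrier B" for b
  proof -
    have "cf b 0 \<in> Opow 0" using that by auto
    then show ?thesis using \<pi>_less \<pi>_max[of "cf b 0"] by (auto simp: Opow_def)
  qed
  then show ?thesis unfolding max_ideal_def using Units_iff by blast
qed

text \<open>The maximal ideal is generated by the uniformizer and the variable, so a monomial of
  degree \<open>i\<close> in the variable still needs \<open>n - i\<close> factors of the
  uniformizer. For O_K only \<open>i = 0\<close> occurs.\<close>

lemma max_ideal_pow_eq: "max_ideal_pow B n = {b \<in> carrier B. \<forall>i\<in>S. cf b i \<in> Opow (n - i)}"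
proof (induction n)
  case 0
  then show ?case by auto
next
  case (Suc n)
  let ?J = "\<lambda>n. {b \<in> carrier B. \<forall>i\<in>S. cf b i \<in> Opow (n - i)}"
  have 1: "b \<in> ?J (Suc n)" if "b \<in> ideal_prod B (max_ideal B) (?J n)" for b
    using that
  proof (induction rule: ideal_prod.induct)
    case (prod a b)
    have ab: "a \<in> carrier B" "b \<in> carrier B" "cf a 0 \<in> Opow 1" "\<And>i. i \<in> S ==> cf b i \<in> Opow (n - i)"
      using prod by (auto simp: max_ideal_eq)
    \<comment> \<open>The gain over \<open>n - k\<close> comes from the constant term of
      \<open>a\<close> if \<open>l = 0\<close>, and from the lower index of \<open>b\<close>
      otherwise.\<close>
    have "cf a l * cf b (k - l) \<in> Opow (Suc n - k)" if "k \<in> S" "l \<le> k" for k l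
    proof (cases "l = 0")
      case True
      then show ?thesis using Opow_mult[OF ab(3) ab(4)[OF that(1)]] by (auto intro: Opow_antimonoD)
    next
      case False
      have "cf b (k - l) \<in> Opow (n - (k - l))" using ab(4) S_down[OF that(1)] by simp
      then have "cf b (k - l) \<in> Opow (Suc n - k)" using False that by (auto intro: Opow_antimonoD)
      then show ?thesis using ab(1) S_down[OF that] by blast
    qed
    then show ?case using ab by (auto simp: cf_mult)
  next
    case (sum a b)
    then show ?case by (auto simp: cf_add)
  qed
  have 2: "b \<in> ideal_prod B (max_ideal B) (?J n)" if b: "b \<in> ?J (Suc n)" for b
  proof -
    have "cf b 0 \<in> Opow (Suc n - 0)" using b S_0 by blast
    then have b0: "cf b 0 \<in> Opow (Suc n)" by simp
    have b0': "cf b 0 / \<pi> \<in> Opow n"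
      using b0 \<pi>_pos by (auto simp: Opow_def absv_divide field_simps)
    define g where "g = emb B (cf b 0 / \<pi>)"
    have bO: "cf b 0 / \<pi> \<in> Opow 0" using b0' by (auto intro: Opow_antimonoD)
    have g: "g \<in> ?J n" using b0' bO by (auto simp: g_def cf_emb)
    have \<pi>O: "\<pi> \<in> Opow 1" "\<pi> \<in> Opow 0" using \<pi>_power_Opow[of 1] by (auto intro: Opow_antimonoD)
    \<comment> \<open>\<open>t\<close> is the variable, and \<open>h\<close> is \<open>b\<close>
      without its constant term, divided by the variable; for \<open>S = {0}\<close> both are
      zero.\<close>
    define t where "t = el (\<lambda>i. if i = 1 then 1 else 0)"
    have t: "t \<in> carrier B" "\<And>i. i \<in> S ==> cf t i = (if i = 1 then 1 else 0)" unfolding t_def by (rule el; simp)+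
    define h where "h = el (\<lambda>i. if Suc i \<in> S then cf b (Suc i) else 0)"
    have h: "h \<in> carrier B" "\<And>i. i \<in> S ==> cf h i = (if Suc i \<in> S then cf b (Suc i) else 0)"
      unfolding h_def by (rule el; use b in auto)+
    have hJ: "h \<in> ?J n" using h b by force
    have eq: "b = emb B \<pi> \<otimes> g \<oplus> t \<otimes> h"
    proof (rule cf_eqI)
      fix i assume i: "i \<in> S"
      have "cf (t \<otimes> h) i = (if i = 0 then 0 else cf b i)"
      proof (cases "i = 0")
        case True
        then show ?thesis using t h by (simp add: cf_mult)
      next
        case False
        have "cf (t \<otimes> h) i = (\<Sum>j\<le>i. cf t j * cf h (i - j))" using t(1) h(1) i by (simp add: cf_mult)
        also have "\<dots> = (\<Sum>j\<le>i. if j = 1 then cf h (i - 1) else 0)"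
          using t(2) S_down[OF i] by (intro sum.cong) auto
        also have "\<dots> = cf h (i - 1)" using False by simp
        also have "\<dots> = cf b i" using h(2)[of "i - 1"] False i S_down[OF i, of "i - 1"] by simp
        finally show ?thesis using False by simp
      qed
      moreover have "cf (emb B \<pi> \<otimes> g) i = (if i = 0 then cf b 0 else 0)"
        using i \<pi>O bO by (simp add: g_def cf_mult_emb cf_emb emb_closed)
      ultimately show "cf b i = cf (emb B \<pi> \<otimes> g \<oplus> t \<otimes> h) i"
        using i t h g \<pi>O by (auto simp: cf_add emb_closed)
    qed (use b t h g \<pi>O in auto)
    have m: "emb B \<pi> \<in> max_ideal B" "t \<in> max_ideal B" using t \<pi>O by (auto simp: max_ideal_eq cf_emb)
    show ?thesis
      by (subst eq, rule ideal_prod.sum[OF ideal_prod.prod[OF m(1) g] ideal_prod.prod[OF m(2) hJ]])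
  qed
  show ?case
    unfolding max_ideal_pow.simps Suc.IH by (rule equalityI; rule subsetI; erule 1 2)
qed

lemma unif_pow_eq: "unif_pow B n = {b \<in> carrier B. \<forall>i\<in>S. cf b i \<in> Opow n}"
proof -
  have \<pi>O: "\<pi> \<in> Opow 0" "\<pi> ^ n \<in> Opow 0" using \<pi>_power_Opow[of 1] by (auto intro: Opow_antimonoD)
  have eq: "unif_pow B n = {b. \<exists>x. b = x \<otimes> emb B (\<pi> ^ n) \<and> x \<in> carrier B}"
    using \<pi>O by (auto simp: unif_pow_def cgenideal_def unif_eq emb_pow)
  show ?thesis
    unfolding eq
  proof (intro equalityI subsetI; clarify)
    fix x assume "x \<in> carrier B"
    then show "x \<otimes> emb B (\<pi> ^ n) \<in> carrier B \<and> (\<forall>i\<in>S. cf (x \<otimes> emb B (\<pi> ^ n)) i \<in> Opow n)"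
      using \<pi>O by (auto simp: cf_mult_emb)
  next
    fix b assume b: "b \<in> carrier B" "\<forall>i\<in>S. cf b i \<in> Opow n"
    have "cf b i / \<pi> ^ n \<in> Opow 0" if "i \<in> S" for i
      using b that \<pi>_pos by (auto simp: Opow_def absv_divide)
    then have e: "el (\<lambda>i. cf b i / \<pi> ^ n) \<in> carrier B" "\<And>i. i \<in> S ==> cf (el (\<lambda>i. cf b i / \<pi> ^ n)) i = cf b i / \<pi> ^ n"
      using el[of "\<lambda>i. cf b i / \<pi> ^ n"] by auto
    have "b = el (\<lambda>i. cf b i / \<pi> ^ n) \<otimes> emb B (\<pi> ^ n)"
      using b e \<pi>O by (intro cf_eqI) (auto simp: cf_mult_emb)
    then show "\<exists>x. b = x \<otimes> emb B (\<pi> ^ n) \<and> x \<in> carrier B" using e by blast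
  qed
qed

lemma unif_pow_mult: "a \<in> unif_pow B n ==> b \<in> carrier B ==> a \<otimes> b \<in> unif_pow B n"
proof -
  assume a: "a \<in> unif_pow B n" and b: "b \<in> carrier B"
  have "cf a j * cf b (i - j) \<in> Opow n" if "i \<in> S" "j \<le> i" for i j
    using a b S_down[OF that(1)] that by (intro Opow_mult_right) (auto simp: unif_pow_eq)
  then show ?thesis using a b by (auto simp: unif_pow_eq cf_mult)
qed

lemma max_ideal_pow_mult: "a \<in> max_ideal_pow B n ==> b \<in> carrier B ==> a \<otimes> b \<in> max_ideal_pow B n"
proof -
  assume a: "a \<in> max_ideal_pow B n" and b: "b \<in> carrier B"
  have "cf a j * cf b (i - j) \<in> Opow (n - i)" if "i \<in> S" "j \<le> i" for i j
  proof -
    have "cf a j \<in> Opow (n - j)" "cf b (i - j) \<in> Opow 0" using a b S_down[OF that(1)] that by (auto simp: max_ideal_pow_eq)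
    then have "cf a j * cf b (i - j) \<in> Opow (n - j)" by blast
    then show ?thesis using that by (auto intro: Opow_antimonoD)
  qed
  then show ?thesis using a b by (auto simp: max_ideal_pow_eq cf_mult)
qed

lemma ord_tends_iff: "range a \<subseteq> carrier B ==>
    ord_tends_to_infinity B a \<longleftrightarrow> (\<forall>M. \<exists>n0. \<forall>n\<ge>n0. \<forall>i\<in>S. cf (a n) i \<in> Opow M)"
  by (simp add: ord_tends_to_infinity_def unif_pow_eq range_subsetD)

lemma Opow_tendsto_0: "(\<And>M. \<exists>n0. \<forall>n\<ge>n0. f n \<in> Opow M) ==> f \<longlonglongrightarrow> 0"
  unfolding na_tendsto_0_iff
proof (intro allI impI)
  fix e :: real assume f: "\<And>M. \<exists>n0. \<forall>n\<ge>n0. f n \<in> Opow M" and e: "e > 0"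
  obtain M where M: "absv \<pi> ^ M < e" using \<pi>_less e real_arch_pow_inv by blast
  obtain n0 where "\<forall>n\<ge>n0. f n \<in> Opow M" using f by blast
  then show "\<exists>N. \<forall>n\<ge>N. absv (f n) < e" using M by (intro exI[of _ n0]) (auto simp: Opow_def)
qed

lemma sums_tail_Opow:
  assumes "f sums s" "\<And>n. n \<ge> N ==> f n \<in> Opow M" "s \<in> K" "\<And>n. f n \<in> K"
  shows "s - (\<Sum>i<N. f i) \<in> Opow M"
proof -
  have "absv (s - (\<Sum>i<N. f i)) \<le> absv \<pi> ^ M"
    using assms by (intro na_sums_le) (auto simp: Opow_def)
  then show ?thesis using assms by (auto simp: Opow_def)
qed

lemma suminf_Opow:
  assumes "f \<longlonglongrightarrow> 0" "\<And>n. f n \<in> Opow M"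
  shows "f sums suminf f" "suminf f \<in> Opow M"
proof -
  show s: "f sums suminf f" using na_summable[OF assms(1)] by blast
  show "suminf f \<in> Opow M"
  proof (rule Lim_in_closed_set[OF closed_Opow])
    show "(\<lambda>n. \<Sum>i<n. f i) \<longlonglongrightarrow> suminf f" using s by (simp add: sums_def)
    show "\<forall>\<^sub>F n in sequentially. (\<Sum>i<n. f i) \<in> Opow M"
      by (intro always_eventually allI Opow_sum assms(2))
  qed simp
qed

lemma sums_Opow: "f sums s ==> (\<And>n. f n \<in> Opow M) ==> s \<in> Opow M"
  using suminf_Opow[of f M] na_sums_tendsto_0[of f s] sums_unique by metis

lemma unif_sums_iff:
  assumes "range u \<subseteq> carrier B" "s \<in> carrier B"
  shows "unif_sums B u s \<longleftrightarrow> (\<forall>M. \<exists>n0. \<forall>n\<ge>n0. \<forall>i\<in>S. cf s i - (\<Sum>j<n. cf (u j) i) \<in> Opow M)"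
proof -
  have u: "u j \<in> carrier B" for j using assms by auto
  then have "finsum B u {..<n} \<in> carrier B" for n by (intro finsum_closed) auto
  then show ?thesis using assms(2) u by (simp add: unif_sums_def unif_pow_eq cf_diff cf_finsum)
qed

lemma unif_sums_sums:
  assumes "range u \<subseteq> carrier B" "s \<in> carrier B" "unif_sums B u s" "i \<in> S"
  shows "(\<lambda>j. cf (u j) i) sums cf s i"
proof -
  have "\<exists>n0. \<forall>n\<ge>n0. cf s i - (\<Sum>j<n. cf (u j) i) \<in> Opow M" for M
    using assms(3,4) unfolding unif_sums_iff[OF assms(1,2)] by blast
  then have "(\<lambda>n. cf s i - (\<Sum>j<n. cf (u j) i)) \<longlonglongrightarrow> 0" by (rule Opow_tendsto_0)
  then have "(\<lambda>n. cf s i - (cf s i - (\<Sum>j<n. cf (u j) i))) \<longlonglongrightarrow> cf s i - 0" by (intro tendsto_intros)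
  then show ?thesis by (simp add: sums_def)
qed

text \<open>A null sequence is small at all coordinates at once, so coordinatewise sums converge
  uniformly in the coordinate, which is convergence in the topology of the uniformizer.\<close>

lemma unif_sumsI:
  assumes u: "range u \<subseteq> carrier B" "ord_tends_to_infinity B u" and s: "s \<in> carrier B"
    and sums: "\<And>i. i \<in> S ==> (\<lambda>j. cf (u j) i) sums cf s i"
  shows "unif_sums B u s"
  unfolding unif_sums_iff[OF u(1) s]
proof
  fix M
  obtain n0 where n0: "\<And>n i. n \<ge> n0 ==> i \<in> S ==> cf (u n) i \<in> Opow M"
    using u unfolding ord_tends_iff[OF u(1)] by blast
  have "cf s i - (\<Sum>j<n. cf (u j) i) \<in> Opow M" if "n \<ge> n0" "i \<in> S" for n i
    using cf_Opow[OF s that(2)] u(1) cf_Opow[OF _ that(2)] that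
    by (intro sums_tail_Opow[OF sums[OF that(2)]] n0) (auto simp: Opow_0)
  then show "\<exists>n0. \<forall>n\<ge>n0. \<forall>i\<in>S. cf s i - (\<Sum>j<n. cf (u j) i) \<in> Opow M" by blast
qed

subsection \<open>The module of functions\<close>

definition nullseq :: "(nat => 'b) => bool" where
  "nullseq a \<longleftrightarrow> range a \<subseteq> carrier B \<and> ord_tends_to_infinity B a"

definition series :: "('c \<times> 'c => 'b) => (nat => 'b) => bool" where
  "series f a \<longleftrightarrow> nullseq a \<and> (\<forall>z\<in>Zp. \<forall>i\<in>S. (\<lambda>n. cf (a n) i * z ^ n) sums cf (f (1, z)) i)"

definition homogeneous :: "('c \<times> 'c => 'b) => bool" where
  "homogeneous f \<longleftrightarrow> f \<in> T0 \<rightarrow>\<^sub>E carrier B \<and>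
     (\<forall>a\<in>Zpx. \<forall>(x, y)\<in>T0. f (a * x, a * y) = wt B a \<otimes> f (x, y))"

lemma nullseq_closed: "nullseq a ==> a n \<in> carrier B"
  by (auto simp: nullseq_def)

lemma nullseq_D: "nullseq a ==> \<exists>n0. \<forall>n\<ge>n0. \<forall>i\<in>S. cf (a n) i \<in> Opow M"
  by (auto simp: nullseq_def ord_tends_iff)

lemma nullseqI: "(\<And>n. a n \<in> carrier B) ==> (\<And>M. \<exists>n0. \<forall>n\<ge>n0. \<forall>i\<in>S. cf (a n) i \<in> Opow M) ==> nullseq a"
  unfolding nullseq_def by (subst ord_tends_iff) auto

lemma nullseq_tendsto: "nullseq a ==> i \<in> S ==> (\<lambda>n. cf (a n) i) \<longlonglongrightarrow> 0"
  using nullseq_D by (intro Opow_tendsto_0) blast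

lemma nullseq_mult:
  assumes a: "nullseq a" and b: "\<And>n. b n \<in> carrier B"
  shows "nullseq (\<lambda>n. a n \<otimes> b n)"
proof (rule nullseqI)
  show "\<exists>n0. \<forall>n\<ge>n0. \<forall>i\<in>S. cf (a n \<otimes> b n) i \<in> Opow M" for M
  proof -
    obtain n0 where "\<forall>n\<ge>n0. \<forall>i\<in>S. cf (a n) i \<in> Opow M" using nullseq_D[OF a] by blast
    then have "\<forall>n\<ge>n0. a n \<in> unif_pow B M" using nullseq_closed[OF a] by (auto simp: unif_pow_eq)
    then have "\<forall>n\<ge>n0. a n \<otimes> b n \<in> unif_pow B M" using unif_pow_mult b by blast
    then show ?thesis by (auto simp: unif_pow_eq)
  qed
qed (use nullseq_closed[OF a] b in auto)

lemma nullseq_add: "nullseq a ==> nullseq b ==> nullseq (\<lambda>n. a n \<oplus> b n)"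
proof (rule nullseqI)
  assume ab: "nullseq a" "nullseq b"
  show "\<exists>n0. \<forall>n\<ge>n0. \<forall>i\<in>S. cf (a n \<oplus> b n) i \<in> Opow M" for M
  proof -
    obtain n0 n1 where "\<forall>n\<ge>n0. \<forall>i\<in>S. cf (a n) i \<in> Opow M" "\<forall>n\<ge>n1. \<forall>i\<in>S. cf (b n) i \<in> Opow M"
      using ab nullseq_D by metis
    then show ?thesis using ab by (intro exI[of _ "max n0 n1"]) (auto simp: cf_add nullseq_closed)
  qed
qed (auto simp: nullseq_closed)

lemma emb_Zp: "z \<in> Zp ==> emb B z [^] (n::nat) = emb B (z ^ n)" "z \<in> Zp ==> emb B (z ^ n) \<in> carrier B"
  using Zp_Opow by (auto simp: emb_pow)

lemma A_iff: "f \<in> A_carrier B \<longleftrightarrow> homogeneous f \<and> (\<exists>a. series f a)"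
proof -
  have "(range a \<subseteq> carrier B \<and> ord_tends_to_infinity B a \<and>
      (\<forall>z\<in>Zp. unif_sums B (\<lambda>n. a n \<otimes> emb B z [^] n) (f (1, z)))) \<longleftrightarrow> series f a"
    if f: "f \<in> T0 \<rightarrow>\<^sub>E carrier B" for a
  proof -
    have f1: "f (1, z) \<in> carrier B" if "z \<in> Zp" for z using f that by (auto simp: T0_def)
    have "unif_sums B (\<lambda>n. a n \<otimes> emb B z [^] n) (f (1, z)) \<longleftrightarrow>
        (\<forall>i\<in>S. (\<lambda>n. cf (a n) i * z ^ n) sums cf (f (1, z)) i)" if a: "nullseq a" and z: "z \<in> Zp" for z
    proof -
      have n: "nullseq (\<lambda>n. a n \<otimes> emb B z [^] n)" using a z by (intro nullseq_mult) (auto simp: emb_Zp)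
      have "cf (a n \<otimes> emb B z [^] n) i = cf (a n) i * z ^ n" if "i \<in> S" for n i
        using nullseq_closed[OF a] z that Zp_Opow[of "z ^ n"] by (simp add: emb_Zp cf_mult_emb Zp_power mult.commute)
      then have eq: "(\<lambda>n. cf (a n \<otimes> emb B z [^] n) i) = (\<lambda>n. cf (a n) i * z ^ n)" if "i \<in> S" for i
        using that by blast
      have "unif_sums B (\<lambda>n. a n \<otimes> emb B z [^] n) (f (1, z)) \<longleftrightarrow>
          (\<forall>i\<in>S. (\<lambda>n. cf (a n \<otimes> emb B z [^] n) i) sums cf (f (1, z)) i)"
        using unif_sums_sums[OF _ f1[OF z]] unif_sumsI[OF _ _ f1[OF z]] n unfolding nullseq_def by blast
      then show ?thesis by (simp add: eq)
    qed
    then show ?thesis by (auto simp: series_def nullseq_def)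
  qed
  then show ?thesis by (auto simp: A_carrier_def homogeneous_def)
qed

lemma homogeneous_eq: "homogeneous f ==> (x, y) \<in> T0 ==> f (x, y) = wt B x \<otimes> f (1, y / x)"
proof -
  assume f: "homogeneous f" and xy: "(x, y) \<in> T0"
  have "(1, y / x) \<in> T0" "x \<in> Zpx" using xy Zp_divide by (auto simp: T0_def)
  then have "case (1, y / x) of (u, v) => f (x * u, x * v) = wt B x \<otimes> f (u, v)"
    using f unfolding homogeneous_def by blast
  then show ?thesis using \<open>x \<in> Zpx\<close> Zpx_nz[of x] by simp
qed

lemma homogeneous_closed: "homogeneous f ==> v \<in> T0 ==> f v \<in> carrier B"
  by (auto simp: homogeneous_def)

lemma A_closed: "f \<in> A_carrier B ==> v \<in> T0 ==> f v \<in> carrier B"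
  by (auto simp: A_iff homogeneous_closed)

lemma T0_1 [intro]: "z \<in> Zp ==> (1, z) \<in> (T0 :: ('c \<times> 'c) set)"
  by (auto simp: T0_def)

lemma series_eq:
  assumes "homogeneous f" "homogeneous g" "series f a" "series g a"
  shows "f = g"
proof -
  have "f (1, z) = g (1, z)" if "z \<in> Zp" for z
  proof (rule cf_eqI)
    fix i assume "i \<in> S"
    then have "(\<lambda>n. cf (a n) i * z ^ n) sums cf (f (1, z)) i" "(\<lambda>n. cf (a n) i * z ^ n) sums cf (g (1, z)) i"
      using assms(3,4) that unfolding series_def by blast+
    then show "cf (f (1, z)) i = cf (g (1, z)) i" by (rule sums_unique2)
  qed (use assms(1,2) that in \<open>auto intro!: homogeneous_closed\<close>)
  then have "f v = g v" if v: "v \<in> T0" for v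
  proof -
    obtain x y where xy: "v = (x, y)" by (cases v)
    have "y / x \<in> Zp" using v Zp_divide by (auto simp: xy T0_def)
    then show ?thesis
      using homogeneous_eq[OF assms(1) v[unfolded xy]] homogeneous_eq[OF assms(2) v[unfolded xy]]
        \<open>\<And>z. z \<in> Zp ==> f (1, z) = g (1, z)\<close>[of "y / x"] by (simp add: xy)
  qed
  then show ?thesis using assms unfolding homogeneous_def by (intro PiE_ext[of f T0 _ g]) auto
qed

text \<open>The difference of two expansions vanishes at the points \<open>p ^ j\<close>, which tend
  to 0, so \<open>null_power_series_zero\<close> applies to each coordinate.\<close>

lemma series_unique:
  assumes "series f a" "series f b"
  shows "a = b"
proof
  fix n
  have ab: "nullseq a" "nullseq b" using assms by (auto simp: series_def)
  show "a n = b n"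
  proof (rule cf_eqI)
    fix i assume i: "i \<in> S"
    have "cf (a n) i - cf (b n) i = 0"
    proof (rule null_power_series_zero[where x = "of_nat p" and a = "\<lambda>n. cf (a n) i - cf (b n) i" and C = 1])
      show "absv (cf (a n) i - cf (b n) i) \<le> 1" for n
        using cf_Opow[OF nullseq_closed[OF ab(1)] i] cf_Opow[OF nullseq_closed[OF ab(2)] i]
        by (intro absv_diff_le) (auto simp: Opow_0)
      show "absv (of_nat p :: 'c) < 1" using p_gt_1 by (simp add: absv_p)
      show "(\<lambda>n. (cf (a n) i - cf (b n) i) * (of_nat p ^ j) ^ n) sums 0" for j
      proof -
        have "of_nat p ^ j \<in> (Zp :: 'c set)" by auto
        then have "(\<lambda>n. cf (a n) i * (of_nat p ^ j) ^ n) sums cf (f (1, of_nat p ^ j)) i"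
          "(\<lambda>n. cf (b n) i * (of_nat p ^ j) ^ n) sums cf (f (1, of_nat p ^ j)) i"
          using assms i unfolding series_def by blast+
        from na_sums_diff[OF this] show ?thesis by (simp add: algebra_simps)
      qed
    qed (use p_gt_1 in simp)
    then show "cf (a n) i = cf (b n) i" by simp
  qed (auto simp: nullseq_closed ab)
qed

definition A_of :: "(nat => 'b) => 'c \<times> 'c => 'b" where
  "A_of a = (\<lambda>(x, y)\<in>T0. wt B x \<otimes> el (\<lambda>i. \<Sum>n. cf (a n) i * (y / x) ^ n))"

lemma nullseq_power_sums:
  assumes a: "nullseq a" and z: "z \<in> Zp" and i: "i \<in> S"
  shows "(\<lambda>n. cf (a n) i * z ^ n) sums (\<Sum>n. cf (a n) i * z ^ n)" "(\<Sum>n. cf (a n) i * z ^ n) \<in> Opow 0"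
proof -
  have "\<exists>n0. \<forall>n\<ge>n0. cf (a n) i * z ^ n \<in> Opow M" for M
    using nullseq_D[OF a, of M] i Zp_Opow[OF Zp_power[OF z]] by blast
  then have "(\<lambda>n. cf (a n) i * z ^ n) \<longlonglongrightarrow> 0" by (rule Opow_tendsto_0)
  moreover have "cf (a n) i * z ^ n \<in> Opow 0" for n
    using cf_Opow[OF nullseq_closed[OF a] i] Zp_Opow[OF Zp_power[OF z]] by blast
  ultimately show "(\<lambda>n. cf (a n) i * z ^ n) sums (\<Sum>n. cf (a n) i * z ^ n)" "(\<Sum>n. cf (a n) i * z ^ n) \<in> Opow 0"
    by (rule suminf_Opow)+
qed

lemma homogeneousI:
  assumes "\<And>z. z \<in> Zp ==> h z \<in> carrier B"
  shows "homogeneous (\<lambda>(x, y)\<in>T0. wt B x \<otimes> h (y / x))"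
  unfolding homogeneous_def
proof (intro conjI ballI; clarify?)
  show "(\<lambda>(x, y)\<in>T0. wt B x \<otimes> h (y / x)) \<in> T0 \<rightarrow>\<^sub>E carrier B"
    using assms Zp_divide by (auto simp: T0_def)
  fix a x y :: 'c assume a: "a \<in> Zpx" and xy: "(x, y) \<in> T0"
  then have "(a * x, a * y) \<in> T0" "a * y / (a * x) = y / x" "a \<noteq> 0" "y / x \<in> Zp" "x \<in> Zpx"
    using Zpx_nz[OF a] Zp_divide by (auto simp: T0_def Zpx_def absv_mult)
  then show "(\<lambda>(x, y)\<in>T0. wt B x \<otimes> h (y / x)) (a * x, a * y) = wt B a \<otimes> (\<lambda>(x, y)\<in>T0. wt B x \<otimes> h (y / x)) (x, y)"
    using a xy assms by (simp add: wt_mult m_assoc wt_closed)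
qed

lemma A_of:
  assumes a: "nullseq a"
  shows "homogeneous (A_of a)" "series (A_of a) a" "A_of a \<in> A_carrier B"
proof -
  show h: "homogeneous (A_of a)"
    unfolding A_of_def using nullseq_power_sums(2)[OF a] by (intro homogeneousI el) auto
  have "A_of a (1, z) = el (\<lambda>i. \<Sum>n. cf (a n) i * z ^ n)" if "z \<in> Zp" for z
    using that nullseq_power_sums(2)[OF a that] by (simp add: A_of_def T0_1 wt_one el)
  then show s: "series (A_of a) a"
    using a nullseq_power_sums[OF a] by (simp add: series_def el)
  show "A_of a \<in> A_carrier B" using h s by (auto simp: A_iff)
qed

lemma A_of_eqI: "homogeneous f ==> series f a ==> f = A_of a"
  using series_eq[of f "A_of a" a] A_of[of a] by (auto simp: series_def)

definition coefs :: "('c \<times> 'c => 'b) => nat => 'b" where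
  "coefs f = (SOME a. series f a)"

lemma coefs_series: "f \<in> A_carrier B ==> series f (coefs f)"
  using someI_ex[of "series f"] by (simp add: coefs_def A_iff)

lemma coefs_nullseq: "f \<in> A_carrier B ==> nullseq (coefs f)"
  using coefs_series by (auto simp: series_def)

lemma A_of_coefs: "f \<in> A_carrier B ==> A_of (coefs f) = f"
  using A_of_eqI[OF _ coefs_series] by (auto simp: A_iff)

lemma coefs_eq: "series f a ==> homogeneous f ==> coefs f = a"
  by (rule series_unique[OF coefs_series]) (auto simp: A_iff)

lemma A_module_simps [simp]:
  "carrier (A_module B) = A_carrier B"
  "f \<oplus>\<^bsub>A_module B\<^esub> g = (\<lambda>v\<in>T0. f v \<oplus> g v)"
  "b \<odot>\<^bsub>A_module B\<^esub> f = (\<lambda>v\<in>T0. b \<otimes> f v)"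
  by (simp_all add: A_module_def fun_module_def)

lemma A_add:
  assumes f: "f \<in> A_carrier B" and g: "g \<in> A_carrier B"
  shows "(\<lambda>v\<in>T0. f v \<oplus> g v) \<in> A_carrier B"
    "coefs (\<lambda>v\<in>T0. f v \<oplus> g v) = (\<lambda>n. coefs f n \<oplus> coefs g n)"
proof -
  have hf: "homogeneous f" "homogeneous g" using f g by (auto simp: A_iff)
  have cl: "v \<in> T0 ==> f v \<in> carrier B" "v \<in> T0 ==> g v \<in> carrier B" for v
    using hf homogeneous_closed by auto
  have sc: "(a * x, a * y) \<in> T0" if "a \<in> Zpx" "(x, y) \<in> T0" for a x y :: 'c
    using that by (auto simp: T0_def Zpx_def absv_mult)
  have h: "homogeneous (\<lambda>v\<in>T0. f v \<oplus> g v)"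
    using hf cl sc by (auto simp: homogeneous_def r_distr wt_closed split: prod.splits)
  have s: "series (\<lambda>v\<in>T0. f v \<oplus> g v) (\<lambda>n. coefs f n \<oplus> coefs g n)"
    using coefs_series[OF f] coefs_series[OF g] cl T0_1 unfolding series_def
    by (auto simp: cf_add nullseq_closed distrib_right intro!: nullseq_add sums_add)
  show "(\<lambda>v\<in>T0. f v \<oplus> g v) \<in> A_carrier B" using h s by (auto simp: A_iff)
  show "coefs (\<lambda>v\<in>T0. f v \<oplus> g v) = (\<lambda>n. coefs f n \<oplus> coefs g n)" using coefs_eq[OF s h] .
qed

lemma A_smult:
  assumes f: "f \<in> A_carrier B" and b: "b \<in> carrier B"
  shows "(\<lambda>v\<in>T0. b \<otimes> f v) \<in> A_carrier B"
    "coefs (\<lambda>v\<in>T0. b \<otimes> f v) = (\<lambda>n. b \<otimes> coefs f n)"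
proof -
  have hf: "homogeneous f" using f by (auto simp: A_iff)
  have cl: "v \<in> T0 ==> f v \<in> carrier B" for v using hf homogeneous_closed by auto
  have sc: "(a * x, a * y) \<in> T0" if "a \<in> Zpx" "(x, y) \<in> T0" for a x y :: 'c
    using that by (auto simp: T0_def Zpx_def absv_mult)
  have h: "homogeneous (\<lambda>v\<in>T0. b \<otimes> f v)"
    using hf cl sc b by (auto simp: homogeneous_def m_lcomm wt_closed split: prod.splits)
  have n: "nullseq (\<lambda>n. b \<otimes> coefs f n)"
    using nullseq_mult[OF coefs_nullseq[OF f], of "\<lambda>_. b"] b nullseq_closed[OF coefs_nullseq[OF f]]
    by (simp add: m_comm)
  have s: "series (\<lambda>v\<in>T0. b \<otimes> f v) (\<lambda>n. b \<otimes> coefs f n)"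
    unfolding series_def
  proof (intro conjI ballI n)
    fix z :: 'c and i assume z: "z \<in> Zp" and i: "i \<in> S"
    have "(\<lambda>n. \<Sum>j\<le>i. cf b j * (cf (coefs f n) (i - j) * z ^ n)) sums (\<Sum>j\<le>i. cf b j * cf (f (1, z)) (i - j))"
      using coefs_series[OF f] z S_down[OF i] unfolding series_def by (intro na_sums_sum na_sums_mult) auto
    then show "(\<lambda>n. cf (b \<otimes> coefs f n) i * z ^ n) sums cf ((\<lambda>v\<in>T0. b \<otimes> f v) (1, z)) i"
      using b i z cl T0_1[OF z] nullseq_closed[OF coefs_nullseq[OF f]]
      by (simp add: cf_mult sum_distrib_right mult.assoc)
  qed
  show "(\<lambda>v\<in>T0. b \<otimes> f v) \<in> A_carrier B" using h s by (auto simp: A_iff)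
  show "coefs (\<lambda>v\<in>T0. b \<otimes> f v) = (\<lambda>n. b \<otimes> coefs f n)" using coefs_eq[OF s h] .
qed

lemma f_basis_A: "f_basis B j \<in> A_carrier B"
  and f_basis_coefs: "coefs (f_basis B j) = (\<lambda>n. if n = j then \<one> else \<zero>)"
proof -
  have h: "homogeneous (f_basis B j)"
    unfolding f_basis_def by (rule homogeneousI) (simp add: emb_Zp)
  have s: "series (f_basis B j) (\<lambda>n. if n = j then \<one> else \<zero>)"
    unfolding series_def
  proof (intro conjI ballI nullseqI)
    show "\<exists>n0. \<forall>n\<ge>n0. \<forall>i\<in>S. cf (if n = j then \<one> else \<zero>) i \<in> Opow M" for M
      by (intro exI[of _ "Suc j"]) (auto simp: cf_zero)
    fix z :: 'c and i assume z: "z \<in> Zp" and i: "i \<in> S"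
    have eq: "(\<lambda>n. cf (if n = j then \<one> else \<zero>) i * z ^ n) = (\<lambda>n. if n = j then cf \<one> i * z ^ n else 0)"
      using i by (auto simp: cf_zero)
    have "cf (f_basis B j (1, z)) i = cf \<one> i * z ^ j"
      using i z Zp_Opow[OF Zp_power[OF z]] by (simp add: f_basis_def T0_1 wt_one emb_Zp cf_emb cf_one)
    then show "(\<lambda>n. cf (if n = j then \<one> else \<zero>) i * z ^ n) sums cf (f_basis B j (1, z)) i"
      unfolding eq using sums_single[of j "\<lambda>n. cf \<one> i * z ^ n"] by simp
  qed auto
  show "f_basis B j \<in> A_carrier B" using h s by (auto simp: A_iff)
  show "coefs (f_basis B j) = (\<lambda>n. if n = j then \<one> else \<zero>)" using coefs_eq[OF s h] .
qed

lemma A_eqI: "f \<in> A_carrier B ==> g \<in> A_carrier B ==> coefs f = coefs g ==> f = g"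
  using A_of_coefs by metis

end

section \<open>Functionals as free sequences of values on the f_j, and the action of Gamma\<close>

section \<open>Distributions\<close>

context coeff_algebra
begin

abbreviation LD :: "(('c \<times> 'c => 'b) => 'b) set" where
  "LD \<equiv> linear_dual B (A_module B)"

lemma LD_closed: "\<mu> \<in> LD ==> f \<in> A_carrier B ==> \<mu> f \<in> carrier B"
  by (auto simp: linear_dual_def)

lemma LD_add: "\<mu> \<in> LD ==> f \<in> A_carrier B ==> g \<in> A_carrier B ==>
    \<mu> (\<lambda>v\<in>T0. f v \<oplus> g v) = \<mu> f \<oplus> \<mu> g"
  by (simp add: linear_dual_def)

lemma LD_smult: "\<mu> \<in> LD ==> f \<in> A_carrier B ==> b \<in> carrier B ==>
    \<mu> (\<lambda>v\<in>T0. b \<otimes> f v) = b \<otimes> \<mu> f"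
  by (simp add: linear_dual_def)

lemma LD_I:
  assumes "\<And>f. f \<in> A_carrier B ==> h f \<in> carrier B"
    and "\<And>f g. f \<in> A_carrier B ==> g \<in> A_carrier B ==> h (\<lambda>v\<in>T0. f v \<oplus> g v) = h f \<oplus> h g"
    and "\<And>b f. b \<in> carrier B ==> f \<in> A_carrier B ==> h (\<lambda>v\<in>T0. b \<otimes> f v) = b \<otimes> h f"
  shows "restrict h (A_carrier B) \<in> LD"
  using assms A_add(1) A_smult(1) by (simp add: linear_dual_def)

lemma coefs_A_of: "nullseq a ==> coefs (A_of a) = a"
  using coefs_eq A_of by blast

lemma LD_finite:
  assumes \<mu>: "\<mu> \<in> LD" and a: "\<And>n. a n \<in> carrier B" and i: "i \<in> S"
  shows "cf (\<mu> (A_of (\<lambda>n. if n < N then a n else \<zero>))) i = (\<Sum>n<N. cf (a n \<otimes> \<mu> (f_basis B n)) i)"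
proof (induction N)
  have ns: "nullseq (\<lambda>n. if n < N then a n else \<zero>)" for N
    by (rule nullseqI) (use a in \<open>auto intro!: exI[of _ N] simp: cf_zero\<close>)
  {
    case 0
    have "nullseq (\<lambda>n. \<zero>)" using ns[of 0] by simp
    then have z: "A_of (\<lambda>n. \<zero>) \<in> A_carrier B" "coefs (A_of (\<lambda>n. \<zero>)) = (\<lambda>n. \<zero>)" using A_of(3) coefs_A_of by auto
    have "(\<lambda>v\<in>T0. \<zero> \<otimes> A_of (\<lambda>n. \<zero>) v) = A_of (\<lambda>n. \<zero>)"
      using z A_smult[OF z(1) zero_closed'] by (intro A_eqI) auto
    then have "\<mu> (A_of (\<lambda>n. \<zero>)) = \<zero>"
      using LD_smult[OF \<mu> z(1) zero_closed'] LD_closed[OF \<mu> z(1)] by simp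
    then show ?case using i by (simp add: cf_zero)
  next
    case (Suc N)
    have f: "(\<lambda>v\<in>T0. a N \<otimes> f_basis B N v) \<in> A_carrier B"
      "coefs (\<lambda>v\<in>T0. a N \<otimes> f_basis B N v) = (\<lambda>n. if n = N then a N else \<zero>)"
      using A_smult[OF f_basis_A a, of N] a by (auto simp: f_basis_coefs fun_eq_iff)
    let ?t = "A_of (\<lambda>n. if n < N then a n else \<zero>)"
    have t: "?t \<in> A_carrier B" "coefs ?t = (\<lambda>n. if n < N then a n else \<zero>)" using A_of(3)[OF ns] coefs_A_of[OF ns] by auto
    have "A_of (\<lambda>n. if n < Suc N then a n else \<zero>) = (\<lambda>v\<in>T0. ?t v \<oplus> (\<lambda>v\<in>T0. a N \<otimes> f_basis B N v) v)"
    proof (rule A_eqI[OF A_of(3)[OF ns] A_add(1)[OF t(1) f(1)]])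
      show "coefs (A_of (\<lambda>n. if n < Suc N then a n else \<zero>)) =
          coefs (\<lambda>v\<in>T0. ?t v \<oplus> (\<lambda>v\<in>T0. a N \<otimes> f_basis B N v) v)"
        unfolding A_add(2)[OF t(1) f(1)] coefs_A_of[OF ns] t f using a by (auto simp: fun_eq_iff less_Suc_eq)
    qed
    then have "\<mu> (A_of (\<lambda>n. if n < Suc N then a n else \<zero>)) = \<mu> ?t \<oplus> a N \<otimes> \<mu> (f_basis B N)"
      using LD_add[OF \<mu> t(1) f(1)] LD_smult[OF \<mu> f_basis_A a, of N] by simp
    then show ?case using Suc i a LD_closed[OF \<mu> t(1)] LD_closed[OF \<mu> f_basis_A] by (simp add: cf_add)
  }
qed

text \<open>Linearity over \<open>B\<close> already gives continuity: from index \<open>N\<close> on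
  the coefficients of \<open>f\<close> are divisible by \<open>\<pi> ^ M\<close>, so
  \<open>f\<close> is a finite combination of basis functions plus \<open>\<pi> ^ M\<close> times
  another element of A.\<close>

lemma LD_tail:
  assumes \<mu>: "\<mu> \<in> LD" and f: "f \<in> A_carrier B" and i: "i \<in> S"
    and N: "\<And>n i. n \<ge> N ==> i \<in> S ==> cf (coefs f n) i \<in> Opow M"
  shows "cf (\<mu> f) i - (\<Sum>n<N. cf (coefs f n \<otimes> \<mu> (f_basis B n)) i) \<in> Opow M"
proof -
  let ?a = "coefs f"
  note nf = coefs_nullseq[OF f]
  have a: "?a n \<in> carrier B" for n using nullseq_closed[OF nf] .
  define b where "b n = el (\<lambda>i. if n < N then 0 else cf (?a n) i / \<pi> ^ M)" for n
  have div: "x \<in> Opow (M + m) ==> x / \<pi> ^ M \<in> Opow m" for x m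
    using \<pi>_pos by (auto simp: Opow_def absv_divide power_add field_simps)
  have b0: "(if n < N then 0 else cf (?a n) i / \<pi> ^ M) \<in> Opow 0" if "i \<in> S" for n i
    using N[of n i] div[of _ 0] that by auto
  have b: "b n \<in> carrier B" "i \<in> S ==> cf (b n) i = (if n < N then 0 else cf (?a n) i / \<pi> ^ M)" for n i
    unfolding b_def using el[OF b0] by auto
  have bn: "nullseq b"
  proof (rule nullseqI[OF b(1)])
    fix m
    obtain n0 where n0: "\<forall>n\<ge>n0. \<forall>i\<in>S. cf (?a n) i \<in> Opow (M + m)" using nullseq_D[OF nf] by blast
    then show "\<exists>n0. \<forall>n\<ge>n0. \<forall>i\<in>S. cf (b n) i \<in> Opow m"
      using div b(2) by (intro exI[of _ n0]) auto
  qed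
  have tn: "nullseq (\<lambda>n. if n < N then ?a n else \<zero>)"
    by (rule nullseqI) (use a in \<open>auto intro!: exI[of _ N] simp: cf_zero\<close>)
  let ?t = "A_of (\<lambda>n. if n < N then ?a n else \<zero>)" and ?e = "emb B (\<pi> ^ M)"
  have \<pi>M: "\<pi> ^ M \<in> Opow 0" using \<pi>_power_Opow[of M] by (auto intro: Opow_antimonoD)
  have e: "?e \<in> carrier B" using \<pi>M by simp
  have t: "?t \<in> A_carrier B" "coefs ?t = (\<lambda>n. if n < N then ?a n else \<zero>)" using A_of(3)[OF tn] coefs_A_of[OF tn] by auto
  have g: "A_of b \<in> A_carrier B" "coefs (A_of b) = b" using A_of(3)[OF bn] coefs_A_of[OF bn] by auto
  note eg = A_smult[OF g(1) e]
  have "f = (\<lambda>v\<in>T0. ?t v \<oplus> (\<lambda>v\<in>T0. ?e \<otimes> A_of b v) v)"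
  proof (rule A_eqI[OF f])
    show "(\<lambda>v\<in>T0. ?t v \<oplus> (\<lambda>v\<in>T0. ?e \<otimes> A_of b v) v) \<in> A_carrier B" by (rule A_add(1)[OF t(1) eg(1)])
    have "?a n = (if n < N then ?a n else \<zero>) \<oplus> ?e \<otimes> b n" for n
      using a b e \<pi>M by (intro cf_eqI) (auto simp: cf_add cf_zero m_comm[of ?e] cf_mult_emb)
    then show "?a = coefs (\<lambda>v\<in>T0. ?t v \<oplus> (\<lambda>v\<in>T0. ?e \<otimes> A_of b v) v)"
      unfolding A_add(2)[OF t(1) eg(1)] eg(2) t(2) g(2) by (intro ext)
  qed
  then have "\<mu> f = \<mu> ?t \<oplus> ?e \<otimes> \<mu> (A_of b)"
    using LD_add[OF \<mu> t(1) eg(1)] LD_smult[OF \<mu> g(1) e] by simp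
  then have "cf (\<mu> f) i = (\<Sum>n<N. cf (?a n \<otimes> \<mu> (f_basis B n)) i) + \<pi> ^ M * cf (\<mu> (A_of b)) i"
    using i e \<pi>M LD_closed[OF \<mu> t(1)] LD_closed[OF \<mu> g(1)] LD_finite[OF \<mu> a i]
    by (simp add: cf_add m_comm[of ?e] cf_mult_emb)
  moreover have "\<pi> ^ M * cf (\<mu> (A_of b)) i \<in> Opow M"
    using LD_closed[OF \<mu> g(1)] i by (intro Opow_mult_right) auto
  ultimately show ?thesis by simp
qed

lemma LD_eval:
  assumes \<mu>: "\<mu> \<in> LD" and f: "f \<in> A_carrier B" and i: "i \<in> S"
  shows "(\<lambda>n. cf (coefs f n \<otimes> \<mu> (f_basis B n)) i) sums cf (\<mu> f) i"
proof -
  have "\<exists>n0. \<forall>N\<ge>n0. cf (\<mu> f) i - (\<Sum>n<N. cf (coefs f n \<otimes> \<mu> (f_basis B n)) i) \<in> Opow M" for M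
  proof -
    obtain n0 where "\<forall>n\<ge>n0. \<forall>i\<in>S. cf (coefs f n) i \<in> Opow M" using nullseq_D[OF coefs_nullseq[OF f]] by blast
    then show ?thesis using LD_tail[OF \<mu> f i] by (intro exI[of _ n0]) auto
  qed
  then have "(\<lambda>N. cf (\<mu> f) i - (\<Sum>n<N. cf (coefs f n \<otimes> \<mu> (f_basis B n)) i)) \<longlonglongrightarrow> 0"
    by (rule Opow_tendsto_0)
  then have "(\<lambda>N. cf (\<mu> f) i - (cf (\<mu> f) i - (\<Sum>n<N. cf (coefs f n \<otimes> \<mu> (f_basis B n)) i))) \<longlonglongrightarrow> cf (\<mu> f) i - 0"
    by (intro tendsto_intros)
  then show ?thesis by (simp add: sums_def)
qed

lemma LD_ext:
  assumes "\<mu> \<in> LD" "\<nu> \<in> LD" "\<And>n. \<mu> (f_basis B n) = \<nu> (f_basis B n)"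
  shows "\<mu> = \<nu>"
proof -
  have "\<mu> f = \<nu> f" if f: "f \<in> A_carrier B" for f
    using LD_eval[OF assms(1) f] LD_eval[OF assms(2) f] assms LD_closed f
    by (intro cf_eqI) (auto intro: sums_unique2)
  then show ?thesis using assms unfolding linear_dual_def by (intro PiE_ext[of \<mu> "A_carrier B" _ \<nu>]) auto
qed

definition functional :: "(nat => 'b) => ('c \<times> 'c => 'b) => 'b" where
  "functional \<nu> = (\<lambda>f\<in>A_carrier B. el (\<lambda>i. \<Sum>n. cf (coefs f n \<otimes> \<nu> n) i))"

text \<open>The values on the basis can be prescribed freely, since the coefficients of any
  \<open>f\<close> tend to 0 and make the sum converge.\<close>

lemma functional:
  fixes \<nu> :: "nat => 'b"
  assumes \<nu>: "\<And>n. \<nu> n \<in> carrier B"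
  shows "functional \<nu> \<in> LD" "functional \<nu> (f_basis B j) = \<nu> j"
proof -
  have s: "(\<lambda>n. cf (coefs f n \<otimes> \<nu> n) i) sums (\<Sum>n. cf (coefs f n \<otimes> \<nu> n) i)"
      "(\<Sum>n. cf (coefs f n \<otimes> \<nu> n) i) \<in> Opow 0"
    if f: "f \<in> A_carrier B" and i: "i \<in> S" for f i
  proof -
    have n: "nullseq (\<lambda>n. coefs f n \<otimes> \<nu> n)" using nullseq_mult[OF coefs_nullseq[OF f] \<nu>] .
    show "(\<lambda>n. cf (coefs f n \<otimes> \<nu> n) i) sums (\<Sum>n. cf (coefs f n \<otimes> \<nu> n) i)"
      "(\<Sum>n. cf (coefs f n \<otimes> \<nu> n) i) \<in> Opow 0"
      by (rule suminf_Opow[OF nullseq_tendsto[OF n i] cf_Opow[OF nullseq_closed[OF n] i]])+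
  qed
  define h where "h f = el (\<lambda>i. \<Sum>n. cf (coefs f n \<otimes> \<nu> n) i)" for f
  have h: "h f \<in> carrier B" "i \<in> S ==> cf (h f) i = (\<Sum>n. cf (coefs f n \<otimes> \<nu> n) i)" if "f \<in> A_carrier B" for f i
    unfolding h_def using el s(2)[OF that] by auto
  have hs: "(\<lambda>n. cf (coefs f n \<otimes> \<nu> n) i) sums cf (h f) i" if "f \<in> A_carrier B" "i \<in> S" for f i
    using s(1) h(2) that by simp
  have cc: "coefs f n \<in> carrier B" if "f \<in> A_carrier B" for f n using nullseq_closed[OF coefs_nullseq[OF that]] .
  have "restrict h (A_carrier B) \<in> LD"
  proof (rule LD_I)
    show "h f \<in> carrier B" if "f \<in> A_carrier B" for f using h that by simp
    show "h (\<lambda>v\<in>T0. f v \<oplus> g v) = h f \<oplus> h g" if fg: "f \<in> A_carrier B" "g \<in> A_carrier B" for f g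
    proof (rule cf_eqI)
      fix i assume i: "i \<in> S"
      have "(\<lambda>n. cf (coefs f n \<otimes> \<nu> n) i + cf (coefs g n \<otimes> \<nu> n) i) sums (cf (h f) i + cf (h g) i)"
        using hs fg i by (intro sums_add) auto
      then have "(\<lambda>n. cf (coefs (\<lambda>v\<in>T0. f v \<oplus> g v) n \<otimes> \<nu> n) i) sums (cf (h f) i + cf (h g) i)"
        using fg i \<nu> cc by (simp add: A_add(2) l_distr cf_add)
      from sums_unique2[OF hs[OF A_add(1)[OF fg] i] this]
      show "cf (h (\<lambda>v\<in>T0. f v \<oplus> g v)) i = cf (h f \<oplus> h g) i" using h fg i by (simp add: cf_add)
    qed (use h fg A_add(1) in auto)
    show "h (\<lambda>v\<in>T0. b \<otimes> f v) = b \<otimes> h f" if b: "b \<in> carrier B" and f: "f \<in> A_carrier B" for b f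
    proof (rule cf_eqI)
      fix i assume i: "i \<in> S"
      have "(\<lambda>n. \<Sum>j\<le>i. cf b j * cf (coefs f n \<otimes> \<nu> n) (i - j)) sums (\<Sum>j\<le>i. cf b j * cf (h f) (i - j))"
        using hs[OF f] S_down[OF i] by (intro na_sums_sum na_sums_mult) auto
      then have "(\<lambda>n. cf (coefs (\<lambda>v\<in>T0. b \<otimes> f v) n \<otimes> \<nu> n) i) sums cf (b \<otimes> h f) i"
        using b f i \<nu> cc h by (simp add: A_smult(2) m_assoc cf_mult[of b])
      from sums_unique2[OF hs[OF A_smult(1)[OF f b] i] this]
      show "cf (h (\<lambda>v\<in>T0. b \<otimes> f v)) i = cf (b \<otimes> h f) i" .
    qed (use h b f A_smult(1) in auto)
  qed
  then show "functional \<nu> \<in> LD" by (simp add: functional_def h_def[abs_def])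
  have "h (f_basis B j) = \<nu> j"
  proof (rule cf_eqI)
    fix i assume i: "i \<in> S"
    have eq: "(\<lambda>n. cf (coefs (f_basis B j) n \<otimes> \<nu> n) i) = (\<lambda>n. if n = j then cf (\<nu> n) i else 0)"
      using i \<nu> by (auto simp: f_basis_coefs cf_zero fun_eq_iff)
    have "(\<lambda>n. if n = j then cf (\<nu> n) i else 0) sums cf (\<nu> j) i" by (rule sums_single)
    then show "cf (h (f_basis B j)) i = cf (\<nu> j) i"
      using hs[OF f_basis_A i, of j] unfolding eq by (rule sums_unique2[symmetric])
  qed (use h f_basis_A \<nu> in auto)
  then show "functional \<nu> (f_basis B j) = \<nu> j" by (simp add: functional_def h_def f_basis_A)
qed

text \<open>Linearity sends the multiples of A by an ideal into that ideal, so continuity holds with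
  \<open>i = n\<close>.\<close>

lemma continuous_dual_eq: "continuous_dual B (A_module B) = LD"
proof -
  have "\<mu> f \<in> max_ideal_pow B n" if \<mu>: "\<mu> \<in> LD" and f: "f \<in> ideal_smult (A_module B) (max_ideal_pow B n)" for \<mu> n f
  proof -
    have J: "max_ideal_pow B n \<subseteq> carrier B" by (auto simp: max_ideal_pow_eq)
    have "f \<in> A_carrier B \<and> \<mu> f \<in> max_ideal_pow B n"
      using f
    proof (induction rule: ideal_smult.induct)
      case (smult b f)
      then have b: "b \<in> carrier B" "f \<in> A_carrier B" using J by auto
      show ?case
        unfolding A_module_simps LD_smult[OF \<mu> b(2,1)]
        using smult b A_smult(1) LD_closed[OF \<mu>] max_ideal_pow_mult by blast
    next
      case (add f g)
      then have fg: "f \<in> A_carrier B" "g \<in> A_carrier B" by auto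
      have "\<mu> f \<oplus> \<mu> g \<in> max_ideal_pow B n" using add by (auto simp: max_ideal_pow_eq cf_add)
      then show ?case
        unfolding A_module_simps LD_add[OF \<mu> fg] using A_add(1)[OF fg] by blast
    qed
    then show ?thesis by simp
  qed
  then show ?thesis unfolding continuous_dual_def by blast
qed

lemma D_simps [simp]:
  "carrier (D_module B) = LD"
  "\<mu> \<otimes>\<^bsub>D_module B\<^esub> \<nu> = (\<lambda>f\<in>A_carrier B. \<mu> f \<oplus> \<nu> f)"
  "\<one>\<^bsub>D_module B\<^esub> = (\<lambda>f\<in>A_carrier B. \<zero>)"
  "act (D_module B) \<mu> \<gamma> = (\<lambda>f\<in>A_carrier B. \<mu> (fun_act \<gamma> f))"
  by (simp_all add: D_module_def dual_gmodule_def continuous_dual_eq)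

lemma LD_eqI: "\<mu> \<in> LD ==> \<nu> \<in> LD ==> (\<And>f. f \<in> A_carrier B ==> \<mu> f = \<nu> f) ==> \<mu> = \<nu>"
  using LD_ext f_basis_A by blast

lemma LD_plus: "\<mu> \<in> LD ==> \<nu> \<in> LD ==> (\<lambda>f\<in>A_carrier B. \<mu> f \<oplus> \<nu> f) \<in> LD"
  by (rule LD_I) (auto simp: LD_closed LD_add LD_smult r_distr a_ac)

lemma LD_zero: "(\<lambda>f\<in>A_carrier B. \<zero>) \<in> LD"
  by (rule LD_I) auto

lemma LD_scale: "\<mu> \<in> LD ==> c \<in> carrier B ==> (\<lambda>f\<in>A_carrier B. c \<otimes> \<mu> f) \<in> LD"
  by (rule LD_I) (auto simp: LD_closed LD_add LD_smult r_distr m_lcomm)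

lemma D_comm_group: "comm_group (D_module B)"
proof (rule comm_groupI)
  fix x assume x: "x \<in> carrier (D_module B)"
  have m: "(\<lambda>f\<in>A_carrier B. (\<ominus> \<one>) \<otimes> x f) \<in> LD" using x by (intro LD_scale) auto
  show "\<exists>y\<in>carrier (D_module B). y \<otimes>\<^bsub>D_module B\<^esub> x = \<one>\<^bsub>D_module B\<^esub>"
  proof (rule bexI)
    show "(\<lambda>f\<in>A_carrier B. (\<ominus> \<one>) \<otimes> x f) \<otimes>\<^bsub>D_module B\<^esub> x = \<one>\<^bsub>D_module B\<^esub>"
      using x by (auto simp: fun_eq_iff LD_closed l_minus l_neg)
  qed (use m in simp)
  show "\<one>\<^bsub>D_module B\<^esub> \<otimes>\<^bsub>D_module B\<^esub> x = x"
    using x LD_plus[OF LD_zero] by (intro LD_eqI) (auto simp: LD_closed)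
  fix y assume y: "y \<in> carrier (D_module B)"
  show "x \<otimes>\<^bsub>D_module B\<^esub> y \<in> carrier (D_module B)" using x y LD_plus by simp
  show "x \<otimes>\<^bsub>D_module B\<^esub> y = y \<otimes>\<^bsub>D_module B\<^esub> x" using x y by (auto simp: fun_eq_iff LD_closed a_comm)
  fix z assume z: "z \<in> carrier (D_module B)"
  show "x \<otimes>\<^bsub>D_module B\<^esub> y \<otimes>\<^bsub>D_module B\<^esub> z = x \<otimes>\<^bsub>D_module B\<^esub> (y \<otimes>\<^bsub>D_module B\<^esub> z)"
    using x y z by (auto simp: fun_eq_iff LD_closed a_assoc)
qed (simp add: LD_zero)

end

subsection \<open>The congruence subgroup\<close>

lemma row_act_mult: "row_act v (\<gamma> ** \<delta>) = row_act (row_act v \<gamma>) \<delta>"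
  by (simp add: row_act_def matrix_matrix_mult_def sum_2 algebra_simps)

lemma row_act_one [simp]: "row_act v (mat 1) = v"
  by (simp add: row_act_def mat_def)

lemma mat_2_entries: "(mat 1 :: int ^ 2 ^ 2) $ i $ j = (if i = j then 1 else 0)"
  by (simp add: mat_def)

lemma Gamma_group: "group (Gamma N p)"
proof (rule groupI)
  fix \<gamma> assume g: "\<gamma> \<in> carrier (Gamma N p)"
  \<comment> \<open>The adjugate, inverse to \<open>\<gamma>\<close> because the determinant is
    1.\<close>
  define \<delta> :: "int ^ 2 ^ 2" where
    "\<delta> = (\<chi> i j. if i = 1 then (if j = 1 then \<gamma> $ 2 $ 2 else - \<gamma> $ 1 $ 2) else (if j = 1 then - \<gamma> $ 2 $ 1 else \<gamma> $ 1 $ 1))"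
  have d: "\<delta> $ 1 $ 1 = \<gamma> $ 2 $ 2" "\<delta> $ 1 $ 2 = - \<gamma> $ 1 $ 2" "\<delta> $ 2 $ 1 = - \<gamma> $ 2 $ 1" "\<delta> $ 2 $ 2 = \<gamma> $ 1 $ 1"
    by (simp_all add: \<delta>_def)
  have det: "\<gamma> $ 1 $ 1 * \<gamma> $ 2 $ 2 - \<gamma> $ 1 $ 2 * \<gamma> $ 2 $ 1 = 1" using g by (simp add: Gamma_def det_2)
  have "\<delta> \<in> carrier (Gamma N p)" using g d by (simp add: Gamma_def det_2 mult_ac)
  moreover have "\<delta> ** \<gamma> = mat 1"
    using det by (simp add: vec_eq_iff forall_2 matrix_matrix_mult_def sum_2 d mat_def algebra_simps)
  ultimately show "\<exists>\<delta>\<in>carrier (Gamma N p). \<delta> \<otimes>\<^bsub>Gamma N p\<^esub> \<gamma> = \<one>\<^bsub>Gamma N p\<^esub>"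
    by (auto simp: Gamma_def)
next
  fix x y assume x: "x \<in> carrier (Gamma N p)" and y: "y \<in> carrier (Gamma N p)"
  have dv: "m dvd a - 1 ==> m dvd b - 1 ==> m dvd c ==> m dvd a * b + d * c - 1"
    "m dvd a - 1 ==> m dvd b - 1 ==> m dvd c ==> m dvd c * d + a * b - 1" for m a b c d :: int
  proof -
    assume h: "m dvd a - 1" "m dvd b - 1" "m dvd c"
    have "a * b + d * c - 1 = (a - 1) * b + (b - 1) + d * c" by (simp add: algebra_simps)
    then show "m dvd a * b + d * c - 1" using h by (metis dvd_add dvd_mult dvd_mult2)
    then show "m dvd c * d + a * b - 1" by (simp add: algebra_simps)
  qed
  have "det (x ** y) = 1" using x y by (simp add: Gamma_def det_mul)
  then show "x \<otimes>\<^bsub>Gamma N p\<^esub> y \<in> carrier (Gamma N p)"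
    using x y dv by (auto simp: Gamma_def matrix_matrix_mult_def sum_2)
qed (auto simp: Gamma_def matrix_mul_assoc mat_2_entries)

context dv_field
begin

lemma Gamma_units:
  assumes g: "\<gamma> \<in> carrier (Gamma N p)"
  shows "int p dvd \<gamma> $ 2 $ 1" "of_int (\<gamma> $ 1 $ 1) \<in> (Zpx :: 'c set)"
proof -
  show c: "int p dvd \<gamma> $ 2 $ 1" using g by (simp add: Gamma_def)
  have det: "\<gamma> $ 1 $ 1 * \<gamma> $ 2 $ 2 - \<gamma> $ 1 $ 2 * \<gamma> $ 2 $ 1 = 1" using g by (simp add: Gamma_def det_2)
  have "\<not> int p dvd \<gamma> $ 1 $ 1"
  proof
    assume "int p dvd \<gamma> $ 1 $ 1"
    then have "int p dvd 1" using c det by (metis dvd_diff dvd_mult dvd_mult2)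
    then show False using p_gt_1 by simp
  qed
  then show "of_int (\<gamma> $ 1 $ 1) \<in> (Zpx :: 'c set)" by (simp add: Zpx_def absv_int_eq_1_iff)
qed

lemma Zpx_add: "x \<in> Zpx ==> y \<in> Zp ==> absv y < 1 ==> x + y \<in> (Zpx :: 'c set)"
  by (auto simp: Zpx_def absv_add_eq)

lemma row_act_T0:
  assumes g: "\<gamma> \<in> carrier (Gamma N p)" and v: "v \<in> (T0 :: ('c \<times> 'c) set)"
  shows "row_act v \<gamma> \<in> T0"
proof -
  obtain x y where xy: "v = (x, y)" "x \<in> Zpx" "y \<in> Zp" using v by (auto simp: T0_def)
  have "absv (of_int (\<gamma> $ 2 $ 1) * y) < 1"
    using Gamma_units(1)[OF g] Zp_absv_le[OF xy(3)] absv_int_less_iff[of "\<gamma> $ 2 $ 1"]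
    by (metis absv_mult absv_nonneg mult_left_le order_le_less_trans)
  then have "of_int (\<gamma> $ 1 $ 1) * x + of_int (\<gamma> $ 2 $ 1) * y \<in> Zpx"
    using Gamma_units(2)[OF g] xy by (intro Zpx_add) auto
  moreover have "of_int (\<gamma> $ 1 $ 2) * x + of_int (\<gamma> $ 2 $ 2) * y \<in> Zp" using xy by (auto simp: Zpx_def)
  ultimately show ?thesis by (simp add: row_act_def xy T0_def)
qed

lemma fun_act_mult:
  assumes "\<gamma> \<in> carrier (Gamma N p)" "\<delta> \<in> carrier (Gamma N p)"
  shows "fun_act (\<gamma> ** \<delta>) (f :: 'c \<times> 'c => 'e) = fun_act \<gamma> (fun_act \<delta> f)"
  using row_act_T0[OF assms(1)] by (auto simp: fun_act_def row_act_mult fun_eq_iff)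

end

context coeff_algebra
begin

lemma fun_act_one: "f \<in> A_carrier B ==> fun_act (mat 1) f = f"
  by (rule ext) (auto simp: fun_act_def A_iff homogeneous_def PiE_def extensional_def)

lemma LD_act:
  assumes st: "A_stable (Gamma N p) B" and \<mu>: "\<mu> \<in> LD" and g: "\<gamma> \<in> carrier (Gamma N p)"
  shows "(\<lambda>f\<in>A_carrier B. \<mu> (fun_act \<gamma> f)) \<in> LD"
proof (rule LD_I)
  have s: "fun_act \<gamma> f \<in> A_carrier B" if "f \<in> A_carrier B" for f using st g that by (simp add: A_stable_def)
  show "\<mu> (fun_act \<gamma> f) \<in> carrier B" if "f \<in> A_carrier B" for f using LD_closed[OF \<mu> s[OF that]] .
  show "\<mu> (fun_act \<gamma> (\<lambda>v\<in>T0. f v \<oplus> g v)) = \<mu> (fun_act \<gamma> f) \<oplus> \<mu> (fun_act \<gamma> g)"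
    if "f \<in> A_carrier B" "g \<in> A_carrier B" for f g
  proof -
    have "fun_act \<gamma> (\<lambda>v\<in>T0. f v \<oplus> g v) = (\<lambda>v\<in>T0. fun_act \<gamma> f v \<oplus> fun_act \<gamma> g v)"
      using row_act_T0[OF \<open>\<gamma> \<in> _\<close>] by (auto simp: fun_act_def fun_eq_iff)
    then show ?thesis using LD_add[OF \<mu> s[OF that(1)] s[OF that(2)]] by simp
  qed
  show "\<mu> (fun_act \<gamma> (\<lambda>v\<in>T0. b \<otimes> f v)) = b \<otimes> \<mu> (fun_act \<gamma> f)"
    if "b \<in> carrier B" "f \<in> A_carrier B" for b f
  proof -
    have "fun_act \<gamma> (\<lambda>v\<in>T0. b \<otimes> f v) = (\<lambda>v\<in>T0. b \<otimes> fun_act \<gamma> f v)"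
      using row_act_T0[OF g] by (auto simp: fun_act_def fun_eq_iff)
    then show ?thesis using LD_smult[OF \<mu> s[OF that(2)] that(1)] by simp
  qed
qed

lemma D_group_module:
  assumes st: "A_stable (Gamma N p) B"
  shows "group_module (Gamma N p) (D_module B)"
proof (intro group_module.intro Gamma_group group_module_axioms.intro)
  have s: "fun_act \<gamma> f \<in> A_carrier B" if "f \<in> A_carrier B" "\<gamma> \<in> carrier (Gamma N p)" for f \<gamma>
    using st that by (simp add: A_stable_def)
  have G: "\<one>\<^bsub>Gamma N p\<^esub> = mat 1" "\<gamma> \<otimes>\<^bsub>Gamma N p\<^esub> \<delta> = \<gamma> ** \<delta>" for \<gamma> \<delta> by (simp_all add: Gamma_def)
  show "is_gmodule (Gamma N p) (D_module B)"
    unfolding is_gmodule_def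
  proof (intro conjI ballI D_comm_group)
    show "(\<lambda>x. act (D_module B) x \<gamma>) \<in> hom (D_module B) (D_module B)" if "\<gamma> \<in> carrier (Gamma N p)" for \<gamma>
      using that LD_act[OF st] s by (intro homI) (auto simp: fun_eq_iff)
    fix \<mu> assume \<mu>: "\<mu> \<in> carrier (D_module B)"
    show "act (D_module B) \<mu> \<one>\<^bsub>Gamma N p\<^esub> = \<mu>"
      using \<mu> by (auto simp: G fun_act_one fun_eq_iff linear_dual_def PiE_def extensional_def)
    show "act (D_module B) \<mu> (\<gamma> \<otimes>\<^bsub>Gamma N p\<^esub> \<delta>) = act (D_module B) (act (D_module B) \<mu> \<gamma>) \<delta>"
      if "\<gamma> \<in> carrier (Gamma N p)" "\<delta> \<in> carrier (Gamma N p)" for \<gamma> \<delta>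
      using that s by (auto simp: G fun_act_mult fun_eq_iff)
  qed
qed

definition D_crd :: "(('c \<times> 'c => 'b) => 'b) => nat \<times> nat => 'c" where
  "D_crd \<mu> = (\<lambda>(j, i)\<in>UNIV \<times> S. cf (\<mu> (f_basis B j)) i)"

lemma D_crd_bij: "bij_betw D_crd LD (UNIV \<times> S \<rightarrow>\<^sub>E Opow 0)"
proof (rule bij_betw_imageI)
  show "inj_on D_crd LD"
  proof (rule inj_onI)
    fix \<mu> \<nu> assume mn: "\<mu> \<in> LD" "\<nu> \<in> LD" "D_crd \<mu> = D_crd \<nu>"
    have "cf (\<mu> (f_basis B j)) i = cf (\<nu> (f_basis B j)) i" if "i \<in> S" for j i
      using fun_cong[OF mn(3), of "(j, i)"] that by (simp add: D_crd_def)
    then have "\<mu> (f_basis B j) = \<nu> (f_basis B j)" for j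
      using mn f_basis_A LD_closed by (intro cf_eqI) auto
    then show "\<mu> = \<nu>" using LD_ext mn by blast
  qed
  show "D_crd ` LD = (UNIV \<times> S \<rightarrow>\<^sub>E Opow 0)"
  proof (intro equalityI subsetI)
    fix v assume "v \<in> D_crd ` LD"
    then obtain \<mu> where \<mu>: "\<mu> \<in> LD" "v = D_crd \<mu>" by blast
    show "v \<in> (UNIV \<times> S \<rightarrow>\<^sub>E Opow 0)"
      unfolding \<mu>(2) by (rule PiE_I) (auto simp: D_crd_def intro!: cf_Opow LD_closed[OF \<mu>(1)] f_basis_A)
  next
    fix v :: "nat \<times> nat => 'c" assume v: "v \<in> (UNIV \<times> S \<rightarrow>\<^sub>E Opow 0)"
    define \<nu> where "\<nu> j = el (\<lambda>i. v (j, i))" for j :: nat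
    have "v (j, i) \<in> Opow 0" if "i \<in> S" for j i using v that by auto
    then have \<nu>: "\<nu> j \<in> carrier B" "i \<in> S ==> cf (\<nu> j) i = v (j, i)" for j i
      unfolding \<nu>_def using el[of "\<lambda>i. v (j, i)"] by auto
    have "D_crd (functional \<nu>) = v"
    proof
      fix q show "D_crd (functional \<nu>) q = v q"
        using functional(2)[of \<nu>, OF \<nu>(1)] \<nu>(2) PiE_arb[OF v, of q]
        by (cases q; cases "q \<in> UNIV \<times> S") (auto simp: D_crd_def)
    qed
    then show "v \<in> D_crd ` LD" using functional(1)[of \<nu>, OF \<nu>(1)] by blast
  qed
qed

text \<open>The degree of a coordinate adds the index of the basis function and the power of the
  variable coming from \<open>max_ideal_pow_eq\<close>. For indices \<open>j > n\<close> both sides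
  ask only for integrality.\<close>

lemma D_Fil_eq: "D_Fil B n = {\<mu> \<in> LD. \<forall>q\<in>UNIV \<times> S. D_crd \<mu> q \<in> Opow (n - (fst q + snd q))}"
proof -
  have "(\<forall>j\<le>n. \<mu> (f_basis B j) \<in> max_ideal_pow B (n - j)) \<longleftrightarrow>
      (\<forall>j. \<forall>i\<in>S. cf (\<mu> (f_basis B j)) i \<in> Opow (n - (j + i)))" if \<mu>: "\<mu> \<in> LD" for \<mu>
  proof -
    have c: "\<mu> (f_basis B j) \<in> carrier B" for j using LD_closed[OF \<mu> f_basis_A] .
    have "cf (\<mu> (f_basis B j)) i \<in> Opow (n - (j + i))"
      if "\<forall>j\<le>n. \<forall>i\<in>S. cf (\<mu> (f_basis B j)) i \<in> Opow (n - (j + i))" "i \<in> S" for i j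
      using that c by (cases "j \<le> n") auto
    then show ?thesis
      using c by (auto simp: max_ideal_pow_eq)
  qed
  then show ?thesis by (auto simp: D_Fil_def D_crd_def)
qed

text \<open>Compatibility with scalars: a functional with proportional coordinates is a constant
  multiple by \<open>LD_ext\<close>, and the action is by composition, which commutes with
  constants.\<close>

theorem D_coordinate_module:
  assumes st: "A_stable (Gamma N p) B" and fs: "fil_stable (Gamma N p) (D_module B) (D_Fil B)"
  shows "coordinate_module p K \<pi> (Gamma N p) (D_module B) (D_Fil B) D_crd (UNIV \<times> S) (\<lambda>q. fst q + snd q)"
proof (intro coordinate_module.intro coordinate_module_axioms.intro dv_field_axioms D_group_module[OF st] fs)
  show "bij_betw D_crd (carrier (D_module B)) (UNIV \<times> S \<rightarrow>\<^sub>E Opow 0)" using D_crd_bij by simp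
  show "D_crd (x \<otimes>\<^bsub>D_module B\<^esub> y) q = D_crd x q + D_crd y q"
    if "x \<in> carrier (D_module B)" "y \<in> carrier (D_module B)" "q \<in> UNIV \<times> S" for x y q
    using that f_basis_A by (auto simp: D_crd_def LD_closed cf_add)
  show "D_Fil B n = {x \<in> carrier (D_module B). \<forall>q\<in>UNIV \<times> S. D_crd x q \<in> Opow (n - (fst q + snd q))}" for n
    by (simp add: D_Fil_eq)
  show "finite {q \<in> UNIV \<times> S. fst q + snd q < n}" for n
    by (rule finite_subset[of _ "{..n} \<times> {..n}"]) auto
  show "UNIV \<times> S \<noteq> {}" using S_0 by blast
  fix u x y \<gamma> and q :: "nat \<times> nat"
  assume u: "u \<in> Opow 0" and x: "x \<in> carrier (D_module B)" and y: "y \<in> carrier (D_module B)"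
    and yx: "\<And>q. q \<in> UNIV \<times> S ==> D_crd y q = u * D_crd x q" and g: "\<gamma> \<in> carrier (Gamma N p)" and q: "q \<in> UNIV \<times> S"
  have x': "x \<in> LD" and y': "y \<in> LD" using x y by auto
  have "y (f_basis B j) = emb B u \<otimes> x (f_basis B j)" for j
  proof (rule cf_eqI)
    fix i assume i: "i \<in> S"
    then show "cf (y (f_basis B j)) i = cf (emb B u \<otimes> x (f_basis B j)) i"
      using yx[of "(j, i)"] u LD_closed[OF x' f_basis_A, of j] by (simp add: D_crd_def m_comm[of "emb B u"] cf_mult_emb)
  qed (use u LD_closed[OF x' f_basis_A] LD_closed[OF y' f_basis_A] in auto)
  then have "y = (\<lambda>f\<in>A_carrier B. emb B u \<otimes> x f)"
    using f_basis_A u by (intro LD_ext[OF y' LD_scale[OF x']]) auto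
  moreover have "fun_act \<gamma> (f_basis B j) \<in> A_carrier B" for j using st g f_basis_A by (simp add: A_stable_def)
  ultimately show "D_crd (act (D_module B) y \<gamma>) q = u * D_crd (act (D_module B) x \<gamma>) q"
    using q u f_basis_A LD_closed[OF x'] by (auto simp: D_crd_def m_comm[of "emb B u"] cf_mult_emb)
qed

end

section \<open>Powers of principal units and a topological generator of 1 + p Z_p\<close>

section \<open>Principal units\<close>

lemma absv_power_diff_le:
  fixes x y :: "'a :: nonarch_field"
  assumes "absv x \<le> 1" "absv y \<le> 1"
  shows "absv (x ^ n - y ^ n) \<le> absv (x - y)"
proof (induction n)
  case (Suc n)
  have "absv (x * (x ^ n - y ^ n)) \<le> absv (x - y)"
    using absv_mult_le_1[OF Suc assms(1)] by (simp add: mult.commute)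
  moreover have "absv ((x - y) * y ^ n) \<le> absv (x - y)"
    using assms(2) by (intro absv_mult_le_1) (auto simp: power_le_one)
  ultimately have "absv (x * (x ^ n - y ^ n) + (x - y) * y ^ n) \<le> absv (x - y)" by (rule absv_add_le)
  then show ?case by (simp add: algebra_simps)
qed simp

lemma na_tendsto_iff:
  fixes f :: "nat => 'a :: nonarch_field"
  shows "f \<longlonglongrightarrow> l \<longleftrightarrow> (\<forall>e>0. \<exists>N. \<forall>n\<ge>N. absv (f n - l) < e)"
  by (simp add: lim_sequentially dist_absv)

lemma absv_near_1: "absv (x - 1) < 1 ==> absv (x :: 'a :: nonarch_field) = 1"
  using absv_add_eq[of "x - 1" 1] by simp

lemma na_geometric_sums:
  fixes x :: "'a :: nonarch_field"
  assumes "absv x < 1"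
  shows "(\<lambda>n. x ^ n) sums (1 / (1 - x))"
proof -
  have x1: "x \<noteq> 1" using assms by auto
  have "(\<lambda>n. x ^ n) \<longlonglongrightarrow> 0"
    unfolding na_tendsto_0_iff
  proof (intro allI impI)
    fix e :: real assume "e > 0"
    then obtain N where N: "absv x ^ N < e" using assms real_arch_pow_inv by blast
    have "absv (x ^ n) < e" if "n \<ge> N" for n
      using N that power_decreasing[of N n "absv x"] assms by simp
    then show "\<exists>N. \<forall>n\<ge>N. absv (x ^ n) < e" by blast
  qed
  then have "(\<lambda>n. (1 - x ^ n) * (1 / (1 - x))) \<longlonglongrightarrow> (1 - 0) * (1 / (1 - x))"
    by (intro tendsto_mult tendsto_diff tendsto_const)
  moreover have "(\<Sum>i<n. x ^ i) = (1 - x ^ n) * (1 / (1 - x))" for n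
    using one_diff_power_eq[of x n] x1 by (simp add: field_simps)
  ultimately show ?thesis by (simp add: sums_def)
qed

context dv_field
begin

lemma absv_p_less: "absv (of_nat p :: 'c) < 1"
  using p_gt_1 by (simp add: absv_p)

lemma absv_p_pos: "absv (of_nat p :: 'c) > 0"
  using p_gt_1 by (simp add: absv_p)

text \<open>The cofactor, the sum of \<open>x ^ i\<close> for \<open>i < m\<close>, is congruent to
  \<open>m\<close> modulo the maximal ideal, hence a unit.\<close>

lemma absv_power_coprime:
  fixes x :: 'c
  assumes x: "absv (x - 1) < 1" and m: "\<not> p dvd m"
  shows "absv (x ^ m - 1) = absv (x - 1)"
proof -
  have "absv (x ^ i - 1) < 1" for i
    using absv_power_diff_le[of x 1 i] absv_near_1[OF x] x by simp
  then have "absv (\<Sum>i<m. x ^ i - 1) \<le> absv (x - 1)"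
    using absv_power_diff_le[of x 1] absv_near_1[OF x] by (intro absv_sum_le) auto
  then have "absv (of_nat m + (\<Sum>i<m. x ^ i - 1) :: 'c) = absv (of_nat m :: 'c)"
    using x m absv_nat_eq_1_iff[of m] by (intro absv_add_eq) simp
  then have 1: "absv (\<Sum>i<m. x ^ i) = 1" using m absv_nat_eq_1_iff[of m] by (simp add: sum_subtractf)
  have "x ^ m - 1 = (x - 1) * (\<Sum>i<m. x ^ i)" using one_diff_power_eq[of x m] by (simp add: algebra_simps)
  then show ?thesis using 1 by (simp add: absv_mult)
qed

lemma power_p_expand:
  fixes y :: 'c
  shows "(1 + y) ^ p = 1 + of_nat p * y + (\<Sum>i=2..p. of_nat (p choose i) * y ^ i)"
proof -
  have "(1 + y) ^ p = (\<Sum>i=0..p. of_nat (p choose i) * y ^ i)"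
    using binomial_ring[of y 1 p] by (simp add: add.commute atLeast0AtMost)
  also have "\<dots> = 1 + (\<Sum>i=1..p. of_nat (p choose i) * y ^ i)" by (simp add: sum.atLeast_Suc_atMost)
  also have "(\<Sum>i=1..p. of_nat (p choose i) * y ^ i) = of_nat p * y + (\<Sum>i=2..p. of_nat (p choose i) * y ^ i)"
    using p_gt_1 by (simp add: sum.atLeast_Suc_atMost numeral_2_eq_2)
  finally show ?thesis by (simp add: add.assoc)
qed

lemma absv_choose_le: "0 < i ==> i < p ==> absv (of_nat (p choose i) :: 'c) \<le> absv (of_nat p :: 'c)"
proof -
  assume "0 < i" "i < p"
  then have "p dvd (p choose i)" using dvd_choose_prime[of i p] prime_p by simp
  then obtain m where "p choose i = p * m" by blast
  then show ?thesis by (simp add: absv_mult mult_left_le)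
qed

lemma absv_power_p_le:
  fixes x :: 'c
  assumes x: "absv (x - 1) \<le> r" "r < 1" "absv (of_nat p :: 'c) \<le> r"
  shows "absv (x ^ p - 1) \<le> r * absv (x - 1)"
proof -
  define y where "y = x - 1"
  have r0: "r \<ge> 0" using x(1) absv_nonneg[of "x - 1"] by linarith
  have y: "absv y \<le> r" using x by (simp add: y_def)
  have "absv (of_nat (p choose i) * y ^ i) \<le> r * absv y" if i: "2 \<le> i" "i \<le> p" for i
  proof (cases "i = p")
    case True
    have "absv y ^ p \<le> absv y ^ 2" using y x p_gt_1 by (intro power_decreasing) auto
    also have "\<dots> \<le> r * absv y" using y by (simp add: power2_eq_square mult_right_mono)
    finally show ?thesis using True by simp
  next
    case False
    then have "absv (of_nat (p choose i) :: 'c) \<le> r" using absv_choose_le[of i] i x(3) by simp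
    moreover have "absv y ^ i \<le> absv y ^ 1" using y x i by (intro power_decreasing) auto
    ultimately show ?thesis using r0 by (auto simp: absv_mult intro!: mult_mono)
  qed
  then have "absv (\<Sum>i=2..p. of_nat (p choose i) * y ^ i) \<le> r * absv y"
    using r0 by (intro absv_sum_le) auto
  moreover have "absv (of_nat p * y) \<le> r * absv y" using x(3) by (simp add: absv_mult mult_right_mono)
  ultimately have "absv (of_nat p * y + (\<Sum>i=2..p. of_nat (p choose i) * y ^ i)) \<le> r * absv y" by (rule absv_add_le[rotated])
  moreover have "x ^ p - 1 = of_nat p * y + (\<Sum>i=2..p. of_nat (p choose i) * y ^ i)"
    using power_p_expand[of y] by (simp add: y_def)
  ultimately show ?thesis by (simp add: y_def)
qed

lemma absv_power_p_power_le:
  fixes x :: 'c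
  assumes x: "absv (x - 1) \<le> r" "r < 1" "absv (of_nat p :: 'c) \<le> r"
  shows "absv (x ^ (p ^ k) - 1) \<le> r ^ Suc k"
proof (induction k)
  case (Suc k)
  have r: "0 \<le> r" using x(1) absv_nonneg[of "x - 1"] by linarith
  have "r ^ Suc k \<le> r" using r x(2) by (simp add: mult_left_le power_le_one)
  then have "absv ((x ^ (p ^ k)) ^ p - 1) \<le> r * absv (x ^ (p ^ k) - 1)"
    using Suc x by (intro absv_power_p_le) auto
  also have "\<dots> \<le> r * r ^ Suc k" using Suc r by (intro mult_left_mono) auto
  finally show ?case by (simp add: power_mult[symmetric] mult.commute)
qed (use x in simp)

lemma absv_power_multiple_le:
  fixes x :: 'c
  assumes x: "absv (x - 1) \<le> r" "r < 1" "absv (of_nat p :: 'c) \<le> r" and n: "p ^ k dvd n"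
  shows "absv (x ^ n - 1) \<le> r ^ Suc k"
proof -
  obtain m where m: "n = p ^ k * m" using n by blast
  have ax: "absv x = 1" using absv_near_1[of x] x by simp
  have "absv ((x ^ (p ^ k)) ^ m - 1 ^ m) \<le> absv (x ^ (p ^ k) - 1)"
    using ax by (intro absv_power_diff_le) auto
  also have "\<dots> \<le> r ^ Suc k" by (rule absv_power_p_power_le[OF x])
  finally show ?thesis by (simp add: m power_mult)
qed

text \<open>This is 1 + p Z_p, as elements of Z_p of absolute value below 1 are divisible by
  \<open>p\<close>.\<close>

definition Zp1 :: "'c set" where
  "Zp1 = {t \<in> Zp. absv (t - 1) < 1}"

lemma Zp1_Zpx: "t \<in> Zp1 ==> t \<in> Zpx"
  using absv_near_1[of t] by (auto simp: Zp1_def Zpx_def)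

lemma absv_Zp_less_1: "z \<in> (Zp :: 'c set) ==> absv z < 1 ==> absv z \<le> absv (of_nat p :: 'c)"
proof -
  assume z: "z \<in> Zp" "absv z < 1"
  obtain n :: int where n: "absv (z - of_int n) \<le> (1 / real p) ^ 1" using Zp_approx_pow[OF z(1)] by blast
  moreover have "(1 / real p) ^ 1 < 1" using p_gt_1 by simp
  ultimately have "absv (z - of_int n) < 1" by linarith
  from absv_diff_less[OF z(2) this] have "absv (z - (z - of_int n)) < 1" .
  then have "absv (of_int n :: 'c) \<le> (1 / real p) ^ 1"
    using absv_int_less_iff[of n] absv_int_le_iff[of n 1] by simp
  from absv_add_le[OF n this] show ?thesis by (simp add: absv_p)
qed

lemma Zp_divide_p: "z \<in> (Zp :: 'c set) ==> absv z \<le> absv (of_nat p ^ k :: 'c) ==> z / of_nat p ^ k \<in> Zp"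
  unfolding Zp_approx[of "z / of_nat p ^ k"]
proof (intro allI impI)
  fix e :: real assume z: "z \<in> Zp" "absv z \<le> absv (of_nat p ^ k :: 'c)" and e: "e > 0"
  obtain j where j: "(1 / real p) ^ j < e" using inv_p_power_small[OF e] by blast
  obtain n :: int where n: "absv (z - of_int n) \<le> (1 / real p) ^ (j + k)" using Zp_approx_pow[OF z(1)] by blast
  have "(1 / real p) ^ (j + k) \<le> (1 / real p) ^ k" using p_gt_1 by (intro power_decreasing) auto
  then have "absv (z - of_int n) \<le> (1 / real p) ^ k" using n by linarith
  moreover have "absv z \<le> (1 / real p) ^ k" using z(2) by (simp add: absv_p)
  ultimately have "absv (z - (z - of_int n)) \<le> (1 / real p) ^ k" by (rule absv_diff_le[rotated])
  then have "int p ^ k dvd n" using absv_int_le_iff[of n k] by simp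
  then obtain m where m: "n = int p ^ k * m" by blast
  have "z / of_nat p ^ k - of_int m = (z - of_int n) / of_nat p ^ k" using p_gt_1 by (simp add: m diff_divide_distrib)
  then have "absv (z / of_nat p ^ k - of_int m) = absv (z - of_int n) / (1 / real p) ^ k"
    by (simp only: absv_divide absv_power absv_p)
  also have "\<dots> \<le> (1 / real p) ^ (j + k) / (1 / real p) ^ k" using n by (intro divide_right_mono) auto
  also have "\<dots> = (1 / real p) ^ j" using p_gt_1 by (simp add: power_add)
  finally show "\<exists>n. absv (z / of_nat p ^ k - of_int n) < e" using j by (intro exI[of _ m]) simp
qed

lemma Zp_mod_p: "z \<in> (Zp :: 'c set) ==> \<exists>i::nat. absv (z - of_nat i) \<le> absv (of_nat p :: 'c)"
proof -
  assume "z \<in> Zp"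
  then obtain n :: int where n: "absv (z - of_int n) \<le> (1 / real p) ^ 1" using Zp_approx_pow by blast
  define i where "i = nat (n mod int p)"
  have i: "int i = n mod int p" using p_gt_1 by (simp add: i_def)
  have "int p ^ 1 dvd n - int i" by (simp add: i mod_eq_dvd_iff[symmetric])
  then have "absv (of_int (n - int i) :: 'c) \<le> (1 / real p) ^ 1" using absv_int_le_iff[of "n - int i" 1] by blast
  from absv_add_le[OF n this] show ?thesis by (intro exI[of _ i]) (simp add: absv_p)
qed

end

text \<open>
  Instead of \<open>1 + p\<close> the topological generator \<open>(1 + p)\<^bsup>p - 1\<^esup>\<close> of \<open>1 + p\<int>\<^sub>p\<close> is used: accessibility of
  \<open>\<kappa>\<close> bounds \<open>\<kappa>\<close> at this element, and it is a \<open>(p - 1)\<close>-st power in \<open>\<int>\<^sub>p\<^sup>\<times>\<close>.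
\<close>

locale odd_dv_field = dv_field p K \<pi>
  for p :: nat and K :: "'c :: {nonarch_field, complete_space} set" and \<pi> :: 'c +
  assumes p_ge_3: "p \<ge> 3"
begin

definition gen :: 'c where "gen = (1 + of_nat p) ^ (p - 1)"

lemma gen_Zp: "gen \<in> Zp"
proof -
  have "gen = of_nat ((1 + p) ^ (p - 1))" by (simp add: gen_def)
  then show ?thesis using Zp_of_nat by metis
qed

lemma not_p_dvd_pred: "\<not> p dvd p - 1"
  using p_gt_1 by (auto dest: dvd_imp_le)

lemma absv_gen: "absv (gen - 1) = absv (of_nat p :: 'c)"
  using absv_power_coprime[of "1 + of_nat p" "p - 1"] absv_p_less not_p_dvd_pred by (simp add: gen_def)

lemma gen_Zp1: "gen ^ n \<in> Zp1"
proof -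
  have "absv (gen ^ n - 1 ^ n) \<le> absv (gen - 1)"
    using absv_near_1[of gen] absv_gen absv_p_less by (intro absv_power_diff_le) auto
  then show ?thesis using gen_Zp absv_gen absv_p_less by (auto simp: Zp1_def)
qed

text \<open>The linear term dominates the binomial expansion. Here \<open>p\<close> has to be odd:
  \<open>p >= 3\<close> bounds the last term by \<open>p\<close> times the square of
  \<open>x - 1\<close>, whereas for \<open>p = 2\<close> it can cancel the linear one, as
  \<open>x = -1\<close> shows.\<close>

lemma absv_power_p_eq:
  fixes x :: 'c
  assumes x: "absv (x - 1) \<le> absv (of_nat p :: 'c)"
  shows "absv (x ^ p - 1) = absv (of_nat p :: 'c) * absv (x - 1)"
proof (cases "x = 1")
  case False
  define y where "y = x - 1"
  have y: "absv y \<le> absv (of_nat p :: 'c)" using x by (simp add: y_def)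
  moreover have "absv y > 0" using False by (simp add: y_def order_less_le)
  moreover have "absv y < 1" using y absv_p_less by linarith
  ultimately have y: "absv y \<le> absv (of_nat p :: 'c)" "absv y > 0" "absv y < 1" by auto
  let ?P = "absv (of_nat p :: 'c)"
  have "absv (of_nat (p choose i) * y ^ i) \<le> ?P * absv y ^ 2" if i: "2 \<le> i" "i \<le> p" for i
  proof (cases "i = p")
    case True
    have "absv y ^ p \<le> absv y ^ 3" using y p_ge_3 by (intro power_decreasing) auto
    also have "\<dots> \<le> ?P * absv y ^ 2" using y by (simp add: eval_nat_numeral mult_right_mono)
    finally show ?thesis using True by simp
  next
    case False
    have "absv y ^ i \<le> absv y ^ 2" using y i by (intro power_decreasing) auto
    then show ?thesis using absv_choose_le[of i] i False by (auto simp: absv_mult intro!: mult_mono)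
  qed
  then have "absv (\<Sum>i=2..p. of_nat (p choose i) * y ^ i) \<le> ?P * absv y ^ 2"
    by (intro absv_sum_le) auto
  also have "\<dots> < ?P * absv y" using y absv_p_pos by (simp add: power2_eq_square)
  finally have "absv (of_nat p * y + (\<Sum>i=2..p. of_nat (p choose i) * y ^ i)) = absv (of_nat p * y)"
    by (intro absv_add_eq) (simp add: absv_mult)
  moreover have "x ^ p - 1 = of_nat p * y + (\<Sum>i=2..p. of_nat (p choose i) * y ^ i)"
    using power_p_expand[of y] by (simp add: y_def)
  ultimately show ?thesis by (simp add: y_def absv_mult)
qed (simp add: p_ge_3)

text \<open>The induction strips one factor \<open>p\<close> at a time by
  \<open>absv_power_p_eq\<close>; exponents prime to \<open>p\<close> are covered by
  \<open>absv_power_coprime\<close>.\<close>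

lemma absv_gen_power: "absv (gen ^ n - 1) = absv (of_nat p :: 'c) * absv (of_nat n :: 'c)"
proof (induction n rule: less_induct)
  case (less n)
  consider "n = 0" | "n > 0" "p dvd n" | "\<not> p dvd n" by blast
  then show ?case
  proof cases
    case 2
    then obtain m where m: "n = p * m" by blast
    then have "m < n" using 2 p_gt_1 by simp
    then have IH: "absv (gen ^ m - 1) = absv (of_nat p :: 'c) * absv (of_nat m :: 'c)" by (rule less)
    then have "absv ((gen ^ m) ^ p - 1) = absv (of_nat p :: 'c) * absv (gen ^ m - 1)"
      by (intro absv_power_p_eq) (simp add: mult_left_le)
    then show ?thesis by (simp add: IH m absv_mult power_mult[symmetric] mult.commute)
  next
    case 3
    then show ?thesis
      using absv_power_coprime[of gen n] absv_gen absv_p_less absv_nat_eq_1_iff[of n] by simp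
  qed simp
qed

text \<open>Successive approximation: multiplying by \<open>gen ^ (p ^ k * i)\<close> changes the
  value, to first order, by \<open>i\<close> times a unit multiple of \<open>p ^ Suc k\<close>, and
  \<open>i\<close> is chosen modulo \<open>p\<close> to cancel the current error.\<close>

lemma gen_dense:
  assumes t: "t \<in> Zp1"
  shows "\<exists>a::nat. absv (t - gen ^ a) \<le> absv (of_nat p :: 'c) ^ Suc k"
proof (induction k)
  case 0
  show ?case using t absv_Zp_less_1[of "t - 1"] by (intro exI[of _ 0]) (auto simp: Zp1_def)
next
  case (Suc k)
  let ?P = "of_nat p :: 'c"
  obtain a where a: "absv (t - gen ^ a) \<le> absv ?P ^ Suc k" using Suc by blast
  define \<theta> where "\<theta> = (t - gen ^ a) / ?P ^ Suc k"
  define \<eta> where "\<eta> = (gen ^ (p ^ k) - 1) / ?P ^ Suc k"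
  have ga: "gen ^ a \<in> Zpx" using gen_Zp1 Zp1_Zpx by blast
  have \<theta>: "\<theta> \<in> Zp" using a t gen_Zp unfolding \<theta>_def by (intro Zp_divide_p) (auto simp: Zp1_def absv_mult)
  have a\<eta>: "absv (gen ^ (p ^ k) - 1) = absv ?P ^ Suc k" by (simp add: absv_gen_power)
  have "\<eta> \<in> Zp" using a\<eta> gen_Zp unfolding \<eta>_def by (intro Zp_divide_p) (auto simp: absv_mult)
  then have \<eta>: "\<eta> \<in> Zpx" using a\<eta> p_gt_1 by (simp add: Zpx_def \<eta>_def absv_divide absv_mult)
  have "\<theta> / (\<eta> * gen ^ a) \<in> Zp" using \<theta> \<eta> ga by (intro Zp_divide) auto
  then obtain i :: nat where i: "absv (\<theta> / (\<eta> * gen ^ a) - of_nat i) \<le> absv ?P" using Zp_mod_p by blast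
  have "\<eta> * gen ^ a \<in> Zpx" using \<eta> ga by blast
  then have n0: "\<eta> * gen ^ a \<noteq> 0" and n1: "absv (\<eta> * gen ^ a) = 1" using Zpx_nz by (blast, simp add: Zpx_def)
  have "\<theta> - of_nat i * (\<eta> * gen ^ a) = (\<theta> / (\<eta> * gen ^ a) - of_nat i) * (\<eta> * gen ^ a)"
    using n0 by (simp add: field_simps)
  then have 1: "absv (\<theta> - of_nat i * (\<eta> * gen ^ a)) \<le> absv ?P" using i n1 by (simp add: absv_mult)
  let ?x = "gen ^ (p ^ k)"
  \<comment> \<open>First-order expansion of the power; the error is quadratic in
    \<open>?x - 1\<close>, and \<open>2 * Suc k\<close> is at least
    \<open>Suc (Suc k)\<close>.\<close>
  have "absv (?x ^ i - 1 - of_nat i * (?x - 1)) \<le> absv (?x - 1) ^ 2"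
  proof (induction i)
    case (Suc i)
    have "absv ((?x ^ i - 1) * (?x - 1)) \<le> absv (?x - 1) ^ 2"
      using absv_power_diff_le[of ?x 1 i] gen_Zp1[of "p ^ k"] absv_near_1[of ?x]
      by (simp add: absv_mult power2_eq_square mult_right_mono Zp1_def)
    from absv_add_le[OF Suc this] show ?case by (simp add: algebra_simps)
  qed simp
  also have "absv (?x - 1) ^ 2 = absv ?P ^ (2 * Suc k)" by (simp only: a\<eta> power_mult[symmetric] mult.commute)
  also have "\<dots> \<le> absv ?P ^ Suc (Suc k)" using absv_p_less by (intro power_decreasing) auto
  finally have "absv (gen ^ a * (?x ^ i - 1 - of_nat i * (?x - 1))) \<le> absv ?P ^ Suc (Suc k)"
    using ga by (simp add: absv_mult Zpx_def del: power_Suc absv_power)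
  moreover have "absv (?P ^ Suc k * (\<theta> - of_nat i * (\<eta> * gen ^ a))) \<le> absv ?P ^ Suc (Suc k)"
    using mult_left_mono[OF 1, of "absv ?P ^ Suc k"] by (simp add: absv_mult mult_ac)
  ultimately have "absv (?P ^ Suc k * (\<theta> - of_nat i * (\<eta> * gen ^ a)) - gen ^ a * (?x ^ i - 1 - of_nat i * (?x - 1)))
      \<le> absv ?P ^ Suc (Suc k)" by (intro absv_diff_le)
  moreover have "?P ^ Suc k * (\<theta> - of_nat i * (\<eta> * gen ^ a)) - gen ^ a * (?x ^ i - 1 - of_nat i * (?x - 1))
      = t - gen ^ (a + p ^ k * i)"
  proof -
    have "?P ^ Suc k * \<theta> = t - gen ^ a" "?P ^ Suc k * \<eta> = ?x - 1"
      using p_nz by (simp_all add: \<theta>_def \<eta>_def del: of_nat_eq_0_iff)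
    then have "?P ^ Suc k * (\<theta> - of_nat i * (\<eta> * gen ^ a)) = t - gen ^ a - of_nat i * ((?x - 1) * gen ^ a)"
      by (metis (no_types, lifting) mult.assoc mult.left_commute right_diff_distrib)
    moreover have "gen ^ (a + p ^ k * i) = gen ^ a * ?x ^ i" by (simp add: power_add power_mult)
    ultimately show ?thesis by (simp only: right_diff_distrib) (simp add: algebra_simps)
  qed
  ultimately show ?case by metis
qed

lemma gen_limit:
  assumes t: "t \<in> Zp1"
  shows "\<exists>a. (\<lambda>k. gen ^ a k) \<longlonglongrightarrow> t"
proof -
  obtain a where a: "\<And>k. absv (t - gen ^ a k) \<le> absv (of_nat p :: 'c) ^ Suc k" using gen_dense[OF t] by metis
  have "(\<lambda>k. gen ^ a k) \<longlonglongrightarrow> t"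
    unfolding na_tendsto_iff
  proof (intro allI impI)
    fix e :: real assume "e > 0"
    then obtain N where N: "absv (of_nat p :: 'c) ^ N < e" using absv_p_less real_arch_pow_inv by blast
    have "absv (gen ^ a k - t) < e" if "k \<ge> N" for k
    proof -
      have "absv (of_nat p :: 'c) ^ Suc k \<le> absv (of_nat p :: 'c) ^ N"
        using that absv_p_less by (intro power_decreasing) auto
      then show ?thesis using a[of k] N by (simp add: absv_minus_commute)
    qed
    then show "\<exists>N. \<forall>k\<ge>N. absv (gen ^ a k - t) < e" by blast
  qed
  then show ?thesis by blast
qed

subsection \<open>Restricted power series\<close>

text \<open>For \<open>w = 0\<close> these are the functions f(1, z) with f in A over O_K; a growing
  \<open>w\<close> records the divisibility of coefficients behind the stability of the
  filtration.\<close>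

definition rps :: "(nat => nat) => ('c => 'c) => bool" where
  "rps w g \<longleftrightarrow> (\<exists>a. (\<forall>n. a n \<in> Opow (w n)) \<and> a \<longlonglongrightarrow> 0 \<and> (\<forall>z\<in>Zp. (\<lambda>n. a n * z ^ n) sums g z))"

lemma rps_cong: "rps w g ==> (\<And>z. z \<in> Zp ==> g z = h z) ==> rps w h"
  by (auto simp: rps_def)

lemma rps_mono: "rps w g ==> (\<And>n. v n \<le> w n) ==> rps v g"
  unfolding rps_def using Opow_antimonoD by blast

lemma rps_poly:
  assumes "\<And>n. a n \<in> Opow (w n)" "\<And>n. n \<ge> N ==> a n = 0"
  shows "rps w (\<lambda>z. \<Sum>n<N. a n * z ^ n)"
proof -
  have "(\<lambda>n. a n * z ^ n) sums (\<Sum>n<N. a n * z ^ n)" for z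
    by (rule sums_finite) (use assms in \<open>auto simp: not_less\<close>)
  moreover have "a \<longlonglongrightarrow> 0" by (rule tendsto_eventually) (use assms(2) in \<open>auto simp: eventually_sequentially\<close>)
  ultimately show ?thesis using assms(1) unfolding rps_def by blast
qed

lemma rps_linear:
  assumes "c \<in> Opow (w 0)" "e \<in> Opow (w 1)"
  shows "rps w (\<lambda>z. c + e * z)"
proof -
  have "rps w (\<lambda>z. \<Sum>n<2. (if n = 0 then c else if n = 1 then e else 0) * z ^ n)"
    using assms by (intro rps_poly) auto
  then show ?thesis by (rule rps_cong) (simp add: numeral_2_eq_2)
qed

lemma rps_const: "c \<in> Opow (w 0) ==> rps w (\<lambda>z. c)"
  using rps_linear[of c w 0] by simp

lemma rps_add: "rps w g ==> rps w h ==> rps w (\<lambda>z. g z + h z)"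
proof -
  assume gh: "rps w g" "rps w h"
  obtain a where a: "\<And>n. a n \<in> Opow (w n)" "a \<longlonglongrightarrow> 0" "\<And>z. z \<in> Zp ==> (\<lambda>n. a n * z ^ n) sums g z"
    using gh(1) unfolding rps_def by blast
  obtain b where b: "\<And>n. b n \<in> Opow (w n)" "b \<longlonglongrightarrow> 0" "\<And>z. z \<in> Zp ==> (\<lambda>n. b n * z ^ n) sums h z"
    using gh(2) unfolding rps_def by blast
  note ab = a b
  show ?thesis
    unfolding rps_def using ab(1,4) tendsto_add[OF ab(2,5)] sums_add[OF ab(3,6)]
    by (intro exI[of _ "\<lambda>n. a n + b n"]) (auto simp: distrib_right)
qed

lemma rps_mult:
  assumes "rps w g" "rps v h" and u: "\<And>i n. i \<le> n ==> u n \<le> w i + v (n - i)"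
  shows "rps u (\<lambda>z. g z * h z)"
proof -
  obtain a where a: "\<And>n. a n \<in> Opow (w n)" "a \<longlonglongrightarrow> 0" "\<And>z. z \<in> Zp ==> (\<lambda>n. a n * z ^ n) sums g z"
    using assms(1) unfolding rps_def by blast
  obtain b where b: "\<And>n. b n \<in> Opow (v n)" "b \<longlonglongrightarrow> 0" "\<And>z. z \<in> Zp ==> (\<lambda>n. b n * z ^ n) sums h z"
    using assms(2) unfolding rps_def by blast
  note ab = a b
  define e where "e n = (\<Sum>i\<le>n. a i * b (n - i))" for n
  have s: "(\<lambda>n. e n * z ^ n) sums (g z * h z)" if z: "z \<in> Zp" for z
  proof -
    have "(\<Sum>i\<le>n. (a i * z ^ i) * (b (n - i) * z ^ (n - i))) = e n * z ^ n" for n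
      unfolding e_def sum_distrib_right
    proof (rule sum.cong[OF refl])
      fix i assume "i \<in> {..n}"
      then have "z ^ n = z ^ i * z ^ (n - i)" by (simp flip: power_add)
      then show "(a i * z ^ i) * (b (n - i) * z ^ (n - i)) = a i * b (n - i) * z ^ n" by simp
    qed
    then show ?thesis using na_cauchy_product[OF ab(3)[OF z] ab(6)[OF z]] by simp
  qed
  \<comment> \<open>Convergence at \<open>z = 1\<close> forces the coefficients to tend to
    0.\<close>
  have "e \<longlonglongrightarrow> 0" using na_sums_tendsto_0[OF s[OF Zp_1]] by simp
  moreover have "e n \<in> Opow (u n)" for n
    unfolding e_def by (intro Opow_sum Opow_antimonoD[OF Opow_mult[OF ab(1,4)]] u) auto
  ultimately show ?thesis using s unfolding rps_def by blast
qed

lemma rps0_mult: "rps (\<lambda>_. 0) g ==> rps (\<lambda>_. 0) h ==> rps (\<lambda>_. 0) (\<lambda>z. g z * h z)"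
  by (rule rps_mult) auto

lemma rps0_power: "rps (\<lambda>_. 0) g ==> rps (\<lambda>_. 0) (\<lambda>z. g z ^ n)"
  by (induction n) (auto intro: rps_const rps0_mult)

lemma rps0_sum: "(\<And>i. i \<in> A ==> rps (\<lambda>_. 0) (g i)) ==> rps (\<lambda>_. 0) (\<lambda>z. \<Sum>i\<in>A. g i z)"
  by (induction A rule: infinite_finite_induct) (auto intro: rps_const rps_add)

lemma rps_scale:
  assumes "rps (\<lambda>_. 0) g" "e \<in> Zp"
  shows "rps (\<lambda>_. 0) (\<lambda>z. g (e * z))"
proof -
  obtain a where a: "\<And>n. a n \<in> Opow 0" "a \<longlonglongrightarrow> 0" "\<And>z. z \<in> Zp ==> (\<lambda>n. a n * z ^ n) sums g z"
    using assms(1) by (auto simp: rps_def)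
  have s: "(\<lambda>n. (a n * e ^ n) * z ^ n) sums g (e * z)" if "z \<in> Zp" for z
    using a(3)[OF Zp_mult[OF assms(2) that]] by (simp add: power_mult_distrib mult.assoc)
  have "(\<lambda>n. a n * e ^ n) \<longlonglongrightarrow> 0" using na_sums_tendsto_0[OF s[OF Zp_1]] by simp
  moreover have "a n * e ^ n \<in> Opow 0" for n using a(1) Zp_Opow[OF assms(2)] by blast
  ultimately show ?thesis using s unfolding rps_def by (intro exI[of _ "\<lambda>n. a n * e ^ n"]) auto
qed

text \<open>Powers of \<open>z\<close> are collected in a series of series. The interchange is
  legitimate because \<open>b\<close> tends to 0 and the coefficients of each \<open>g n\<close> are
  integral and tend to 0.\<close>

lemma rps_series:
  assumes g: "\<And>n. rps w (g n)" and b: "\<And>n. b n \<in> Opow 0" "b \<longlonglongrightarrow> 0"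
    and h: "\<And>z. z \<in> Zp ==> (\<lambda>n. b n * g n z) sums h z"
  shows "rps w h"
proof -
  obtain a where a: "\<And>n m. a n m \<in> Opow (w m)" "\<And>n. a n \<longlonglongrightarrow> 0" "\<And>n z. z \<in> Zp ==> (\<lambda>m. a n m * z ^ m) sums g n z"
    using g unfolding rps_def by metis
  have a1: "absv (a n m) \<le> 1" for n m using Opow_antimonoD[OF a(1), of 0] by (auto simp: Opow_0)
  have b1: "absv (b n) \<le> 1" for n using b(1) by (auto simp: Opow_0)
  define f where "f z n m = b n * a n m * z ^ m" for z n m
  have dn: "doubly_null (f z)" if z: "z \<in> Zp" for z
    unfolding doubly_null_def
  proof (intro allI impI)
    fix e :: real assume e: "e > 0"
    have zm: "absv (z ^ m) \<le> 1" for m using Zp_absv_le[OF z] by (simp add: power_le_one)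
    obtain N where N: "\<And>n. n \<ge> N ==> absv (b n) < e" using b(2) e unfolding na_tendsto_0_iff by blast
    have "\<exists>M. \<forall>m\<ge>M. absv (a n m) < e" for n using a(2) e unfolding na_tendsto_0_iff by blast
    then obtain M where M: "\<And>n m. m \<ge> M n ==> absv (a n m) < e" by metis
    have "absv (f z n m) < e" if "n \<ge> N + (\<Sum>i<N. M i) \<or> m \<ge> N + (\<Sum>i<N. M i)" for n m
    proof (cases "n \<ge> N")
      case True
      have "absv (f z n m) \<le> absv (b n)"
        unfolding f_def by (intro absv_mult_le_1 order.refl a1 zm)
      then show ?thesis using N[OF True] by linarith
    next
      case False
      then have "M n \<le> (\<Sum>i<N. M i)" by (intro member_le_sum) auto
      then have "absv (a n m) < e" using that False by (intro M) auto
      moreover have "absv (a n m * b n * z ^ m) \<le> absv (a n m)" by (intro absv_mult_le_1 order.refl b1 zm)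
      ultimately show ?thesis by (simp add: f_def mult.commute[of "b n"])
    qed
    then show "\<exists>N. \<forall>m n. N \<le> m \<or> N \<le> n \<longrightarrow> absv (f z m n) < e" by blast
  qed
  define c where "c m = (\<Sum>n. b n * a n m)" for m
  have c: "(\<lambda>n. b n * a n m) sums c m" "c m \<in> Opow (w m)" for m
  proof -
    have "(\<lambda>n. b n * a n m) \<longlonglongrightarrow> 0"
      unfolding na_tendsto_0_iff
    proof (intro allI impI)
      fix e :: real assume "e > 0"
      then obtain N where N: "\<And>n. n \<ge> N ==> absv (b n) < e" using b(2) unfolding na_tendsto_0_iff by blast
      have "absv (b n * a n m) < e" if "n \<ge> N" for n
        using absv_mult_le_1[OF order.refl a1, of "b n" n m] N[OF that] by linarith
      then show "\<exists>N. \<forall>n\<ge>N. absv (b n * a n m) < e" by blast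
    qed
    then have s: "(\<lambda>n. b n * a n m) sums c m" unfolding c_def by (intro summable_sums na_summable)
    then show "(\<lambda>n. b n * a n m) sums c m" .
    show "c m \<in> Opow (w m)"
    proof (rule Lim_in_closed_set[OF closed_Opow])
      show "(\<lambda>k. \<Sum>n<k. b n * a n m) \<longlonglongrightarrow> c m" using s by (simp add: sums_def)
      show "\<forall>\<^sub>F k in sequentially. (\<Sum>n<k. b n * a n m) \<in> Opow (w m)"
        by (intro always_eventually allI Opow_sum Opow_mult_left b(1) a(1))
    qed simp
  qed
  have s: "(\<lambda>m. c m * z ^ m) sums h z" if z: "z \<in> Zp" for z
  proof -
    have "f z n sums (b n * g n z)" for n
    proof -
      have "f z n = (\<lambda>m. b n * (a n m * z ^ m))" by (auto simp: f_def)
      then show ?thesis using na_sums_mult[OF a(3)[OF z], of "b n" n] by simp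
    qed
    moreover have "(\<lambda>n. f z n m) sums (c m * z ^ m)" for m
      using na_sums_mult[OF c(1)[of m], of "z ^ m"] by (simp add: f_def mult.commute)
    ultimately have "\<exists>s. (\<lambda>n. b n * g n z) sums s \<and> (\<lambda>m. c m * z ^ m) sums s"
      by (rule na_fubini[OF dn[OF z]])
    then obtain s where "(\<lambda>n. b n * g n z) sums s" "(\<lambda>m. c m * z ^ m) sums s" by blast
    then show ?thesis using sums_unique2[OF h[OF z]] by metis
  qed
  have "c \<longlonglongrightarrow> 0" using na_sums_tendsto_0[OF s[OF Zp_1]] by simp
  then show ?thesis using s c(2) unfolding rps_def by blast
qed

lemma rps_Lipschitz:
  assumes "rps (\<lambda>_. 0) g" "z \<in> Zp" "y \<in> Zp"
  shows "absv (g z - g y) \<le> absv (z - y)"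
proof -
  obtain a where a: "\<And>n. a n \<in> Opow 0" "\<And>z. z \<in> Zp ==> (\<lambda>n. a n * z ^ n) sums g z"
    using assms(1) by (auto simp: rps_def)
  have "absv (a n * z ^ n - a n * y ^ n) \<le> absv (z - y)" for n
  proof -
    have "absv ((z ^ n - y ^ n) * a n) \<le> absv (z - y)"
      using a(1)[of n] assms Zp_absv_le by (intro absv_mult_le_1 absv_power_diff_le) (auto simp: Opow_0)
    then show ?thesis by (simp add: algebra_simps)
  qed
  then show ?thesis
    by (rule na_sums_bound[OF na_sums_diff[OF a(2)[OF assms(2)] a(2)[OF assms(3)]]]) simp
qed

lemma rps_tendsto:
  assumes "rps (\<lambda>_. 0) g" "z \<in> Zp" "\<And>n. y n \<in> Zp" "y \<longlonglongrightarrow> z"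
  shows "(\<lambda>n. g (y n)) \<longlonglongrightarrow> g z"
  unfolding na_tendsto_iff
proof (intro allI impI)
  fix e :: real assume "e > 0"
  then obtain N where N: "\<And>n. n \<ge> N ==> absv (y n - z) < e" using assms(4) unfolding na_tendsto_iff by blast
  have "absv (g (y n) - g z) < e" if "n \<ge> N" for n
    using rps_Lipschitz[OF assms(1) assms(3)[of n] assms(2)] N[OF that] by linarith
  then show "\<exists>N. \<forall>n\<ge>N. absv (g (y n) - g z) < e" by blast
qed

end

context odd_dv_field
begin

subsection \<open>The logarithm\<close>

text \<open>
  \<open>log (1 + p u) / p\<close> is the limit of the polynomials \<open>((1 + p u)\<^bsup>p^n\<^esup> - 1) / p\<^bsup>n+1\<^esup>\<close>, whose
  successive differences are integral polynomials divisible by \<open>p\<^bsup>n+1\<^esup>\<close>.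
\<close>

definition plog_approx :: "nat => 'c => 'c" where
  "plog_approx n u = ((1 + of_nat p * u) ^ (p ^ n) - 1) / of_nat p ^ (n + 1)"

text \<open>With \<open>Y = plog_approx n u\<close>, this expands the \<open>p\<close>-th power of
  \<open>1 + p ^ (n + 1) * Y\<close>. Its terms of degree at least two are divisible by
  \<open>p ^ (2 * n + 3)\<close>, the last one because \<open>p >= 3\<close>; of this,
  \<open>p ^ (n + 2)\<close> is the denominator of the next approximation.\<close>

lemma plog_approx_step:
  "\<exists>e :: nat => nat. \<forall>u. plog_approx (Suc n) u =
     plog_approx n u + of_nat p ^ (n + 1) * (\<Sum>i=2..p. of_nat (e i) * plog_approx n u ^ i)"
proof -
  have "p ^ (2 * n + 3) dvd (p choose i) * p ^ ((n + 1) * i)" if i: "2 \<le> i" "i \<le> p" for i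
  proof (cases "i = p")
    case True
    have "(n + 1) * 3 \<le> (n + 1) * p" using p_ge_3 by (intro mult_left_mono) auto
    then have "p ^ (2 * n + 3) dvd p ^ ((n + 1) * p)" by (intro le_imp_power_dvd) simp
    then show ?thesis using True by simp
  next
    case False
    then have "p dvd (p choose i)" using dvd_choose_prime[of i p] prime_p i by simp
    moreover have "(n + 1) * 2 \<le> (n + 1) * i" using i by (intro mult_left_mono) auto
    then have "p ^ (2 * n + 2) dvd p ^ ((n + 1) * i)" by (intro le_imp_power_dvd) simp
    ultimately have "p * p ^ (2 * n + 2) dvd (p choose i) * p ^ ((n + 1) * i)" by (rule mult_dvd_mono)
    then show ?thesis by (simp add: eval_nat_numeral)
  qed
  then have "\<exists>e. \<forall>i. 2 \<le> i \<and> i \<le> p \<longrightarrow> (p choose i) * p ^ ((n + 1) * i) = p ^ (2 * n + 3) * e i"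
    unfolding dvd_def by metis
  then obtain e where e: "\<And>i. 2 \<le> i ==> i \<le> p ==> (p choose i) * p ^ ((n + 1) * i) = p ^ (2 * n + 3) * e i"
    by blast
  let ?P = "of_nat p :: 'c"
  have "plog_approx (Suc n) u = plog_approx n u + ?P ^ (n + 1) * (\<Sum>i=2..p. of_nat (e i) * plog_approx n u ^ i)" for u
  proof -
    let ?Y = "plog_approx n u"
    have Y: "(1 + ?P * u) ^ (p ^ n) = 1 + ?P ^ (n + 1) * ?Y"
      using p_nz by (simp add: plog_approx_def del: of_nat_eq_0_iff)
    have trm: "of_nat (p choose i) * (?P ^ (n + 1) * ?Y) ^ i = ?P ^ (2 * n + 3) * (of_nat (e i) * ?Y ^ i)"
      if "i \<in> {2..p}" for i
    proof -
      have "of_nat (p choose i) * ?P ^ ((n + 1) * i) = (of_nat ((p choose i) * p ^ ((n + 1) * i)) :: 'c)" by simp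
      also have "\<dots> = of_nat (p ^ (2 * n + 3) * e i)" using e[of i] that by simp
      finally have "of_nat (p choose i) * ?P ^ ((n + 1) * i) = ?P ^ (2 * n + 3) * of_nat (e i)" by simp
      then show ?thesis by (simp only: power_mult_distrib power_mult mult.assoc[symmetric])
    qed
    have "(1 + ?P * u) ^ (p ^ Suc n) = (1 + ?P ^ (n + 1) * ?Y) ^ p"
      unfolding Y[symmetric] by (simp only: power_Suc mult.commute[of p] power_mult)
    also have "\<dots> = 1 + ?P * (?P ^ (n + 1) * ?Y) + (\<Sum>i=2..p. ?P ^ (2 * n + 3) * (of_nat (e i) * ?Y ^ i))"
      unfolding power_p_expand using trm by (intro arg_cong2[of _ _ _ _ "(+)"] sum.cong refl) auto
    finally have "(1 + ?P * u) ^ (p ^ Suc n) - 1 =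
        ?P ^ (Suc n + 1) * ?Y + ?P ^ (2 * n + 3) * (\<Sum>i=2..p. of_nat (e i) * ?Y ^ i)"
      by (simp add: sum_distrib_left mult.assoc)
    also have "\<dots> = ?P ^ (Suc n + 1) * (?Y + ?P ^ (n + 1) * (\<Sum>i=2..p. of_nat (e i) * ?Y ^ i))"
    proof -
      have "2 * n + 3 = (Suc n + 1) + (n + 1)" by simp
      then have "?P ^ (2 * n + 3) = ?P ^ (Suc n + 1) * ?P ^ (n + 1)" by (simp only: power_add)
      then show ?thesis by (simp only: distrib_left mult.assoc)
    qed
    finally show ?thesis unfolding plog_approx_def[of "Suc n"] using p_nz by (simp del: of_nat_eq_0_iff)
  qed
  then show ?thesis by blast
qed

definition plog_coef :: "nat => nat => nat" where
  "plog_coef n = (SOME e. \<forall>u. plog_approx (Suc n) u =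
     plog_approx n u + of_nat p ^ (n + 1) * (\<Sum>i=2..p. of_nat (e i) * plog_approx n u ^ i))"

definition plog_diff :: "nat => 'c => 'c" where
  "plog_diff n u = (\<Sum>i=2..p. of_nat (plog_coef n i) * plog_approx n u ^ i)"

lemma plog_approx_Suc: "plog_approx (Suc n) u = plog_approx n u + of_nat p ^ (n + 1) * plog_diff n u"
  using someI_ex[OF plog_approx_step[of n]] unfolding plog_coef_def[symmetric] plog_diff_def by blast

lemma plog_approx_0: "plog_approx 0 u = u"
  using p_gt_1 by (simp add: plog_approx_def)

lemma Opow_0I: "x \<in> Opow n ==> x \<in> Opow 0"
  by (auto intro: Opow_antimonoD)

lemma p_power_Opow_0: "of_nat p ^ n \<in> Opow 0"
  using p_power_Opow Opow_0I by blast

lemma rps0_plog_approx: "rps (\<lambda>_. 0) (plog_approx n)"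
  and rps0_plog_diff: "rps (\<lambda>_. 0) (plog_diff n)"
proof -
  have d: "rps (\<lambda>_. 0) (plog_diff n)" if "rps (\<lambda>_. 0) (plog_approx n)" for n
    unfolding plog_diff_def[abs_def] using that
    by (intro rps0_sum rps0_mult rps0_power) (auto intro: rps_const)
  show a: "rps (\<lambda>_. 0) (plog_approx n)" for n
  proof (induction n)
    case 0
    have "rps (\<lambda>_. 0) (\<lambda>z. 0 + 1 * z)" by (rule rps_linear) auto
    then show ?case by (rule rps_cong) (simp add: plog_approx_0)
  next
    case (Suc n)
    have "rps (\<lambda>_. 0) (\<lambda>u. plog_approx n u + of_nat p ^ (n + 1) * plog_diff n u)"
      by (intro rps_add rps0_mult Suc d rps_const p_power_Opow_0)
    then show ?case by (rule rps_cong) (simp add: plog_approx_Suc)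
  qed
  show "rps (\<lambda>_. 0) (plog_diff n)" by (rule d[OF a])
qed

lemma rps_value: "rps (\<lambda>_. 0) g ==> z \<in> Zp ==> g z \<in> Opow 0"
proof -
  assume g: "rps (\<lambda>_. 0) g" and z: "z \<in> Zp"
  then obtain a where a: "\<And>n. a n \<in> Opow 0" "(\<lambda>n. a n * z ^ n) sums g z" unfolding rps_def by blast
  have az: "a n * z ^ n \<in> Opow 0" for n using a(1) Zp_Opow[OF z] by blast
  show ?thesis
  proof (rule Lim_in_closed_set[OF closed_Opow])
    show "(\<lambda>k. \<Sum>n<k. a n * z ^ n) \<longlonglongrightarrow> g z" using a(2) by (simp add: sums_def)
    show "\<forall>\<^sub>F k in sequentially. (\<Sum>n<k. a n * z ^ n) \<in> Opow 0"
      by (intro always_eventually allI Opow_sum az)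
  qed simp
qed

lemma p_power_tendsto_0: "(\<lambda>n. of_nat p ^ (n + 1) :: 'c) \<longlonglongrightarrow> 0"
  unfolding na_tendsto_0_iff
proof (intro allI impI)
  fix e :: real assume "e > 0"
  then obtain N where N: "absv (of_nat p :: 'c) ^ N < e" using absv_p_less real_arch_pow_inv by blast
  have "absv (of_nat p ^ (n + 1) :: 'c) < e" if "n \<ge> N" for n
  proof -
    have "absv (of_nat p :: 'c) ^ (n + 1) \<le> absv (of_nat p :: 'c) ^ N"
      using that absv_p_less by (intro power_decreasing) auto
    then show ?thesis using N unfolding absv_power by linarith
  qed
  then show "\<exists>N. \<forall>n\<ge>N. absv (of_nat p ^ (n + 1) :: 'c) < e" by blast
qed

lemma na_null_mult_bounded:
  fixes b c :: "nat => 'c"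
  assumes "b \<longlonglongrightarrow> 0" "\<And>n. absv (c n) \<le> 1"
  shows "(\<lambda>n. b n * c n) \<longlonglongrightarrow> 0"
  unfolding na_tendsto_0_iff
proof (intro allI impI)
  fix e :: real assume "e > 0"
  then obtain N where N: "\<And>n. n \<ge> N ==> absv (b n) < e" using assms(1) unfolding na_tendsto_0_iff by blast
  have "absv (b n * c n) < e" if "n \<ge> N" for n
    using absv_mult_le_1[OF order.refl assms(2), of "b n" n] N[OF that] by linarith
  then show "\<exists>N. \<forall>n\<ge>N. absv (b n * c n) < e" by blast
qed

definition plog :: "'c => 'c" where
  "plog u = u + (\<Sum>n. of_nat p ^ (n + 1) * plog_diff n u)"

lemma plog_sums:
  assumes u: "u \<in> Zp"
  shows "(\<lambda>n. of_nat p ^ (n + 1) * plog_diff n u) sums (plog u - u)"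
proof -
  have "absv (plog_diff n u) \<le> 1" for n using rps_value[OF rps0_plog_diff u] by (auto simp: Opow_0)
  then have "(\<lambda>n. of_nat p ^ (n + 1) * plog_diff n u) \<longlonglongrightarrow> 0" by (rule na_null_mult_bounded[OF p_power_tendsto_0])
  from summable_sums[OF na_summable[OF this]] show ?thesis unfolding plog_def by (simp only: add_diff_cancel_left')
qed

lemma plog_tendsto:
  assumes u: "u \<in> Zp"
  shows "(\<lambda>n. plog_approx n u) \<longlonglongrightarrow> plog u"
proof -
  have "plog_approx n u = u + (\<Sum>i<n. of_nat p ^ (i + 1) * plog_diff i u)" for n
    by (induction n) (simp_all add: plog_approx_0 plog_approx_Suc)
  moreover have "(\<lambda>n. u + (\<Sum>i<n. of_nat p ^ (i + 1) * plog_diff i u)) \<longlonglongrightarrow> u + (plog u - u)"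
    using plog_sums[OF u] unfolding sums_def by (intro tendsto_add tendsto_const)
  ultimately show ?thesis by simp
qed

lemma rps0_plog: "rps (\<lambda>_. 0) plog"
proof -
  have id: "rps (\<lambda>_. 0) (\<lambda>z. 0 + 1 * z)" by (rule rps_linear) auto
  have "rps (\<lambda>_. 0) (\<lambda>u. plog u - u)"
    by (rule rps_series[OF rps0_plog_diff p_power_Opow_0 p_power_tendsto_0 plog_sums])
  from rps_add[OF id this] show ?thesis by (rule rps_cong) simp
qed

definition gen_log :: "nat => 'c" where
  "gen_log a = (gen ^ a - 1) / of_nat p"

lemma gen_log_Zp: "gen_log a \<in> Zp"
proof -
  have "absv (gen ^ a - 1) \<le> absv (of_nat p ^ 1 :: 'c)" by (simp add: absv_gen_power mult_left_le)
  moreover have "gen ^ a - 1 \<in> Zp" using gen_Zp by auto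
  ultimately show ?thesis using Zp_divide_p[of "gen ^ a - 1" 1] by (simp add: gen_log_def)
qed

lemma gen_log_eq: "1 + of_nat p * gen_log a = gen ^ a"
  using p_nz by (simp add: gen_log_def del: of_nat_eq_0_iff)

text \<open>Functional equation of the logarithm: in
  \<open>(x * y) ^ q - 1 = x ^ q * (y ^ q - 1) + (x ^ q - 1)\<close> with \<open>q = p ^ n\<close>
  the factor \<open>x ^ q\<close> tends to 1.\<close>

lemma plog_gen: "plog (gen_log a) = of_nat a * plog (gen_log 1)"
proof (induction a)
  case 0
  have "plog_approx n (gen_log 0) = 0" for n by (simp add: plog_approx_def gen_log_def)
  then have "(\<lambda>n. 0) \<longlonglongrightarrow> plog (gen_log 0)" using plog_tendsto[OF gen_log_Zp, of 0] by simp
  then show ?case using LIMSEQ_unique tendsto_const by (metis mult_zero_left of_nat_0)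
next
  case (Suc a)
  let ?P = "of_nat p :: 'c"
  have x: "(gen ^ a) ^ (p ^ n) = 1 + ?P ^ (n + 1) * plog_approx n (gen_log a)" for n a
    using p_nz by (simp add: plog_approx_def gen_log_eq del: of_nat_eq_0_iff)
  have "(\<lambda>n. ?P ^ (n + 1) * plog_approx n (gen_log a)) \<longlonglongrightarrow> 0"
    using rps_value[OF rps0_plog_approx gen_log_Zp] by (intro na_null_mult_bounded p_power_tendsto_0) (auto simp: Opow_0)
  then have "(\<lambda>n. (1 + ?P ^ (n + 1) * plog_approx n (gen_log a)) * plog_approx n (gen_log 1) + plog_approx n (gen_log a))
      \<longlonglongrightarrow> (1 + 0) * plog (gen_log 1) + plog (gen_log a)"
    by (intro tendsto_add tendsto_mult tendsto_const plog_tendsto gen_log_Zp)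
  moreover have "(1 + ?P ^ (n + 1) * plog_approx n (gen_log a)) * plog_approx n (gen_log 1) + plog_approx n (gen_log a)
      = plog_approx n (gen_log (Suc a))" for n
    unfolding x[symmetric] plog_approx_def gen_log_eq
    by (simp add: power_mult_distrib diff_divide_distrib algebra_simps flip: add_divide_distrib)
  ultimately have "(\<lambda>n. plog_approx n (gen_log (Suc a))) \<longlonglongrightarrow> plog (gen_log 1) + plog (gen_log a)" by simp
  then have "plog (gen_log (Suc a)) = plog (gen_log 1) + plog (gen_log a)"
    using plog_tendsto[OF gen_log_Zp] LIMSEQ_unique by blast
  then show ?case by (simp add: Suc algebra_simps)
qed

text \<open>Modulo \<open>p\<close> the function \<open>plog\<close> is the identity, and
  \<open>gen_log 1\<close> is a unit by \<open>absv_gen\<close>.\<close>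

lemma absv_plog_gen: "absv (plog (gen_log 1)) = 1"
proof -
  have 1: "absv (gen_log 1) = 1" using p_gt_1 by (simp add: gen_log_def absv_divide absv_gen)
  have "absv (plog (gen_log 1) - gen_log 1) \<le> absv (of_nat p :: 'c)"
  proof (rule na_sums_bound[OF plog_sums[OF gen_log_Zp]])
    fix n
    have "absv (of_nat p ^ (n + 1) :: 'c) \<le> absv (of_nat p :: 'c)"
      using absv_p_less by (simp add: absv_mult mult_left_le power_le_one)
    then show "absv (of_nat p ^ (n + 1) * plog_diff n (gen_log 1)) \<le> absv (of_nat p :: 'c)"
      using rps_value[OF rps0_plog_diff gen_log_Zp] by (intro absv_mult_le_1) (auto simp: Opow_0)
  qed simp
  then have "absv (gen_log 1 + (plog (gen_log 1) - gen_log 1)) = absv (gen_log 1)"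
    using absv_p_less 1 by (intro absv_add_eq) linarith
  then show ?thesis using 1 by simp
qed

text \<open>log (1 + p u) divided by log \<open>gen\<close>: the exponent to which
  \<open>gen\<close> has to be raised to give 1 + p u.\<close>

definition exponent :: "'c => 'c" where
  "exponent u = plog u * inverse (plog (gen_log 1))"

lemma exponent_gen: "exponent (gen_log a) = of_nat a"
proof -
  have "plog (gen_log 1) \<noteq> 0" using absv_plog_gen by auto
  then show ?thesis by (simp add: exponent_def plog_gen[of a])
qed

lemma rps0_exponent: "rps (\<lambda>_. 0) exponent"
proof -
  have "inverse (plog (gen_log 1)) \<in> Opow 0"
    using rps_value[OF rps0_plog gen_log_Zp] absv_plog_gen by (auto simp: Opow_0 absv_inverse)
  then show ?thesis unfolding exponent_def[abs_def] by (intro rps0_mult rps0_plog rps_const)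
qed

subsection \<open>Analyticity of accessible characters\<close>

text \<open>The bound in \<open>accessible\<close>. By \<open>absv_fact_ge\<close>, powers of an
  element below this bound still tend to 0 after division by factorials.\<close>

definition \<rho> :: real where "\<rho> = real p powr (- 1 / (real p - 1))"

lemma \<rho>_pos: "\<rho> > 0" and \<rho>_less: "\<rho> < 1" and \<rho>_power: "\<rho> ^ (p - 1) = 1 / real p"
proof -
  show "\<rho> > 0" using p_gt_1 by (simp add: \<rho>_def)
  show "\<rho> < 1" using p_gt_1 by (simp add: \<rho>_def powr_less_one)
  have "\<rho> ^ (p - 1) = real p powr (- 1 / (real p - 1) * real (p - 1))"
    using p_gt_1 by (simp add: \<rho>_def powr_powr flip: powr_realpow)
  also have "- 1 / (real p - 1) * real (p - 1) = - 1" using p_gt_1 by (simp add: of_nat_diff)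
  finally show "\<rho> ^ (p - 1) = 1 / real p" using p_gt_1 by (simp add: powr_minus divide_inverse)
qed

text \<open>Legendre's recursion: only the multiples of \<open>p\<close> up to \<open>n\<close>
  contribute, and these are \<open>p\<close> times the numbers up to \<open>n div p\<close>.\<close>

lemma absv_fact_div: "absv (fact n :: 'c) = absv (of_nat p :: 'c) ^ (n div p) * absv (fact (n div p) :: 'c)"
proof (induction n)
  case (Suc n)
  show ?case
  proof (cases "p dvd Suc n")
    case True
    then obtain m where m: "Suc n = p * m" by blast
    have "m > 0" using m by (cases m) auto
    then obtain l where l: "m = Suc l" by (cases m) auto
    have n: "n = p * l + (p - 1)" using m l p_gt_1 by simp
    have nl: "n div p = l" by (rule div_nat_eqI) (use p_gt_1 in \<open>auto simp: n\<close>)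
    have "Suc n div p = Suc l" using m l p_gt_1 by simp
    moreover have "absv (of_nat (Suc n) :: 'c) = absv (of_nat p :: 'c) * absv (of_nat (Suc l) :: 'c)"
      unfolding m l by (simp only: of_nat_mult absv_mult)
    ultimately show ?thesis using Suc nl by (simp only: fact_Suc absv_mult power_Suc mult_ac)
  next
    case False
    then have "Suc n div p = n div p" using div_Suc[of n p] by (simp add: mod_eq_0_iff_dvd)
    moreover have "absv (of_nat (Suc n) :: 'c) = 1" using False absv_nat_eq_1_iff by blast
    ultimately show ?thesis using Suc by (simp only: fact_Suc absv_mult mult_1)
  qed
qed simp

text \<open>With \<open>m = n div p\<close>, the recursion of \<open>absv_fact_div\<close> meets
  \<open>\<rho>_power\<close> because \<open>n\<close> is at least
  \<open>(p - 1) * m + m\<close>.\<close>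

lemma absv_fact_ge: "absv (fact n :: 'c) \<ge> \<rho> ^ n"
proof (induction n rule: less_induct)
  case (less n)
  show ?case
  proof (cases "n < p")
    case True
    then show ?thesis using absv_fact_div[of n] \<rho>_pos \<rho>_less by (simp add: power_le_one)
  next
    case False
    define m where "m = n div p"
    have "m < n" using False p_gt_1 by (simp add: m_def)
    have pm: "p * m \<le> n" by (simp add: m_def)
    have "\<rho> ^ n \<le> \<rho> ^ (p * m)" using pm \<rho>_pos \<rho>_less by (intro power_decreasing) auto
    also have "p * m = (p - 1) * m + m" using p_gt_1 by (simp add: algebra_simps)
    also have "\<rho> ^ ((p - 1) * m + m) = (1 / real p) ^ m * \<rho> ^ m"
      by (simp only: power_add power_mult \<rho>_power)
    also have "\<dots> \<le> (1 / real p) ^ m * absv (fact m :: 'c)"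
      using less[OF \<open>m < n\<close>] by (intro mult_left_mono) auto
    also have "\<dots> = absv (fact n :: 'c)" using absv_fact_div[of n] by (simp add: m_def absv_p)
    finally show ?thesis .
  qed
qed

text \<open>\<open>F\<close> is the binomial series of \<open>x\<close> to the power
  \<open>exponent u\<close>. The bound on \<open>x - 1\<close> makes its coefficients integral and
  null, and it agrees with \<open>\<kappa>\<close> at the powers of \<open>gen\<close>, hence by
  continuity on 1 + p Z_p.\<close>

theorem accessible_analytic:
  assumes \<kappa>: "\<And>a. \<kappa> (gen ^ a) = x ^ a" "continuous_on Zpx \<kappa>" and x: "x \<in> K" "absv (x - 1) < \<rho>"
  shows "rps (\<lambda>_. 0) (\<lambda>u. \<kappa> (1 + of_nat p * u))"
proof -
  define b where "b n = (x - 1) ^ n / fact n" for n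
  define q where "q = absv (x - 1) / \<rho>"
  have q: "0 \<le> q" "q < 1" using x(2) \<rho>_pos by (auto simp: q_def)
  have bq: "absv (b n) \<le> q ^ n" for n
  proof -
    have "absv (b n) = absv (x - 1) ^ n / absv (fact n :: 'c)" by (simp add: b_def absv_divide)
    also have "\<dots> \<le> absv (x - 1) ^ n / \<rho> ^ n"
      using absv_fact_ge[of n] \<rho>_pos
      by (intro divide_left_mono mult_pos_pos) (auto intro: order_less_le_trans[of _ "\<rho> ^ n"])
    finally show ?thesis by (simp add: q_def power_divide)
  qed
  have fK: "(fact n :: 'c) \<in> K" for n by (metis K_of_nat of_nat_fact)
  have b0: "b n \<in> Opow 0" for n
    using order.trans[OF bq power_le_one[OF q(1)]] q x(1) fK by (auto simp: Opow_0 b_def)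
  have bt: "b \<longlonglongrightarrow> 0"
    unfolding na_tendsto_0_iff
  proof (intro allI impI)
    fix e :: real assume "e > 0"
    then obtain N where N: "q ^ N < e" using q(2) real_arch_pow_inv by blast
    have "absv (b n) < e" if "n \<ge> N" for n
      using bq[of n] N power_decreasing[OF that q(1)] q(2) by linarith
    then show "\<exists>N. \<forall>n\<ge>N. absv (b n) < e" by blast
  qed
  \<comment> \<open>Falling factorials rather than binomial coefficients: the division by
    \<open>fact n\<close> is kept in \<open>b\<close>, so that the functions \<open>ff n\<close>
    have integral coefficients.\<close>
  define ff where "ff n u = (\<Prod>i<n. exponent u - of_nat i)" for n u
  have ff: "rps (\<lambda>_. 0) (ff n)" for n
  proof (induction n)
    case 0
    show ?case unfolding ff_def[abs_def] using rps_const[of 1 "\<lambda>_. 0"] by simp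
  next
    case (Suc n)
    have "rps (\<lambda>_. 0) (\<lambda>u. ff n u * (exponent u + (- of_nat n)))"
      by (intro rps0_mult Suc rps_add rps0_exponent rps_const) auto
    then show ?case by (rule rps_cong) (simp add: ff_def)
  qed
  define F where "F u = (\<Sum>n. b n * ff n u)" for u
  have F: "(\<lambda>n. b n * ff n u) sums F u" if "u \<in> Zp" for u
  proof -
    have "(\<lambda>n. b n * ff n u) \<longlonglongrightarrow> 0"
      using rps_value[OF ff that] by (intro na_null_mult_bounded bt) (auto simp: Opow_0)
    from summable_sums[OF na_summable[OF this]] show ?thesis unfolding F_def .
  qed
  have rF: "rps (\<lambda>_. 0) F" by (rule rps_series[OF ff b0 bt F])
  have Fgen: "F (gen_log a) = x ^ a" for a
  proof -
    have "(\<lambda>n. b n * ff n (gen_log a)) = (\<lambda>n. of_nat (a choose n) * (x - 1) ^ n)"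
    proof
      fix n show "b n * ff n (gen_log a) = of_nat (a choose n) * (x - 1) ^ n"
      using gbinomial_prod_rev[of "of_nat a :: 'c" n] binomial_gbinomial[of a n, where 'a = 'c]
        by (simp add: b_def ff_def exponent_gen atLeast0LessThan field_simps)
    qed
    then have "(\<lambda>n. of_nat (a choose n) * (x - 1) ^ n) sums F (gen_log a)" using F[OF gen_log_Zp, of a] by simp
    moreover have "(\<lambda>n. of_nat (a choose n) * (x - 1) ^ n) sums (\<Sum>n\<le>a. of_nat (a choose n) * (x - 1) ^ n)"
      by (rule sums_finite) auto
    moreover have "(\<Sum>n\<le>a. of_nat (a choose n) * (x - 1) ^ n) = x ^ a"
      using binomial_ring[of "x - 1" 1 a] by simp
    ultimately show ?thesis using sums_unique2 by metis
  qed
  have "F u = \<kappa> (1 + of_nat p * u)" if u: "u \<in> Zp" for u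
  proof -
    have "absv (of_nat p * u) \<le> absv (of_nat p :: 'c)" using Zp_absv_le[OF u] by (simp add: absv_mult mult_left_le)
    then have "absv (of_nat p * u) < 1" using absv_p_less by linarith
    then have t: "1 + of_nat p * u \<in> Zp1" using u by (auto simp: Zp1_def)
    obtain a where a: "(\<lambda>k. gen ^ a k) \<longlonglongrightarrow> 1 + of_nat p * u" using gen_limit[OF t] by blast
    have lim: "(\<lambda>k. (gen ^ a k - 1) * inverse (of_nat p)) \<longlonglongrightarrow> (1 + of_nat p * u - 1) * inverse (of_nat p)"
      by (intro tendsto_mult tendsto_diff a tendsto_const)
    have u': "(1 + of_nat p * u - 1) * inverse (of_nat p) = u" using p_gt_1 by simp
    have "(\<lambda>k. gen_log (a k)) \<longlonglongrightarrow> u" unfolding gen_log_def divide_inverse using lim unfolding u' .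
    then have "(\<lambda>k. F (gen_log (a k))) \<longlonglongrightarrow> F u" by (intro rps_tendsto[OF rF u] gen_log_Zp)
    moreover have "(\<lambda>k. \<kappa> (gen ^ a k)) \<longlonglongrightarrow> \<kappa> (1 + of_nat p * u)"
      using continuous_on_tendsto_compose[OF \<kappa>(2) a] Zp1_Zpx[OF t] Zp1_Zpx[OF gen_Zp1] by simp
    ultimately show ?thesis using LIMSEQ_unique by (simp add: Fgen \<kappa>(1))
  qed
  then show ?thesis by (rule rps_cong[OF rF])
qed

end

context odd_dv_field
begin

lemma one_plus_p_Zpx: "1 + of_nat p \<in> (Zpx :: 'c set)"
  using absv_near_1[of "1 + of_nat p :: 'c"] absv_p_less by (auto simp: Zpx_def)

lemma weight_mult: "weight \<kappa> ==> s \<in> Zpx ==> t \<in> Zpx ==> \<kappa> (s * t) = \<kappa> s * \<kappa> (t :: 'c)"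
  by (simp add: weight_def)

lemma weight_nz: "weight \<kappa> ==> t \<in> Zpx ==> \<kappa> (t :: 'c) \<noteq> 0"
  by (simp add: weight_def)

lemma weight_1: "weight \<kappa> ==> \<kappa> (1 :: 'c) = 1"
  using weight_mult[of \<kappa> 1 1] weight_nz[of \<kappa> 1] by simp

lemma weight_power: "weight \<kappa> ==> t \<in> Zpx ==> \<kappa> (t ^ n) = \<kappa> (t :: 'c) ^ n"
  by (induction n) (auto simp: weight_1 weight_mult Zpx_power)

lemma accessible_absv: "accessible p \<kappa> ==> t \<in> Zpx ==> absv (\<kappa> (t :: 'c)) = 1"
proof -
  assume a: "accessible p \<kappa>" and t: "t \<in> Zpx"
  have "absv (\<kappa> t ^ (p - 1) - 1) < 1" using a t \<rho>_less unfolding accessible_def \<rho>_def by force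
  then have "absv (\<kappa> t ^ (p - 1)) = 1" by (rule absv_near_1)
  then have "absv (\<kappa> t) ^ (p - 1) = 1" by simp
  then show ?thesis using p_ge_3 power_eq_imp_eq_base[of "absv (\<kappa> t)" "p - 1" 1] by simp
qed

lemma accessible_gen: "accessible p \<kappa> ==> absv (\<kappa> gen - 1) < \<rho>"
  using one_plus_p_Zpx weight_power[of \<kappa> "1 + of_nat p" "p - 1"]
  by (simp add: accessible_def \<rho>_def gen_def)

lemma gen_power_Zpx: "gen ^ n \<in> Zpx"
  using gen_Zp1 Zp1_Zpx by blast

lemma accessible_rps:
  assumes "accessible p \<kappa>" "\<kappa> ` Zpx \<subseteq> K"
  shows "rps (\<lambda>_. 0) (\<lambda>u. \<kappa> (1 + of_nat p * u))"
proof -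
  have g: "gen \<in> Zpx" using gen_power_Zpx[of 1] by simp
  show ?thesis
    using assms g weight_power[of \<kappa> gen] accessible_gen[OF assms(1)]
    by (intro accessible_analytic[where x = "\<kappa> gen"]) (auto simp: accessible_def weight_def)
qed

end

section \<open>Stability under Gamma over O_K, and the polynomial quotient V_k\<close>

section \<open>The ring of integers\<close>

locale integral_weight = odd_dv_field p K \<pi>
  for p :: nat and K :: "'c :: {nonarch_field, complete_space} set" and \<pi> :: 'c +
  fixes k :: "'c => 'c"
  assumes k: "accessible p k" "k ` Zpx \<subseteq> K"
begin

abbreviation Bk :: "('c, 'c) coeff_ring" where "Bk \<equiv> OK K \<pi> k"

lemma k_weight: "weight k"
  using k by (simp add: accessible_def)

lemma k_Opow: "t \<in> Zpx ==> k t \<in> Opow 0"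
  using k accessible_absv[OF k(1)] by (auto simp: Opow_0)

lemma Bk_simps [simp]:
  "carrier Bk = Opow 0" "a \<otimes>\<^bsub>Bk\<^esub> b = a * b" "\<one>\<^bsub>Bk\<^esub> = 1" "\<zero>\<^bsub>Bk\<^esub> = 0" "a \<oplus>\<^bsub>Bk\<^esub> b = a + b"
  "emb Bk u = u" "unif Bk = \<pi>" "wt Bk t = k t"
  by (auto simp: OK_def Opow_0)

sublocale OK: coeff_algebra p K \<pi> "OK K \<pi> k" "\<lambda>x. (\<lambda>i\<in>{0::nat}. x)" "{0}"
proof unfold_locales
  show "bij_betw (\<lambda>x. \<lambda>i\<in>{0::nat}. x) (carrier Bk) ({0} \<rightarrow>\<^sub>E Opow 0)"
  proof (rule bij_betw_imageI)
    show "inj_on (\<lambda>x. \<lambda>i\<in>{0::nat}. x) (carrier Bk)"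
      by (rule inj_onI) (drule fun_cong[of _ _ 0], simp)
    show "(\<lambda>x. \<lambda>i\<in>{0::nat}. x) ` carrier Bk = {0} \<rightarrow>\<^sub>E Opow 0"
    proof (intro equalityI subsetI)
      fix v :: "nat => 'c" assume v: "v \<in> {0} \<rightarrow>\<^sub>E Opow 0"
      then have "v = (\<lambda>i\<in>{0}. v 0)" by (auto simp: PiE_def extensional_def fun_eq_iff)
      then show "v \<in> (\<lambda>x. \<lambda>i\<in>{0::nat}. x) ` carrier Bk" using v by (auto intro!: image_eqI[of _ _ "v 0"])
    next
      fix v assume "v \<in> (\<lambda>x. \<lambda>i\<in>{0::nat}. x) ` carrier Bk"
      then obtain x where x: "x \<in> Opow 0" "v = (\<lambda>i\<in>{0::nat}. x)" by auto
      show "v \<in> {0} \<rightarrow>\<^sub>E Opow 0" unfolding x(2) by (rule PiE_I) (use x(1) in auto)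
    qed
  qed
qed (auto simp: k_Opow weight_mult[OF k_weight] weight_1[OF k_weight])

lemma nullseq_iff: "OK.nullseq a \<longleftrightarrow> (\<forall>n. a n \<in> Opow 0) \<and> a \<longlonglongrightarrow> 0"
proof
  assume a: "OK.nullseq a"
  then show "(\<forall>n. a n \<in> Opow 0) \<and> a \<longlonglongrightarrow> 0"
    using OK.nullseq_closed[OF a] OK.nullseq_tendsto[OF a, of 0] by simp
next
  assume a: "(\<forall>n. a n \<in> Opow 0) \<and> a \<longlonglongrightarrow> 0"
  show "OK.nullseq a"
  proof (rule OK.nullseqI)
    fix M
    have "absv \<pi> ^ M > 0" using \<pi>_pos by simp
    then obtain n0 where "\<forall>n\<ge>n0. absv (a n) < absv \<pi> ^ M" using a unfolding na_tendsto_0_iff by blast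
    then show "\<exists>n0. \<forall>n\<ge>n0. \<forall>i\<in>{0}. (\<lambda>i\<in>{0::nat}. a n) i \<in> Opow M"
      using a by (intro exI[of _ n0]) (auto simp: Opow_def less_imp_le)
  qed (use a in auto)
qed

lemma series_iff: "OK.series f a \<longleftrightarrow> (\<forall>n. a n \<in> Opow 0) \<and> a \<longlonglongrightarrow> 0 \<and> (\<forall>z\<in>Zp. (\<lambda>n. a n * z ^ n) sums f (1, z))"
  by (auto simp: OK.series_def nullseq_iff)

lemma A_iff_rps: "f \<in> A_carrier Bk \<longleftrightarrow> OK.homogeneous f \<and> rps (\<lambda>_. 0) (\<lambda>z. f (1, z))"
  by (simp add: OK.A_iff series_iff rps_def)

lemma homogeneous_eq: "OK.homogeneous f ==> (x, y) \<in> T0 ==> f (x, y) = k x * f (1, y / x)"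
  using OK.homogeneous_eq by simp

text \<open>A geometric series in \<open>- (c / a) * z\<close>, where \<open>c / a\<close> lies in
  the maximal ideal because \<open>p\<close> divides \<open>c\<close>; this is the source of the
  growing divisibility.\<close>

lemma rps_denominator:
  assumes g: "\<gamma> \<in> carrier (Gamma N p)"
  shows "rps (\<lambda>n. n) (\<lambda>z. 1 / (of_int (\<gamma> $ 1 $ 1) + of_int (\<gamma> $ 2 $ 1) * z))"
proof -
  define a c :: 'c where "a = of_int (\<gamma> $ 1 $ 1)" and "c = of_int (\<gamma> $ 2 $ 1)"
  have a: "a \<in> Zpx" using Gamma_units(2)[OF g] by (simp add: a_def)
  have a0: "a \<noteq> 0" "absv a = 1" using a Zpx_nz by (auto simp: Zpx_def)
  have cl: "absv c < 1" using Gamma_units(1)[OF g] absv_int_less_iff by (simp add: c_def)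
  have ca: "- (c / a) \<in> Opow 1"
    using \<pi>_max[of "- (c / a)"] cl a0 by (auto simp: Opow_def absv_divide a_def c_def)
  have s: "(\<lambda>n. (inverse a * (- (c / a)) ^ n) * z ^ n) sums (1 / (a + c * z))" if z: "z \<in> Zp" for z
  proof -
    have "absv (- (c / a) * z) \<le> absv c" using Zp_absv_le[OF z] a0 by (simp add: absv_mult absv_divide mult_left_le)
    then have "absv (- (c / a) * z) < 1" using cl by linarith
    from na_sums_mult[OF na_geometric_sums[OF this], of "inverse a"]
    have "(\<lambda>n. inverse a * (- (c / a) * z) ^ n) sums (inverse a * (1 / (1 - - (c / a) * z)))" .
    moreover have "inverse a * (1 / (1 - - (c / a) * z)) = 1 / (a + c * z)" using a0 by (simp add: field_simps)
    ultimately show ?thesis by (simp only: power_mult_distrib mult.assoc)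
  qed
  have "(\<lambda>n. inverse a * (- (c / a)) ^ n) \<longlonglongrightarrow> 0" using na_sums_tendsto_0[OF s[OF Zp_1]] by simp
  moreover have "inverse a * (- (c / a)) ^ n \<in> Opow n" for n
  proof (rule Opow_mult_left)
    show "inverse a \<in> Opow 0" using a0 by (auto simp: Opow_0 absv_inverse a_def)
    show "(- (c / a)) ^ n \<in> Opow n" by (induction n) (use Opow_mult[OF ca] in auto)
  qed
  ultimately show ?thesis
    using s unfolding rps_def by (intro exI[of _ "\<lambda>n. inverse a * (- (c / a)) ^ n"]) (simp add: a_def c_def)
qed

lemma row_act_1: "row_act (1, z) \<gamma> =
    (of_int (\<gamma> $ 1 $ 1) + of_int (\<gamma> $ 2 $ 1) * z, of_int (\<gamma> $ 1 $ 2) + of_int (\<gamma> $ 2 $ 2) * z)"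
  by (simp add: row_act_def)

lemma fun_act_homogeneous:
  assumes g: "\<gamma> \<in> carrier (Gamma N p)" and f: "OK.homogeneous f"
  shows "OK.homogeneous (fun_act \<gamma> f)"
  unfolding OK.homogeneous_def
proof (intro conjI ballI; clarify?)
  show "fun_act \<gamma> f \<in> T0 \<rightarrow>\<^sub>E carrier Bk"
    using row_act_T0[OF g] OK.homogeneous_closed[OF f] by (auto simp: fun_act_def)
  fix a x y :: 'c assume a: "a \<in> Zpx" and xy: "(x, y) \<in> T0"
  have s: "(a * x, a * y) \<in> T0" using a xy by (auto simp: T0_def Zpx_def absv_mult)
  obtain u v where uv: "row_act (x, y) \<gamma> = (u, v)" by (cases "row_act (x, y) \<gamma>")
  have "row_act (a * x, a * y) \<gamma> = (a * u, a * v)" using uv by (auto simp: row_act_def algebra_simps)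
  moreover have "f (a * u, a * v) = wt Bk a \<otimes>\<^bsub>Bk\<^esub> f (u, v)"
    using f a row_act_T0[OF g xy] uv unfolding OK.homogeneous_def by fastforce
  ultimately show "fun_act \<gamma> f (a * x, a * y) = wt Bk a \<otimes>\<^bsub>Bk\<^esub> fun_act \<gamma> f (x, y)"
    using xy s uv by (simp add: fun_act_def)
qed

lemma fun_act_1:
  assumes g: "\<gamma> \<in> carrier (Gamma N p)" and f: "OK.homogeneous f" and z: "z \<in> Zp"
  shows "fun_act \<gamma> f (1, z) = k (of_int (\<gamma> $ 1 $ 1) + of_int (\<gamma> $ 2 $ 1) * z) *
    f (1, (of_int (\<gamma> $ 1 $ 2) + of_int (\<gamma> $ 2 $ 2) * z) / (of_int (\<gamma> $ 1 $ 1) + of_int (\<gamma> $ 2 $ 1) * z))"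
  using homogeneous_eq[OF f, of _ _] row_act_T0[OF g OK.T0_1[OF z]] z
  by (simp add: fun_act_def row_act_1 OK.T0_1)

lemma row_quotient_Zp:
  fixes z :: 'c
  assumes g: "\<gamma> \<in> carrier (Gamma N p)" and z: "z \<in> Zp"
  shows "of_int (\<gamma> $ 1 $ 1) + of_int (\<gamma> $ 2 $ 1) * z \<in> Zpx"
    "(of_int (\<gamma> $ 1 $ 2) + of_int (\<gamma> $ 2 $ 2) * z) / (of_int (\<gamma> $ 1 $ 1) + of_int (\<gamma> $ 2 $ 1) * z) \<in> Zp"
  using row_act_T0[OF g OK.T0_1[OF z]] Zp_divide by (auto simp: row_act_1 T0_def)

text \<open>The translate is k(a + c z) times f at the quotient (b + d z) / (a + c z). Since
  \<open>p\<close> divides \<open>c\<close>, the factor is k(a) k(1 + p e z) with e in Z_p, a power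
  series by \<open>accessible_rps\<close>; the quotient is an integral series, and
  \<open>rps_series\<close> performs the substitution.\<close>

lemma A_stable_OK: "A_stable (Gamma N p) Bk"
  unfolding A_stable_def
proof (intro ballI)
  fix \<gamma> f assume g: "\<gamma> \<in> carrier (Gamma N p)" and f: "f \<in> A_carrier Bk"
  have hf: "OK.homogeneous f" using f by (simp add: A_iff_rps)
  define a b c d :: 'c where "a = of_int (\<gamma> $ 1 $ 1)" and "b = of_int (\<gamma> $ 1 $ 2)"
    and "c = of_int (\<gamma> $ 2 $ 1)" and "d = of_int (\<gamma> $ 2 $ 2)"
  have a: "a \<in> Zpx" using Gamma_units(2)[OF g] by (simp add: a_def)
  obtain c' where "\<gamma> $ 2 $ 1 = int p * c'" using Gamma_units(1)[OF g] by blast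
  then have c: "c = of_nat p * of_int c'" by (simp add: c_def)
  have w: "rps (\<lambda>_. 0) (\<lambda>z. (b + d * z) / (a + c * z))"
  proof -
    have "rps (\<lambda>_. 0) (\<lambda>z. (b + d * z) * (1 / (a + c * z)))"
      using rps_denominator[OF g] unfolding a_def c_def b_def d_def
      by (intro rps0_mult rps_linear rps_mono[where w = "\<lambda>n. n" and v = "\<lambda>_. 0"]) auto
    then show ?thesis by simp
  qed
  have e: "of_int c' / a \<in> Zp" using a by (intro Zp_divide) auto
  have "rps (\<lambda>_. 0) (\<lambda>z. k a * k (1 + of_nat p * (of_int c' / a * z)))"
    using k_Opow[OF a] by (intro rps0_mult rps_const rps_scale[OF accessible_rps[OF k] e])
  moreover have "k a * k (1 + of_nat p * (of_int c' / a * z)) = k (a + c * z)" if z: "z \<in> Zp" for z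
  proof -
    have az: "a + c * z \<in> Zpx" using row_quotient_Zp(1)[OF g z] by (simp add: a_def c_def)
    have eq: "1 + of_nat p * (of_int c' / a * z) = (a + c * z) * inverse a" using Zpx_nz[OF a] by (simp add: c field_simps)
    have "1 + of_nat p * (of_int c' / a * z) \<in> Zpx" unfolding eq using az Zpx_inverse[OF a] by blast
    moreover have "a * (1 + of_nat p * (of_int c' / a * z)) = a + c * z" using Zpx_nz[OF a] by (simp add: c field_simps)
    ultimately show ?thesis using weight_mult[OF k_weight a] by metis
  qed
  ultimately have kk: "rps (\<lambda>_. 0) (\<lambda>z. k (a + c * z))" by (rule rps_cong)
  obtain u where u: "\<And>n. u n \<in> Opow 0" "u \<longlonglongrightarrow> 0" "\<And>z. z \<in> Zp ==> (\<lambda>n. u n * z ^ n) sums f (1, z)"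
    using f unfolding A_iff_rps rps_def by blast
  have ff: "rps (\<lambda>_. 0) (\<lambda>z. f (1, (b + d * z) / (a + c * z)))"
    by (rule rps_series[where b = u and g = "\<lambda>n z. ((b + d * z) / (a + c * z)) ^ n", OF rps0_power[OF w] u(1,2)])
       (use u(3) row_quotient_Zp(2)[OF g] in \<open>simp add: a_def b_def c_def d_def\<close>)
  have "rps (\<lambda>_. 0) (\<lambda>z. fun_act \<gamma> f (1, z))"
    by (rule rps_cong[OF rps0_mult[OF kk ff]]) (simp add: fun_act_1[OF g hf] a_def b_def c_def d_def)
  then show "fun_act \<gamma> f \<in> A_carrier Bk"
    using fun_act_homogeneous[OF g hf] by (simp add: A_iff_rps)
qed

lemma max_ideal_pow_OK: "max_ideal_pow Bk n = Opow n"
  using Opow_0I by (auto simp: OK.max_ideal_pow_eq)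

lemma D_Fil_OK: "D_Fil Bk n = {\<mu> \<in> OK.LD. \<forall>j. \<mu> (f_basis Bk j) \<in> Opow (n - j)}"
proof -
  have "\<mu> (f_basis Bk j) \<in> Opow (n - j)"
    if "\<mu> \<in> OK.LD" "\<forall>j\<le>n. \<mu> (f_basis Bk j) \<in> Opow (n - j)" for \<mu> j
    using that OK.LD_closed[OF that(1) OK.f_basis_A, of j] by (cases "j \<le> n") auto
  then show ?thesis by (auto simp: D_Fil_def max_ideal_pow_OK)
qed

text \<open>
  For a classical weight \<open>m\<close>, \<open>\<gamma> f\<^sub>j\<close> is \<open>(a + c z)\<^bsup>m-j\<^esup> (b + d z)\<^bsup>j\<^esup>\<close>; as \<open>p\<close> divides \<open>c\<close>, its \<open>i\<close>-th
  coefficient is divisible by \<open>p\<^bsup>i-j\<^esup>\<close>.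
\<close>

lemma classical_fil_stable:
  assumes km: "k = classical_weight m"
  shows "fil_stable (Gamma N p) (D_module Bk) (D_Fil Bk)"
  unfolding fil_stable_def
proof (intro allI ballI)
  fix n \<mu> \<gamma> assume \<mu>: "\<mu> \<in> D_Fil Bk n" and g: "\<gamma> \<in> carrier (Gamma N p)"
  have \<mu>': "\<mu> \<in> OK.LD" "\<And>j. \<mu> (f_basis Bk j) \<in> Opow (n - j)" using \<mu> by (auto simp: D_Fil_OK)
  define a b c d :: 'c where "a = of_int (\<gamma> $ 1 $ 1)" and "b = of_int (\<gamma> $ 1 $ 2)"
    and "c = of_int (\<gamma> $ 2 $ 1)" and "d = of_int (\<gamma> $ 2 $ 2)"
  have c1: "c \<in> Opow 1"
    using Gamma_units(1)[OF g] absv_int_less_iff[of "\<gamma> $ 2 $ 1"] \<pi>_max[of c] by (auto simp: c_def Opow_def)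
  have den: "rps (\<lambda>n. n) (\<lambda>z. 1 / (a + c * z))" using rps_denominator[OF g] by (simp add: a_def c_def)
  have num: "rps (\<lambda>n. n) (\<lambda>z. a + c * z)" using c1 by (intro rps_linear) (auto simp: a_def)
  have pw: "rps (\<lambda>n. n) (\<lambda>z. (a + c * z) ^ l)" for l
  proof (induction l)
    case 0
    have "rps (\<lambda>n. n) (\<lambda>z. 1)" by (intro rps_const) auto
    then show ?case by simp
  next
    case (Suc l)
    have "rps (\<lambda>n. n) (\<lambda>z. (a + c * z) * (a + c * z) ^ l)" by (rule rps_mult[OF num Suc]) auto
    then show ?case by simp
  qed
  have q: "rps (\<lambda>n. n - j) (\<lambda>z. ((b + d * z) / (a + c * z)) ^ j)" for j
  proof (induction j)
    case 0
    have "rps (\<lambda>n. n - 0) (\<lambda>z. 1)" by (intro rps_const) auto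
    then show ?case by simp
  next
    case (Suc j)
    have r1: "rps (\<lambda>n. n - 1) (\<lambda>z. (b + d * z) * (1 / (a + c * z)))"
      by (rule rps_mult[OF rps_linear[of b "\<lambda>n. n - 1" d] den]) (auto simp: b_def d_def)
    have "rps (\<lambda>n. n - Suc j) (\<lambda>z. (b + d * z) * (1 / (a + c * z)) * ((b + d * z) / (a + c * z)) ^ j)"
      by (rule rps_mult[OF r1 Suc]) arith
    then show ?case by simp
  qed
  have main: "\<mu> (fun_act \<gamma> (f_basis Bk j)) \<in> Opow (n - j)" for j
  proof -
    let ?f = "fun_act \<gamma> (f_basis Bk j)"
    have fA: "?f \<in> A_carrier Bk" using A_stable_OK g OK.f_basis_A by (simp add: A_stable_def)
    have hj: "OK.homogeneous (f_basis Bk j)" using OK.f_basis_A[of j] by (simp add: A_iff_rps)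
    have "rps (\<lambda>n. n - j) (\<lambda>z. (a + c * z) ^ m * ((b + d * z) / (a + c * z)) ^ j)"
      by (rule rps_mult[OF pw q]) auto
    then have "rps (\<lambda>n. n - j) (\<lambda>z. ?f (1, z))"
    proof (rule rps_cong)
      fix z :: 'c assume z: "z \<in> Zp"
      note rq = row_quotient_Zp[OF g z, folded a_def b_def c_def d_def]
      have "f_basis Bk j (1, (b + d * z) / (a + c * z)) = ((b + d * z) / (a + c * z)) ^ j"
        using OK.T0_1[OF rq(2)] rq(2) OK.emb_Zp(1)[OF rq(2)] by (simp add: f_basis_def weight_1[OF k_weight])
      then show "(a + c * z) ^ m * ((b + d * z) / (a + c * z)) ^ j = ?f (1, z)"
        using rq(1) fun_act_1[OF g hj z] by (simp add: km classical_weight_def a_def b_def c_def d_def)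
    qed
    then obtain e where e: "\<And>i. e i \<in> Opow (i - j)" "e \<longlonglongrightarrow> 0" "\<And>z. z \<in> Zp ==> (\<lambda>n. e n * z ^ n) sums ?f (1, z)"
      unfolding rps_def by blast
    have "OK.series ?f e" unfolding series_iff using e Opow_0I by blast
    then have "OK.coefs ?f = e" using OK.coefs_series[OF fA] OK.series_unique by blast
    then have "(\<lambda>i. e i * \<mu> (f_basis Bk i)) sums \<mu> ?f" using OK.LD_eval[OF \<mu>'(1) fA, of 0] by simp
    \<comment> \<open>The exponents \<open>i - j\<close> and \<open>n - i\<close> add up to at least
      \<open>n - j\<close>, also when one of them is truncated to 0.\<close>
    moreover have "e i * \<mu> (f_basis Bk i) \<in> Opow (n - j)" for i
      using Opow_mult[OF e(1) \<mu>'(2), of i i] by (rule Opow_antimonoD) auto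
    ultimately show ?thesis by (rule OK.sums_Opow)
  qed
  have "act (D_module Bk) \<mu> \<gamma> \<in> OK.LD" using OK.LD_act[OF A_stable_OK \<mu>'(1) g] by simp
  then show "act (D_module Bk) \<mu> \<gamma> \<in> D_Fil Bk n"
    using main OK.f_basis_A by (simp add: D_Fil_OK)
qed

end

text \<open>Used to pass the module axioms from D to V along the surjection
  \<open>rho\<close>.\<close>

lemma group_module_epimorphic_image:
  assumes M: "group_module G M" and c: "h ` carrier M = carrier V"
    and mult: "\<And>x y. x \<in> carrier M ==> y \<in> carrier M ==> h (x \<otimes>\<^bsub>M\<^esub> y) = h x \<otimes>\<^bsub>V\<^esub> h y"
    and one: "h \<one>\<^bsub>M\<^esub> = \<one>\<^bsub>V\<^esub>"
    and act: "\<And>x g. x \<in> carrier M ==> g \<in> carrier G ==> h (act M x g) = act V (h x) g"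
  shows "group_module G V"
proof -
  interpret M: group_module G M by fact
  have a: "act M x g \<in> carrier M" if "x \<in> carrier M" "g \<in> carrier G" for x g
    using hom_in_carrier[OF M.act_hom[OF that(2)] that(1)] .
  have ex: "\<exists>x\<in>carrier M. h x = v" if "v \<in> carrier V" for v using that unfolding c[symmetric] by blast
  have hc: "h x \<in> carrier V" if "x \<in> carrier M" for x using that c by blast
  have cg: "comm_group V"
  proof (rule comm_groupI)
    show "\<one>\<^bsub>V\<^esub> \<in> carrier V" using hc[of "\<one>\<^bsub>M\<^esub>"] one by simp
    fix u assume "u \<in> carrier V"
    then obtain x where x: "x \<in> carrier M" "h x = u" using ex by blast
    show "\<one>\<^bsub>V\<^esub> \<otimes>\<^bsub>V\<^esub> u = u" using mult[of "\<one>\<^bsub>M\<^esub>" x] x one by simp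
    have "h (inv\<^bsub>M\<^esub> x) \<otimes>\<^bsub>V\<^esub> u = \<one>\<^bsub>V\<^esub>" using mult[of "inv\<^bsub>M\<^esub> x" x] x one by simp
    then show "\<exists>y\<in>carrier V. y \<otimes>\<^bsub>V\<^esub> u = \<one>\<^bsub>V\<^esub>" using hc[of "inv\<^bsub>M\<^esub> x"] x by blast
    fix v assume "v \<in> carrier V"
    then obtain y where y: "y \<in> carrier M" "h y = v" using ex by blast
    show "u \<otimes>\<^bsub>V\<^esub> v \<in> carrier V" using mult[OF x(1) y(1)] hc[of "x \<otimes>\<^bsub>M\<^esub> y"] x y by simp
    show "u \<otimes>\<^bsub>V\<^esub> v = v \<otimes>\<^bsub>V\<^esub> u"
      using mult[OF x(1) y(1)] mult[OF y(1) x(1)] M.m_comm[OF x(1) y(1)] x y by simp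
    fix w assume "w \<in> carrier V"
    then obtain z where z: "z \<in> carrier M" "h z = w" using ex by blast
    show "u \<otimes>\<^bsub>V\<^esub> v \<otimes>\<^bsub>V\<^esub> w = u \<otimes>\<^bsub>V\<^esub> (v \<otimes>\<^bsub>V\<^esub> w)"
      using mult[of "x \<otimes>\<^bsub>M\<^esub> y" z] mult[of x "y \<otimes>\<^bsub>M\<^esub> z"] mult[of x y] mult[of y z] x y z by (simp add: M.m_assoc)
  qed
  have "is_gmodule G V"
    unfolding is_gmodule_def
  proof (intro conjI ballI cg)
    show "(\<lambda>u. act V u g) \<in> hom V V" if g: "g \<in> carrier G" for g
    proof (rule homI)
      fix u assume "u \<in> carrier V"
      then obtain x where x: "x \<in> carrier M" "h x = u" using ex by blast
      show "act V u g \<in> carrier V" using act[OF x(1) g] hc[OF a[OF x(1) g]] x by simp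
      fix v assume "v \<in> carrier V"
      then obtain y where y: "y \<in> carrier M" "h y = v" using ex by blast
      have "act V (u \<otimes>\<^bsub>V\<^esub> v) g = h (act M (x \<otimes>\<^bsub>M\<^esub> y) g)"
        using act[of "x \<otimes>\<^bsub>M\<^esub> y" g] mult[OF x(1) y(1)] x y g by simp
      also have "\<dots> = h (act M x g \<otimes>\<^bsub>M\<^esub> act M y g)"
        using hom_mult[OF M.act_hom[OF g] x(1) y(1)] by simp
      also have "\<dots> = act V u g \<otimes>\<^bsub>V\<^esub> act V v g"
        using mult[OF a[OF x(1) g] a[OF y(1) g]] act[OF x(1) g] act[OF y(1) g] x y by simp
      finally show "act V (u \<otimes>\<^bsub>V\<^esub> v) g = act V u g \<otimes>\<^bsub>V\<^esub> act V v g" .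
    qed
    fix u assume "u \<in> carrier V"
    then obtain x where x: "x \<in> carrier M" "h x = u" using ex by blast
    have gm: "act M x \<one>\<^bsub>G\<^esub> = x" "\<And>g g'. g \<in> carrier G ==> g' \<in> carrier G ==> act M x (g \<otimes>\<^bsub>G\<^esub> g') = act M (act M x g) g'"
      using M.gmod x(1) unfolding is_gmodule_def by blast+
    show "act V u \<one>\<^bsub>G\<^esub> = u" using act[OF x(1) M.G.one_closed] gm(1) x by simp
    show "act V u (g \<otimes>\<^bsub>G\<^esub> g') = act V (act V u g) g'" if g: "g \<in> carrier G" "g' \<in> carrier G" for g g'
      using act[OF x(1), of "g \<otimes>\<^bsub>G\<^esub> g'"] act[OF x(1) g(1)] act[OF a[OF x(1) g(1)] g(2)] gm(2)[OF g] x g by simp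
  qed
  then show ?thesis by (intro group_module.intro group_module_axioms.intro M.G.is_group)
qed

locale classical_integral_weight = integral_weight p K \<pi> k
  for p :: nat and K :: "'c :: {nonarch_field, complete_space} set" and \<pi> k +
  fixes m :: nat
  assumes classical: "k = classical_weight m"
begin

abbreviation P :: "('c \<times> 'c => 'c) set" where "P \<equiv> carrier (P_module Bk m)"

abbreviation polyfun :: "(nat => 'c) => 'c \<times> 'c => 'c" where
  "polyfun a \<equiv> (\<lambda>(x, y)\<in>T0. \<Sum>i\<le>m. a i * x ^ (m - i) * y ^ i)"

lemma k_eq: "t \<in> Zpx ==> k t = t ^ m"
  by (simp add: classical classical_weight_def)

lemma carrier_Bk: "carrier Bk = Opow 0"
  by (auto simp: OK_def Opow_0)

lemma polyfun_A:
  assumes a: "\<And>n. a n \<in> Opow 0"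
  shows "polyfun a \<in> A_carrier Bk" "OK.coefs (polyfun a) = (\<lambda>n. if n \<le> m then a n else 0)"
proof -
  let ?b = "\<lambda>n. if n \<le> m then a n else 0"
  have h: "OK.homogeneous (polyfun a)"
    unfolding OK.homogeneous_def
  proof (intro conjI ballI; clarify?)
    show "polyfun a \<in> T0 \<rightarrow>\<^sub>E carrier Bk"
    proof (rule PiE_I)
      fix v :: "'c \<times> 'c" assume "v \<in> T0"
      then obtain x y where v: "v = (x, y)" "x \<in> Zp" "y \<in> Zp" "(x, y) \<in> T0" by (auto simp: T0_def Zpx_def)
      have "(\<Sum>i\<le>m. a i * x ^ (m - i) * y ^ i) \<in> Opow 0"
        using a Zp_Opow[OF v(2)] Zp_Opow[OF v(3)]
        by (intro Opow_sum Opow_mult_left Opow_mult_right Opow_power) auto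
      then show "polyfun a v \<in> carrier Bk" using v by (simp add: carrier_Bk)
    qed auto
    fix t x y :: 'c assume t: "t \<in> Zpx" and xy: "(x, y) \<in> T0"
    have s: "(t * x, t * y) \<in> T0" using t xy by (auto simp: T0_def Zpx_def absv_mult)
    have "a i * (t * x) ^ (m - i) * (t * y) ^ i = t ^ m * (a i * x ^ (m - i) * y ^ i)" if "i \<le> m" for i
    proof -
      have "t ^ (m - i) * t ^ i = t ^ m" using that by (simp flip: power_add)
      then show ?thesis by (simp add: power_mult_distrib mult_ac)
    qed
    then have "(\<Sum>i\<le>m. a i * (t * x) ^ (m - i) * (t * y) ^ i) = (\<Sum>i\<le>m. t ^ m * (a i * x ^ (m - i) * y ^ i))"
      by (intro sum.cong) auto
    then show "polyfun a (t * x, t * y) = wt Bk t \<otimes>\<^bsub>Bk\<^esub> polyfun a (x, y)"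
      using s xy t by (simp add: k_eq sum_distrib_left)
  qed
  have "(\<lambda>n. ?b n * z ^ n) sums polyfun a (1, z)" if z: "z \<in> Zp" for z
  proof -
    have "(\<lambda>n. ?b n * z ^ n) sums (\<Sum>n\<le>m. ?b n * z ^ n)" by (rule sums_finite) auto
    also have "(\<Sum>n\<le>m. ?b n * z ^ n) = polyfun a (1, z)" using OK.T0_1[OF z] by simp
    finally show ?thesis .
  qed
  moreover have "?b \<longlonglongrightarrow> 0"
    by (rule tendsto_eventually) (auto simp: eventually_sequentially intro!: exI[of _ "Suc m"])
  ultimately have s: "OK.series (polyfun a) ?b" using a by (auto simp: series_iff)
  show "polyfun a \<in> A_carrier Bk" unfolding OK.A_iff using h s by blast
  show "OK.coefs (polyfun a) = ?b" by (rule OK.coefs_eq[OF s h])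
qed

lemma coefs_Opow: "f \<in> A_carrier Bk ==> OK.coefs f n \<in> Opow 0"
  using OK.nullseq_closed[OF OK.coefs_nullseq] by (simp add: carrier_Bk)

lemma P_iff: "f \<in> P \<longleftrightarrow> f \<in> A_carrier Bk \<and> (\<forall>n>m. OK.coefs f n = 0)"
proof
  assume "f \<in> P"
  then obtain a where a: "range a \<subseteq> carrier Bk" "f = polyfun a" by (auto simp: P_module_def fun_module_def)
  then have "\<And>n. a n \<in> Opow 0" by (auto simp: carrier_Bk)
  from polyfun_A[OF this] show "f \<in> A_carrier Bk \<and> (\<forall>n>m. OK.coefs f n = 0)" by (simp add: a)
next
  assume f: "f \<in> A_carrier Bk \<and> (\<forall>n>m. OK.coefs f n = 0)"
  have c: "\<And>n. OK.coefs f n \<in> Opow 0" using f coefs_Opow by blast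
  have "f = polyfun (OK.coefs f)"
    using f polyfun_A[OF c] by (intro OK.A_eqI) (auto simp: fun_eq_iff not_le)
  moreover have "range (OK.coefs f) \<subseteq> carrier Bk" using c by (auto simp: carrier_Bk)
  ultimately show "f \<in> P" unfolding P_module_def fun_module_def by simp blast
qed

lemma f_basis_P: "j \<le> m ==> f_basis Bk j \<in> P"
  using OK.f_basis_A by (auto simp: P_iff OK.f_basis_coefs)

lemma P_A: "f \<in> P ==> f \<in> A_carrier Bk"
  by (simp add: P_iff)

lemma P_add: "f \<in> P ==> g \<in> P ==> (\<lambda>v\<in>T0. f v + g v) \<in> P"
  using OK.A_add[of f g] by (simp add: P_iff)

lemma P_smult: "f \<in> P ==> b \<in> Opow 0 ==> (\<lambda>v\<in>T0. b * f v) \<in> P"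
  using OK.A_smult[of f b] by (simp add: P_iff carrier_Bk)

definition integral_poly :: "nat => 'c poly => bool" where
  "integral_poly l q \<longleftrightarrow> degree q \<le> l \<and> (\<forall>i. coeff q i \<in> Opow 0)"

lemma integral_poly_mult: "integral_poly l q ==> integral_poly l' r ==> integral_poly (l + l') (q * r)"
  unfolding integral_poly_def
  by (auto simp: coeff_mult intro!: Opow_sum Opow_mult_left order.trans[OF degree_mult_le])

lemma integral_poly_power: "integral_poly 1 q ==> integral_poly l (q ^ l)"
proof (induction l)
  case 0
  then show ?case by (auto simp: integral_poly_def coeff_1)
next
  case (Suc l)
  then show ?case using integral_poly_mult[of 1 q l "q ^ l"] by simp
qed

text \<open>Substituting a row into a form of degree \<open>m\<close> and setting the first variable
  to 1 gives a polynomial \<open>q\<close> in \<open>z\<close> of degree at most \<open>m\<close>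
  with integral coefficients.\<close>

lemma fun_act_P:
  assumes g: "\<gamma> \<in> carrier (Gamma N p)" and f: "f \<in> P"
  shows "fun_act \<gamma> f \<in> P"
proof -
  define a b c d :: 'c where "a = of_int (\<gamma> $ 1 $ 1)" and "b = of_int (\<gamma> $ 1 $ 2)"
    and "c = of_int (\<gamma> $ 2 $ 1)" and "d = of_int (\<gamma> $ 2 $ 2)"
  have abcd: "a \<in> Opow 0" "b \<in> Opow 0" "c \<in> Opow 0" "d \<in> Opow 0"
    by (simp_all add: a_def b_def c_def d_def Zp_Opow)
  obtain u where u: "range u \<subseteq> carrier Bk" "f = polyfun u" using f by (auto simp: P_module_def fun_module_def)
  define q where "q = (\<Sum>i\<le>m. Polynomial.smult (u i) ([:a, c:] ^ (m - i) * [:b, d:] ^ i))"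
  have lin: "integral_poly 1 [:s, t:]" if "s \<in> Opow 0" "t \<in> Opow 0" for s t
    using that by (auto simp: integral_poly_def coeff_pCons split: nat.splits)
  have ip: "integral_poly m ([:a, c:] ^ (m - i) * [:b, d:] ^ i)" if "i \<le> m" for i
    using integral_poly_mult[OF integral_poly_power[OF lin[OF abcd(1,3)], of "m - i"]
        integral_poly_power[OF lin[OF abcd(2,4)], of i]] that by simp
  have "integral_poly m q"
    unfolding integral_poly_def
  proof (intro conjI allI)
    show "degree q \<le> m"
      unfolding q_def using ip by (intro degree_sum_le order.trans[OF degree_smult_le]) (auto simp: integral_poly_def)
    show "coeff q i \<in> Opow 0" for i
      unfolding q_def coeff_sum coeff_smult
      using ip u(1) by (intro Opow_sum Opow_mult_left) (auto simp: integral_poly_def carrier_Bk)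
  qed
  then have q: "\<And>i. coeff q i \<in> Opow 0" "\<And>i. i > m ==> coeff q i = 0"
    by (auto simp: integral_poly_def coeff_eq_0)
  have A: "fun_act \<gamma> f \<in> A_carrier Bk" using A_stable_OK g P_A[OF f] by (simp add: A_stable_def)
  have h: "OK.homogeneous (fun_act \<gamma> f)" using A by (simp add: A_iff_rps)
  have "(\<lambda>n. coeff q n * z ^ n) sums fun_act \<gamma> f (1, z)" if z: "z \<in> Zp" for z
  proof -
    have "(\<lambda>n. coeff q n * z ^ n) sums (\<Sum>n\<le>degree q. coeff q n * z ^ n)"
      by (rule sums_finite) (auto simp: coeff_eq_0)
    also have "(\<Sum>n\<le>degree q. coeff q n * z ^ n) = poly q z" by (simp add: poly_altdef)
    also have "\<dots> = (\<Sum>i\<le>m. u i * (a + c * z) ^ (m - i) * (b + d * z) ^ i)"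
      by (simp add: q_def poly_sum mult_ac)
    also have "\<dots> = fun_act \<gamma> f (1, z)"
      using row_act_T0[OF g OK.T0_1[OF z]] OK.T0_1[OF z]
      by (simp add: fun_act_def u(2) row_act_1 a_def b_def c_def d_def)
    finally show ?thesis .
  qed
  moreover have "coeff q \<longlonglongrightarrow> 0"
    by (rule tendsto_eventually) (auto simp: eventually_sequentially q(2) intro!: exI[of _ "Suc m"])
  ultimately have "OK.series (fun_act \<gamma> f) (coeff q)" using q by (auto simp: series_iff)
  from OK.coefs_eq[OF this h] show ?thesis using A q(2) by (simp add: P_iff)
qed

lemma V_simps [simp]:
  "carrier (V_module Bk m) = linear_dual Bk (P_module Bk m)"
  "\<mu> \<otimes>\<^bsub>V_module Bk m\<^esub> \<nu> = (\<lambda>f\<in>P. \<mu> f + \<nu> f)"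
  "\<one>\<^bsub>V_module Bk m\<^esub> = (\<lambda>f\<in>P. 0)"
  "act (V_module Bk m) \<mu> \<gamma> = (\<lambda>f\<in>P. \<mu> (fun_act \<gamma> f))"
  by (simp_all add: V_module_def dual_gmodule_def)

lemma V_iff: "\<mu> \<in> linear_dual Bk (P_module Bk m) \<longleftrightarrow> \<mu> \<in> P \<rightarrow>\<^sub>E Opow 0 \<and>
    (\<forall>f\<in>P. \<forall>g\<in>P. \<mu> (\<lambda>v\<in>T0. f v + g v) = \<mu> f + \<mu> g) \<and> (\<forall>b\<in>Opow 0. \<forall>f\<in>P. \<mu> (\<lambda>v\<in>T0. b * f v) = b * \<mu> f)"
  unfolding linear_dual_def carrier_Bk by (simp add: P_module_def fun_module_def)

definition trunc :: "('c \<times> 'c => 'c) => 'c \<times> 'c => 'c" where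
  "trunc f = polyfun (OK.coefs f)"

lemma trunc:
  assumes f: "f \<in> A_carrier Bk"
  shows "trunc f \<in> P" "OK.coefs (trunc f) = (\<lambda>n. if n \<le> m then OK.coefs f n else 0)"
  using polyfun_A[of "OK.coefs f", OF coefs_Opow[OF f]] by (simp_all add: P_iff trunc_def)

lemma trunc_P: "f \<in> P ==> trunc f = f"
  using trunc[OF P_A] P_A by (intro OK.A_eqI) (auto simp: P_iff fun_eq_iff not_le)

text \<open>A section of \<open>rho\<close>: the functional on polynomials is extended by zero on
  the basis functions of index above \<open>m\<close>.\<close>

definition extend :: "(('c \<times> 'c => 'c) => 'c) => ('c \<times> 'c => 'c) => 'c" where
  "extend \<mu> = (\<lambda>f\<in>A_carrier Bk. \<mu> (trunc f))"

lemma extend_LD: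
  assumes \<mu>: "\<mu> \<in> linear_dual Bk (P_module Bk m)"
  shows "extend \<mu> \<in> OK.LD"
  unfolding extend_def
proof (rule OK.LD_I)
  show "\<mu> (trunc f) \<in> carrier Bk" if "f \<in> A_carrier Bk" for f
    using that \<mu> trunc(1) unfolding V_iff carrier_Bk by blast
  fix f assume f: "f \<in> A_carrier Bk"
  show "\<mu> (trunc (\<lambda>v\<in>T0. f v \<oplus>\<^bsub>Bk\<^esub> g v)) = \<mu> (trunc f) \<oplus>\<^bsub>Bk\<^esub> \<mu> (trunc g)" if g: "g \<in> A_carrier Bk" for g
  proof -
    have "trunc (\<lambda>v\<in>T0. f v \<oplus>\<^bsub>Bk\<^esub> g v) = (\<lambda>v\<in>T0. trunc f v \<oplus>\<^bsub>Bk\<^esub> trunc g v)"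
      using OK.A_add[OF f g] OK.A_add[OF P_A P_A, OF trunc(1)[OF f] trunc(1)[OF g]] trunc[OF f] trunc[OF g]
        trunc[OF OK.A_add(1)[OF f g]] P_A
      by (intro OK.A_eqI) (auto simp: fun_eq_iff)
    then show ?thesis using \<mu> trunc(1)[OF f] trunc(1)[OF g] unfolding V_iff by simp
  qed
  show "\<mu> (trunc (\<lambda>v\<in>T0. b \<otimes>\<^bsub>Bk\<^esub> f v)) = b \<otimes>\<^bsub>Bk\<^esub> \<mu> (trunc f)" if b: "b \<in> carrier Bk" for b
  proof -
    have "trunc (\<lambda>v\<in>T0. b \<otimes>\<^bsub>Bk\<^esub> f v) = (\<lambda>v\<in>T0. b \<otimes>\<^bsub>Bk\<^esub> trunc f v)"
      using OK.A_smult[OF f b] OK.A_smult[OF P_A b, OF trunc(1)[OF f]] trunc[OF f] trunc[OF OK.A_smult(1)[OF f b]] P_A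
      by (intro OK.A_eqI) (auto simp: fun_eq_iff)
    then show ?thesis using \<mu> trunc(1)[OF f] b unfolding V_iff by (simp add: carrier_Bk)
  qed
qed

lemma rho_extend: "\<mu> \<in> linear_dual Bk (P_module Bk m) ==> rho Bk m (extend \<mu>) = \<mu>"
  by (rule extensionalityI[of _ P]) (auto simp: rho_def extend_def V_iff P_A trunc_P PiE_def)

lemma V_zero: "\<mu> \<in> linear_dual Bk (P_module Bk m) ==> \<mu> (\<lambda>v\<in>T0. 0) = 0"
  using f_basis_P[of 0] Opow_0I unfolding V_iff by (auto dest!: bspec[of "Opow 0" _ 0] bspec[of P _ "f_basis Bk 0"])

lemma extend_f_basis:
  assumes \<mu>: "\<mu> \<in> linear_dual Bk (P_module Bk m)"
  shows "extend \<mu> (f_basis Bk j) = (if j \<le> m then \<mu> (f_basis Bk j) else 0)"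
proof (cases "j \<le> m")
  case True
  then show ?thesis using OK.f_basis_A trunc_P[OF f_basis_P] by (simp add: extend_def)
next
  case False
  then have "trunc (f_basis Bk j) = (\<lambda>v\<in>T0. 0)"
    by (auto simp: trunc_def OK.f_basis_coefs fun_eq_iff intro!: sum.neutral)
  then show ?thesis using False V_zero[OF \<mu>] OK.f_basis_A by (simp add: extend_def)
qed

lemma rho_V:
  assumes \<mu>: "\<mu> \<in> OK.LD"
  shows "rho Bk m \<mu> \<in> linear_dual Bk (P_module Bk m)"
  using OK.LD_closed[OF \<mu> P_A] OK.LD_add[OF \<mu> P_A P_A] OK.LD_smult[OF \<mu> P_A]
  by (auto simp: V_iff rho_def carrier_Bk P_add P_smult)

lemma rho_hom: "rho Bk m \<in> gmodule_hom (Gamma N p) (D_module Bk) (V_module Bk m)"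
  using rho_V P_A fun_act_P by (auto simp: gmodule_hom_def rho_def fun_eq_iff intro!: homI)

lemma V_ext:
  assumes "\<mu> \<in> linear_dual Bk (P_module Bk m)" "\<nu> \<in> linear_dual Bk (P_module Bk m)"
    and "\<And>j. j \<le> m ==> \<mu> (f_basis Bk j) = \<nu> (f_basis Bk j)"
  shows "\<mu> = \<nu>"
proof -
  have e: "extend \<mu> (f_basis Bk j) = extend \<nu> (f_basis Bk j)" for j
    unfolding extend_f_basis[OF assms(1)] extend_f_basis[OF assms(2)] using assms(3)[of j] by (cases "j \<le> m") auto
  have "extend \<mu> = extend \<nu>" by (rule OK.LD_ext[OF extend_LD[OF assms(1)] extend_LD[OF assms(2)] e])
  from arg_cong[OF this, of "rho Bk m"] show ?thesis unfolding rho_extend[OF assms(1)] rho_extend[OF assms(2)] .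
qed

text \<open>Extension by zero satisfies the filtration conditions at indices above \<open>m\<close>
  trivially, so the conditions up to \<open>m\<close> suffice for a lift inside the
  filtration.\<close>

lemma V_Fil_eq: "V_Fil Bk m n = {\<mu> \<in> linear_dual Bk (P_module Bk m). \<forall>j\<le>m. \<mu> (f_basis Bk j) \<in> Opow (n - j)}"
proof (intro equalityI subsetI)
  fix \<mu> assume "\<mu> \<in> V_Fil Bk m n"
  then obtain \<nu> where \<nu>: "\<nu> \<in> D_Fil Bk n" "\<mu> = rho Bk m \<nu>" by (auto simp: V_Fil_def)
  then show "\<mu> \<in> {\<mu> \<in> linear_dual Bk (P_module Bk m). \<forall>j\<le>m. \<mu> (f_basis Bk j) \<in> Opow (n - j)}"
    using rho_V f_basis_P by (auto simp: D_Fil_OK rho_def)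
next
  fix \<mu> assume \<mu>: "\<mu> \<in> {\<mu> \<in> linear_dual Bk (P_module Bk m). \<forall>j\<le>m. \<mu> (f_basis Bk j) \<in> Opow (n - j)}"
  then have "extend \<mu> \<in> D_Fil Bk n" using extend_LD Opow_0I by (auto simp: D_Fil_OK extend_f_basis)
  then show "\<mu> \<in> V_Fil Bk m n" using \<mu> rho_extend[of \<mu>] unfolding V_Fil_def by (intro image_eqI) auto
qed

definition V_crd :: "(('c \<times> 'c => 'c) => 'c) => nat => 'c" where
  "V_crd \<mu> = (\<lambda>j\<in>{..m}. \<mu> (f_basis Bk j))"

theorem V_coordinate_module:
  "coordinate_module p K \<pi> (Gamma N p) (V_module Bk m) (V_Fil Bk m) V_crd {..m} (\<lambda>j. j)"
proof (intro coordinate_module.intro coordinate_module_axioms.intro dv_field_axioms)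
  let ?V = "linear_dual Bk (P_module Bk m)"
  have onto: "rho Bk m ` carrier (D_module Bk) = carrier (V_module Bk m)"
    using rho_V rho_extend extend_LD by (auto intro!: image_eqI[OF sym])
  show "group_module (Gamma N p) (V_module Bk m)"
    using rho_hom P_A onto
    by (intro group_module_epimorphic_image[OF OK.D_group_module[OF A_stable_OK] onto])
       (auto simp: gmodule_hom_def hom_def rho_def fun_eq_iff)
  have closed: "\<mu> (f_basis Bk j) \<in> Opow 0" if "\<mu> \<in> ?V" "j \<le> m" for \<mu> j
    using that f_basis_P unfolding V_iff by blast
  show "bij_betw V_crd (carrier (V_module Bk m)) ({..m} \<rightarrow>\<^sub>E Opow 0)"
  proof (rule bij_betw_imageI)
    show "inj_on V_crd (carrier (V_module Bk m))"
    proof (rule inj_onI)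
      fix \<mu> \<nu> assume mn: "\<mu> \<in> carrier (V_module Bk m)" "\<nu> \<in> carrier (V_module Bk m)" "V_crd \<mu> = V_crd \<nu>"
      show "\<mu> = \<nu>"
      proof (rule V_ext)
        show "\<mu> (f_basis Bk j) = \<nu> (f_basis Bk j)" if "j \<le> m" for j
          using fun_cong[OF mn(3), of j] that by (simp add: V_crd_def)
      qed (use mn in auto)
    qed
    show "V_crd ` carrier (V_module Bk m) = {..m} \<rightarrow>\<^sub>E Opow 0"
    proof (intro equalityI subsetI)
      fix g assume g: "g \<in> {..m} \<rightarrow>\<^sub>E Opow 0"
      define \<nu> where "\<nu> n = (if n \<le> m then g n else 0)" for n
      have \<nu>: "\<nu> n \<in> carrier Bk" for n using g Opow_0I by (auto simp: \<nu>_def carrier_Bk)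
      have "V_crd (rho Bk m (OK.functional \<nu>)) = g"
        using g OK.functional(2)[of \<nu>, OF \<nu>] f_basis_P
        by (auto simp: V_crd_def rho_def fun_eq_iff \<nu>_def PiE_def extensional_def)
      then show "g \<in> V_crd ` carrier (V_module Bk m)"
        using rho_V[OF OK.functional(1)[of \<nu>, OF \<nu>]] by (intro image_eqI[OF sym]) auto
    next
      fix g assume "g \<in> V_crd ` carrier (V_module Bk m)"
      then show "g \<in> {..m} \<rightarrow>\<^sub>E Opow 0" using closed unfolding V_crd_def by force
    qed
  qed
  show "V_crd (x \<otimes>\<^bsub>V_module Bk m\<^esub> y) q = V_crd x q + V_crd y q" if "q \<in> {..m}" for x y q
    using that f_basis_P by (simp add: V_crd_def)
  show "V_Fil Bk m n = {x \<in> carrier (V_module Bk m). \<forall>q\<in>{..m}. V_crd x q \<in> Opow (n - q)}" for n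
    by (auto simp: V_Fil_eq V_crd_def)
  show "finite {q \<in> {..m}. q < n}" for n by simp
  show "{..m} \<noteq> {}" by simp
  show "fil_stable (Gamma N p) (V_module Bk m) (V_Fil Bk m)"
    unfolding fil_stable_def
  proof (intro allI ballI)
    fix n \<mu> \<gamma> assume "\<mu> \<in> V_Fil Bk m n" and g: "\<gamma> \<in> carrier (Gamma N p)"
    then obtain \<nu> where \<nu>: "\<nu> \<in> D_Fil Bk n" "\<mu> = rho Bk m \<nu>" by (auto simp: V_Fil_def)
    have "act (V_module Bk m) \<mu> \<gamma> = rho Bk m (act (D_module Bk) \<nu> \<gamma>)"
      using rho_hom g \<nu> by (auto simp: gmodule_hom_def D_Fil_def)
    moreover have "act (D_module Bk) \<nu> \<gamma> \<in> D_Fil Bk n"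
      using classical_fil_stable[OF classical] \<nu>(1) g unfolding fil_stable_def by blast
    ultimately show "act (V_module Bk m) \<mu> \<gamma> \<in> V_Fil Bk m n" unfolding V_Fil_def by blast
  qed
  fix u x y \<gamma> q
  assume u: "u \<in> Opow 0" and x: "x \<in> carrier (V_module Bk m)" and y: "y \<in> carrier (V_module Bk m)"
    and yx: "\<And>q. q \<in> {..m} ==> V_crd y q = u * V_crd x q" and g: "\<gamma> \<in> carrier (Gamma N p)" and q: "q \<in> {..m}"
  have x': "x \<in> ?V" and y': "y \<in> ?V" using x y by auto
  have "(\<lambda>f\<in>P. u * x f) \<in> ?V"
    unfolding V_iff
  proof (intro conjI ballI)
    note x = x'[unfolded V_iff]
    show "(\<lambda>f\<in>P. u * x f) \<in> P \<rightarrow>\<^sub>E Opow 0" using x u by (auto intro!: Opow_mult_left)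
    fix f assume f: "f \<in> P"
    show "(\<lambda>f\<in>P. u * x f) (\<lambda>v\<in>T0. f v + g v) = (\<lambda>f\<in>P. u * x f) f + (\<lambda>f\<in>P. u * x f) g" if "g \<in> P" for g
      using x f that P_add[OF f that] by (simp add: distrib_left)
    show "(\<lambda>f\<in>P. u * x f) (\<lambda>v\<in>T0. b * f v) = b * (\<lambda>f\<in>P. u * x f) f" if "b \<in> Opow 0" for b
      using x f that P_smult[OF f that] by simp
  qed
  then have y_eq: "y = (\<lambda>f\<in>P. u * x f)"
  proof (rule V_ext[OF y'])
    show "y (f_basis Bk j) = (\<lambda>f\<in>P. u * x f) (f_basis Bk j)" if "j \<le> m" for j
      using yx[of j] that f_basis_P[OF that] by (simp add: V_crd_def)
  qed
  have "q \<le> m" using q by simp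
  then show "V_crd (act (V_module Bk m) y \<gamma>) q = u * V_crd (act (V_module Bk m) x \<gamma>) q"
    using fun_act_P[OF g f_basis_P] f_basis_P unfolding y_eq V_simps V_crd_def by simp
qed

end

section \<open>Teichmueller representatives, and characters with prescribed value at 1 + p\<close>

section \<open>Characters\<close>

lemma na_seq_close:
  fixes f :: "nat => 'a :: nonarch_field"
  assumes f: "f \<longlonglongrightarrow> l" and r: "\<And>n. n \<ge> N ==> absv (f n - x) \<le> r" "r \<ge> 0"
  shows "absv (l - x) \<le> r"
proof (rule ccontr)
  assume n: "\<not> absv (l - x) \<le> r"
  then obtain M where M: "\<And>n. n \<ge> M ==> absv (f n - l) < absv (l - x)"
    using f r(2) unfolding na_tendsto_iff by (meson le_less_trans not_le)
  have "absv ((l - x) + (f (max M N) - l)) = absv (l - x)" by (rule absv_add_eq) (use M in auto)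
  then show False using n r(1)[of "max M N"] by simp
qed

context odd_dv_field
begin

text \<open>By the exact formula \<open>absv_gen_power\<close> the exponents are congruent modulo
  \<open>p ^ k\<close>, and then the powers of \<open>w\<close> are close. So sending
  \<open>gen ^ a\<close> to \<open>w ^ a\<close> is uniformly continuous.\<close>

lemma power_gen_close:
  fixes w :: 'c
  assumes w: "absv (w - 1) \<le> s" "s < 1" "absv (of_nat p :: 'c) \<le> s"
    and ab: "absv (gen ^ a - gen ^ b) \<le> absv (of_nat p :: 'c) ^ Suc k"
  shows "absv (w ^ a - w ^ b) \<le> s ^ Suc k"
  using ab
proof (induction a b rule: linorder_wlog)
  case (le a b)
  have g: "absv gen = 1" and aw: "absv w = 1" using absv_gen absv_p_less w by (auto intro!: absv_near_1)
  have split: "x ^ a - x ^ b = - (x ^ a * (x ^ (b - a) - 1))" for x :: 'c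
    using le(1) by (simp add: algebra_simps flip: power_add)
  have "absv (of_nat p :: 'c) * absv (of_nat (b - a) :: 'c) \<le> absv (of_nat p :: 'c) * absv (of_nat p :: 'c) ^ k"
    using le(2) unfolding split absv_minus absv_mult by (simp only: absv_power g absv_gen_power) simp
  then have "absv (of_int (int (b - a)) :: 'c) \<le> (1 / real p) ^ k"
    using absv_p_pos unfolding absv_p by (simp only: mult_le_cancel_left_pos of_int_of_nat_eq)
  then have "p ^ k dvd b - a" unfolding absv_int_le_iff by (metis of_nat_dvd_iff of_nat_power)
  from absv_power_multiple_le[OF w this] show ?case
    unfolding split absv_minus absv_mult by (simp add: aw)
next
  case (sym a b)
  then show ?case by (simp add: absv_minus_commute)
qed

lemma absv_fermat: "absv (of_nat n ^ p - of_nat n :: 'c) \<le> absv (of_nat p :: 'c)"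
proof (induction n)
  case 0
  then show ?case using p_gt_1 by (simp add: power_0_left)
next
  case (Suc n)
  let ?y = "of_nat n :: 'c"
  have "{2..p} = insert p {2..<p}" using p_ge_3 by auto
  then have e: "of_nat (Suc n) ^ p - of_nat (Suc n) =
      of_nat p * ?y + (\<Sum>i=2..<p. of_nat (p choose i) * ?y ^ i) + (?y ^ p - ?y)"
    unfolding of_nat_Suc power_p_expand by (simp add: algebra_simps)
  have "absv (of_nat p * ?y + (\<Sum>i=2..<p. of_nat (p choose i) * ?y ^ i) + (?y ^ p - ?y)) \<le> absv (of_nat p :: 'c)"
    using Suc absv_choose_le
    by (intro absv_add_le absv_sum_le absv_mult_le_1) (auto intro!: power_le_one)
  then show ?case unfolding e .
qed

lemma Zpx_power_Zp1:
  assumes t: "t \<in> Zpx"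
  shows "t ^ (p - 1) \<in> Zp1"
proof -
  have t': "t \<in> Zp" "absv t = 1" using t by (auto simp: Zpx_def)
  obtain i where i: "absv (t - of_nat i) \<le> absv (of_nat p :: 'c)" using Zp_mod_p[OF t'(1)] by blast
  have "absv (t ^ p - of_nat i ^ p) \<le> absv (of_nat p :: 'c)"
    using absv_power_diff_le[of t "of_nat i" p] t' i by simp
  moreover have "absv (of_nat i - t) \<le> absv (of_nat p :: 'c)" using i by (simp add: absv_minus_commute)
  ultimately have "absv (t ^ p - t) \<le> absv (of_nat p :: 'c)"
    using absv_triangle_le[OF absv_triangle_le[OF _ absv_fermat]] by blast
  moreover have "t ^ p - t = t * (t ^ (p - 1) - 1)"
    using p_ge_3 by (simp add: algebra_simps flip: power_Suc)
  ultimately have "absv (t ^ (p - 1) - 1) < 1" using absv_p_less t' by (simp add: absv_mult)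
  then show ?thesis using Zp_power[OF t'(1)] by (simp add: Zp1_def)
qed

text \<open>\<open>\<omega>\<close> is the limit of \<open>t ^ (p ^ n)\<close>: consecutive terms
  differ by the factor \<open>(t ^ (p - 1)) ^ (p ^ n)\<close>, which tends to 1.\<close>

lemma teichmuller:
  fixes t :: 'c
  assumes t: "t \<in> Zpx"
  shows "\<exists>\<omega>\<in>Zpx. \<omega> ^ (p - 1) = 1 \<and> t / \<omega> \<in> Zp1"
proof -
  let ?p = "absv (of_nat p :: 'c)"
  have t': "t \<in> Zp" "absv t = 1" using t by (auto simp: Zpx_def)
  have "t ^ (p - 1) \<in> Zp" "absv (t ^ (p - 1) - 1) < 1" using Zpx_power_Zp1[OF t] by (auto simp: Zp1_def)
  then have t1: "absv (t ^ (p - 1) - 1) \<le> ?p" using absv_Zp_less_1[of "t ^ (p - 1) - 1"] by blast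
  define u where "u n = t ^ (p ^ n)" for n
  have u: "u n \<in> Zp" "absv (u n) = 1" for n using t' by (auto simp: u_def)
  have u1: "absv (u n ^ (p - 1) - 1) \<le> ?p ^ Suc n" for n
    using absv_power_p_power_le[OF t1 absv_p_less order.refl, of n] by (simp add: u_def mult.commute flip: power_mult)
  have d: "absv (u (Suc n) - u n) \<le> ?p ^ Suc n" for n
  proof -
    have "u (Suc n) = u n ^ p" by (simp add: u_def mult.commute flip: power_mult)
    then have "u (Suc n) - u n = u n * (u n ^ (p - 1) - 1)" using p_ge_3 by (simp add: algebra_simps flip: power_Suc)
    then show ?thesis using u1[of n] u by (simp add: absv_mult)
  qed
  have "(\<lambda>n. u (Suc n) - u n) \<longlonglongrightarrow> 0"
    unfolding na_tendsto_0_iff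
  proof (intro allI impI)
    fix e :: real assume "e > 0"
    then obtain k where k: "(1 / real p) ^ k < e" using inv_p_power_small by blast
    have "absv (u (Suc n) - u n) < e" if "n \<ge> k" for n
    proof -
      have "?p ^ Suc n \<le> ?p ^ k" using that absv_p_less by (intro power_decreasing) auto
      then show ?thesis using d[of n] k unfolding absv_p by linarith
    qed
    then show "\<exists>k. \<forall>n\<ge>k. absv (u (Suc n) - u n) < e" by blast
  qed
  then obtain l where l: "(\<lambda>n. u (Suc n) - u n) sums l" using na_summable unfolding summable_def by blast
  have "(\<lambda>n. u n - u 0) \<longlonglongrightarrow> l" using l by (simp add: sums_def sum_lessThan_telescope)
  \<comment> \<open>The telescoping sum starts at \<open>u 0 = t\<close>, so the representative is
    \<open>l + t\<close>.\<close>
  from tendsto_add[OF this tendsto_const[of "u 0"]] have lim: "u \<longlonglongrightarrow> l + t" by (simp add: u_def[of 0])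
  have "absv l \<le> ?p"
  proof (rule na_sums_bound[OF l])
    show "absv (u (Suc n) - u n) \<le> ?p" for n
      using d[of n] power_decreasing[of 1 "Suc n" ?p] absv_p_less by simp
  qed simp
  then have l1: "absv l < 1" using absv_p_less by simp
  have w1: "absv (l + t) = 1" using absv_add_eq[of l t] l1 t' by (simp add: add.commute)
  have wZ: "l + t \<in> Zpx" using closed_sequentially[OF closed_Zp u(1) lim] w1 by (simp add: Zpx_def)
  moreover have "(l + t) ^ (p - 1) = 1"
  proof (rule na_eqI)
    fix e :: real assume e: "e > 0"
    then obtain k where k: "(1 / real p) ^ k < e" using inv_p_power_small by blast
    obtain n0 where n0: "\<And>n. n \<ge> n0 ==> absv (u n - (l + t)) < e" using lim e unfolding na_tendsto_iff by blast
    let ?n = "max k n0"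
    have "absv ((l + t) ^ (p - 1) - u ?n ^ (p - 1)) \<le> absv (l + t - u ?n)"
      by (rule absv_power_diff_le) (simp_all add: w1 u)
    also have "\<dots> \<le> e" using n0[of ?n] by (simp add: absv_minus_commute)
    finally have 1: "absv ((l + t) ^ (p - 1) - u ?n ^ (p - 1)) \<le> e" .
    have "?p ^ Suc ?n \<le> ?p ^ k" using absv_p_less by (intro power_decreasing) auto
    then have 2: "absv (u ?n ^ (p - 1) - 1) \<le> e" using u1[of ?n] k unfolding absv_p by linarith
    show "absv ((l + t) ^ (p - 1) - 1) \<le> e" by (rule absv_triangle_le[OF 1 2])
  qed
  moreover have "t / (l + t) \<in> Zp1"
  proof -
    have "t / (l + t) - 1 = - l / (l + t)" using Zpx_nz[OF wZ] by (simp add: field_simps)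
    then have "absv (t / (l + t) - 1) < 1" using l1 w1 by (simp add: absv_divide)
    then show ?thesis using Zp_divide[OF t'(1) wZ] by (simp add: Zp1_def)
  qed
  ultimately show ?thesis by blast
qed

text \<open>The rule \<open>gen ^ a\<close> to \<open>w ^ a\<close> extends by uniform continuity to
  1 + p Z_p. Composing with the power \<open>p - 1\<close> extends it to all units, makes it trivial
  on the roots of unity, and gives the value \<open>w\<close> at 1 + p because that power of 1 + p
  is \<open>gen\<close>.\<close>

lemma character_exists:
  fixes w :: 'c
  assumes w: "absv (w - 1) < 1"
  shows "\<exists>\<psi>. weight \<psi> \<and> \<psi> (1 + of_nat p) = w \<and> (\<forall>z\<in>Zpx. z ^ (p - 1) = 1 \<longrightarrow> \<psi> z = 1)"
proof -
  define s where "s = max (absv (w - 1)) (absv (of_nat p :: 'c))"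
  have s: "absv (w - 1) \<le> s" "s < 1" "absv (of_nat p :: 'c) \<le> s" "s \<ge> 0"
    using w absv_p_less by (auto simp: s_def le_max_iff_disj)
  note close = power_gen_close[OF s(1-3)]
  have small: "\<exists>k. s ^ Suc k < e" if e: "e > 0" for e
  proof -
    obtain k where "s ^ k < e" using real_arch_pow_inv[OF e s(2)] by blast
    moreover have "s ^ Suc k \<le> s ^ k" by (rule power_decreasing) (use s in auto)
    ultimately show ?thesis by (intro exI[of _ k]) linarith
  qed
  define X where "X = range (\<lambda>a. gen ^ a)"
  \<comment> \<open>\<open>f_close\<close>, with \<open>k\<close> arbitrarily large, shows that the
    chosen exponent does not affect the value.\<close>
  define f where "f x = w ^ (SOME a. x = gen ^ a)" for x
  have f_close: "absv (f (gen ^ a) - w ^ b) \<le> s ^ Suc k"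
    if "absv (gen ^ a - gen ^ b) \<le> absv (of_nat p :: 'c) ^ Suc k" for a b k
  proof -
    have "gen ^ a = gen ^ (SOME c. gen ^ a = gen ^ c)" by (rule someI) (rule refl)
    then show ?thesis unfolding f_def using that by (intro close) metis
  qed
  have f_gen: "f (gen ^ a) = w ^ a" for a
  proof (rule na_eqI)
    fix e :: real assume "e > 0"
    then obtain k where "s ^ Suc k < e" using small by blast
    then show "absv (f (gen ^ a) - w ^ a) \<le> e" using f_close[of a a k] by simp
  qed
  have "uniformly_continuous_on X f"
    unfolding uniformly_continuous_on_def dist_absv
  proof (intro allI impI)
    fix e :: real assume "e > 0"
    then obtain k where k: "s ^ Suc k < e" using small by blast
    have "absv (f x' - f x) < e" if "x \<in> X" "x' \<in> X" "absv (x' - x) < absv (of_nat p :: 'c) ^ Suc k" for x x'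
    proof -
      obtain a b where "x = gen ^ a" "x' = gen ^ b" using \<open>x \<in> X\<close> \<open>x' \<in> X\<close> unfolding X_def by blast
      then show ?thesis using f_close[of b a k] that(3) k f_gen[of a] by simp
    qed
    then show "\<exists>d>0. \<forall>x\<in>X. \<forall>x'\<in>X. absv (x' - x) < d \<longrightarrow> absv (f x' - f x) < e"
      using absv_p_pos by (intro exI[of _ "absv (of_nat p :: 'c) ^ Suc k"]) simp
  qed
  then obtain g where g: "uniformly_continuous_on (closure X) g" "\<And>x. x \<in> X ==> f x = g x"
    by (rule uniformly_continuous_on_extension_on_closure) blast
  have gX: "g (gen ^ a) = w ^ a" for a using g(2)[of "gen ^ a"] f_gen by (auto simp: X_def)
  have cl: "Zp1 \<subseteq> closure X"
  proof
    fix t assume "t \<in> Zp1"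
    then obtain a where "(\<lambda>k. gen ^ a k) \<longlonglongrightarrow> t" using gen_limit by blast
    then show "t \<in> closure X" unfolding closure_sequential by (intro exI[of _ "\<lambda>k. gen ^ a k"]) (auto simp: X_def)
  qed
  have gc: "continuous_on Zp1 g" using uniformly_continuous_imp_continuous[OF g(1)] continuous_on_subset cl by blast
  have lim: "(\<lambda>k. w ^ a k) \<longlonglongrightarrow> g t" if "t \<in> Zp1" "(\<lambda>k. gen ^ a k) \<longlonglongrightarrow> t" for a t
  proof -
    have "(\<lambda>k. g (gen ^ a k)) \<longlonglongrightarrow> g t"
      by (rule continuous_on_tendsto_compose[OF gc that(2,1)]) (use gen_Zp1 in auto)
    then show ?thesis by (simp add: gX)
  qed
  have Zp1_mult: "t * u \<in> Zp1" if "t \<in> Zp1" "u \<in> Zp1" for t u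
  proof -
    have "absv (t * (u - 1) + (t - 1)) < 1"
      using that Zp_absv_le[of t] mult_right_mono[of "absv t" 1 "absv (u - 1)"]
      by (intro absv_add_less) (auto simp: Zp1_def absv_mult)
    then show ?thesis using that by (auto simp: Zp1_def algebra_simps)
  qed
  have g_mult: "g (t * u) = g t * g u" if t: "t \<in> Zp1" and u: "u \<in> Zp1" for t u
  proof -
    obtain a where a: "(\<lambda>k. gen ^ a k) \<longlonglongrightarrow> t" using gen_limit[OF t] by blast
    obtain b where b: "(\<lambda>k. gen ^ b k) \<longlonglongrightarrow> u" using gen_limit[OF u] by blast
    have "(\<lambda>k. gen ^ (a k + b k)) \<longlonglongrightarrow> t * u" unfolding power_add by (rule tendsto_mult[OF a b])
    from lim[OF Zp1_mult[OF t u] this] have "(\<lambda>k. w ^ a k * w ^ b k) \<longlonglongrightarrow> g (t * u)" by (simp add: power_add)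
    then show ?thesis using tendsto_mult[OF lim[OF t a] lim[OF u b]] LIMSEQ_unique by blast
  qed
  define \<psi> where "\<psi> = (\<lambda>t\<in>Zpx. g (t ^ (p - 1)))"
  have one: "g 1 = 1" using gX[of 0] by simp
  have \<psi>_mult: "\<psi> (t * u) = \<psi> t * \<psi> u" if "t \<in> Zpx" "u \<in> Zpx" for t u
    using that g_mult[OF Zpx_power_Zp1[OF that(1)] Zpx_power_Zp1[OF that(2)]] by (simp add: \<psi>_def Zpx_mult power_mult_distrib)
  have "weight \<psi>"
    unfolding weight_def
  proof (intro conjI ballI)
    show "\<psi> \<in> extensional Zpx" by (simp add: \<psi>_def)
    show "\<psi> (t * u) = \<psi> t * \<psi> u" if "t \<in> Zpx" "u \<in> Zpx" for t u using \<psi>_mult that by blast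
    show "\<psi> t \<noteq> 0" if t: "t \<in> Zpx" for t
    proof -
      have "\<psi> t * \<psi> (inverse t) = 1"
        using \<psi>_mult[OF t Zpx_inverse[OF t]] Zpx_nz[OF t] one by (simp add: \<psi>_def)
      then show ?thesis by auto
    qed
    have "continuous_on Zpx (\<lambda>t :: 'c. t ^ (p - 1))"
      unfolding continuous_on_iff dist_absv
    proof (intro ballI allI impI)
      fix t :: 'c and e :: real assume t: "t \<in> Zpx" and e: "e > 0"
      have "absv (u ^ (p - 1) - t ^ (p - 1)) < e" if "u \<in> Zpx" "absv (u - t) < e" for u
        using absv_power_diff_le[of u t "p - 1"] that t by (simp add: Zpx_def)
      then show "\<exists>d>0. \<forall>u\<in>Zpx. absv (u - t) < d \<longrightarrow> absv (u ^ (p - 1) - t ^ (p - 1)) < e" using e by blast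
    qed
    then have "continuous_on Zpx (\<lambda>t. g (t ^ (p - 1)))"
      by (rule continuous_on_compose2[OF gc]) (use Zpx_power_Zp1 in auto)
    then show "continuous_on Zpx \<psi>" unfolding \<psi>_def by (rule continuous_on_eq) simp
  qed
  moreover have "\<psi> (1 + of_nat p) = w"
    using gX[of 1] one_plus_p_Zpx by (simp add: \<psi>_def gen_def)
  moreover have "\<forall>z\<in>Zpx. z ^ (p - 1) = 1 \<longrightarrow> \<psi> z = 1" by (simp add: \<psi>_def one)
  ultimately show ?thesis by blast
qed

end

section \<open>Coefficient bounds from values on the open disk, and change of centre\<close>

section \<open>Power series on the open unit disk\<close>

text \<open>A zero of 1 + X + ... + X^(q - 1); it differs from 1 because the value there is
  \<open>q\<close>.\<close>

lemma prime_root_of_unity: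
  assumes q: "prime q"
  shows "\<exists>\<zeta> :: 'a :: {alg_closed_field, field_char_0}. \<zeta> ^ q = 1 \<and> (\<forall>k. \<not> q dvd k \<longrightarrow> \<zeta> ^ k \<noteq> 1)"
proof -
  have q1: "q > 1" using q prime_gt_1_nat by blast
  obtain \<zeta> :: 'a where z: "(\<Sum>k\<le>q - 1. 1 * \<zeta> ^ k) = 0"
    using alg_closed[of "q - 1" "\<lambda>_. 1 :: 'a"] q1 by auto
  have "{..q - 1} = {..<q}" using q1 by auto
  then have z0: "(\<Sum>k<q. \<zeta> ^ k) = 0" using z by simp
  have ne: "\<zeta> \<noteq> 1" using z0 q1 by auto
  have zq: "\<zeta> ^ q = 1" using z0 power_diff_1_eq[of \<zeta> q] by simp
  have "\<zeta> ^ k \<noteq> 1" if k: "\<not> q dvd k" for k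
  proof
    assume zk: "\<zeta> ^ k = 1"
    have "gcd k q = 1" using prime_imp_coprime[OF q k] by (simp add: coprime_iff_gcd_eq_1 gcd.commute)
    moreover have "k \<noteq> 0" using k by (metis dvd_0_right)
    ultimately obtain x y where "k * x = q * y + 1" using bezout_nat[of k q] by auto
    then have "(\<zeta> ^ k) ^ x = (\<zeta> ^ q) ^ y * \<zeta>" by (simp flip: power_mult power_add add: mult.commute)
    then show False using zk zq ne by simp
  qed
  then show ?thesis using zq by blast
qed

text \<open>Fourier inversion over the \<open>q\<close>-th roots of unity: averaging recovers each
  coefficient from values on the unit circle, and \<open>q\<close> is a unit, so dividing by it
  preserves the bound.\<close>

lemma polynomial_coefficient_bound:
  fixes \<beta> :: "nat => 'a :: {alg_closed_field, nonarch_field}"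
  assumes q: "prime q" "absv (of_nat q :: 'a) = 1" and C: "C \<ge> 0"
    and b: "\<And>u. absv u = 1 ==> absv (\<Sum>n<q. \<beta> n * u ^ n) \<le> C" and m: "m < q"
  shows "absv (\<beta> m) \<le> C"
proof -
  obtain \<zeta> :: 'a where z: "\<zeta> ^ q = 1" "\<And>k. \<not> q dvd k ==> \<zeta> ^ k \<noteq> 1" using prime_root_of_unity[OF q(1)] by blast
  have "absv \<zeta> ^ q = 1" using z(1) by (simp flip: absv_power)
  then have z1: "absv \<zeta> = 1" using m power_eq_imp_eq_base[of "absv \<zeta>" q 1] by simp
  \<comment> \<open>The exponent \<open>q - m + n\<close> stands for \<open>n - m\<close> modulo
    \<open>q\<close>, which avoids negative exponents.\<close>
  have orth: "(\<Sum>i<q. (\<zeta> ^ (q - m + n)) ^ i) = (if n = m then of_nat q else 0)" if n: "n < q" for n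
  proof (cases "n = m")
    case True
    then show ?thesis using m z(1) by simp
  next
    case False
    have "\<not> q dvd q - m + n"
    proof
      assume "q dvd q - m + n"
      then obtain c where c: "q - m + n = q * c" by blast
      have "0 < q * c" "q * c < q * 2" "q * c \<noteq> q" using c m n False by linarith+
      then show False by (auto simp: less_2_cases_iff)
    qed
    then have "\<zeta> ^ (q - m + n) \<noteq> 1" by (rule z(2))
    moreover have "(\<zeta> ^ (q - m + n)) ^ q = 1" using z(1) by (metis power_commutes power_mult power_one mult.commute)
    ultimately show ?thesis using False power_diff_1_eq[of "\<zeta> ^ (q - m + n)" q] by simp
  qed
  have "(\<Sum>i<q. (\<zeta> ^ i) ^ (q - m) * (\<Sum>n<q. \<beta> n * (\<zeta> ^ i) ^ n)) = (\<Sum>i<q. \<Sum>n<q. \<beta> n * (\<zeta> ^ (q - m + n)) ^ i)"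
    by (simp add: sum_distrib_left power_add power_mult_distrib mult_ac flip: power_mult)
  also have "\<dots> = (\<Sum>n<q. \<beta> n * (\<Sum>i<q. (\<zeta> ^ (q - m + n)) ^ i))"
    unfolding sum_distrib_left by (rule sum.swap)
  also have "\<dots> = (\<Sum>n<q. if n = m then \<beta> n * of_nat q else 0)" by (rule sum.cong) (simp_all add: orth)
  also have "\<dots> = \<beta> m * of_nat q" using m by simp
  finally have "\<beta> m * of_nat q = (\<Sum>i<q. (\<zeta> ^ i) ^ (q - m) * (\<Sum>n<q. \<beta> n * (\<zeta> ^ i) ^ n))" by simp
  moreover have "absv \<dots> \<le> C"
    using b C by (intro absv_sum_le) (simp_all add: absv_mult z1)
  ultimately show ?thesis using q(2) by (metis absv_mult mult.right_neutral)
qed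

locale alg_closed_dv_field = odd_dv_field p K \<pi>
  for p :: nat and K :: "'c :: complete_alg_closed_nonarch_field set" and \<pi> :: 'c
begin

lemma root_of_p: "n > 0 ==> \<exists>t :: 'c. t ^ n = of_nat p"
  using nth_root_exists[of n "of_nat p :: 'c"] by auto

text \<open>On a circle of radius below 1 the series is a polynomial up to terms bounded by
  \<open>C\<close>, so \<open>polynomial_coefficient_bound\<close> applies. Letting the radius tend
  to 1 gives the bound for the coefficient itself.\<close>

lemma coefficient_bound:
  fixes \<alpha> :: "nat => 'c"
  assumes s: "\<And>T. absv T < 1 ==> (\<lambda>n. \<alpha> n * T ^ n) sums g T" and b: "\<And>T. absv T < 1 ==> absv (g T) \<le> C"
    and C: "C > 0"
  shows "absv (\<alpha> m) \<le> C"
proof -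
  have t: "absv (\<alpha> m) * absv t ^ m \<le> C" if t: "absv t < 1" for t :: 'c
  proof -
    have "(\<lambda>n. \<alpha> n * t ^ n) \<longlonglongrightarrow> 0" using na_sums_tendsto_0[OF s[OF t]] .
    then obtain n0 where n0: "\<And>n. n \<ge> n0 ==> absv (\<alpha> n * t ^ n) < C" using C unfolding na_tendsto_0_iff by blast
    \<comment> \<open>\<open>q\<close> exceeds \<open>n0\<close> so that the tail is bounded by
      \<open>C\<close>, exceeds \<open>m\<close> so that the coefficient is among the first
      \<open>q\<close>, and exceeds \<open>p\<close> so that it is a unit.\<close>
    obtain q where q: "prime q" "q > m + n0 + p" using bigger_prime by blast
    have "\<not> p dvd q" using q prime_p primes_dvd_imp_eq[of p q] by auto
    then have q1: "absv (of_nat q :: 'c) = 1" by (simp add: absv_nat_eq_1_iff)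
    have "absv (\<alpha> m * t ^ m) \<le> C"
    proof (rule polynomial_coefficient_bound[OF q(1) q1])
      fix u :: 'c assume u: "absv u = 1"
      have tu: "absv (t * u) < 1" using t u by (simp add: absv_mult)
      have su: "(\<lambda>n. \<alpha> n * t ^ n * u ^ n) sums g (t * u)" using s[OF tu] by (simp add: power_mult_distrib mult.assoc)
      have "absv (g (t * u) - (\<Sum>n<q. \<alpha> n * t ^ n * u ^ n)) \<le> C"
      proof (rule na_sums_le[OF su])
        show "absv (\<alpha> n * t ^ n * u ^ n) \<le> C" if "n \<ge> q" for n
          using n0[of n] that q(2) u by (simp add: absv_mult)
      qed (use C in simp)
      from absv_diff_le[OF b[OF tu] this] show "absv (\<Sum>n<q. \<alpha> n * t ^ n * u ^ n) \<le> C" by simp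
    qed (use C q(2) in auto)
    then show ?thesis by (simp add: absv_mult)
  qed
  show ?thesis
  proof (cases "m = 0")
    case True
    then show ?thesis using t[of 0] by simp
  next
    case False
    show ?thesis
    proof (rule ccontr)
      assume "\<not> absv (\<alpha> m) \<le> C"
      then have c: "C / absv (\<alpha> m) < 1" "absv (\<alpha> m) > 0" "C / absv (\<alpha> m) \<ge> 0" using C by auto
      have "1 / real p > 0" using p_gt_1 by simp
      then obtain M where M: "(C / absv (\<alpha> m)) ^ M < 1 / real p" using real_arch_pow_inv c(1) by blast
      then have M0: "M > 0" using p_gt_1 by (cases "M = 0") auto
      \<comment> \<open>Roots of \<open>p\<close> supply radii near 1: \<open>absv x ^ m\<close> is
        the \<open>M\<close>-th root of \<open>1 / p\<close>, which exceeds
        \<open>C / absv (\<alpha> m)\<close> by the choice of \<open>M\<close>.\<close>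
      obtain x :: 'c where x: "x ^ (m * M) = of_nat p" using root_of_p[of "m * M"] False M0 by auto
      have xp: "(absv x ^ m) ^ M = 1 / real p" using x by (metis absv_p absv_power power_mult)
      have "absv x < 1"
      proof (rule ccontr)
        assume "\<not> absv x < 1"
        then have "(absv x ^ m) ^ M \<ge> 1" by (intro one_le_power) auto
        then show False using xp p_gt_1 by simp
      qed
      from t[OF this] have "absv x ^ m \<le> C / absv (\<alpha> m)" using c by (simp add: field_simps)
      then have "(absv x ^ m) ^ M \<le> (C / absv (\<alpha> m)) ^ M" by (rule power_mono) simp
      then show False using xp M by simp
    qed
  qed
qed

lemma bounded_power_series_sums:
  assumes "\<And>n. absv (\<alpha> n :: 'c) \<le> 1" "absv T < 1"
  shows "(\<lambda>n. \<alpha> n * T ^ n) sums (\<Sum>n. \<alpha> n * T ^ n)"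
proof -
  have "(\<lambda>n. T ^ n) \<longlonglongrightarrow> 0" using na_sums_tendsto_0[OF na_geometric_sums[OF assms(2)]] .
  from na_null_mult_bounded[of "\<lambda>n. T ^ n" \<alpha>, OF this assms(1)] have "(\<lambda>n. \<alpha> n * T ^ n) \<longlonglongrightarrow> 0" by (simp add: mult.commute)
  then show ?thesis using na_summable summable_sums by blast
qed

text \<open>A rigid function may be given around any rational point. Expanding
  \<open>(T - s) ^ n\<close> binomially and exchanging sums moves the centre to 0, and the new
  coefficients stay in \<open>K\<close> because \<open>K\<close> is closed.\<close>

lemma recentre:
  fixes b :: "nat => 'c"
  assumes b: "\<And>n. b n \<in> K" and s: "s \<in> K" "absv s < 1"
    and g: "\<And>T. absv T < 1 ==> (\<lambda>n. b n * (T - s) ^ n) sums g T"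
  shows "\<exists>\<alpha>. (\<forall>n. \<alpha> n \<in> K) \<and> (\<forall>T. absv T < 1 \<longrightarrow> (\<lambda>n. \<alpha> n * T ^ n) sums g T)"
proof -
  define e where "e T n m = (if m \<le> n then b n * of_nat (n choose m) * T ^ m * (- s) ^ (n - m) else 0)" for T n m
  define \<alpha> where "\<alpha> m = (\<Sum>n. e 1 n m)" for m
  have u0: "(\<lambda>n. b n * u ^ n) \<longlonglongrightarrow> 0" if u: "absv u < 1" for u
    using na_sums_tendsto_0[OF g[of "u + s"]] absv_add_less[OF u s(2)] by simp
  have null: "doubly_null (e T)" if T: "absv T < 1" for T
    unfolding doubly_null_def
  proof (intro allI impI)
    fix \<epsilon> :: real assume eps: "\<epsilon> > 0"
    \<comment> \<open>The larger of \<open>T\<close> and \<open>s\<close>: all terms of the binomial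
      expansion are bounded by \<open>b n * u ^ n\<close>, which tends to 0 since the series
      converges at \<open>u + s\<close>.\<close>
    define u where "u = (if absv T \<ge> absv s then T else s)"
    have u: "absv u < 1" "absv T \<le> absv u" "absv s \<le> absv u" using T s by (auto simp: u_def)
    obtain n0 where n0: "\<And>n. n \<ge> n0 ==> absv (b n * u ^ n) < \<epsilon>" using u0[OF u(1)] eps unfolding na_tendsto_0_iff by blast
    have "absv (e T n m) < \<epsilon>" if nm: "n \<ge> n0 \<or> m \<ge> n0" for n m
    proof (cases "m \<le> n")
      case True
      have "absv (of_nat (n choose m) :: 'c) * (absv T ^ m * absv s ^ (n - m)) \<le> 1 * (absv u ^ m * absv u ^ (n - m))"
        using u by (intro mult_mono power_mono) auto
      also have "\<dots> = absv u ^ n" using True by (simp flip: power_add)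
      finally have "absv (b n) * (absv (of_nat (n choose m) :: 'c) * (absv T ^ m * absv s ^ (n - m))) \<le> absv (b n) * absv u ^ n"
        by (rule mult_left_mono) simp
      then have "absv (e T n m) \<le> absv (b n * u ^ n)" using True by (simp add: e_def absv_mult mult.assoc)
      moreover have "n \<ge> n0" using nm True by auto
      ultimately show ?thesis using n0[of n] by linarith
    qed (use eps in \<open>simp add: e_def\<close>)
    then show "\<exists>N. \<forall>n m. n \<ge> N \<or> m \<ge> N \<longrightarrow> absv (e T n m) < \<epsilon>" by blast
  qed
  have scale: "e T n m = T ^ m * e 1 n m" for T n m by (simp add: e_def)
  have eK: "e 1 n m \<in> K" for n m
    using b s by (auto simp: e_def intro!: K_mult K_power K_minus K_of_nat)
  \<comment> \<open>\<open>T = 1\<close> is outside the open disk, so the columns at 1 are obtained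
    from those at \<open>T = p\<close> by dividing by \<open>p ^ m\<close>.\<close>
  have col: "(\<lambda>n. e 1 n m) sums \<alpha> m" for m
  proof -
    have "(\<lambda>n. e (of_nat p) n m) \<longlonglongrightarrow> 0"
      unfolding na_tendsto_0_iff using null[OF absv_p_less] unfolding doubly_null_def by blast
    then have "summable (\<lambda>n. e (of_nat p) n m)" by (rule na_summable)
    then obtain l where "(\<lambda>n. of_nat p ^ m * e 1 n m) sums l" unfolding scale[of "of_nat p"] summable_def by blast
    from na_sums_mult[OF this, of "inverse (of_nat p ^ m)"] have "(\<lambda>n. inverse (of_nat p ^ m) * of_nat p ^ m * e 1 n m) sums (inverse (of_nat p ^ m) * l)"
      by (simp only: mult.assoc)
    moreover have "inverse (of_nat p ^ m) * of_nat p ^ m = (1 :: 'c)" using p_gt_1 by (intro left_inverse) simp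
    ultimately have "(\<lambda>n. e 1 n m) sums (inverse (of_nat p ^ m) * l)" by simp
    then show ?thesis unfolding \<alpha>_def by (simp add: sums_iff)
  qed
  have "\<alpha> m \<in> K" for m
  proof (rule closed_sequentially[OF closed_K])
    show "(\<lambda>N. \<Sum>n<N. e 1 n m) \<longlonglongrightarrow> \<alpha> m" using col[of m] by (simp add: sums_def)
    show "(\<Sum>n<N. e 1 n m) \<in> K" for N using eK by (intro K_sum) auto
  qed
  moreover have "(\<lambda>n. \<alpha> n * T ^ n) sums g T" if T: "absv T < 1" for T
  proof -
    have row: "e T n sums (b n * (T - s) ^ n)" for n
    proof -
      have "e T n sums (\<Sum>m\<le>n. e T n m)" by (rule sums_finite) (auto simp: e_def)
      also have "(\<Sum>m\<le>n. e T n m) = b n * (T + - s) ^ n"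
        unfolding binomial_ring sum_distrib_left by (rule sum.cong) (auto simp: e_def mult_ac)
      finally show ?thesis by simp
    qed
    have colT: "(\<lambda>n. e T n m) sums (\<alpha> m * T ^ m)" for m
      using na_sums_mult[OF col, of "T ^ m" m] by (simp add: scale[of T] mult.commute)
    obtain l where "(\<lambda>n. b n * (T - s) ^ n) sums l" "(\<lambda>m. \<alpha> m * T ^ m) sums l"
      using na_fubini[OF null[OF T] row colT] by blast
    then show ?thesis using g[OF T] sums_unique2 by blast
  qed
  ultimately show ?thesis by blast
qed

end

section \<open>Lambda_U as the ring of integral power series in the coordinate of U\<close>

section \<open>The Iwasawa algebra\<close>

locale weight_disk = alg_closed_dv_field p K \<pi>
  for p :: nat and K :: "'c :: complete_alg_closed_nonarch_field set" and \<pi> :: 'c +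
  fixes U :: "('c => 'c) set" and \<kappa>0 :: "'c => 'c" and r :: 'c
  assumes \<kappa>0: "weight \<kappa>0" "\<kappa>0 ` Zpx \<subseteq> K" and r: "r \<in> K" "r \<noteq> 0"
    and U: "U = {\<kappa>. weight \<kappa> \<and> (\<forall>z\<in>Zpx. z ^ (p - 1) = 1 \<longrightarrow> \<kappa> z = \<kappa>0 z) \<and>
                 absv (\<kappa> (1 + of_nat p) - \<kappa>0 (1 + of_nat p)) < absv r}"
    and acc: "\<kappa> \<in> U ==> accessible p \<kappa>"
begin

abbreviation BU :: "(('c => 'c) => 'c, 'c) coeff_ring" where "BU \<equiv> Lam p K \<pi> U"

definition coord :: "('c => 'c) => 'c" where
  "coord \<kappa> = (\<kappa> (1 + of_nat p) - \<kappa>0 (1 + of_nat p)) / r"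

lemma r_pos: "absv r > 0"
  using r absv_eq_0_iff[of r] absv_nonneg[of r] by (simp add: order.strict_iff_order)

lemma coord_less: "\<kappa> \<in> U ==> absv (coord \<kappa>) < 1"
  using r_pos by (simp add: U coord_def absv_divide)

lemma coord_eq: "\<kappa> (1 + of_nat p) = \<kappa>0 (1 + of_nat p) + r * coord \<kappa>"
  using r by (simp add: coord_def)

lemma \<kappa>0_U: "\<kappa>0 \<in> U"
  using \<kappa>0 r_pos by (simp add: U)

lemma twist:
  assumes w: "absv (w - 1) < 1" "absv (w - 1) < absv r"
  shows "\<exists>\<kappa>\<in>U. \<kappa> (1 + of_nat p) = \<kappa>0 (1 + of_nat p) * w"
proof -
  obtain \<psi> where \<psi>: "weight \<psi>" "\<psi> (1 + of_nat p) = w" "\<And>z. z \<in> Zpx ==> z ^ (p - 1) = 1 ==> \<psi> z = 1"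
    using character_exists[OF w(1)] by blast
  let ?\<kappa> = "\<lambda>t\<in>Zpx. \<kappa>0 t * \<psi> t"
  have "continuous_on Zpx (\<lambda>t. \<kappa>0 t * \<psi> t)"
    using \<kappa>0(1) \<psi>(1) by (intro continuous_on_mult') (auto simp: weight_def)
  then have "continuous_on Zpx ?\<kappa>" by (rule continuous_on_eq) simp
  then have "weight ?\<kappa>" using \<kappa>0(1) \<psi>(1) Zpx_mult by (auto simp: weight_def)
  moreover have "absv (\<kappa>0 (1 + of_nat p) * w - \<kappa>0 (1 + of_nat p)) < absv r"
  proof -
    have "\<kappa>0 (1 + of_nat p) * w - \<kappa>0 (1 + of_nat p) = \<kappa>0 (1 + of_nat p) * (w - 1)" by (simp add: algebra_simps)
    then show ?thesis using w(2) accessible_absv[OF acc[OF \<kappa>0_U] one_plus_p_Zpx] by (simp add: absv_mult)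
  qed
  ultimately have "?\<kappa> \<in> U" using \<psi> one_plus_p_Zpx by (simp add: U)
  moreover have "?\<kappa> (1 + of_nat p) = \<kappa>0 (1 + of_nat p) * w" using \<psi>(2) one_plus_p_Zpx by simp
  ultimately show ?thesis by blast
qed

text \<open>
  Otherwise the disk would contain the twist of \<open>\<kappa>\<^sub>0\<close> by a character with value \<open>1 + v\<close> at \<open>1 + p\<close>,
  where \<open>\<bar>v\<bar> = p\<^bsup>-1/(p-1)\<^esup>\<close>, and this twist is not accessible.
\<close>

lemma absv_r_le: "absv r \<le> 1"
proof (rule ccontr)
  assume "\<not> absv r \<le> 1"
  then have r1: "absv r > 1" by simp
  obtain v :: 'c where v: "v ^ (p - 1) = of_nat p" using root_of_p[of "p - 1"] p_ge_3 by auto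
  have "absv v ^ (p - 1) = \<rho> ^ (p - 1)" using v by (metis absv_p absv_power \<rho>_power)
  then have v\<rho>: "absv v = \<rho>" using power_eq_imp_eq_base[of "absv v" "p - 1" \<rho>] p_ge_3 \<rho>_pos by simp
  obtain \<kappa> where \<kappa>: "\<kappa> \<in> U" "\<kappa> (1 + of_nat p) = \<kappa>0 (1 + of_nat p) * (1 + v)"
    using twist[of "1 + v"] v\<rho> \<rho>_less r1 by auto
  let ?x = "\<kappa>0 (1 + of_nat p) ^ (p - 1)" and ?y = "(1 + v) ^ (p - 1)"
  have x: "absv (?x - 1) < \<rho>" "absv ?x = 1"
    using acc[OF \<kappa>0_U] one_plus_p_Zpx accessible_absv[OF acc[OF \<kappa>0_U] one_plus_p_Zpx]
    by (auto simp: accessible_def \<rho>_def)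
  have "absv (?x * ?y - 1) < \<rho>"
    using acc[OF \<kappa>(1)] one_plus_p_Zpx \<kappa>(2) by (auto simp: accessible_def \<rho>_def power_mult_distrib)
  from absv_diff_less[OF this x(1)] have "absv (?x * (?y - 1)) < \<rho>" by (simp add: algebra_simps)
  moreover have "absv (?y - 1) = \<rho>"
    using absv_power_coprime[of "1 + v", OF _ not_p_dvd_pred] v\<rho> \<rho>_less by simp
  ultimately show False using x(2) by (simp add: absv_mult)
qed

text \<open>The weight is the twist of \<open>\<kappa>0\<close> by a character with value 1 + r T /
  \<open>\<kappa>0 (1 + of_nat p)\<close> at 1 + p; \<open>absv_r_le\<close> ensures that such a
  character exists.\<close>

lemma coord_surj:
  assumes T: "absv T < 1"
  shows "\<exists>\<kappa>\<in>U. coord \<kappa> = T"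
proof -
  let ?q = "\<kappa>0 (1 + of_nat p)"
  have q: "absv ?q = 1" using accessible_absv[OF acc[OF \<kappa>0_U] one_plus_p_Zpx] .
  then have q0: "?q \<noteq> 0" by auto
  have rT: "absv (r * T) < absv r" using T r_pos by (simp add: absv_mult)
  then have "absv (1 + r * T / ?q - 1) < 1" "absv (1 + r * T / ?q - 1) < absv r"
    using absv_r_le q by (auto simp: absv_divide)
  from twist[OF this] obtain \<kappa> where "\<kappa> \<in> U" "\<kappa> (1 + of_nat p) = ?q * (1 + r * T / ?q)" by blast
  moreover have "?q * (1 + r * T / ?q) = ?q + r * T" using q0 by (simp add: field_simps)
  ultimately show ?thesis using r(2) by (intro bexI[of _ \<kappa>]) (simp_all add: coord_def)
qed

definition expansion :: "(('c => 'c) => 'c) => (nat => 'c) => bool" where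
  "expansion F \<alpha> \<longleftrightarrow> (\<forall>n. \<alpha> n \<in> Opow 0) \<and> (\<forall>\<kappa>\<in>U. (\<lambda>n. \<alpha> n * coord \<kappa> ^ n) sums F \<kappa>)"

text \<open>By \<open>coord_surj\<close>, convergence at all weights of \<open>U\<close> is
  convergence on the whole open unit disk of the ambient field, as \<open>coefficient_bound\<close>
  requires.\<close>

lemma expansion_disk:
  assumes "\<And>\<kappa>. \<kappa> \<in> U ==> (\<lambda>n. \<alpha> n * coord \<kappa> ^ n) sums F \<kappa>"
  shows "\<exists>g. (\<forall>T. absv T < 1 \<longrightarrow> (\<lambda>n. \<alpha> n * T ^ n) sums g T) \<and> (\<forall>\<kappa>\<in>U. g (coord \<kappa>) = F \<kappa>)"
proof (intro exI[of _ "\<lambda>T. \<Sum>n. \<alpha> n * T ^ n"] conjI allI impI ballI)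
  fix T :: 'c assume "absv T < 1"
  then obtain \<kappa> where "\<kappa> \<in> U" "coord \<kappa> = T" using coord_surj by blast
  then show "(\<lambda>n. \<alpha> n * T ^ n) sums (\<Sum>n. \<alpha> n * T ^ n)" using assms sums_summable summable_sums by metis
next
  fix \<kappa> assume "\<kappa> \<in> U"
  then show "(\<Sum>n. \<alpha> n * coord \<kappa> ^ n) = F \<kappa>" using assms sums_unique by metis
qed

lemma expansion_bound:
  assumes s: "\<And>\<kappa>. \<kappa> \<in> U ==> (\<lambda>n. \<alpha> n * coord \<kappa> ^ n) sums F \<kappa>"
    and b: "\<And>\<kappa>. \<kappa> \<in> U ==> absv (F \<kappa>) \<le> C" and C: "C > 0"
  shows "absv (\<alpha> m) \<le> C"
proof -
  obtain g where g: "\<And>T. absv T < 1 ==> (\<lambda>n. \<alpha> n * T ^ n) sums g T" "\<And>\<kappa>. \<kappa> \<in> U ==> g (coord \<kappa>) = F \<kappa>"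
    using expansion_disk[OF s] by blast
  have "absv (g T) \<le> C" if "absv T < 1" for T using coord_surj[OF that] g(2) b by force
  from coefficient_bound[OF g(1) this C] show ?thesis .
qed

lemma expansion_unique:
  assumes "expansion F \<alpha>" "expansion F \<beta>"
  shows "\<alpha> = \<beta>"
proof
  fix m
  show "\<alpha> m = \<beta> m"
  proof (rule na_eqI)
    fix e :: real assume e: "e > 0"
    have "(\<lambda>n. (\<alpha> n - \<beta> n) * coord \<kappa> ^ n) sums 0" if "\<kappa> \<in> U" for \<kappa>
    proof -
      have "(\<lambda>n. \<alpha> n * coord \<kappa> ^ n) sums F \<kappa>" "(\<lambda>n. \<beta> n * coord \<kappa> ^ n) sums F \<kappa>"
        using assms that by (auto simp: expansion_def)
      from na_sums_diff[OF this] show ?thesis by (simp add: left_diff_distrib)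
    qed
    then show "absv (\<alpha> m - \<beta> m) \<le> e"
      by (rule expansion_bound[where \<alpha> = "\<lambda>n. \<alpha> n - \<beta> n" and F = "\<lambda>_. 0"]) (use e in auto)
  qed
qed

lemma expansion_cong: "expansion F \<alpha> ==> (\<And>\<kappa>. \<kappa> \<in> U ==> F \<kappa> = G \<kappa>) ==> expansion G \<alpha>"
  by (simp add: expansion_def)

lemma expansion_add: "expansion F \<alpha> ==> expansion G \<beta> ==> expansion (\<lambda>\<kappa>. F \<kappa> + G \<kappa>) (\<lambda>n. \<alpha> n + \<beta> n)"
  unfolding expansion_def distrib_right by (intro conjI allI ballI Opow_add sums_add) auto

lemma expansion_mult:
  assumes "expansion F \<alpha>" "expansion G \<beta>"
  shows "expansion (\<lambda>\<kappa>. F \<kappa> * G \<kappa>) (\<lambda>n. \<Sum>j\<le>n. \<alpha> j * \<beta> (n - j))"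
  unfolding expansion_def
proof (intro conjI allI ballI)
  show "(\<Sum>j\<le>n. \<alpha> j * \<beta> (n - j)) \<in> Opow 0" for n
    using assms by (intro Opow_sum Opow_mult_left) (auto simp: expansion_def)
  fix \<kappa> assume "\<kappa> \<in> U"
  then have "(\<lambda>n. \<Sum>j\<le>n. (\<alpha> j * coord \<kappa> ^ j) * (\<beta> (n - j) * coord \<kappa> ^ (n - j))) sums (F \<kappa> * G \<kappa>)"
    using assms by (intro na_cauchy_product) (auto simp: expansion_def)
  moreover have "(\<Sum>j\<le>n. (\<alpha> j * coord \<kappa> ^ j) * (\<beta> (n - j) * coord \<kappa> ^ (n - j))) = (\<Sum>j\<le>n. \<alpha> j * \<beta> (n - j)) * coord \<kappa> ^ n" for n
  proof -
    have "(\<alpha> j * coord \<kappa> ^ j) * (\<beta> (n - j) * coord \<kappa> ^ (n - j)) = \<alpha> j * \<beta> (n - j) * coord \<kappa> ^ n" if "j \<le> n" for j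
    proof -
      have "coord \<kappa> ^ j * coord \<kappa> ^ (n - j) = coord \<kappa> ^ n" using that by (simp flip: power_add)
      then show ?thesis by (metis mult.assoc mult.left_commute)
    qed
    then show ?thesis unfolding sum_distrib_right by (intro sum.cong) auto
  qed
  ultimately show "(\<lambda>n. (\<Sum>j\<le>n. \<alpha> j * \<beta> (n - j)) * coord \<kappa> ^ n) sums (F \<kappa> * G \<kappa>)" by simp
qed

lemma expansion_const: "u \<in> Opow 0 ==> expansion (\<lambda>_. u) (\<lambda>n. if n = 0 then u else 0)"
proof -
  have "(\<lambda>n. (if n = 0 then u else 0) * T ^ n) sums u" for T :: 'c
    using sums_finite[of "{0}" "\<lambda>n. (if n = 0 then u else 0) * T ^ n"] by simp
  then show "u \<in> Opow 0 ==> ?thesis" by (simp add: expansion_def)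
qed

lemma expansion_of:
  assumes "\<And>n. \<alpha> n \<in> Opow 0"
  shows "expansion (\<lambda>\<kappa>. \<Sum>n. \<alpha> n * coord \<kappa> ^ n) \<alpha>"
  using assms coord_less bounded_power_series_sums[of \<alpha>] by (auto simp: expansion_def Opow_0)

text \<open>Rescaling by \<open>r ^ n\<close> and recentring turns any expansion of a rigid function
  into one in \<open>coord\<close> over \<open>K\<close>; by \<open>expansion_bound\<close>, being
  bounded by 1 then means that the coefficients are integral.\<close>

lemma Lam_carrier: "F \<in> carrier BU \<longleftrightarrow> F \<in> extensional U \<and> (\<exists>\<alpha>. expansion F \<alpha>)"
proof
  assume "F \<in> carrier BU"
  then have F: "rigid_function p K U F" "\<And>\<kappa>. \<kappa> \<in> U ==> absv (F \<kappa>) \<le> 1" by (auto simp: Lam_def)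
  then obtain \<kappa>1 a where 1: "F \<in> extensional U" "\<kappa>1 \<in> rational_points K U" "range a \<subseteq> K"
    "\<And>\<kappa>. \<kappa> \<in> U ==> (\<lambda>n. a n * (\<kappa> (1 + of_nat p) - \<kappa>1 (1 + of_nat p)) ^ n) sums F \<kappa>"
    unfolding rigid_function_def by blast
  have \<kappa>1: "\<kappa>1 \<in> U" "\<kappa>1 ` Zpx \<subseteq> K" using 1(2) by (auto simp: rational_points_def)
  let ?b = "\<lambda>n. a n * r ^ n"
  have s: "(\<lambda>n. ?b n * (coord \<kappa> - coord \<kappa>1) ^ n) sums F \<kappa>" if "\<kappa> \<in> U" for \<kappa>
  proof -
    have "\<kappa> (1 + of_nat p) - \<kappa>1 (1 + of_nat p) = r * (coord \<kappa> - coord \<kappa>1)"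
      using r by (simp add: coord_def diff_divide_distrib[symmetric])
    then show ?thesis using 1(4)[OF that] by (simp add: power_mult_distrib mult.assoc)
  qed
  have "\<exists>g. (\<forall>T. absv T < 1 \<longrightarrow> (\<lambda>n. ?b n * (T - coord \<kappa>1) ^ n) sums g T) \<and> (\<forall>\<kappa>\<in>U. g (coord \<kappa>) = F \<kappa>)"
  proof (intro exI[of _ "\<lambda>T. \<Sum>n. ?b n * (T - coord \<kappa>1) ^ n"] conjI allI impI ballI)
    fix T :: 'c assume "absv T < 1"
    then obtain \<kappa> where "\<kappa> \<in> U" "coord \<kappa> = T" using coord_surj by blast
    then show "(\<lambda>n. ?b n * (T - coord \<kappa>1) ^ n) sums (\<Sum>n. ?b n * (T - coord \<kappa>1) ^ n)"
      using s[of \<kappa>] sums_summable summable_sums by metis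
  qed (use s sums_unique in metis)
  then obtain g where g: "\<And>T. absv T < 1 ==> (\<lambda>n. ?b n * (T - coord \<kappa>1) ^ n) sums g T"
    "\<And>\<kappa>. \<kappa> \<in> U ==> g (coord \<kappa>) = F \<kappa>" by blast
  have "?b n \<in> K" for n using 1(3) r by (intro K_mult K_power) auto
  moreover have "coord \<kappa>1 \<in> K"
    using \<kappa>0(2) \<kappa>1(2) one_plus_p_Zpx r unfolding coord_def by (intro K_divide K_diff) auto
  ultimately obtain \<alpha> where \<alpha>: "\<And>n. \<alpha> n \<in> K" "\<And>T. absv T < 1 ==> (\<lambda>n. \<alpha> n * T ^ n) sums g T"
    using recentre[of ?b "coord \<kappa>1" g, OF _ _ coord_less[OF \<kappa>1(1)] g(1)] by blast
  have sums: "(\<lambda>n. \<alpha> n * coord \<kappa> ^ n) sums F \<kappa>" if "\<kappa> \<in> U" for \<kappa>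
    using \<alpha>(2)[OF coord_less[OF that]] g(2)[OF that] by simp
  have "absv (\<alpha> n) \<le> 1" for n by (rule expansion_bound[OF sums F(2)]) auto
  then have "expansion F \<alpha>" using sums \<alpha>(1) by (simp add: expansion_def Opow_0)
  then show "F \<in> extensional U \<and> (\<exists>\<alpha>. expansion F \<alpha>)" using 1(1) by blast
next
  assume "F \<in> extensional U \<and> (\<exists>\<alpha>. expansion F \<alpha>)"
  then obtain \<alpha> where F: "F \<in> extensional U" and \<alpha>: "expansion F \<alpha>" by blast
  have "rigid_function p K U F"
    unfolding rigid_function_def
  proof (intro conjI F bexI[of _ \<kappa>0] exI[of _ "\<lambda>n. \<alpha> n / r ^ n"] ballI)
    show "range (\<lambda>n. \<alpha> n / r ^ n) \<subseteq> K" using \<alpha> r by (auto simp: expansion_def Opow_0 intro!: K_divide K_power)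
    show "\<kappa>0 \<in> rational_points K U" using \<kappa>0 \<kappa>0_U by (simp add: rational_points_def)
    show "(\<lambda>n. \<alpha> n / r ^ n * (\<kappa> (1 + of_nat p) - \<kappa>0 (1 + of_nat p)) ^ n) sums F \<kappa>" if "\<kappa> \<in> U" for \<kappa>
      using \<alpha> that r by (simp add: expansion_def coord_def power_divide)
  qed
  moreover have "absv (F \<kappa>) \<le> 1" if "\<kappa> \<in> U" for \<kappa>
  proof (rule na_sums_bound)
    show "(\<lambda>n. \<alpha> n * coord \<kappa> ^ n) sums F \<kappa>" using \<alpha> that by (simp add: expansion_def)
    show "absv (\<alpha> n * coord \<kappa> ^ n) \<le> 1" for n
      using \<alpha> coord_less[OF that] by (intro absv_mult_le_1) (auto simp: expansion_def Opow_0 intro!: power_le_one)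
  qed simp
  ultimately show "F \<in> carrier BU" by (simp add: Lam_def)
qed

definition cf :: "(('c => 'c) => 'c) => nat => 'c" where
  "cf F = (SOME \<alpha>. expansion F \<alpha>)"

lemma cf_eq: "expansion F \<alpha> ==> cf F = \<alpha>"
  unfolding cf_def using expansion_unique by (intro some_equality) auto

lemma cf_expansion: "F \<in> carrier BU ==> expansion F (cf F)"
  using Lam_carrier cf_eq by auto

end

context weight_disk
begin

lemma U_weight: "\<kappa> \<in> U ==> weight \<kappa>"
  by (simp add: U)

text \<open>\<open>expansion_bound\<close> turns uniform approximation of \<open>F\<close> into
  approximation of coefficients that is uniform in the index, so these converge, and to integral
  limits.\<close>

lemma expansion_limit:
  assumes G: "\<And>i. expansion (G i) (a i)" and c: "c \<longlonglongrightarrow> 0"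
    and close: "\<And>i \<kappa>. \<kappa> \<in> U ==> absv (F \<kappa> - G i \<kappa>) \<le> c i"
  shows "\<exists>\<alpha>. expansion F \<alpha>"
proof -
  have ev: "\<exists>M. \<forall>i\<ge>M. c i < e" if "e > 0" for e :: real
    using order_tendstoD(2)[OF c that] by (simp add: eventually_sequentially)
  have aa: "absv (a i n - a j n) \<le> e" if "c i < e" "c j < e" "e > 0" for i j n e
  proof (rule expansion_bound[where \<alpha> = "\<lambda>n. a i n - a j n" and F = "\<lambda>\<kappa>. G i \<kappa> - G j \<kappa>"])
    fix \<kappa> assume \<kappa>: "\<kappa> \<in> U"
    have "(\<lambda>n. a i n * coord \<kappa> ^ n) sums G i \<kappa>" "(\<lambda>n. a j n * coord \<kappa> ^ n) sums G j \<kappa>"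
      using G \<kappa> by (auto simp: expansion_def)
    from na_sums_diff[OF this] show "(\<lambda>n. (a i n - a j n) * coord \<kappa> ^ n) sums (G i \<kappa> - G j \<kappa>)"
      by (simp add: left_diff_distrib)
    have "absv (G i \<kappa> - F \<kappa>) \<le> e" "absv (F \<kappa> - G j \<kappa>) \<le> e"
      using close[OF \<kappa>, of i] close[OF \<kappa>, of j] that by (auto simp: absv_minus_commute)
    then show "absv (G i \<kappa> - G j \<kappa>) \<le> e" by (rule absv_triangle_le)
  qed fact
  have "\<exists>l. (\<lambda>i. a i n) \<longlonglongrightarrow> l" for n
  proof -
    have "Cauchy (\<lambda>i. a i n)"
      unfolding Cauchy_def dist_absv
    proof (intro allI impI)
      fix e :: real assume e: "e > 0"
      then obtain M where M: "\<And>i. i \<ge> M ==> c i < e / 2" using ev[of "e / 2"] by auto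
      have "absv (a i n - a j n) < e" if "i \<ge> M" "j \<ge> M" for i j
        using aa[OF M[OF that(1)] M[OF that(2)], of n] e by linarith
      then show "\<exists>M. \<forall>i\<ge>M. \<forall>j\<ge>M. absv (a i n - a j n) < e" by blast
    qed
    then show ?thesis using Cauchy_convergent convergent_def by blast
  qed
  then obtain \<alpha> where \<alpha>: "\<And>n. (\<lambda>i. a i n) \<longlonglongrightarrow> \<alpha> n" by metis
  have \<alpha>O: "\<alpha> n \<in> Opow 0" for n
    by (rule closed_sequentially[OF closed_Opow _ \<alpha>]) (use G in \<open>auto simp: expansion_def\<close>)
  have "expansion F \<alpha>"
  proof (rule expansion_cong[OF expansion_of[OF \<alpha>O]])
    fix \<kappa> assume \<kappa>: "\<kappa> \<in> U"
    show "(\<Sum>n. \<alpha> n * coord \<kappa> ^ n) = F \<kappa>"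
    proof (rule na_eqI)
      fix e :: real assume e: "e > 0"
      then obtain M where M: "\<And>i. i \<ge> M ==> c i < e" using ev by blast
      have "absv (\<alpha> n - a M n) \<le> e" for n
        by (rule na_seq_close[OF \<alpha>, of M]) (use aa M e in auto)
      then have b: "absv ((\<alpha> n - a M n) * coord \<kappa> ^ n) \<le> e" for n
        using coord_less[OF \<kappa>] by (intro absv_mult_le_1) (auto intro!: power_le_one)
      have s: "(\<lambda>n. \<alpha> n * coord \<kappa> ^ n) sums (\<Sum>n. \<alpha> n * coord \<kappa> ^ n)" "(\<lambda>n. a M n * coord \<kappa> ^ n) sums G M \<kappa>"
        using expansion_of[of \<alpha>, OF \<alpha>O] G[of M] \<kappa> unfolding expansion_def by blast+
      have 1: "absv ((\<Sum>n. \<alpha> n * coord \<kappa> ^ n) - G M \<kappa>) \<le> e"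
        by (rule na_sums_bound[OF na_sums_diff[OF s, folded left_diff_distrib] b]) (use e in simp)
      have 2: "absv (G M \<kappa> - F \<kappa>) \<le> e" using close[OF \<kappa>, of M] M[of M] by (simp add: absv_minus_commute)
      show "absv ((\<Sum>n. \<alpha> n * coord \<kappa> ^ n) - F \<kappa>) \<le> e" by (rule absv_triangle_le[OF 1 2])
    qed
  qed
  then show ?thesis by blast
qed

lemma expansion_power: "\<exists>\<alpha>. expansion F \<alpha> ==> \<exists>\<alpha>. expansion (\<lambda>\<kappa>. F \<kappa> ^ n) \<alpha>"
proof (induction n)
  case 0
  have "expansion (\<lambda>_. 1) (\<lambda>n. if n = 0 then 1 else 0)" by (rule expansion_const) simp
  then show ?case unfolding power_0 by blast
next
  case (Suc n)
  then show ?case using expansion_mult unfolding power_Suc by blast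
qed

lemma \<kappa>0_Opow: "t \<in> Zpx ==> \<kappa>0 t \<in> Opow 0"
  using \<kappa>0(2) accessible_absv[OF acc[OF \<kappa>0_U]] by (auto simp: Opow_0)

text \<open>At 1 + p a weight is linear in the coordinate, with slope \<open>r\<close>, integral by
  \<open>absv_r_le\<close>; and \<open>gen\<close> is a power of 1 + p.\<close>

lemma expansion_gen: "\<exists>\<alpha>. expansion (\<lambda>\<kappa>. \<kappa> gen) \<alpha>"
proof -
  let ?q = "\<kappa>0 (1 + of_nat p)"
  let ?a = "\<lambda>n. if n = 0 then ?q else if n = 1 then r else 0"
  have lin: "(\<lambda>n. ?a n * T ^ n) sums (?q + r * T)" for T
    using sums_finite[of "{0, 1}" "\<lambda>n. ?a n * T ^ n"] by simp
  have "(\<lambda>n. ?a n * coord \<kappa> ^ n) sums \<kappa> (1 + of_nat p)" for \<kappa>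
    using lin[of "coord \<kappa>"] unfolding coord_eq[of \<kappa>, symmetric] .
  then have "expansion (\<lambda>\<kappa>. \<kappa> (1 + of_nat p)) ?a"
    using \<kappa>0_Opow[OF one_plus_p_Zpx] r(1) absv_r_le unfolding expansion_def by (auto simp: Opow_0)
  then have "\<exists>\<alpha>. expansion (\<lambda>\<kappa>. \<kappa> (1 + of_nat p)) \<alpha>" by blast
  from expansion_power[OF this, of "p - 1"] obtain \<alpha> where "expansion (\<lambda>\<kappa>. \<kappa> (1 + of_nat p) ^ (p - 1)) \<alpha>" by blast
  moreover have "\<kappa> (1 + of_nat p) ^ (p - 1) = \<kappa> gen" if "\<kappa> \<in> U" for \<kappa>
    using weight_power[OF _ one_plus_p_Zpx, of \<kappa> "p - 1"] that by (simp add: U gen_def)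
  ultimately have "expansion (\<lambda>\<kappa>. \<kappa> gen) \<alpha>" by (rule expansion_cong)
  then show ?thesis by blast
qed

text \<open>
  Write \<open>t = \<omega> t\<^sub>1\<close> with a Teichmueller representative \<open>\<omega>\<close>: then \<open>\<kappa> \<omega> = \<kappa>\<^sub>0 \<omega>\<close>, and \<open>\<kappa> t\<^sub>1\<close> is a
  limit, uniform in \<open>\<kappa>\<close>, of powers of \<open>\<kappa> (1 + p)\<close>.
\<close>

lemma expansion_weight:
  assumes t: "t \<in> Zpx"
  shows "\<exists>\<alpha>. expansion (\<lambda>\<kappa>. \<kappa> t) \<alpha>"
proof -
  let ?p = "absv (of_nat p :: 'c)"
  obtain \<omega> where \<omega>: "\<omega> \<in> Zpx" "\<omega> ^ (p - 1) = 1" "t / \<omega> \<in> Zp1" using teichmuller[OF t] by blast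
  define t1 where "t1 = t / \<omega>"
  have t1: "t1 \<in> Zp1" "t1 \<in> Zpx" "t = \<omega> * t1" using \<omega> Zp1_Zpx Zpx_nz by (auto simp: t1_def)
  \<comment> \<open>A contraction factor valid for all weights of \<open>U\<close> at once, since
    accessibility bounds \<open>\<kappa> gen - 1\<close> by \<open>\<rho>\<close> uniformly.\<close>
  define s where "s = max \<rho> ?p"
  have s: "s < 1" "?p \<le> s" "s \<ge> 0" using \<rho>_less absv_p_less by (auto simp: s_def le_max_iff_disj)
  obtain a where a: "\<And>k. absv (t1 - gen ^ a k) \<le> ?p ^ Suc k" using gen_dense[OF t1(1)] by metis
  have lim: "(\<lambda>k. gen ^ a k) \<longlonglongrightarrow> t1"
    unfolding na_tendsto_iff
  proof (intro allI impI)
    fix e :: real assume "e > 0"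
    then obtain k where k: "(1 / real p) ^ k < e" using inv_p_power_small by blast
    have "absv (gen ^ a n - t1) < e" if "n \<ge> k" for n
    proof -
      have "?p ^ Suc n \<le> ?p ^ k" using that absv_p_less by (intro power_decreasing) auto
      then show ?thesis using a[of n] k unfolding absv_p absv_minus_commute[of t1] by linarith
    qed
    then show "\<exists>k. \<forall>n\<ge>k. absv (gen ^ a n - t1) < e" by blast
  qed
  obtain g where g: "expansion (\<lambda>\<kappa>. \<kappa> gen) g" using expansion_gen by blast
  have "\<exists>\<alpha>. expansion (\<lambda>\<kappa>. \<kappa>0 \<omega> * \<kappa> gen ^ a k) \<alpha>" for k
    using expansion_mult[OF expansion_const[OF \<kappa>0_Opow[OF \<omega>(1)]]] expansion_power expansion_gen by blast
  then obtain b where b: "\<And>k. expansion (\<lambda>\<kappa>. \<kappa>0 \<omega> * \<kappa> gen ^ a k) (b k)" by metis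
  have close: "absv (\<kappa> t - \<kappa>0 \<omega> * \<kappa> gen ^ a k) \<le> s ^ Suc k" if \<kappa>: "\<kappa> \<in> U" for k \<kappa>
  proof -
    have w: "weight \<kappa>" "\<kappa> \<omega> = \<kappa>0 \<omega>" using \<kappa> \<omega> by (auto simp: U)
    have gz: "gen \<in> Zpx" using gen_power_Zpx[of 1] by simp
    have x: "absv (\<kappa> gen - 1) \<le> s" using accessible_gen[OF acc[OF \<kappa>]] by (auto simp: s_def)
    have "(\<lambda>l. \<kappa> (gen ^ a l)) \<longlonglongrightarrow> \<kappa> t1"
      by (rule continuous_on_tendsto_compose[of Zpx \<kappa>, OF _ lim t1(2)])
         (use w gen_power_Zpx in \<open>auto simp: weight_def\<close>)
    then have "(\<lambda>l. \<kappa> gen ^ a l) \<longlonglongrightarrow> \<kappa> t1" by (simp add: weight_power[OF w(1) gz])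
    then have "absv (\<kappa> t1 - \<kappa> gen ^ a k) \<le> s ^ Suc k"
    proof (rule na_seq_close)
      fix l assume "l \<ge> k"
      then have "?p ^ Suc l \<le> ?p ^ Suc k" using absv_p_less by (intro power_decreasing) auto
      then have "absv (gen ^ a l - t1) \<le> ?p ^ Suc k" using a[of l] unfolding absv_minus_commute[of t1] by linarith
      from absv_triangle_le[OF this a] show "absv (\<kappa> gen ^ a l - \<kappa> gen ^ a k) \<le> s ^ Suc k"
        by (rule power_gen_close[OF x s(1,2)])
    qed (use s in simp)
    moreover have "\<kappa> t - \<kappa>0 \<omega> * \<kappa> gen ^ a k = \<kappa>0 \<omega> * (\<kappa> t1 - \<kappa> gen ^ a k)"
      using weight_mult[OF w(1) \<omega>(1) t1(2)] w(2) t1(3) by (simp add: right_diff_distrib)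
    ultimately show ?thesis using accessible_absv[OF acc[OF \<kappa>0_U] \<omega>(1)] by (simp add: absv_mult)
  qed
  have "(\<lambda>k. s ^ Suc k) \<longlonglongrightarrow> 0" using s by (intro LIMSEQ_power_zero[THEN LIMSEQ_Suc]) simp
  then show ?thesis
    by (rule expansion_limit[where F = "\<lambda>\<kappa>. \<kappa> t" and G = "\<lambda>k \<kappa>. \<kappa>0 \<omega> * \<kappa> gen ^ a k" and a = b, OF b])
       (rule close)
qed

lemma BU_simps [simp]:
  "F \<otimes>\<^bsub>BU\<^esub> G = (\<lambda>\<kappa>\<in>U. F \<kappa> * G \<kappa>)" "F \<oplus>\<^bsub>BU\<^esub> G = (\<lambda>\<kappa>\<in>U. F \<kappa> + G \<kappa>)"
  "\<zero>\<^bsub>BU\<^esub> = (\<lambda>\<kappa>\<in>U. 0)" "\<one>\<^bsub>BU\<^esub> = (\<lambda>\<kappa>\<in>U. 1)"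
  "emb BU u = (\<lambda>\<kappa>\<in>U. u)" "unif BU = (\<lambda>\<kappa>\<in>U. \<pi>)" "wt BU t = (\<lambda>\<kappa>\<in>U. \<kappa> t)"
  by (simp_all add: Lam_def)

lemma Lam_restrict:
  assumes "expansion F \<alpha>"
  shows "restrict F U \<in> carrier BU" "cf (restrict F U) = \<alpha>"
proof -
  have "expansion (restrict F U) \<alpha>" using expansion_cong[OF assms] by simp
  then show "restrict F U \<in> carrier BU" "cf (restrict F U) = \<alpha>" using cf_eq by (auto simp: Lam_carrier)
qed

lemma Lam_eval: "F \<in> carrier BU ==> \<kappa> \<in> U ==> (\<lambda>n. cf F n * coord \<kappa> ^ n) sums F \<kappa>"
  using cf_expansion by (simp add: expansion_def)

sublocale Lam: coeff_algebra p K \<pi> BU cf UNIV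
proof (intro coeff_algebra.intro coeff_algebra_axioms.intro dv_field_axioms)
  show "bij_betw cf (carrier BU) (UNIV \<rightarrow>\<^sub>E Opow 0)"
  proof (rule bij_betw_imageI)
    show "inj_on cf (carrier BU)"
    proof (rule inj_onI)
      fix F G assume FG: "F \<in> carrier BU" "G \<in> carrier BU" "cf F = cf G"
      have "F \<kappa> = G \<kappa>" if "\<kappa> \<in> U" for \<kappa>
        by (rule sums_unique2[OF Lam_eval[OF FG(1) that, unfolded FG(3)] Lam_eval[OF FG(2) that]])
      moreover have "F \<in> extensional U" "G \<in> extensional U" using FG(1,2) unfolding Lam_carrier by blast+
      ultimately show "F = G" by (intro extensionalityI[of F U G])
    qed
    show "cf ` carrier BU = UNIV \<rightarrow>\<^sub>E Opow 0"
    proof (intro equalityI subsetI)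
      fix \<alpha> assume "\<alpha> \<in> cf ` carrier BU"
      then show "\<alpha> \<in> UNIV \<rightarrow>\<^sub>E Opow 0" using cf_expansion by (auto simp: expansion_def)
    next
      fix \<alpha> :: "nat => 'c" assume "\<alpha> \<in> UNIV \<rightarrow>\<^sub>E Opow 0"
      then have "\<And>n. \<alpha> n \<in> Opow 0" by auto
      from Lam_restrict[OF expansion_of[OF this]] show "\<alpha> \<in> cf ` carrier BU" by (intro image_eqI[OF sym])
    qed
  qed
  fix F G assume F: "F \<in> carrier BU" and G: "G \<in> carrier BU"
  note E = cf_expansion[OF F] cf_expansion[OF G]
  show "F \<oplus>\<^bsub>BU\<^esub> G \<in> carrier BU" "\<And>i. cf (F \<oplus>\<^bsub>BU\<^esub> G) i = cf F i + cf G i"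
    using Lam_restrict[OF expansion_add[OF E]] by simp_all
  show "F \<otimes>\<^bsub>BU\<^esub> G \<in> carrier BU" "\<And>i. cf (F \<otimes>\<^bsub>BU\<^esub> G) i = (\<Sum>j\<le>i. cf F j * cf G (i - j))"
    using Lam_restrict[OF expansion_mult[OF E]] by simp_all
next
  show "\<zero>\<^bsub>BU\<^esub> \<in> carrier BU" "\<And>i. cf \<zero>\<^bsub>BU\<^esub> i = 0"
    using Lam_restrict[OF expansion_const[of 0]] by simp_all
  show "\<one>\<^bsub>BU\<^esub> \<in> carrier BU" "\<And>i. cf \<one>\<^bsub>BU\<^esub> i = (if i = 0 then 1 else 0)"
    using Lam_restrict[OF expansion_const[of 1]] by simp_all
  fix u assume u: "u \<in> Opow 0"
  show "emb BU u \<in> carrier BU" "\<And>i. cf (emb BU u) i = (if i = 0 then u else 0)"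
    using Lam_restrict[OF expansion_const[OF u]] by simp_all
next
  show "wt BU t \<in> carrier BU" if "t \<in> Zpx" for t
    using expansion_weight[OF that] Lam_restrict(1) by auto
  show "wt BU (s * t) = wt BU s \<otimes>\<^bsub>BU\<^esub> wt BU t" if "s \<in> Zpx" "t \<in> Zpx" for s t
    using that weight_mult[OF U_weight] unfolding BU_simps by (intro restrict_ext) simp
  show "wt BU 1 = \<one>\<^bsub>BU\<^esub>" using weight_1[OF U_weight] unfolding BU_simps by (intro restrict_ext) simp
qed auto

end

section \<open>Evaluation at a rational weight, and equivariance of specialization\<close>

section \<open>Specialization\<close>

locale rational_point = weight_disk p K \<pi> U \<kappa>0 r
  for p :: nat and K :: "'c :: complete_alg_closed_nonarch_field set" and \<pi> :: 'c
    and U :: "('c => 'c) set" and \<kappa>0 :: "'c => 'c" and r :: 'c +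
  fixes k :: "'c => 'c"
  assumes rational: "k \<in> rational_points K U"
begin

lemma k_U: "k \<in> U" and k_K: "k ` Zpx \<subseteq> K"
  using rational by (auto simp: rational_points_def)

sublocale integral_weight p K \<pi> k
  using acc k_U k_K by unfold_locales auto

lemma carrier_OK: "carrier Bk = Opow 0"
  by (auto simp: OK_def Opow_0)

text \<open>A rational point has its coordinate in \<open>K\<close>, where absolute value below 1
  means divisibility by \<open>\<pi>\<close>.\<close>

lemma coord_k: "coord k \<in> Opow 1"
proof -
  have "coord k \<in> K" using \<kappa>0(2) k_K one_plus_p_Zpx r(1) unfolding coord_def by (intro K_divide K_diff) auto
  then show ?thesis using \<pi>_max[of "coord k"] coord_less[OF k_U] by (simp add: Opow_def)
qed

lemma coord_k_power: "coord k ^ i \<in> Opow i"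
  by (induction i) (use Opow_mult[OF coord_k] in auto)

text \<open>Evaluation at \<open>k\<close> sends the variable into the maximal ideal, and hence the
  \<open>n\<close>-th power of the maximal ideal of Lambda_U into that of O_K. This is why
  \<open>eta\<close> respects the filtrations.\<close>

lemma eval_Opow:
  assumes F: "F \<in> carrier BU" and c: "\<And>i. cf F i \<in> Opow (n - i)"
  shows "F k \<in> Opow n"
proof (rule OK.sums_Opow[OF Lam_eval[OF F k_U]])
  show "cf F i * coord k ^ i \<in> Opow n" for i
    using Opow_mult[OF c[of i] coord_k_power[of i]] by (rule Opow_antimonoD) simp
qed

lemma eval_closed:
  assumes F: "F \<in> carrier BU"
  shows "F k \<in> Opow 0"
proof (rule eval_Opow[OF F])
  show "cf F i \<in> Opow (0 - i)" for i using Lam.cf_Opow[OF F UNIV_I] by simp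
qed

text \<open>Evaluation at \<open>k\<close> is continuous: a tail with all coefficients divisible by
  \<open>\<pi> ^ M\<close> evaluates into \<open>Opow M\<close>.\<close>

lemma eval_sums:
  assumes u: "Lam.nullseq u" and F: "F \<in> carrier BU" and s: "\<And>i. (\<lambda>n. cf (u n) i) sums cf F i"
  shows "(\<lambda>n. u n k) sums F k"
  unfolding sums_def na_tendsto_iff
proof (intro allI impI)
  fix e :: real assume "e > 0"
  then obtain M where M: "absv \<pi> ^ M < e" using real_arch_pow_inv[OF _ \<pi>_less] by blast
  have uc: "\<And>n. u n \<in> carrier BU" using Lam.nullseq_closed[OF u] .
  obtain n0 where n0: "\<And>n i. n \<ge> n0 ==> cf (u n) i \<in> Opow M" using Lam.nullseq_D[OF u, of M] by blast
  have "absv ((\<Sum>j<n. u j k) - F k) < e" if n: "n \<ge> n0" for n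
  proof -
    have tail: "cf F i - (\<Sum>j<n. cf (u j) i) \<in> Opow M" for i
      by (rule Lam.sums_tail_Opow[OF s]) (use n0 n Lam.cf_Opow uc F in \<open>auto simp: Opow_def\<close>)
    have "(\<lambda>i. (cf F i - (\<Sum>j<n. cf (u j) i)) * coord k ^ i) sums (F k - (\<Sum>j<n. u j k))"
      unfolding left_diff_distrib sum_distrib_right
      by (intro na_sums_diff na_sums_sum Lam_eval F uc k_U)
    then have "F k - (\<Sum>j<n. u j k) \<in> Opow M"
    proof (rule OK.sums_Opow)
      show "(cf F i - (\<Sum>j<n. cf (u j) i)) * coord k ^ i \<in> Opow M" for i
        using tail[of i] Opow_0I[OF coord_k_power] by (rule Opow_mult_right)
    qed
    then show ?thesis using M by (simp add: Opow_def absv_minus_commute)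
  qed
  then show "\<exists>N. \<forall>n\<ge>N. absv ((\<Sum>j<n. u j k) - F k) < e" by blast
qed

lemma specialized_series:
  assumes h: "h \<in> A_carrier BU" and z: "z \<in> Zp"
  shows "(\<lambda>n. Lam.coefs h n k * z ^ n) sums h (1, z) k"
proof -
  have s: "Lam.series h (Lam.coefs h)" using Lam.coefs_series[OF h] .
  let ?u = "\<lambda>n. Lam.coefs h n \<otimes>\<^bsub>BU\<^esub> emb BU (z ^ n)"
  have c: "Lam.coefs h n \<in> carrier BU" for n using Lam.nullseq_closed[OF Lam.coefs_nullseq[OF h]] .
  have zn: "z ^ n \<in> Opow 0" for n using Zp_Opow[OF z] by blast
  have "(\<lambda>n. ?u n k) sums h (1, z) k"
  proof (rule eval_sums)
    show "Lam.nullseq ?u" by (rule Lam.nullseq_mult[OF Lam.coefs_nullseq[OF h]]) (use zn in blast)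
    show "h (1, z) \<in> carrier BU" using Lam.A_closed[OF h OK.T0_1[OF z]] .
    have "cf (?u n) i = cf (Lam.coefs h n) i * z ^ n" for n i using Lam.cf_mult_emb[OF c zn] by (simp add: mult.commute)
    then show "(\<lambda>n. cf (?u n) i) sums cf (h (1, z)) i" for i using s z unfolding Lam.series_def by simp
  qed
  then show ?thesis using k_U by simp
qed

text \<open>Functions that agree at \<open>k\<close> have expansions whose coefficients agree at
  \<open>k\<close>, by \<open>null_power_series_zero\<close>. Since \<open>\<mu>\<close> is computed
  termwise from the expansion, its value at \<open>k\<close> sees only these.\<close>

lemma specialization_determined:
  assumes \<mu>: "\<mu> \<in> Lam.LD" and g: "g \<in> A_carrier BU" and h: "h \<in> A_carrier BU"
    and eq: "\<And>v. v \<in> T0 ==> g v k = h v k"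
  shows "\<mu> g k = \<mu> h k"
proof -
  have c: "Lam.nullseq (Lam.coefs f)" "\<And>n. Lam.coefs f n \<in> carrier BU" if "f \<in> A_carrier BU" for f
    using Lam.coefs_nullseq[OF that] Lam.nullseq_closed by blast+
  have b: "\<mu> (f_basis BU n) \<in> carrier BU" for n using Lam.LD_closed[OF \<mu> Lam.f_basis_A] .
  have ev: "(\<lambda>n. Lam.coefs f n k * \<mu> (f_basis BU n) k) sums \<mu> f k" if f: "f \<in> A_carrier BU" for f
  proof -
    have "(\<lambda>n. (Lam.coefs f n \<otimes>\<^bsub>BU\<^esub> \<mu> (f_basis BU n)) k) sums \<mu> f k"
      by (rule eval_sums[OF Lam.nullseq_mult[OF c(1)[OF f] b] Lam.LD_closed[OF \<mu> f] Lam.LD_eval[OF \<mu> f UNIV_I]])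
    then show ?thesis using k_U by simp
  qed
  have "Lam.coefs g n k - Lam.coefs h n k = 0" for n
  proof (rule null_power_series_zero[where C = 1])
    show "absv (Lam.coefs g n k - Lam.coefs h n k) \<le> 1" for n
      using eval_closed[OF c(2)[OF g]] eval_closed[OF c(2)[OF h]] by (intro absv_diff_le) (auto simp: Opow_0)
    show "(of_nat p :: 'c) \<noteq> 0" "absv (of_nat p :: 'c) < 1" using p_nz absv_p_less by auto
    show "(\<lambda>n. (Lam.coefs g n k - Lam.coefs h n k) * (of_nat p ^ j) ^ n) sums 0" for j
    proof -
      have z: "of_nat p ^ j \<in> (Zp :: 'c set)" by blast
      from na_sums_diff[OF specialized_series[OF g z] specialized_series[OF h z]] eq[OF OK.T0_1[OF z]]
      show ?thesis by (simp add: left_diff_distrib)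
    qed
  qed
  then have "\<And>n. Lam.coefs g n k = Lam.coefs h n k" by simp
  then show ?thesis using ev[OF g] ev[OF h] sums_unique2 by simp
qed

definition lift :: "('c \<times> 'c => 'c) => 'c \<times> 'c => (('c => 'c) => 'c)" where
  "lift f = (\<lambda>(x, y)\<in>T0. wt BU x \<otimes>\<^bsub>BU\<^esub> emb BU (f (1, y / x)))"

lemma T0_quotient: "(x, y) \<in> T0 ==> (1, y / x) \<in> (T0 :: ('c \<times> 'c) set)"
  using Zp_divide by (auto simp: T0_def)

lemma A_Opow: "f \<in> A_carrier Bk ==> v \<in> T0 ==> f v \<in> Opow 0"
  using OK.A_closed[of f v] by (simp add: carrier_OK)

lemma lift_A:
  assumes f: "f \<in> A_carrier Bk"
  shows "lift f \<in> A_carrier BU"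
proof -
  have h: "Lam.homogeneous (lift f)"
    unfolding lift_def using A_Opow[OF f OK.T0_1] by (intro Lam.homogeneousI) blast
  have s: "OK.series f (OK.coefs f)" using OK.coefs_series[OF f] .
  then have c: "\<And>n. OK.coefs f n \<in> Opow 0" "OK.coefs f \<longlonglongrightarrow> 0" by (auto simp: series_iff)
  have "Lam.series (lift f) (\<lambda>n. emb BU (OK.coefs f n))"
    unfolding Lam.series_def
  proof (intro conjI ballI)
    show "Lam.nullseq (\<lambda>n. emb BU (OK.coefs f n))"
    proof (rule Lam.nullseqI)
      show "emb BU (OK.coefs f n) \<in> carrier BU" for n using c(1) by blast
      fix M
      obtain n0 where "\<And>n. n \<ge> n0 ==> OK.coefs f n \<in> Opow M"
        using OK.nullseq_D[OF OK.coefs_nullseq[OF f], of M] by auto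
      then show "\<exists>n0. \<forall>n\<ge>n0. \<forall>i\<in>UNIV. cf (emb BU (OK.coefs f n)) i \<in> Opow M"
        unfolding Lam.cf_emb[OF c(1) UNIV_I] by (intro exI[of _ n0]) auto
    qed
    fix z :: 'c and i :: nat assume z: "z \<in> Zp"
    have fz: "f (1, z) \<in> Opow 0" using A_Opow[OF f OK.T0_1[OF z]] .
    have "lift f (1, z) = wt BU 1 \<otimes>\<^bsub>BU\<^esub> emb BU (f (1, z / 1))"
      using OK.T0_1[OF z] unfolding lift_def by (simp only: restrict_apply' case_prod_conv)
    also have "\<dots> = \<one>\<^bsub>BU\<^esub> \<otimes>\<^bsub>BU\<^esub> emb BU (f (1, z))" unfolding Lam.wt_one div_by_1 ..
    also have "\<dots> = emb BU (f (1, z))" by (rule Lam.l_one) (use fz in blast)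
    finally have e: "lift f (1, z) = emb BU (f (1, z))" .
    have "(\<lambda>n. OK.coefs f n * z ^ n) sums f (1, z)" using s z by (auto simp: series_iff)
    then show "(\<lambda>n. cf (emb BU (OK.coefs f n)) i * z ^ n) sums cf (lift f (1, z)) i"
      unfolding e Lam.cf_emb[OF c(1) UNIV_I] Lam.cf_emb[OF fz UNIV_I] by (cases "i = 0") auto
  qed
  then show ?thesis unfolding Lam.A_iff using h by blast
qed

lemma lift_eval: "f \<in> A_carrier Bk ==> v \<in> T0 ==> lift f v k = f v"
  using homogeneous_eq[of f "fst v" "snd v"] k_U OK.A_iff[of f] by (auto simp: lift_def split: prod.splits)

lemma lift_add:
  assumes "f \<in> A_carrier Bk" "g \<in> A_carrier Bk"
  shows "lift (\<lambda>v\<in>T0. f v + g v) = (\<lambda>v\<in>T0. lift f v \<oplus>\<^bsub>BU\<^esub> lift g v)"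
  using T0_quotient by (auto simp: lift_def fun_eq_iff distrib_left)

lemma lift_smult:
  assumes "f \<in> A_carrier Bk"
  shows "lift (\<lambda>v\<in>T0. b * f v) = (\<lambda>v\<in>T0. emb BU b \<otimes>\<^bsub>BU\<^esub> lift f v)"
  using T0_quotient by (auto simp: lift_def fun_eq_iff mult.left_commute)

lemma lift_f_basis: "lift (f_basis Bk j) = f_basis BU j"
proof -
  have "emb BU z [^]\<^bsub>BU\<^esub> j = emb BU (f_basis Bk j (1, z))" if z: "z \<in> Zp" for z
    using Lam.emb_Zp(1)[OF z] OK.emb_Zp(1)[OF z] OK.T0_1[OF z] weight_1[OF k_weight] by (simp add: f_basis_def)
  then show ?thesis unfolding lift_def f_basis_def[of BU] using Zp_divide by (intro restrict_ext) (auto simp: T0_def)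
qed

lemma eta_eq: "eta BU Bk k \<mu> = (\<lambda>f\<in>A_carrier Bk. \<mu> (lift f) k)"
  by (simp only: eta_def lift_def)

lemma eta_LD:
  assumes \<mu>: "\<mu> \<in> Lam.LD"
  shows "eta BU Bk k \<mu> \<in> OK.LD"
  unfolding eta_eq
proof (rule OK.LD_I)
  fix f assume f: "f \<in> A_carrier Bk"
  show "\<mu> (lift f) k \<in> carrier Bk" using eval_closed[OF Lam.LD_closed[OF \<mu> lift_A[OF f]]] by (simp add: carrier_OK)
  show "\<mu> (lift (\<lambda>v\<in>T0. f v \<oplus>\<^bsub>Bk\<^esub> g v)) k = \<mu> (lift f) k \<oplus>\<^bsub>Bk\<^esub> \<mu> (lift g) k" if g: "g \<in> A_carrier Bk" for g
    unfolding Bk_simps lift_add[OF f g] Lam.LD_add[OF \<mu> lift_A[OF f] lift_A[OF g]] using k_U by simp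
  show "\<mu> (lift (\<lambda>v\<in>T0. b \<otimes>\<^bsub>Bk\<^esub> f v)) k = b \<otimes>\<^bsub>Bk\<^esub> \<mu> (lift f) k" if b: "b \<in> carrier Bk" for b
  proof -
    have "emb BU b \<in> carrier BU" using b by (intro Lam.emb_closed) (simp add: carrier_OK)
    from Lam.LD_smult[OF \<mu> lift_A[OF f] this] show ?thesis unfolding Bk_simps lift_smult[OF f] using k_U by simp
  qed
qed

lemma eta_hom:
  assumes st: "A_stable (Gamma N p) BU"
  shows "eta BU Bk k \<in> gmodule_hom (Gamma N p) (D_module BU) (D_module Bk)"
  unfolding gmodule_hom_def
proof (intro CollectI conjI ballI)
  show "eta BU Bk k \<in> hom (D_module BU) (D_module Bk)"
  proof (rule homI)
    show "eta BU Bk k \<mu> \<in> carrier (D_module Bk)" if "\<mu> \<in> carrier (D_module BU)" for \<mu>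
      using that eta_LD by simp
    show "eta BU Bk k (\<mu> \<otimes>\<^bsub>D_module BU\<^esub> \<nu>) = eta BU Bk k \<mu> \<otimes>\<^bsub>D_module Bk\<^esub> eta BU Bk k \<nu>" for \<mu> \<nu>
      unfolding eta_eq Lam.D_simps OK.D_simps Bk_simps BU_simps using k_U lift_A by (intro restrict_ext) simp
  qed
  fix \<gamma> \<mu> assume g: "\<gamma> \<in> carrier (Gamma N p)" and "\<mu> \<in> carrier (D_module BU)"
  then have \<mu>: "\<mu> \<in> Lam.LD" by simp
  show "eta BU Bk k (act (D_module BU) \<mu> \<gamma>) = act (D_module Bk) (eta BU Bk k \<mu>) \<gamma>"
    unfolding eta_eq Lam.D_simps OK.D_simps
  proof (intro restrict_ext)
    fix f assume f: "f \<in> A_carrier Bk"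
    have gf: "fun_act \<gamma> f \<in> A_carrier Bk" using A_stable_OK g f by (simp add: A_stable_def)
    have gl: "fun_act \<gamma> (lift f) \<in> A_carrier BU" using st g lift_A[OF f] by (simp add: A_stable_def)
    \<comment> \<open>The two functions differ in general: the first involves the universal
      character at a + c z, the second only its specialization there.\<close>
    have "\<mu> (fun_act \<gamma> (lift f)) k = \<mu> (lift (fun_act \<gamma> f)) k"
    proof (rule specialization_determined[OF \<mu> gl lift_A[OF gf]])
      fix v :: "'c \<times> 'c" assume v: "v \<in> T0"
      show "fun_act \<gamma> (lift f) v k = lift (fun_act \<gamma> f) v k"
        unfolding lift_eval[OF gf v] using lift_eval[OF f row_act_T0[OF g v]] v by (simp add: fun_act_def)
    qed
    then show "(\<lambda>f\<in>A_carrier BU. \<mu> (fun_act \<gamma> f)) (lift f) k = (\<lambda>f\<in>A_carrier Bk. \<mu> (lift f) k) (fun_act \<gamma> f)"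
      using lift_A[OF f] gf by simp
  qed
qed

lemma eta_Fil: "eta BU Bk k ` D_Fil BU n \<subseteq> D_Fil Bk n"
proof
  fix \<nu> assume "\<nu> \<in> eta BU Bk k ` D_Fil BU n"
  then obtain \<mu> where m: "\<mu> \<in> D_Fil BU n" and \<nu>: "\<nu> = eta BU Bk k \<mu>" by (rule imageE)
  have mc: "\<mu> \<in> carrier (D_module BU) \<and> (\<forall>j\<le>n. \<mu> (f_basis BU j) \<in> max_ideal_pow BU (n - j))"
    using m unfolding D_Fil_def by (rule CollectD)
  have \<mu>: "\<mu> \<in> Lam.LD" using conjunct1[OF mc] unfolding Lam.D_simps(1) .
  have "\<nu> (f_basis Bk j) \<in> max_ideal_pow Bk (n - j)" if "j \<le> n" for j
  proof -
    have e: "\<mu> (f_basis BU j) \<in> max_ideal_pow BU (n - j)" using conjunct2[OF mc] that by blast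
    have "cf (\<mu> (f_basis BU j)) i \<in> Opow (n - j - i)" for i using e unfolding Lam.max_ideal_pow_eq by blast
    from eval_Opow[OF Lam.LD_closed[OF \<mu> Lam.f_basis_A] this] have "\<mu> (f_basis BU j) k \<in> Opow (n - j)" .
    then show ?thesis unfolding \<nu> eta_eq max_ideal_pow_OK using OK.f_basis_A by (simp add: lift_f_basis)
  qed
  then show "\<nu> \<in> D_Fil Bk n" using eta_LD[OF \<mu>] \<nu> by (simp add: D_Fil_def)
qed

end

lemma (in coordinate_module) coordinate_comparison_isos:
  assumes "injective_resolution G (quotient_system M Fil) \<epsilon> I d"
  shows "resolved_filtered_module G M Fil \<epsilon> I d" "comparison_isos G M Fil \<epsilon> I d"
proof -
  interpret C: complete_filtered_module G M Fil by (rule complete_filtered)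
  show R: "resolved_filtered_module G M Fil \<epsilon> I d"
    by (intro resolved_filtered_module.intro resolved_filtered_module_axioms.intro C.filtered_module_axioms assms)
  show "comparison_isos G M Fil \<epsilon> I d"
    by (intro resolved_complete_module.comparison_isos resolved_complete_module.intro complete_filtered R)
qed

text \<open>Over O_K the module A is stable by \<open>A_stable_OK\<close>, and for a classical
  weight the filtration is stable by \<open>classical_fil_stable\<close>; the remaining stability
  conditions enter as assumptions. All comparison maps then come from
  \<open>coordinate_comparison_isos\<close>.\<close>

theorem mainTheorem16:
  fixes p N :: nat
    and K :: "'c::complete_alg_closed_nonarch_field set" and \<pi> :: 'c
    and U :: "('c \<Rightarrow> 'c) set" and k :: "'c \<Rightarrow> 'c"
    and G :: "(int ^ 2 ^ 2) monoid"
    and BU :: "(('c \<Rightarrow> 'c) \<Rightarrow> 'c, 'c) coeff_ring" and Bk :: "('c, 'c) coeff_ring"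
  assumes "prime p" and "p \<ge> 3" and "N \<ge> 3" and "coprime N p"
    and "complete_dv_field p K" and "uniformizer K \<pi>"
    and "wide_open_disk p K U" and "\<forall>\<kappa>\<in>U. accessible p \<kappa>"
    and "k \<in> rational_points K U"
    and "G = Gamma N p" and "BU = Lam p K \<pi> U" and "Bk = OK K \<pi> k"
  shows
    "(\<forall>\<epsilon> (I :: nat \<Rightarrow> ('i, int ^ 2 ^ 2) proj_sys) d.
        A_stable G BU \<and> fil_stable G (D_module BU) (D_Fil BU) \<and>
        injective_resolution G (quotient_system (D_module BU) (D_Fil BU)) \<epsilon> I d \<longrightarrow>
        comparison_isos G (D_module BU) (D_Fil BU) \<epsilon> I d) \<and>
     (\<forall>\<epsilon> (I :: nat \<Rightarrow> ('i, int ^ 2 ^ 2) proj_sys) d.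
        fil_stable G (D_module Bk) (D_Fil Bk) \<and>
        injective_resolution G (quotient_system (D_module Bk) (D_Fil Bk)) \<epsilon> I d \<longrightarrow>
        comparison_isos G (D_module Bk) (D_Fil Bk) \<epsilon> I d) \<and>
     (\<forall>m \<epsilon> (I :: nat \<Rightarrow> ('i, int ^ 2 ^ 2) proj_sys) d.
        k = classical_weight m \<and>
        injective_resolution G (quotient_system (V_module Bk m) (V_Fil Bk m)) \<epsilon> I d \<longrightarrow>
        comparison_isos G (V_module Bk m) (V_Fil Bk m) \<epsilon> I d) \<and>
     (\<forall>\<epsilon> (I :: nat \<Rightarrow> ('i, int ^ 2 ^ 2) proj_sys) d
       \<epsilon>' (J :: nat \<Rightarrow> ('i, int ^ 2 ^ 2) proj_sys) d' \<phi>.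
        A_stable G BU \<and> fil_stable G (D_module BU) (D_Fil BU) \<and>
        fil_stable G (D_module Bk) (D_Fil Bk) \<and>
        injective_resolution G (quotient_system (D_module BU) (D_Fil BU)) \<epsilon> I d \<and>
        injective_resolution G (quotient_system (D_module Bk) (D_Fil Bk)) \<epsilon>' J d' \<and>
        resolution_morphism G (quotient_system (D_module BU) (D_Fil BU))
          (quotient_system_map (D_module Bk) (D_Fil Bk) (eta BU Bk k)) \<epsilon> I d \<epsilon>' J d' \<phi> \<longrightarrow>
        comparison_compatible G (D_module BU) (D_Fil BU) \<epsilon> I d
          (D_module Bk) (D_Fil Bk) \<epsilon>' J d' (eta BU Bk k) \<phi>) \<and>
     (\<forall>m \<epsilon> (I :: nat \<Rightarrow> ('i, int ^ 2 ^ 2) proj_sys) d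
       \<epsilon>' (J :: nat \<Rightarrow> ('i, int ^ 2 ^ 2) proj_sys) d' \<phi>.
        k = classical_weight m \<and>
        injective_resolution G (quotient_system (D_module Bk) (D_Fil Bk)) \<epsilon> I d \<and>
        injective_resolution G (quotient_system (V_module Bk m) (V_Fil Bk m)) \<epsilon>' J d' \<and>
        resolution_morphism G (quotient_system (D_module Bk) (D_Fil Bk))
          (quotient_system_map (V_module Bk m) (V_Fil Bk m) (rho Bk m)) \<epsilon> I d \<epsilon>' J d' \<phi> \<longrightarrow>
        comparison_compatible G (D_module Bk) (D_Fil Bk) \<epsilon> I d
          (V_module Bk m) (V_Fil Bk m) \<epsilon>' J d' (rho Bk m) \<phi>)"
proof -
  obtain \<kappa>0 r where d: "weight \<kappa>0" "\<kappa>0 ` Zpx \<subseteq> K" "r \<in> K" "r \<noteq> 0"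
    "U = {\<kappa>. weight \<kappa> \<and> (\<forall>z\<in>Zpx. z ^ (p - 1) = 1 \<longrightarrow> \<kappa> z = \<kappa>0 z) \<and>
                 absv (\<kappa> (1 + of_nat p) - \<kappa>0 (1 + of_nat p)) < absv r}"
    using assms(7) unfolding wide_open_disk_def by blast
  have dv: "dv_field p K \<pi>" using assms(1,5,6) by (rule dv_field.intro)
  have odd: "odd_dv_field p K \<pi>" using assms(2) by (intro odd_dv_field.intro dv odd_dv_field_axioms.intro)
  have disk: "weight_disk p K \<pi> U \<kappa>0 r"
    using d assms(8) by (intro weight_disk.intro alg_closed_dv_field.intro odd weight_disk_axioms.intro) blast+
  interpret R: rational_point p K \<pi> U \<kappa>0 r k
    using assms(9) by (intro rational_point.intro disk rational_point_axioms.intro)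
  note defs = assms(10-12)
  note DU = coordinate_module.coordinate_comparison_isos[OF R.Lam.D_coordinate_module]
  note Dk = coordinate_module.coordinate_comparison_isos[OF R.OK.D_coordinate_module[OF R.A_stable_OK]]
  have V: "coordinate_module p K \<pi> (Gamma N p) (V_module (OK K \<pi> k) m) (V_Fil (OK K \<pi> k) m) (classical_integral_weight.V_crd K \<pi> k m) {..m} (\<lambda>j. j)"
      "rho (OK K \<pi> k) m \<in> gmodule_hom (Gamma N p) (D_module (OK K \<pi> k)) (V_module (OK K \<pi> k) m)"
      "fil_stable (Gamma N p) (D_module (OK K \<pi> k)) (D_Fil (OK K \<pi> k))" if "k = classical_weight m" for m
  proof -
    interpret C: classical_integral_weight p K \<pi> k m
      using that by (intro classical_integral_weight.intro R.integral_weight_axioms classical_integral_weight_axioms.intro)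
    show "coordinate_module p K \<pi> (Gamma N p) (V_module (OK K \<pi> k) m) (V_Fil (OK K \<pi> k) m) (classical_integral_weight.V_crd K \<pi> k m) {..m} (\<lambda>j. j)"
      by (rule C.V_coordinate_module)
    show "rho (OK K \<pi> k) m \<in> gmodule_hom (Gamma N p) (D_module (OK K \<pi> k)) (V_module (OK K \<pi> k) m)" by (rule C.rho_hom)
    show "fil_stable (Gamma N p) (D_module (OK K \<pi> k)) (D_Fil (OK K \<pi> k))" by (rule R.classical_fil_stable[OF that])
  qed
  note VV = coordinate_module.coordinate_comparison_isos[OF V(1)]
  have DU_Dk: "comparison_compatible G (D_module BU) (D_Fil BU) \<epsilon> I d (D_module Bk) (D_Fil Bk) \<epsilon>' J d' (eta BU Bk k) \<phi>"
    if "A_stable G BU" "fil_stable G (D_module BU) (D_Fil BU)" "fil_stable G (D_module Bk) (D_Fil Bk)"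
      "injective_resolution G (quotient_system (D_module BU) (D_Fil BU)) \<epsilon> I d"
      "injective_resolution G (quotient_system (D_module Bk) (D_Fil Bk)) \<epsilon>' J d'"
      "resolution_morphism G (quotient_system (D_module BU) (D_Fil BU))
        (quotient_system_map (D_module Bk) (D_Fil Bk) (eta BU Bk k)) \<epsilon> I d \<epsilon>' J d' \<phi>"
    for \<epsilon> d \<epsilon>' d' \<phi> and I J :: "nat => ('i, int ^ 2 ^ 2) proj_sys"
    using that(6) unfolding defs
    by (rule comparison_compatibleI[OF DU(1)[OF that(1,2,4)[unfolded defs]] Dk(1)[OF that(3,5)[unfolded defs]]
        R.eta_hom[OF that(1)[unfolded defs]] R.eta_Fil])
  have rho_Fil: "rho B m ` D_Fil B n \<subseteq> V_Fil B m n" for B :: "('c, 'c) coeff_ring" and m n by (simp add: V_Fil_def)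
  have Dk_V: "comparison_compatible G (D_module Bk) (D_Fil Bk) \<epsilon> I d (V_module Bk m) (V_Fil Bk m) \<epsilon>' J d' (rho Bk m) \<phi>"
    if "k = classical_weight m"
      "injective_resolution G (quotient_system (D_module Bk) (D_Fil Bk)) \<epsilon> I d"
      "injective_resolution G (quotient_system (V_module Bk m) (V_Fil Bk m)) \<epsilon>' J d'"
      "resolution_morphism G (quotient_system (D_module Bk) (D_Fil Bk))
        (quotient_system_map (V_module Bk m) (V_Fil Bk m) (rho Bk m)) \<epsilon> I d \<epsilon>' J d' \<phi>"
    for m \<epsilon> d \<epsilon>' d' \<phi> and I J :: "nat => ('i, int ^ 2 ^ 2) proj_sys"
    using that(4) unfolding defs
    by (rule comparison_compatibleI[OF Dk(1)[OF V(3)[OF that(1)] that(2)[unfolded defs]]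
        VV(1)[OF that(1) that(3)[unfolded defs]] V(2)[OF that(1)] rho_Fil])
  show ?thesis
  proof (intro conjI allI impI, goal_cases)
    case (1 \<epsilon> I d)
    then show ?case unfolding defs by (elim conjE) (rule DU(2))
  next
    case (2 \<epsilon> I d)
    then show ?case unfolding defs by (elim conjE) (rule Dk(2))
  next
    case (3 m \<epsilon> I d)
    then have m: "k = classical_weight m"
      "injective_resolution G (quotient_system (V_module Bk m) (V_Fil Bk m)) \<epsilon> I d" by simp_all
    from VV(2)[OF m(1) m(2)[unfolded defs]] show ?case unfolding defs .
  next
    case (4 \<epsilon> I d \<epsilon>' J d' \<phi>)
    then show ?case by (elim conjE) (rule DU_Dk)
  next
    case (5 m \<epsilon> I d \<epsilon>' J d' \<phi>)
    then show ?case by (elim conjE) (rule Dk_V)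
  qed
qed

end
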